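(* Let $F\colon\mathbb{T}^2\to\mathbb{T}^2$ be a homeomorphism homotopic to the identity and satisfying the curve intersection property. Then either $F$ has a fixed point, or the rotation set of $F$ (that is, $\rho(f)$ for any lift $f$ of $F$) has nonempty interior in $\mathbb{R}^2$. (The "or" is inclusive.)
   Context: $\mathbb{T}^2=\mathbb{R}^2/\mathbb{Z}^2$, with canonical projection $\pi\colon\mathbb{R}^2\to\mathbb{T}^2$. A lift of $F$ is a homeomorphism $f$ of $\mathbb{R}^2$ with $\pi f=F\pi$; since $F$ is homotopic to the identity, $f$ commutes with all integer translations. The rotation set of $f$ is $$\rho(f)=\bigcap_{m=1}^{\infty}\overline{\bigcup_{n=m}^{\infty}\left\{\frac{f^n(x)-x}{n}:x\in\mathbb{R}^2\right\}}\subset\mathbb{R}^2.$$ Changing the lift translates $\rho(f)$ by an element of $\mathbb{Z}^2$, so the rotation set of $F$ is well defined modulo $\mathbb{Z}^2$. A closed curve in $\mathbb{T}^2$ is essential if it is homotopically non-trivial. A free curve for $F$ is an essential simple closed curve $\gamma\subset\mathbb{T}^2$ with $F(\gamma)\cap\gamma=\emptyset$. $F$ has the curve intersection property if it has no free curves, i.e. every essential simple closed curve in $\mathbb{T}^2$ intersects its image under $F$. *)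

theory Defs
  imports "HOL-Analysis.Analysis"
begin

quotient_type torus = "real^2" / "\<lambda>x y. \<forall>i. x $ i - y $ i \<in> \<int>"
  morphisms torus_rep torus_proj
proof (rule equivpI)
  show "reflp (\<lambda>x y::real^2. \<forall>i. x $ i - y $ i \<in> \<int>)"
    by (simp add: reflp_def)
  show "symp (\<lambda>x y::real^2. \<forall>i. x $ i - y $ i \<in> \<int>)"
  proof (rule sympI, rule allI)
    fix x y :: "real^2" and i
    assume "\<forall>i. x $ i - y $ i \<in> \<int>"
    then have "- (x $ i - y $ i) \<in> \<int>"
      by (intro Ints_minus) auto
    then show "y $ i - x $ i \<in> \<int>" by simp
  qed
  show "transp (\<lambda>x y::real^2. \<forall>i. x $ i - y $ i \<in> \<int>)"
  proof (rule transpI, rule allI)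
    fix x y z :: "real^2" and i
    assume "\<forall>i. x $ i - y $ i \<in> \<int>" "\<forall>i. y $ i - z $ i \<in> \<int>"
    then have "(x $ i - y $ i) + (y $ i - z $ i) \<in> \<int>"
      by (intro Ints_add) auto
    then show "x $ i - z $ i \<in> \<int>" by simp
  qed
qed

instantiation torus :: topological_space
begin

definition open_torus :: "torus set \<Rightarrow> bool" where
  "open_torus U \<longleftrightarrow> open (torus_proj -` U)"

instance
proof
  show "open (UNIV :: torus set)"
    by (simp add: open_torus_def)
  show "open (S \<inter> T)" if "open S" "open T" for S T :: "torus set"
    using that by (simp add: open_torus_def vimage_Int open_Int)
  show "open (\<Union> K)" if "\<forall>S\<in>K. open S" for K :: "torus set set"
    using that by (auto simp: open_torus_def vimage_Union intro!: open_UN)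
qed

end

definition is_lift :: "(real^2 \<Rightarrow> real^2) \<Rightarrow> (torus \<Rightarrow> torus) \<Rightarrow> bool" where
  "is_lift f F \<longleftrightarrow> (\<exists>g. homeomorphism UNIV UNIV f g) \<and> torus_proj \<circ> f = F \<circ> torus_proj"

definition rotation_set :: "(real^2 \<Rightarrow> real^2) \<Rightarrow> (real^2) set" where
  "rotation_set f =
     (\<Inter>m\<in>{1..}. closure (\<Union>n\<in>{m..}. {((f ^^ n) x - x) /\<^sub>R real n | x. x \<in> UNIV}))"

text \<open>Homotopies of closed curves are free: the base point may move.\<close>

definition essential_curve :: "(real \<Rightarrow> torus) \<Rightarrow> bool" where
  "essential_curve \<gamma> \<longleftrightarrow> path \<gamma> \<and> pathfinish \<gamma> = pathstart \<gamma> \<and>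
     \<not> (\<exists>a. homotopic_loops UNIV \<gamma> (\<lambda>t. a))"

definition free_curve :: "(torus \<Rightarrow> torus) \<Rightarrow> (real \<Rightarrow> torus) \<Rightarrow> bool" where
  "free_curve F \<gamma> \<longleftrightarrow> essential_curve \<gamma> \<and> simple_path \<gamma> \<and>
     F ` path_image \<gamma> \<inter> path_image \<gamma> = {}"

definition curve_intersection_property :: "(torus \<Rightarrow> torus) \<Rightarrow> bool" where
  "curve_intersection_property F \<longleftrightarrow> \<not> (\<exists>\<gamma>. free_curve F \<gamma>)"

end

theory Submission imports Defs "HOL-Complex_Analysis.Complex_Analysis" begin

text \<open>Identify the plane with the complex numbers, let \<open>f\<close> be the lift and suppose that \<open>F\<close> has no fixed point while the
  rotation set has empty interior. By a variant of the Misiurewicz--Ziemian theorem its convex hull has empty interior as well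
  and hence is a segment \<open>I\<close>. If a primitive integer functional had no integer value on \<open>I\<close>, averages of that functional
  along orbits would define a half plane whose boundary projects to a free curve. So every primitive functional has an integer value on \<open>I\<close>,
  and a Euclidean algorithm produces a lattice point on \<open>I\<close>. After changing the lift this point is \<open>0\<close>.

  Cut the plane into squares of side \<open>1 / N\<close> and let \<open>E\<close> relate a square to those that meet its image. Since \<open>f\<close>
  moves every point by a definite amount, Brouwer's lemma on translation arcs, in the form given by Franks, shows that for large
  \<open>N\<close> the periodic graph \<open>E\<close> has no closed walk. The translations realised by walks between equivalent squares in a
  strongly connected class thus form semigroups without \<open>0\<close>, and such a semigroup lies in a half plane.

  If \<open>0\<close> is an end point of \<open>I\<close>, some orbits have sublinear displacement. Discarding from \<open>E\<close>, one by one, the classes of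
  edges that such orbits use with frequency \<open>0\<close> leaves nothing, which is absurd. If \<open>0\<close> is an interior point of \<open>I\<close>, consider
  unions of squares that are mapped into themselves by \<open>f\<close>. As there are no free curves, such a set or its complement has
  only bounded components; the squares between the largest set of the first kind and the next one form a single class. Its half plane
  is either bounded by the line through \<open>I\<close>, which again yields a half plane bounded by free curves, or the closed walks of extremal
  speed run through bounded periodic components, whose basins have an impossible boundary.\<close>

section \<open>Fixed points of plane homeomorphisms\<close>

text \<open>A walk in \<open>E\<close> is only a pseudo-orbit, so the translation of a closed walk
  need not be a rotation vector; this obstacle shapes the proof. Along a walk the components of an
  attractor really are mapped into one another, so closed walks through bounded components are
  realised by orbits up to a bounded error. In the single class between the two attractors nothing
  is realised, but there the semigroup without 0 supplies a functional that is nonnegative on all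
  closed walks. Since long walks split into loops of at most \<open>N * N\<close> steps, which are
  finite in number up to translation, such functionals have potentials and extremal rates, and these
  compare walks with orbits. The mesh is chosen with \<open>2 / N\<close> below the least
  displacement of the lift: closing up a chain then moves points by less than this displacement and
  creates no fixed point. The hypothesis on curves enters only as \<open>no_free_grid_curve\<close>,
  a statement about lattice periodic sets of grid edges. It does not depend on the lift, so the lift
  can be changed freely, and it yields a contradiction from any unbounded connected piece of a free
  boundary.\<close>

text \<open>The difference takes values in the discrete set of integer multiples of
  \<open>2 * pi * \<i>\<close>. All bookkeeping of angles below compares two branches at two points
  of a connected set in this way.\<close>

lemma continuous_logs_differ_const:
  fixes h1 h2 :: "'a::metric_space \<Rightarrow> complex"
  assumes "connected S" "continuous_on S h1" "continuous_on S h2"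
    and "\<And>x. x \<in> S \<Longrightarrow> exp (h1 x) = exp (h2 x)" "a \<in> S" "b \<in> S"
  shows "h1 a - h2 a = h1 b - h2 b"
proof -
  have "(\<lambda>x. h1 x - h2 x) constant_on S"
  proof (rule continuous_discrete_range_constant[OF assms(1)])
    show "continuous_on S (\<lambda>x. h1 x - h2 x)"
      by (intro continuous_intros assms)
    fix x assume x: "x \<in> S"
    have "2 * pi \<le> norm ((h1 y - h2 y) - (h1 x - h2 x))"
      if y: "y \<in> S" "h1 y - h2 y \<noteq> h1 x - h2 x" for y
    proof -
      obtain m n :: int where "h1 x = h2 x + (of_int (2 * m) * pi) * \<i>" "h1 y = h2 y + (of_int (2 * n) * pi) * \<i>"
        using assms(4)[OF x] assms(4)[OF y(1)] by (meson exp_eq)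
      then have "(h1 y - h2 y) - (h1 x - h2 x) = of_real (2 * of_int (n - m) * pi) * \<i>"
        by (simp add: algebra_simps)
      then have e: "norm ((h1 y - h2 y) - (h1 x - h2 x)) = \<bar>2 * of_int (n - m) * pi\<bar>"
        and "n \<noteq> m" using y(2) by (auto simp: norm_mult simp del: of_real_mult)
      then have "1 \<le> \<bar>real_of_int (n - m)\<bar>" by linarith
      then show ?thesis unfolding e by (simp add: abs_mult)
    qed
    then show "\<exists>e>0. \<forall>y. y \<in> S \<and> h1 y - h2 y \<noteq> h1 x - h2 x \<longrightarrow> e \<le> norm ((h1 y - h2 y) - (h1 x - h2 x))"
      using pi_gt_zero by (intro exI[of _ "2 * pi"]) auto
  qed
  then show ?thesis using assms(5,6) unfolding constant_on_def by metis
qed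

lemma exp_add_odd_pi:
  fixes k :: int assumes "odd k"
  shows "exp (z + of_int k * pi * \<i>) = - exp z"
proof -
  obtain m where "k = 2 * m + 1" using assms by (elim oddE)
  then have "exp (of_int k * pi * \<i>) = exp (pi * \<i> + (of_int (2 * m) * pi) * \<i>)"
    by (simp add: algebra_simps)
  also have "\<dots> = exp (pi * \<i>)" using exp_eq by blast
  finally show ?thesis by (simp add: exp_add)
qed

lemma exp_eq_uminus_exp:
  assumes "exp a = - exp (b::complex)"
  obtains k :: int where "odd k" "a = b + of_int k * pi * \<i>"
proof -
  have "exp a = exp (b + of_int 1 * pi * \<i>)" using exp_add_odd_pi[of 1 b] assms by simp
  then obtain n :: int where "a = b + of_int 1 * pi * \<i> + (of_int (2 * n) * pi) * \<i>" by (meson exp_eq)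
  then show ?thesis by (intro that[of "2 * n + 1"]) (auto simp: algebra_simps)
qed

text \<open>The angle by which a plane map of bounded displacement turns the segment between two points:
  \<open>G\<close> is a logarithm of \<open>(f q - f p) / (q - p)\<close> with \<open>q = p + exp \<zeta>\<close>. It is single valued and symmetric
  in \<open>p\<close> and \<open>q\<close> because the quotient tends to 1 for distant points.\<close>

lemma secant_ratio_log:
  fixes f :: "complex \<Rightarrow> complex"
  assumes cf: "continuous_on UNIV f" and inj: "inj f" and M: "\<And>z. norm (f z - z) \<le> M"
  obtains G :: "complex \<times> complex \<Rightarrow> complex" where "continuous_on UNIV G"
    "\<And>p \<zeta>. f (p + exp \<zeta>) - f p = exp (\<zeta> + G (p, \<zeta>))"
    "\<And>p \<zeta> k. odd (k::int) \<Longrightarrow> G (p + exp \<zeta>, \<zeta> + of_int k * pi * \<i>) = G (p, \<zeta>)"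
proof -
  define R where "R = (\<lambda>x::complex\<times>complex. (f (fst x + exp (snd x)) - f (fst x)) / exp (snd x))"
  have cR: "continuous_on UNIV R" unfolding R_def
    by (intro continuous_intros continuous_on_compose2[OF cf]) auto
  have nzR: "R x \<noteq> 0" for x
    using injD[OF inj, of "fst x + exp (snd x)" "fst x"] by (auto simp: R_def)
  obtain G where cG: "continuous_on UNIV G" and G: "\<And>x. R x = exp (G x)"
    using continuous_logarithm_on_contractible[OF cR contractible_UNIV nzR] by auto
  \<comment> \<open>Distant pairs: the points are more than \<open>2 * M\<close> apart while their
    displacements differ by at most \<open>2 * M\<close>, so \<open>R\<close> stays within distance
    1 of 1 and the principal branch \<open>Ln\<close> applies.\<close>
  define D where "D = {x::complex\<times>complex. Re (snd x) > ln (2 * M + 1)}"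
  have "0 \<le> M" using M[of 0] norm_ge_zero order_trans by blast
  have RD: "R x \<notin> \<real>\<^sub>\<le>\<^sub>0" if "x \<in> D" for x
  proof -
    obtain p \<zeta> where x: "x = (p, \<zeta>)" by (cases x)
    have "2 * M < exp (Re \<zeta>)"
    proof -
      have "exp (ln (2 * M + 1)) < exp (Re \<zeta>)" using that unfolding D_def x by simp
      then show ?thesis using \<open>0 \<le> M\<close> by simp
    qed
    moreover have "R x - 1 = ((f (p + exp \<zeta>) - (p + exp \<zeta>)) - (f p - p)) / exp \<zeta>"
      by (simp add: R_def x field_simps)
    then have "norm (R x - 1) * exp (Re \<zeta>) = norm ((f (p + exp \<zeta>) - (p + exp \<zeta>)) - (f p - p))"
      by (simp add: norm_divide)
    moreover have "\<dots> \<le> 2 * M"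
      using M[of p] M[of "p + exp \<zeta>"] norm_triangle_ineq4[of "f (p + exp \<zeta>) - (p + exp \<zeta>)" "f p - p"] by linarith
    ultimately have "norm (R x - 1) < 1"
    proof -
      assume a: "2 * M < exp (Re \<zeta>)" and b: "norm (R x - 1) * exp (Re \<zeta>) = norm ((f (p + exp \<zeta>) - (p + exp \<zeta>)) - (f p - p))"
        and c: "norm ((f (p + exp \<zeta>) - (p + exp \<zeta>)) - (f p - p)) \<le> 2 * M"
      have "norm (R x - 1) * exp (Re \<zeta>) < 1 * exp (Re \<zeta>)" using a b c by linarith
      then show ?thesis by (simp only: mult_less_cancel_right_pos exp_gt_zero)
    qed
    then have "\<bar>Re (R x) - 1\<bar> < 1" by (metis abs_Re_le_cmod le_less_trans minus_complex.simps(1) one_complex.simps(1))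
    then have "Re (R x) > 0" by linarith
    then show ?thesis by (auto simp: complex_nonpos_Reals_iff)
  qed
  have "convex D"
  proof -
    have "D = (\<lambda>x. Re (snd x)) -` {ln (2 * M + 1)<..}" unfolding D_def by auto
    moreover have "linear (\<lambda>x::complex\<times>complex. Re (snd x))" by (simp add: linear_iff)
    ultimately show ?thesis using convex_linear_vimage convex_real_interval(3) by blast
  qed
  have sym: "G (p + exp \<zeta>, \<zeta> + of_int k * pi * \<i>) = G (p, \<zeta>)" if k: "odd (k::int)" for p \<zeta> k
  proof -
    \<comment> \<open>\<open>\<sigma>\<close> exchanges the two points, as an odd multiple of
      \<open>pi * \<i>\<close> reverses the direction \<open>exp \<zeta>\<close>. \<open>R\<close>
      is invariant, so \<open>G\<close> changes by a constant; comparison with \<open>Ln\<close> on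
      \<open>D\<close> shows that this constant is 0.\<close>
    define \<sigma> where "\<sigma> = (\<lambda>x::complex\<times>complex. (fst x + exp (snd x), snd x + of_int k * pi * \<i>))"
    have R\<sigma>: "R (\<sigma> x) = R x" for x
      using exp_add_odd_pi[OF k, of "snd x"] by (simp add: R_def \<sigma>_def minus_divide_left [symmetric] divide_simps)
    have c\<sigma>: "continuous_on UNIV \<sigma>" unfolding \<sigma>_def by (intro continuous_intros)
    have *: "G (\<sigma> x) - G x = G (\<sigma> y) - G y" for x y
    proof (rule continuous_logs_differ_const[of UNIV "\<lambda>x. G (\<sigma> x)"])
      show "continuous_on UNIV (\<lambda>x. G (\<sigma> x))" by (rule continuous_on_compose2[OF cG c\<sigma>]) auto
      show "exp (G (\<sigma> x)) = exp (G x)" for x using G R\<sigma> by metis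
    qed (use cG in auto)
    define x where "x = (p, of_real (ln (2 * M + 1) + 1) :: complex)"
    have xD: "x \<in> D" "\<sigma> x \<in> D" by (auto simp: D_def x_def \<sigma>_def)
    have "G x - Ln (R x) = G (\<sigma> x) - Ln (R (\<sigma> x))"
    proof (rule continuous_logs_differ_const[OF convex_connected[OF \<open>convex D\<close>]])
      show "continuous_on D G" using cG continuous_on_subset by blast
      show "continuous_on D (\<lambda>x. Ln (R x))"
        by (rule continuous_on_Ln') (use cR RD continuous_on_subset in blast)+
      show "exp (G x) = exp (Ln (R x))" for x using G[of x] nzR[of x] by simp
    qed (use xD in auto)
    then have "G (\<sigma> x) = G x" using R\<sigma> by simp
    then show ?thesis using *[of "(p,\<zeta>)" x] by (simp add: \<sigma>_def)
  qed
  show ?thesis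
  proof (rule that[OF cG _ sym])
    show "f (p + exp \<zeta>) - f p = exp (\<zeta> + G (p, \<zeta>))" for p \<zeta>
      using G[of "(p,\<zeta>)"] by (simp add: R_def exp_add field_simps)
  qed
qed

text \<open>For a simple loop \<open>\<gamma>\<close> on \<open>[s1, u1]\<close> the direction of \<open>\<gamma> t - \<gamma> s\<close> turns by an odd multiple
  of \<open>\<pi>\<close> when \<open>(s, t)\<close> moves from \<open>(s1, t)\<close> to \<open>(t, u1)\<close>. Hence, if \<open>f\<close> shifts the parameter by 1,
  the displacement of \<open>f\<close> turns by a nonzero multiple of \<open>2\<pi>\<close> along the loop and \<open>f\<close> has a fixed point.\<close>

lemma first_return_fixed_point:
  fixes f :: "complex \<Rightarrow> complex" and \<gamma> :: "real \<Rightarrow> complex"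
  assumes cf: "continuous_on UNIV f" and inj: "inj f" and M: "\<And>z. norm (f z - z) \<le> M"
    and nofix: "\<And>z. f z \<noteq> z"
    and c\<gamma>: "continuous_on {s1..u1 + 1} \<gamma>" and shift: "\<And>t. s1 \<le> t \<Longrightarrow> \<gamma> (t + 1) = f (\<gamma> t)"
    and L: "s1 + 1 < u1" and ret: "\<gamma> s1 = \<gamma> u1"
    and simple: "\<And>s t. \<lbrakk>s1 \<le> s; s < t; t \<le> u1; t - s < u1 - s1\<rbrakk> \<Longrightarrow> \<gamma> s \<noteq> \<gamma> t"
    and mid: "\<And>s t. \<lbrakk>u1 - 1 \<le> s; s \<le> s1 + 1; u1 \<le> t; t \<le> s + 1\<rbrakk> \<Longrightarrow> \<gamma> s \<noteq> \<gamma> t"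
  shows False
proof -
  have cd: "continuous_on UNIV (\<lambda>z. f z - z)" by (intro continuous_intros cf)
  obtain \<theta> where c\<theta>: "continuous_on UNIV \<theta>" and \<theta>: "\<And>z. f z - z = exp (\<theta> z)"
    using continuous_logarithm_on_contractible[OF cd contractible_UNIV] nofix by auto
  obtain G where cG: "continuous_on UNIV G"
    and G: "\<And>p \<zeta>. f (p + exp \<zeta>) - f p = exp (\<zeta> + G (p, \<zeta>))"
    and Gsym: "\<And>p \<zeta> k. odd (k::int) \<Longrightarrow> G (p + exp \<zeta>, \<zeta> + of_int k * pi * \<i>) = G (p, \<zeta>)"
    using secant_ratio_log[OF cf inj M] by metis
  \<comment> \<open>Parameters of the nondegenerate chords of the loop, without the corner
    \<open>(s1, u1)\<close> where the chord closes up. \<open>l\<close> is a logarithm of the chord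
    on this convex set.\<close>
  define T where "T = {x::real\<times>real. s1 \<le> fst x \<and> snd x \<le> u1 \<and> fst x < snd x \<and> snd x - fst x < u1 - s1}"
  have csec: "continuous_on S (\<lambda>x. \<gamma> (snd x) - \<gamma> (fst x))"
    if "S \<subseteq> {x. s1 \<le> fst x \<and> fst x \<le> u1 + 1 \<and> s1 \<le> snd x \<and> snd x \<le> u1 + 1}" for S
    by (intro continuous_intros continuous_on_compose2[OF c\<gamma>]) (use that in auto)
  have convex_strip: "convex {x::real\<times>real. fst x \<in> A \<and> snd x \<in> B \<and> snd x - fst x \<in> C}"
    if "convex A" "convex B" "convex C" for A B C
  proof -
    have lin: "linear (\<lambda>x::real\<times>real. fst x)" "linear (\<lambda>x::real\<times>real. snd x)" "linear (\<lambda>x::real\<times>real. snd x - fst x)"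
      by (auto simp: linear_iff algebra_simps)
    have eq: "{x::real\<times>real. fst x \<in> A \<and> snd x \<in> B \<and> snd x - fst x \<in> C} =
      (\<lambda>x. fst x) -` A \<inter> ((\<lambda>x. snd x) -` B \<inter> (\<lambda>x. snd x - fst x) -` C)"
      by auto
    show ?thesis unfolding eq
      by (intro convex_Int convex_linear_vimage[OF lin(1)] convex_linear_vimage[OF lin(2)] convex_linear_vimage[OF lin(3)] that)
  qed
  have cvT: "convex T"
  proof -
    have "T = {x. fst x \<in> {s1..} \<and> snd x \<in> {..u1} \<and> snd x - fst x \<in> {0<..<u1 - s1}}"
      unfolding T_def by auto
    then show ?thesis using convex_strip[of "{s1..}" "{..u1}" "{0<..<u1 - s1}"] by simp
  qed
  obtain l where cl: "continuous_on T l" and l: "\<And>x. x \<in> T \<Longrightarrow> \<gamma> (snd x) - \<gamma> (fst x) = exp (l x)"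
  proof (rule continuous_logarithm_on_contractible[of T "\<lambda>x. \<gamma> (snd x) - \<gamma> (fst x)"])
    show "continuous_on T (\<lambda>x. \<gamma> (snd x) - \<gamma> (fst x))" by (rule csec) (auto simp: T_def)
    show "contractible T" by (rule convex_imp_contractible[OF cvT])
    show "\<gamma> (snd z) - \<gamma> (fst z) \<noteq> 0" if "z \<in> T" for z
      using simple[of "fst z" "snd z"] that unfolding T_def by auto
  qed metis
  \<comment> \<open>\<open>T\<close> moved by \<open>(1,1)\<close>: the chords over it are the
    images under \<open>f\<close> of chords over \<open>T\<close>, so \<open>l'\<close> arises from
    \<open>l\<close> by adding the turning \<open>G\<close>.\<close>
  define T' where "T' = (\<lambda>x. x - (1,1)) -` T"
  have T'_eq: "T' = {x. s1 + 1 \<le> fst x \<and> snd x \<le> u1 + 1 \<and> fst x < snd x \<and> snd x - fst x < u1 - s1}"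
    unfolding T'_def T_def by auto
  have cvT': "convex T'"
  proof -
    have "T' = (+) (1,1) ` T" unfolding T'_def by (force simp: image_iff algebra_simps)
    then show ?thesis using cvT by (metis convex_translation)
  qed
  have cl2: "continuous_on X (\<lambda>x. l (g x))" if "continuous_on X g" "\<And>x. x \<in> X \<Longrightarrow> g x \<in> T"
    for X :: "real set" and g
    by (rule continuous_on_compose2[OF cl that(1)]) (use that in auto)
  define l' where "l' = (\<lambda>x. l (x - (1,1)) + G (\<gamma> (fst x - 1), l (x - (1,1))))"
  have cl': "continuous_on T' l'"
  proof -
    have 1: "continuous_on T' (\<lambda>x. l (x - (1,1)))"
      by (rule continuous_on_compose2[OF cl]) (auto simp: T'_def intro!: continuous_intros)
    have 2: "continuous_on T' (\<lambda>x. \<gamma> (fst x - 1))"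
      by (rule continuous_on_compose2[OF c\<gamma>]) (auto simp: T'_eq intro!: continuous_on_diff continuous_on_fst continuous_on_const continuous_on_id)
    show ?thesis unfolding l'_def
      by (intro continuous_on_add 1 continuous_on_compose2[OF cG] continuous_on_Pair 2) auto
  qed
  have cl2': "continuous_on X (\<lambda>x. l' (g x))" if "continuous_on X g" "\<And>x. x \<in> X \<Longrightarrow> g x \<in> T'"
    for X :: "real set" and g
    by (rule continuous_on_compose2[OF cl' that(1)]) (use that in auto)
  have el: "exp (l (s, t)) = \<gamma> t - \<gamma> s" if "(s, t) \<in> T" for s t using l[OF that] by simp
  have l'0: "\<gamma> (snd x) - \<gamma> (fst x) = exp (l' x)" if "x \<in> T'" for x
  proof -
    have x: "x - (1,1) \<in> T" using that by (simp add: T'_def)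
    then have b: "s1 \<le> fst x - 1" "s1 \<le> snd x - 1" by (auto simp: T_def)
    have "\<gamma> (snd x - 1) = \<gamma> (fst x - 1) + exp (l (x - (1,1)))" using l[OF x] by (simp add: algebra_simps)
    then have "f (\<gamma> (snd x - 1)) - f (\<gamma> (fst x - 1)) = exp (l' x)" using G by (simp add: l'_def)
    then show ?thesis using shift[OF b(1)] shift[OF b(2)] by simp
  qed
  note l' = l'0
  have el': "exp (l' (s, t)) = \<gamma> t - \<gamma> s" if "(s, t) \<in> T'" for s t using l'[OF that] by simp
  have inT: "(s1, t) \<in> T" "(t, u1) \<in> T" if "s1 < t" "t < u1" for t using that by (auto simp: T_def)
  define a where "a = s1 + 1"
  have a: "s1 < a" "a < u1" and u: "s1 < u1 - 1" "u1 - 1 < u1" using L by (auto simp: a_def)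
  have "exp (l (a, u1)) = - exp (l (s1, a))" using el[OF inT(1)[OF a]] el[OF inT(2)[OF a]] ret by simp
  then obtain k :: int where k: "odd k" "l (a, u1) = l (s1, a) + of_int k * pi * \<i>" by (rule exp_eq_uminus_exp)
  have c1: "continuous_on {s1<..<u1} (\<lambda>t. l (t, u1))" "continuous_on {s1<..<u1} (\<lambda>t. l (s1, t))"
    by (rule cl2; auto simp: T_def intro!: continuous_on_Pair continuous_on_const continuous_on_id)+
  have "l (a, u1) - (l (s1, a) + of_int k * pi * \<i>) = l (u1 - 1, u1) - (l (s1, u1 - 1) + of_int k * pi * \<i>)"
  proof (rule continuous_logs_differ_const[of "{s1<..<u1}" "\<lambda>t. l (t, u1)" "\<lambda>t. l (s1, t) + of_int k * pi * \<i>"])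
    fix t assume "t \<in> {s1<..<u1}"
    then show "exp (l (t, u1)) = exp (l (s1, t) + of_int k * pi * \<i>)"
      using exp_add_odd_pi[OF k(1)] el[OF inT(1), of t] el[OF inT(2), of t] ret by simp
  qed (use a u c1 in \<open>auto intro!: continuous_on_add continuous_on_const\<close>)
  then have k2: "l (u1 - 1, u1) = l (s1, u1 - 1) + of_int k * pi * \<i>" using k by simp
  \<comment> \<open>As \<open>\<gamma> u1 = \<gamma> s1\<close>, the chords over
    \<open>(u1 - 1, u1)\<close> and \<open>(s1, u1 - 1)\<close> are one segment in opposite
    orientations; the symmetry of \<open>G\<close> carries the odd number \<open>k\<close> over to
    the image chords.\<close>
  have "G (\<gamma> (u1 - 1), l (u1 - 1, u1)) = G (\<gamma> s1, l (s1, u1 - 1))"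
    using Gsym[OF k(1), of "\<gamma> s1" "l (s1, u1 - 1)"] el[OF inT(1)[OF u]] k2 by simp
  then have k3: "l' (u1, u1 + 1) = l' (a, u1) + of_int k * pi * \<i>"
    using k2 by (simp add: l'_def a_def algebra_simps)
  define D where "D = l' (a, u1) - l (a, u1)"
  have D: "l' x - l x = D" if "x \<in> T \<inter> T'" for x
    unfolding D_def
  proof (rule continuous_logs_differ_const[of "T \<inter> T'"])
    show "connected (T \<inter> T')" using cvT cvT' by (simp add: convex_Int convex_connected)
    show "continuous_on (T \<inter> T') l'" "continuous_on (T \<inter> T') l" using cl cl' by (auto intro: continuous_on_subset)
    show "exp (l' x) = exp (l x)" if "x \<in> T \<inter> T'" for x using l[of x] l'[of x] that by auto
    show "(a, u1) \<in> T \<inter> T'" using L by (auto simp: T'_eq T_def a_def)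
  qed (fact that)
  define \<Theta> where "\<Theta> = (\<lambda>u. \<theta> (\<gamma> u))"
  have c\<Theta>: "continuous_on {s1..u1} \<Theta>"
    unfolding \<Theta>_def by (rule continuous_on_compose2[OF c\<theta>]) (auto intro: continuous_on_subset[OF c\<gamma>])
  have e\<Theta>: "exp (\<Theta> u) = \<gamma> (u + 1) - \<gamma> u" if "s1 \<le> u" for u
    using \<theta>[of "\<gamma> u"] shift[OF that] by (simp add: \<Theta>_def)
  have c\<Theta>2: "continuous_on X \<Theta>" if "X \<subseteq> {s1..u1}" for X using continuous_on_subset[OF c\<Theta> that] .
  have cdiag: "continuous_on X (\<lambda>u. (u, u + 1))" for X :: "real set"
    by (intro continuous_on_Pair continuous_on_add continuous_on_const continuous_on_id)
  have A: "l (u, u + 1) - \<Theta> u = l (v, v + 1) - \<Theta> v" if "u \<in> {s1..u1 - 1}" "v \<in> {s1..u1 - 1}" for u v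
  proof (rule continuous_logs_differ_const[of "{s1..u1 - 1}" "\<lambda>u. l (u, u + 1)"])
    have T: "(u, u + 1) \<in> T" if "u \<in> {s1..u1 - 1}" for u using that L by (auto simp: T_def)
    show "continuous_on {s1..u1 - 1} (\<lambda>u. l (u, u + 1))" by (rule cl2[OF cdiag T])
    show "continuous_on {s1..u1 - 1} \<Theta>" by (rule c\<Theta>2) auto
    show "exp (l (u, u + 1)) = exp (\<Theta> u)" if "u \<in> {s1..u1 - 1}" for u
      using el[OF T[OF that]] e\<Theta>[of u] that by simp
  qed (use that in auto)
  have B: "l' (u, u + 1) - \<Theta> u = l' (v, v + 1) - \<Theta> v" if "u \<in> {a..u1}" "v \<in> {a..u1}" for u v
  proof (rule continuous_logs_differ_const[of "{a..u1}" "\<lambda>u. l' (u, u + 1)"])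
    have T: "(u, u + 1) \<in> T'" if "u \<in> {a..u1}" for u using that L by (auto simp: T'_eq a_def)
    show "continuous_on {a..u1} (\<lambda>u. l' (u, u + 1))" by (rule cl2'[OF cdiag T])
    show "continuous_on {a..u1} \<Theta>" by (rule c\<Theta>2) (auto simp: a_def)
    show "exp (l' (u, u + 1)) = exp (\<Theta> u)" if "u \<in> {a..u1}" for u
      using el'[OF T[OF that]] e\<Theta>[of u] that by (simp add: a_def)
  qed (use that in auto)
  have C: "l' (a, a + 1) - \<Theta> a = l (u1 - 1, u1) - \<Theta> (u1 - 1) + D"
  proof (cases "a \<le> u1 - 1")
    case True
    then have "l' (a, a + 1) - l (a, a + 1) = D" using L by (intro D) (auto simp: T'_eq T_def a_def)
    then show ?thesis using A[of a "u1 - 1"] True L by (auto simp: a_def algebra_simps)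
  next
    case False
    \<comment> \<open>For loops of parameter length less than 2 the ranges of \<open>A\<close> and
      \<open>B\<close> do not overlap; the chords over the triangle \<open>S\<close>, nondegenerate
      by \<open>mid\<close>, bridge the gap.\<close>
    define S where "S = {x::real\<times>real. u1 - 1 \<le> fst x \<and> fst x \<le> a \<and> u1 \<le> snd x \<and> snd x - fst x \<le> 1}"
    have cvS: "convex S"
    proof -
      have "S = {x. fst x \<in> {u1 - 1..a} \<and> snd x \<in> {u1..} \<and> snd x - fst x \<in> {..1}}"
        unfolding S_def by auto
      then show ?thesis using convex_strip[of "{u1 - 1..a}" "{u1..}" "{..1}"] by simp
    qed
    obtain m where cm: "continuous_on S m" and m: "\<And>x. x \<in> S \<Longrightarrow> \<gamma> (snd x) - \<gamma> (fst x) = exp (m x)"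
    proof (rule continuous_logarithm_on_contractible[of S "\<lambda>x. \<gamma> (snd x) - \<gamma> (fst x)"])
      show "continuous_on S (\<lambda>x. \<gamma> (snd x) - \<gamma> (fst x))" by (rule csec) (use L False in \<open>auto simp: S_def a_def\<close>)
      show "contractible S" by (rule convex_imp_contractible[OF cvS])
      show "\<gamma> (snd z) - \<gamma> (fst z) \<noteq> 0" if "z \<in> S" for z
        using mid[of "fst z" "snd z"] that unfolding S_def a_def by auto
    qed metis
    have em: "exp (m (s, t)) = \<gamma> t - \<gamma> s" if "(s, t) \<in> S" for s t using m[OF that] by simp
    have cm2: "continuous_on X (\<lambda>x. m (g x))" if "continuous_on X g" "\<And>x. x \<in> X \<Longrightarrow> g x \<in> S"
      for X :: "real set" and g
      by (rule continuous_on_compose2[OF cm that(1)]) (use that in auto)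
    have 1: "m (u1 - 1, u1) - l (u1 - 1, u1) = m (a, u1) - l (a, u1)"
    proof (rule continuous_logs_differ_const[of "{u1 - 1..a}" "\<lambda>s. m (s, u1)" "\<lambda>s. l (s, u1)"])
      have T: "(s, u1) \<in> T" "(s, u1) \<in> S" if "s \<in> {u1 - 1..a}" for s
        using that L by (auto simp: T_def S_def a_def)
      have c: "continuous_on {u1 - 1..a} (\<lambda>s. (s, u1))"
        by (intro continuous_on_Pair continuous_on_const continuous_on_id)
      show "continuous_on {u1 - 1..a} (\<lambda>s. m (s, u1))" by (rule cm2[OF c T(2)])
      show "continuous_on {u1 - 1..a} (\<lambda>s. l (s, u1))" by (rule cl2[OF c T(1)])
      show "exp (m (s, u1)) = exp (l (s, u1))" if "s \<in> {u1 - 1..a}" for s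
        using el em T that by metis
    qed (use False in auto)
    have 2: "m (a, a + 1) - l' (a, a + 1) = m (a, u1) - l' (a, u1)"
    proof (rule continuous_logs_differ_const[of "{u1..a + 1}" "\<lambda>t. m (a, t)" "\<lambda>t. l' (a, t)"])
      have T: "(a, t) \<in> T'" "(a, t) \<in> S" if "t \<in> {u1..a + 1}" for t
        using that L False by (auto simp: T'_eq S_def a_def)
      have c: "continuous_on {u1..a + 1} (\<lambda>t. (a, t))"
        by (intro continuous_on_Pair continuous_on_const continuous_on_id)
      show "continuous_on {u1..a + 1} (\<lambda>t. m (a, t))" by (rule cm2[OF c T(2)])
      show "continuous_on {u1..a + 1} (\<lambda>t. l' (a, t))" by (rule cl2'[OF c T(1)])
      show "exp (m (a, t)) = exp (l' (a, t))" if "t \<in> {u1..a + 1}" for t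
        using el' em T that by metis
    qed (use False in auto)
    have 3: "m (a, a + 1) - \<Theta> a = m (u1 - 1, u1 - 1 + 1) - \<Theta> (u1 - 1)"
    proof (rule continuous_logs_differ_const[of "{u1 - 1..a}" "\<lambda>u. m (u, u + 1)" \<Theta>])
      have T: "(u, u + 1) \<in> S" if "u \<in> {u1 - 1..a}" for u using that by (auto simp: S_def)
      show "continuous_on {u1 - 1..a} (\<lambda>u. m (u, u + 1))" by (rule cm2[OF cdiag T])
      show "continuous_on {u1 - 1..a} \<Theta>" by (rule c\<Theta>2) (use L in \<open>auto simp: a_def\<close>)
      show "exp (m (u, u + 1)) = exp (\<Theta> u)" if "u \<in> {u1 - 1..a}" for u
        using em[OF T[OF that]] e\<Theta>[of u] that L by simp
    qed (use False in auto)
    have 3: "m (a, a + 1) - \<Theta> a = m (u1 - 1, u1) - \<Theta> (u1 - 1)" using 3 by simp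
    show ?thesis using 1 2 3 unfolding D_def by algebra
  qed
  \<comment> \<open>The displacement has the same logarithm at both ends of the loop, while the two
    gains of \<open>k * pi * \<i>\<close> add up instead of cancelling; this is impossible for odd
    \<open>k\<close>.\<close>
  have "l' (u1, u1 + 1) - \<Theta> u1 = l (s1, s1 + 1) - \<Theta> s1 + D"
    using A[of s1 "u1 - 1"] B[of u1 a] C L by (simp add: a_def)
  moreover have "\<Theta> u1 = \<Theta> s1" using ret by (simp add: \<Theta>_def)
  ultimately have "l' (a, u1) + of_int k * pi * \<i> = l (s1, a) + D" using k3 by (simp add: a_def)
  then have "2 * (of_int k * pi * \<i>) = 0" using k(2) by (simp add: D_def algebra_simps)
  then show False using k(1) by auto
qed

text \<open>The arc \<open>\<alpha>\<close> consists of two radii of the largest open disc around \<open>x\<close> that is disjoint from its image.\<close>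

lemma translation_arc:
  fixes f :: "complex \<Rightarrow> complex"
  assumes cf: "continuous_on UNIV f" and cg: "continuous_on UNIV g"
    and fg: "\<And>z. f (g z) = z" and gf: "\<And>z. g (f z) = z" and nofix: "\<And>z. f z \<noteq> z"
  obtains \<alpha> :: "real \<Rightarrow> complex" where "path \<alpha>" "inj_on \<alpha> {0..1}" "\<alpha> 1 = f (\<alpha> 0)" "\<alpha> (1/2) = x"
    "\<And>s t. \<lbrakk>s \<in> {0..1}; t \<in> {0..1}; \<alpha> s = f (\<alpha> t)\<rbrakk> \<Longrightarrow> s = 1 \<and> t = 0 \<or> s = 0 \<and> t = 1"
proof -
  \<comment> \<open>A point with \<open>\<rho> y < r\<close> would lie in the open disc of radius
    \<open>r\<close> together with its image, so the minimum \<open>r\<close> of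
    \<open>\<rho>\<close> is the radius of the largest disc that is disjoint from its image.\<close>
  define \<rho> where "\<rho> = (\<lambda>y. max (dist x y) (dist x (f y)))"
  have c\<rho>: "continuous_on S \<rho>" for S
    unfolding \<rho>_def by (intro continuous_intros continuous_on_subset[OF cf]) auto
  obtain z where z: "z \<in> cball x (dist x (f x))" "\<And>y. y \<in> cball x (dist x (f x)) \<Longrightarrow> \<rho> z \<le> \<rho> y"
    using continuous_attains_inf[OF compact_cball _ c\<rho>, of x "dist x (f x)"] by fastforce
  define r where "r = \<rho> z"
  have r: "r \<le> \<rho> y" for y
  proof (cases "y \<in> cball x (dist x (f x))")
    case False
    then have "\<rho> x \<le> \<rho> y" by (auto simp: \<rho>_def)
    then show ?thesis using z(2)[of x] unfolding r_def by fastforce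
  qed (use z in \<open>auto simp: r_def\<close>)
  have "0 < r" using nofix[of z] unfolding r_def \<rho>_def by (metis dist_nz less_max_iff_disj)
  \<comment> \<open>If only one of \<open>y\<close> and \<open>f y\<close> were on the circle, a
    small move of that point towards \<open>x\<close> would keep the other one inside, by continuity
    of \<open>f\<close> or \<open>g\<close>, and push \<open>\<rho>\<close> below its
    minimum.\<close>
  have both: "dist x y = r \<and> dist x (f y) = r" if y: "\<rho> y = r" for y
  proof (rule ccontr)
    assume neg: "\<not> (dist x y = r \<and> dist x (f y) = r)"
    have le: "dist x y \<le> r" "dist x (f y) \<le> r" using y by (auto simp: \<rho>_def)
    have shrink: "dist x (a + of_real e * (x - a)) < r" if "dist x a = r" "0 < e" "e < 1" for a e
    proof -
      have "x - (a + of_real e * (x - a)) = of_real (1 - e) * (x - a)" by (simp add: algebra_simps)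
      then have "dist x (a + of_real e * (x - a)) = (1 - e) * r"
        using that unfolding dist_norm by (simp only: norm_mult norm_of_real)
      then show ?thesis using that \<open>0 < r\<close> by simp
    qed
    have tend: "((\<lambda>e. a + of_real e * (x - a)) \<longlongrightarrow> a) (at_right 0)" for a :: complex
      by (rule tendsto_eq_intros refl | simp)+
    consider "dist x y < r" "dist x (f y) = r" | "dist x (f y) < r" "dist x y = r"
      using neg le y unfolding \<rho>_def by fastforce
    then show False
    proof cases
      case 1
      have "((\<lambda>e. dist x (g (f y + of_real e * (x - f y)))) \<longlongrightarrow> dist x y) (at_right 0)"
        by (intro tendsto_dist tendsto_const continuous_on_tendsto_compose[OF cg, of _ "f y", simplified gf] tend) auto
      then have "\<forall>\<^sub>F e in at_right 0. dist x (g (f y + of_real e * (x - f y))) < r" using 1 order_tendstoD by blast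
      moreover have "\<forall>\<^sub>F e in at_right (0::real). 0 < e \<and> e < 1" by (auto simp: eventually_at_right_field intro!: exI[of _ 1])
      ultimately have "\<forall>\<^sub>F e in at_right (0::real). False"
      proof eventually_elim
        case (elim e)
        then show False using r[of "g (f y + of_real e * (x - f y))"] shrink[OF 1(2), of e] by (simp add: \<rho>_def fg)
      qed
      then show False by (simp add: trivial_limit_at_right_real)
    next
      case 2
      have "((\<lambda>e. dist x (f (y + of_real e * (x - y)))) \<longlongrightarrow> dist x (f y)) (at_right 0)"
        by (intro tendsto_dist tendsto_const continuous_on_tendsto_compose[OF cf] tend) auto
      then have "\<forall>\<^sub>F e in at_right 0. dist x (f (y + of_real e * (x - y))) < r" using 2 order_tendstoD by blast
      moreover have "\<forall>\<^sub>F e in at_right (0::real). 0 < e \<and> e < 1" by (auto simp: eventually_at_right_field intro!: exI[of _ 1])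
      ultimately have "\<forall>\<^sub>F e in at_right (0::real). False"
      proof eventually_elim
        case (elim e)
        then show False using r[of "y + of_real e * (x - y)"] shrink[OF 2(2), of e] by (simp add: \<rho>_def)
      qed
      then show False by (simp add: trivial_limit_at_right_real)
    qed
  qed
  have zr: "dist x z = r" "dist x (f z) = r" using both[of z] by (auto simp: r_def)
  define \<alpha> where "\<alpha> = linepath z x +++ linepath x (f z)"
  have \<alpha>1: "\<alpha> t = x + of_real (1 - 2 * t) * (z - x)" if "t \<le> 1/2" for t
    using that by (simp add: \<alpha>_def joinpaths_def linepath_def scaleR_conv_of_real algebra_simps)
  have \<alpha>2: "\<alpha> t = x + of_real (2 * t - 1) * (f z - x)" if "1/2 \<le> t" for t
    using that by (cases "t = 1/2") (auto simp: \<alpha>_def joinpaths_def linepath_def scaleR_conv_of_real algebra_simps)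
  have dist\<alpha>: "dist x (\<alpha> t) = \<bar>2 * t - 1\<bar> * r" for t
  proof -
    have *: "dist x (x + of_real c * (w - x)) = \<bar>c\<bar> * dist x w" for c w
    proof -
      have "dist x (x + of_real c * (w - x)) = norm (of_real c * (w - x))" by (simp add: dist_norm)
      then show ?thesis by (simp only: norm_mult norm_of_real dist_norm norm_minus_commute)
    qed
    show ?thesis
    proof (cases "t \<le> 1/2")
      case True
      then show ?thesis using *[of "1 - 2 * t" z] zr \<alpha>1[OF True] by simp
    next
      case False
      then show ?thesis using *[of "2 * t - 1" "f z"] zr \<alpha>2[of t] by simp
    qed
  qed
  have inj: "inj_on \<alpha> {0..1}"
  proof (rule linorder_inj_onI)
    fix s t :: real assume st: "s < t" "s \<in> {0..1}" "t \<in> {0..1}"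
    show "\<alpha> s \<noteq> \<alpha> t"
    proof
      assume eq: "\<alpha> s = \<alpha> t"
      then have "\<bar>2 * s - 1\<bar> = \<bar>2 * t - 1\<bar>" using dist\<alpha> \<open>0 < r\<close> by (metis mult_cancel_right order_less_irrefl)
      then have "s < 1/2" "t > 1/2" "1 - 2 * s = 2 * t - 1" using st by auto
      then have "of_real (1 - 2 * s) * (z - x) = of_real (1 - 2 * s) * (f z - x)"
        using \<alpha>1[of s] \<alpha>2[of t] eq by (simp only: add_left_cancel order.strict_implies_order)
      then have "z - x = f z - x" using \<open>s < 1/2\<close> by (simp only: mult_cancel_left of_real_eq_0_iff) auto
      then show False using nofix[of z] by simp
    qed
  qed auto
  \<comment> \<open>A point of the arc whose image is on the arc attains the minimum of
    \<open>\<rho>\<close>. Hence it and its image lie on the circle, which the arc meets only at its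
    two ends.\<close>
  have cross: "s = 1 \<and> t = 0 \<or> s = 0 \<and> t = 1" if s: "s \<in> {0..1}" and t: "t \<in> {0..1}" and eq: "\<alpha> s = f (\<alpha> t)" for s t
  proof -
    have end01: "\<alpha> 0 = z" "\<alpha> 1 = f z" using \<alpha>1[of 0] \<alpha>2[of 1] by auto
    have sr: "\<bar>2 * s - 1\<bar> * r \<le> r" and tr: "\<bar>2 * t - 1\<bar> * r \<le> r"
      using s t \<open>0 < r\<close> by (auto simp: abs_if mult_le_cancel_right)
    then have "\<rho> (\<alpha> t) \<le> r" using dist\<alpha>[of t] dist\<alpha>[of s] eq by (simp add: \<rho>_def)
    then have "\<rho> (\<alpha> t) = r" using r[of "\<alpha> t"] by simp
    then have "dist x (\<alpha> t) = r" "dist x (\<alpha> s) = r" using both eq by auto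
    then have "\<bar>2 * t - 1\<bar> = 1" "\<bar>2 * s - 1\<bar> = 1" using dist\<alpha> \<open>0 < r\<close> by simp_all
    then have "s = 0 \<or> s = 1" "t = 0 \<or> t = 1" by linarith+
    moreover have "\<not> (s = t)" using eq nofix by metis
    ultimately show ?thesis by blast
  qed
  show ?thesis
  proof (rule that[OF _ inj])
    show "path \<alpha>" by (simp add: \<alpha>_def)
    show "\<alpha> 1 = f (\<alpha> 0)" "\<alpha> (1/2) = x" using \<alpha>1[of 0] \<alpha>2[of 1] \<alpha>1[of "1/2"] by auto
  qed (fact cross)
qed

text \<open>The iterates of a translation arc through \<open>x\<close> form a line with
  \<open>\<gamma> (t + 1) = f (\<gamma> t)\<close>, and a periodic point forces this line to return
  to itself. Up to the first return it is a simple loop, to which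
  \<open>first_return_fixed_point\<close> applies.\<close>

theorem brouwer_no_periodic_point:
  fixes f :: "complex \<Rightarrow> complex"
  assumes cf: "continuous_on UNIV f" and cg: "continuous_on UNIV g"
    and fg: "\<And>z. f (g z) = z" and gf: "\<And>z. g (f z) = z" and nofix: "\<And>z. f z \<noteq> z"
    and M: "\<And>z. norm (f z - z) \<le> M" and n: "0 < n"
  shows "(f ^^ n) x \<noteq> x"
proof
  assume per: "(f ^^ n) x = x"
  have inj: "inj f" by (metis gf injI)
  obtain \<alpha> :: "real \<Rightarrow> complex" where p\<alpha>: "path \<alpha>" and inj\<alpha>: "inj_on \<alpha> {0..1}" and \<alpha>10: "\<alpha> 1 = f (\<alpha> 0)"
    and \<alpha>x: "\<alpha> (1/2) = x"
    and cross: "\<And>s t. \<lbrakk>s \<in> {0..1}; t \<in> {0..1}; \<alpha> s = f (\<alpha> t)\<rbrakk> \<Longrightarrow> s = 1 \<and> t = 0 \<or> s = 0 \<and> t = 1"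
    using translation_arc[OF cf cg fg gf nofix, of x] by metis
  define \<gamma> where "\<gamma> = (\<lambda>t. (f ^^ nat \<lfloor>t\<rfloor>) (\<alpha> (t - of_int \<lfloor>t\<rfloor>)))"
  have shift: "\<gamma> (t + 1) = f (\<gamma> t)" if "0 \<le> t" for t
    using that by (simp add: \<gamma>_def nat_add_distrib)
  have \<gamma>01: "\<gamma> t = \<alpha> t" if "t \<in> {0..1}" for t
  proof (cases "t = 1")
    case False
    then have "\<lfloor>t\<rfloor> = 0" using that by (simp add: floor_eq_iff)
    then show ?thesis by (simp add: \<gamma>_def)
  qed (simp add: \<gamma>_def \<alpha>10)
  have c\<gamma>: "continuous_on {0..real k + 1} \<gamma>" for k
  proof (induction k)
    case 0
    have "continuous_on {0..1} \<gamma>"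
      using p\<alpha> unfolding path_def by (rule continuous_on_eq) (use \<gamma>01 in auto)
    then show ?case by simp
  next
    case (Suc k)
    have "continuous_on {1..real k + 2} (\<lambda>t. f (\<gamma> (t - 1)))"
      by (rule continuous_on_compose2[OF cf continuous_on_compose2[OF Suc]]) (auto intro!: continuous_intros)
    then have "continuous_on {1..real k + 2} \<gamma>"
      by (rule continuous_on_eq) (use shift[of "t - 1" for t] in auto)
    then have "continuous_on ({0..real k + 1} \<union> {1..real k + 2}) \<gamma>"
      by (intro continuous_on_closed_Un Suc) auto
    moreover have "{0..real k + 1} \<union> {1..real k + 2} = {0..real (Suc k) + 1}" by auto
    ultimately show ?case by simp
  qed
  have unshift: "\<gamma> s = \<gamma> t \<Longrightarrow> 1 \<le> s \<Longrightarrow> 1 \<le> t \<Longrightarrow> \<gamma> (s - 1) = \<gamma> (t - 1)" for s t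
    using shift[of "s - 1"] shift[of "t - 1"] injD[OF inj] by simp
  have base: "2 \<le> t" if "\<gamma> s = \<gamma> t" "0 \<le> s" "s < 1" "s < t" for s t
  proof (rule ccontr)
    assume "\<not> 2 \<le> t"
    show False
    proof (cases "t < 1")
      case True
      then have "\<alpha> s = \<alpha> t" using that \<gamma>01[of s] \<gamma>01[of t] by auto
      then show False using inj\<alpha> that True by (auto dest: inj_onD)
    next
      case False
      then have "\<alpha> s = f (\<alpha> (t - 1))" using that \<gamma>01[of s] \<gamma>01[of "t - 1"] shift[of "t - 1"] \<open>\<not> 2 \<le> t\<close> by auto
      then show False using cross[of s "t - 1"] that False \<open>\<not> 2 \<le> t\<close> by auto
    qed
  qed
  have gap: "1 < t - s" if "\<gamma> s = \<gamma> t" "0 \<le> s" "s < t" for s t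
  proof -
    have "\<gamma> (s - real k) = \<gamma> (t - real k)" if "real k \<le> s" for k
      using that
    proof (induction k)
      case 0
      then show ?case using \<open>\<gamma> s = \<gamma> t\<close> by simp
    next
      case (Suc k)
      then show ?case using unshift[of "s - real k" "t - real k"] \<open>s < t\<close> by (simp add: algebra_simps)
    qed
    from this[of "nat \<lfloor>s\<rfloor>"] have "\<gamma> (s - \<lfloor>s\<rfloor>) = \<gamma> (t - \<lfloor>s\<rfloor>)" using that by simp
    then have "2 \<le> t - \<lfloor>s\<rfloor>" by (rule base) (use that in linarith)+
    then show ?thesis by linarith
  qed
  \<comment> \<open>By \<open>gap\<close> coincidences of \<open>\<gamma>\<close> are more than 1
    apart, so those up to \<open>n + 1\<close> form a compact set away from the diagonal and one
    with least \<open>u1\<close> exists.\<close>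
  define K where "K = {x::real\<times>real. 0 \<le> fst x \<and> fst x + 1 \<le> snd x \<and> snd x \<le> real n + 1 \<and> \<gamma> (fst x) = \<gamma> (snd x)}"
  define B where "B = {x::real\<times>real. 0 \<le> fst x \<and> fst x + 1 \<le> snd x \<and> snd x \<le> real n + 1}"
  have cB: "closed B" unfolding B_def
    by (intro closed_Collect_conj closed_Collect_le continuous_intros)
  have c2: "continuous_on B (\<lambda>x. \<gamma> (fst x))" "continuous_on B (\<lambda>x. \<gamma> (snd x))"
    by (rule continuous_on_compose2[OF c\<gamma>[of n]]; auto simp: B_def intro!: continuous_on_fst continuous_on_snd continuous_on_id)+
  have Keq: "K = {x \<in> B. \<gamma> (fst x) - \<gamma> (snd x) = 0}" by (auto simp: K_def B_def)
  have "closed K" unfolding Keq by (rule continuous_closed_preimage_constant[OF continuous_on_diff[OF c2] cB])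
  moreover have "bounded K"
    by (rule bounded_subset[OF bounded_Times[OF bounded_closed_interval[of 0 "real n + 1"] bounded_closed_interval[of 0 "real n + 1"]]])
      (auto simp: K_def)
  ultimately have "compact K" by (simp add: compact_eq_bounded_closed)
  have "(1/2, 1/2 + real n) \<in> K"
  proof -
    have "\<gamma> (1/2 + real k) = (f ^^ k) x" for k
    proof (induction k)
      case (Suc k)
      then show ?case using shift[of "1/2 + real k"] by (simp add: algebra_simps)
    qed (use \<gamma>01[of "1/2"] \<alpha>x in simp)
    from this[of 0] this[of n] show ?thesis using per n by (simp add: K_def)
  qed
  then have "K \<noteq> {}" by blast
  then have "\<exists>y\<in>K. \<forall>y'\<in>K. snd y \<le> snd y'"
    by (rule continuous_attains_inf[OF \<open>compact K\<close>]) (rule continuous_on_snd[OF continuous_on_id])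
  then obtain y where y: "y \<in> K" "\<And>y'. y' \<in> K \<Longrightarrow> snd y \<le> snd y'" by blast
  define s1 u1 where "s1 = fst y" and "u1 = snd y"
  have y1: "0 \<le> s1" "s1 + 1 \<le> u1" "u1 \<le> real n + 1" "\<gamma> s1 = \<gamma> u1"
    using y(1) by (auto simp: K_def s1_def u1_def)
  have least: "u1 \<le> t" if "\<gamma> s = \<gamma> t" "0 \<le> s" "s < t" for s t
  proof (cases "t \<le> real n + 1")
    case True
    then have "(s, t) \<in> K" using gap[OF that] that by (auto simp: K_def)
    then show ?thesis using y(2) by (auto simp: u1_def)
  qed (use y1 in auto)
  have L: "s1 + 1 < u1" using gap[of s1 u1] y1 by auto
  \<comment> \<open>Otherwise injectivity of \<open>f\<close> would move the coincidence back by 1,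
    against the choice of \<open>u1\<close>.\<close>
  have "s1 < 1"
  proof (rule ccontr)
    assume "\<not> s1 < 1"
    then have "\<gamma> (s1 - 1) = \<gamma> (u1 - 1)" using unshift[of s1 u1] y1 by auto
    then show False using least[of "s1 - 1" "u1 - 1"] \<open>\<not> s1 < 1\<close> y1 by auto
  qed
  then have "2 \<le> u1" using base[of s1 u1] y1 by auto
  show False
  proof (rule first_return_fixed_point[OF cf inj M nofix _ _ L y1(4)])
    show "continuous_on {s1..u1 + 1} \<gamma>"
      using y1 by (intro continuous_on_subset[OF c\<gamma>[of "Suc n"]]) auto
    show "\<gamma> (t + 1) = f (\<gamma> t)" if "s1 \<le> t" for t using shift that y1 by simp
    show "\<gamma> s \<noteq> \<gamma> t" if "s1 \<le> s" "s < t" "t \<le> u1" "t - s < u1 - s1" for s t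
    proof
      assume eq: "\<gamma> s = \<gamma> t"
      then have "t = u1" using least[of s t] that y1 by auto
      then show False using least[of s1 s] eq y1 that by auto
    qed
    show "\<gamma> s \<noteq> \<gamma> t" if "u1 - 1 \<le> s" "s \<le> s1 + 1" "u1 \<le> t" "t \<le> s + 1" for s t
    proof
      assume "\<gamma> s = \<gamma> t"
      then have "\<gamma> (s - 1) = \<gamma> (t - 1)" using that \<open>2 \<le> u1\<close> by (intro unshift) auto
      then show False using base[of "s - 1" "t - 1"] that \<open>2 \<le> u1\<close> \<open>s1 < 1\<close> by auto
    qed
  qed
qed

section \<open>Closing a chain by local perturbations\<close>

text \<open>The homeomorphisms for the single \<open>V k\<close> have disjoint supports and can be
  composed. The last conclusion bounds the displacement of \<open>h\<close> by the diameters of the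
  \<open>V k\<close>.\<close>

lemma homeomorphism_moving_disjoint:
  fixes a b :: "'i \<Rightarrow> complex"
  assumes "finite K" "\<And>k. k \<in> K \<Longrightarrow> open (V k) \<and> connected (V k) \<and> a k \<in> V k \<and> b k \<in> V k"
    and "\<And>j k. \<lbrakk>j \<in> K; k \<in> K; j \<noteq> k\<rbrakk> \<Longrightarrow> V j \<inter> V k = {}"
  obtains h h' where "homeomorphism UNIV UNIV h h'" "\<And>k. k \<in> K \<Longrightarrow> h (a k) = b k"
    "\<And>x. h x = x \<or> (\<exists>k\<in>K. x \<in> V k \<and> h x \<in> V k)"
proof -
  have "\<exists>h h'. homeomorphism UNIV UNIV h h' \<and> (\<forall>k\<in>K. h (a k) = b k) \<and>
    (\<forall>x. h x = x \<or> (\<exists>k\<in>K. x \<in> V k \<and> h x \<in> V k))"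
    using assms
  proof (induction K rule: finite_induct)
    case empty
    have "homeomorphism UNIV UNIV (\<lambda>x::complex. x) (\<lambda>x. x)" by (simp add: homeomorphism_def)
    then show ?case by (rule_tac exI[of _ "\<lambda>x. x"], rule_tac exI[of _ "\<lambda>x. x"]) simp
  next
    case (insert k K)
    have "\<exists>h h'. homeomorphism UNIV UNIV h h' \<and> (\<forall>k\<in>K. h (a k) = b k) \<and>
      (\<forall>x. h x = x \<or> (\<exists>k\<in>K. x \<in> V k \<and> h x \<in> V k))"
      by (rule insert.IH) (use insert.prems in blast)+
    then obtain h h' where h: "homeomorphism UNIV UNIV h h'" "\<forall>k\<in>K. h (a k) = b k"
      "\<forall>x. h x = x \<or> (\<exists>k\<in>K. x \<in> V k \<and> h x \<in> V k)" by blast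
    have k: "open (V k)" "connected (V k)" "a k \<in> V k" "b k \<in> V k" using insert.prems(1)[of k] by auto
    then have "affine hull V k = UNIV" using affine_hull_open by blast
    obtain p q where pq: "homeomorphism UNIV UNIV p q" "p (a k) = b k" "{x. \<not> (p x = x \<and> q x = x)} \<subseteq> V k"
    proof (rule homeomorphism_moving_point[of "V k" UNIV "a k" "b k"])
      show "openin (top_of_set (affine hull V k)) (V k)" using k \<open>affine hull V k = UNIV\<close> by simp
    qed (use k \<open>affine hull V k = UNIV\<close> in auto)
    have disj: "V j \<inter> V k = {}" if "j \<in> K" for j using insert.prems(2)[of j k] insert.hyps that by auto
    have pout: "p x = x" if "x \<notin> V k" for x using pq(3) that by auto
    have pin: "p x \<in> V k" if "x \<in> V k" for x
    proof (rule ccontr)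
      assume "p x \<notin> V k"
      then have "p (p x) = p x" by (rule pout)
      then have "p x = x" using pq(1) by (metis UNIV_I homeomorphism_apply1)
      then show False using \<open>p x \<notin> V k\<close> that by simp
    qed
    have hk: "h x = x" if "x \<in> V k" for x using h(3) disj that by (metis disjoint_iff)
    have 1: "homeomorphism UNIV UNIV (p \<circ> h) (h' \<circ> q)" using homeomorphism_compose[OF h(1) pq(1)] .
    have 2: "(p \<circ> h) (a j) = b j" if "j \<in> insert k K" for j
    proof (cases "j = k")
      case False
      then have "b j \<in> V j" "j \<in> K" using insert.prems(1)[of j] that by auto
      then have "b j \<notin> V k" using disj by auto
      then show ?thesis using h(2) \<open>j \<in> K\<close> pout by simp
    qed (use hk pq k in auto)
    have 3: "(p \<circ> h) x = x \<or> (\<exists>j\<in>insert k K. x \<in> V j \<and> (p \<circ> h) x \<in> V j)" for x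
    proof (cases "x \<in> V k")
      case True
      then show ?thesis using hk pin by auto
    next
      case False
      then show ?thesis
        using h(3)[rule_format, of x]
      proof (elim disjE bexE conjE)
        fix j assume j: "j \<in> K" "x \<in> V j" "h x \<in> V j"
        then have "p (h x) = h x" using disj[OF j(1)] by (intro pout) auto
        then show ?thesis using j by auto
      qed (use pout in auto)
    qed
    show ?case
      by (rule exI[of _ "p \<circ> h"], rule exI[of _ "h' \<circ> q"]) (intro conjI ballI allI 1 2 3)
  qed
  then obtain h h' where "homeomorphism UNIV UNIV h h'" "\<forall>k\<in>K. h (a k) = b k"
    "\<forall>x. h x = x \<or> (\<exists>k\<in>K. x \<in> V k \<and> h x \<in> V k)" by blast
  then show ?thesis by (intro that[of h h']) auto
qed

lemma finite_points_separated:
  fixes y :: "nat \<Rightarrow> complex"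
  assumes "inj_on y {..<n}" "0 < e0"
  obtains e where "0 < e" "e < e0" "\<And>j k. \<lbrakk>j < n; k < n; j \<noteq> k\<rbrakk> \<Longrightarrow> ball (y j) e \<inter> ball (y k) e = {}"
proof -
  have fin: "finite ({..<n} \<times> {..<n})" by simp
  define D where "D = insert (e0 / 2) ((\<lambda>(j,k). dist (y j) (y k) / 2) ` {(j,k). j < n \<and> k < n \<and> j \<noteq> k})"
  have "finite D" unfolding D_def by (auto intro!: finite_imageI finite_subset[OF _ fin])
  moreover have "D \<noteq> {}" "\<forall>d\<in>D. 0 < d" using assms by (auto simp: D_def inj_on_def)
  ultimately have "0 < Min D" "\<And>d. d \<in> D \<Longrightarrow> Min D \<le> d" by auto
  moreover have "ball (y j) (Min D) \<inter> ball (y k) (Min D) = {}" if "j < n" "k < n" "j \<noteq> k" for j k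
  proof -
    have "dist (y j) (y k) / 2 \<in> D" using that by (force simp: D_def)
    then have "Min D \<le> dist (y j) (y k) / 2" by (rule calculation(2))
    then show ?thesis by (intro disjoint_ballI) auto
  qed
  moreover have "Min D < e0" using calculation(2)[of "e0 / 2"] assms by (auto simp: D_def)
  ultimately show ?thesis using that by blast
qed

text \<open>Franks' lemma: a closed chain of small convex sets could be closed up, by pushing inside the sets,
  to a periodic orbit of a homeomorphism that still has no fixed point.\<close>

theorem no_closed_chain:
  fixes f :: "complex \<Rightarrow> complex" and Q :: "'i \<Rightarrow> complex set"
  assumes cf: "continuous_on UNIV f" and cg: "continuous_on UNIV g"
    and fg: "\<And>z. f (g z) = z" and gf: "\<And>z. g (f z) = z"
    and M: "\<And>z. norm (f z - z) \<le> M" and \<delta>: "\<And>z. \<delta> \<le> norm (f z - z)" "d < \<delta>"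
    and Q: "\<And>i. convex (Q i)" "\<And>i. interior (Q i) \<noteq> {}"
      "\<And>i j. i \<noteq> j \<Longrightarrow> interior (Q i) \<inter> interior (Q j) = {}" "\<And>i x y. x \<in> Q i \<Longrightarrow> y \<in> Q i \<Longrightarrow> dist x y \<le> d"
    and E: "\<And>i j. (i, j) \<in> E \<Longrightarrow> f ` Q i \<inter> Q j \<noteq> {}"
  shows "(i, i) \<notin> E\<^sup>+"
proof
  assume "(i, i) \<in> E\<^sup>+"
  define E' where "E' = {(i, j). f ` Q i \<inter> Q j \<noteq> {}}"
  have "(i, i) \<in> E'\<^sup>+" using \<open>(i, i) \<in> E\<^sup>+\<close> by (rule trancl_mono) (use E in \<open>auto simp: E'_def\<close>)
  then have ex: "\<exists>n>0. \<exists>i. (i, i) \<in> E' ^^ n" by (auto simp: trancl_power)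
  \<comment> \<open>In a shortest closed chain neither a set nor a point \<open>y k\<close> is
    repeated, since a repetition would give a shortcut; this is what makes the supports of the
    perturbations disjoint.\<close>
  define n where "n = (LEAST n. 0 < n \<and> (\<exists>i. (i, i) \<in> E' ^^ n))"
  have n: "0 < n" "\<exists>i. (i, i) \<in> E' ^^ n" and least: "\<And>m i. 0 < m \<Longrightarrow> (i, i) \<in> E' ^^ m \<Longrightarrow> n \<le> m"
    using LeastI_ex[of "\<lambda>n. 0 < n \<and> (\<exists>i. (i, i) \<in> E' ^^ n)"] ex Least_le[of "\<lambda>n. 0 < n \<and> (\<exists>i. (i, i) \<in> E' ^^ n)"]
    unfolding n_def by blast+
  obtain c where c: "c 0 = c n" "\<And>k. k < n \<Longrightarrow> (c k, c (Suc k)) \<in> E'"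
    using n(2) unfolding relpow_fun_conv by metis
  have path: "(c j, c k) \<in> E' ^^ (k - j)" if "j \<le> k" "k \<le> n" for j k
    unfolding relpow_fun_conv by (rule exI[of _ "\<lambda>m. c (j + m)"]) (use that c in auto)
  have "\<exists>y. k < n \<longrightarrow> y \<in> Q (c k) \<and> f y \<in> Q (c (Suc k))" for k
    using c(2)[of k] by (cases "k < n") (auto simp: E'_def)
  then obtain y where y: "\<And>k. k < n \<Longrightarrow> y k \<in> Q (c k)" "\<And>k. k < n \<Longrightarrow> f (y k) \<in> Q (c (Suc k))" by metis
  have injc: "inj_on c {..<n}"
  proof (rule linorder_inj_onI)
    fix j k assume jk: "j < k" "j \<in> {..<n}" "k \<in> {..<n}"
    show "c j \<noteq> c k"
    proof
      assume "c j = c k"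
      then have "(c j, c j) \<in> E' ^^ (k - j)" using path[of j k] jk by simp
      then show False using least[of "k - j" "c j"] jk by simp
    qed
  qed auto
  have injy: "inj_on y {..<n}"
  proof (rule linorder_inj_onI)
    fix j k assume jk: "j < k" "j \<in> {..<n}" "k \<in> {..<n}"
    show "y j \<noteq> y k"
    proof
      assume "y j = y k"
      then have "(c j, c (Suc k)) \<in> E'" using y(1)[of j] y(2)[of k] jk by (force simp: E'_def)
      moreover have "(c 0, c j) \<in> E' ^^ j" "(c (Suc k), c 0) \<in> E' ^^ (n - Suc k)"
        using path[of 0 j] path[of "Suc k" n] jk c(1) by auto
      ultimately have "(c 0, c 0) \<in> E' ^^ (Suc j + (n - Suc k))"
        by (metis relcompI relpow_add relpow.simps(2))
      then show False using least[of "Suc j + (n - Suc k)" "c 0"] jk by simp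
    qed
  qed auto
  define p where "p = (\<lambda>k. f (y k))"
  have injp: "inj_on p {..<n}" using injy gf unfolding p_def inj_on_def by metis
  define m where "m = (\<lambda>k. Suc k mod n)"
  have mn: "m k < n" for k using n by (simp add: m_def)
  have cm: "c (m k) = c (Suc k)" if "k < n" for k using that c(1) by (cases "Suc k = n") (auto simp: m_def)
  have injm: "inj_on m {..<n}"
  proof (rule inj_onI)
    fix j k assume "j \<in> {..<n}" "k \<in> {..<n}" "m j = m k"
    then show "j = k" by (cases "Suc j = n"; cases "Suc k = n") (auto simp: m_def)
  qed
  have pQ: "p k \<in> Q (c (m k))" if "k < n" for k using y(2)[OF that] cm[OF that] by (simp add: p_def)
  \<comment> \<open>The three perturbations move points by less than \<open>2 * e2\<close>, at most
    \<open>d\<close> and less than \<open>2 * e1\<close>; with radii below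
    \<open>(\<delta> - d) / 4\<close> the total stays below \<open>\<delta>\<close>.\<close>
  obtain e1 where e1: "0 < e1" "e1 < (\<delta> - d) / 4"
    "\<And>j k. \<lbrakk>j < n; k < n; j \<noteq> k\<rbrakk> \<Longrightarrow> ball (y j) e1 \<inter> ball (y k) e1 = {}"
    using finite_points_separated[OF injy, of "(\<delta> - d) / 4"] \<delta>(2) by auto
  obtain e2 where e2: "0 < e2" "e2 < (\<delta> - d) / 4"
    "\<And>j k. \<lbrakk>j < n; k < n; j \<noteq> k\<rbrakk> \<Longrightarrow> ball (p j) e2 \<inter> ball (p k) e2 = {}"
    using finite_points_separated[OF injp, of "(\<delta> - d) / 4"] \<delta>(2) by auto
  have near: "\<exists>x'. x' \<in> interior (Q i) \<and> x' \<in> ball x e" if "x \<in> Q i" "0 < e" for x i e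
  proof -
    have "x \<in> closure (interior (Q i))"
      using convex_closure_interior[OF Q(1) Q(2)] closure_subset that by blast
    then show ?thesis using that(2) by (metis closure_approachable dist_commute mem_ball)
  qed
  have "\<forall>k. \<exists>x'. k < n \<longrightarrow> x' \<in> interior (Q (c k)) \<and> x' \<in> ball (y k) e1" using near y(1) e1(1) by metis
  then obtain y' where y': "\<And>k. k < n \<Longrightarrow> y' k \<in> interior (Q (c k)) \<and> y' k \<in> ball (y k) e1" by metis
  have "\<forall>k. \<exists>x'. k < n \<longrightarrow> x' \<in> interior (Q (c (m k))) \<and> x' \<in> ball (p k) e2" using near pQ e2(1) by metis
  then obtain p' where p': "\<And>k. k < n \<Longrightarrow> p' k \<in> interior (Q (c (m k))) \<and> p' k \<in> ball (p k) e2" by metis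
  \<comment> \<open>The points \<open>p k\<close> and \<open>y k\<close> may lie on the boundaries
    of their sets. So \<open>h1\<close> pushes \<open>p k\<close> into the interior,
    \<open>h2\<close> moves it there close to the next starting point, and \<open>h3\<close> puts it
    onto \<open>y (m k)\<close>, where \<open>m\<close> is the cyclic successor.\<close>
  obtain h1 h1' where h1: "homeomorphism UNIV UNIV h1 h1'" "\<And>k. k \<in> {..<n} \<Longrightarrow> h1 (p k) = p' k"
    "\<And>x. h1 x = x \<or> (\<exists>k\<in>{..<n}. x \<in> ball (p k) e2 \<and> h1 x \<in> ball (p k) e2)"
    by (rule homeomorphism_moving_disjoint[of "{..<n}" "\<lambda>k. ball (p k) e2" p p']) (use e2 p' in auto)
  obtain h2 h2' where h2: "homeomorphism UNIV UNIV h2 h2'" "\<And>k. k \<in> {..<n} \<Longrightarrow> h2 (p' k) = y' (m k)"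
    "\<And>x. h2 x = x \<or> (\<exists>k\<in>{..<n}. x \<in> interior (Q (c (m k))) \<and> h2 x \<in> interior (Q (c (m k))))"
  proof (rule homeomorphism_moving_disjoint[of "{..<n}" "\<lambda>k. interior (Q (c (m k)))" p' "\<lambda>k. y' (m k)"])
    show "open (interior (Q (c (m k)))) \<and> connected (interior (Q (c (m k)))) \<and>
      p' k \<in> interior (Q (c (m k))) \<and> y' (m k) \<in> interior (Q (c (m k)))" if "k \<in> {..<n}" for k
      using p' y' mn that Q(1) by (auto intro: convex_connected convex_interior)
    show "interior (Q (c (m j))) \<inter> interior (Q (c (m k))) = {}" if "j \<in> {..<n}" "k \<in> {..<n}" "j \<noteq> k" for j k
      by (rule Q(3)) (use that injc injm mn in \<open>auto simp: inj_on_def\<close>)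
  qed auto
  obtain h3 h3' where h3: "homeomorphism UNIV UNIV h3 h3'" "\<And>k. k \<in> {..<n} \<Longrightarrow> h3 (y' k) = y k"
    "\<And>x. h3 x = x \<or> (\<exists>k\<in>{..<n}. x \<in> ball (y k) e1 \<and> h3 x \<in> ball (y k) e1)"
    by (rule homeomorphism_moving_disjoint[of "{..<n}" "\<lambda>k. ball (y k) e1" y' y]) (use e1 y' in auto)
  define F where "F = h3 \<circ> (h2 \<circ> (h1 \<circ> f))"
  define F' where "F' = ((g \<circ> h1') \<circ> h2') \<circ> h3'"
  have "homeomorphism UNIV UNIV f g" using cf cg fg gf by (auto simp: homeomorphism_def surjI[of f g] surjI[of g f])
  then have hF: "homeomorphism UNIV UNIV F F'" unfolding F_def F'_def
    by (rule homeomorphism_compose[OF homeomorphism_compose[OF homeomorphism_compose[OF _ h1(1)] h2(1)] h3(1)])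
  have ball2: "dist a b < 2 * e" if "a \<in> ball z e" "b \<in> ball z e" for a b z :: complex and e
    using that dist_triangle[of a b z] by (simp add: dist_commute)
  have d1: "dist (h1 x) x < 2 * e2" for x using h1(3)[of x] ball2 e2(1) by (metis dist_self mult_pos_pos zero_less_numeral)
  have d3: "dist (h3 x) x < 2 * e1" for x using h3(3)[of x] ball2 e1(1) by (metis dist_self mult_pos_pos zero_less_numeral)
  have "0 \<le> d" using Q(2,4) interior_subset by (metis dist_self ex_in_conv subsetD)
  have d2: "dist (h2 x) x \<le> d" for x
    using h2(3)[of x] Q(4) \<open>0 \<le> d\<close> interior_subset by (metis dist_self subsetD)
  have dF: "dist (F x) (f x) < \<delta>" for x
  proof -
    have "dist (F x) (f x) \<le> dist (h3 (h2 (h1 (f x)))) (h2 (h1 (f x))) + dist (h2 (h1 (f x))) (h1 (f x)) + dist (h1 (f x)) (f x)"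
      using dist_triangle[of "F x" "f x" "h1 (f x)"] dist_triangle[of "F x" "h1 (f x)" "h2 (h1 (f x))"]
      by (simp add: F_def)
    then show ?thesis using d1[of "f x"] d2[of "h1 (f x)"] d3[of "h2 (h1 (f x))"] e1(2) e2(2) by (simp add: field_simps)
  qed
  have "(F ^^ k) (y 0) = y (k mod n)" for k
  proof (induction k)
    case (Suc k)
    have "k mod n < n" using n by simp
    then have "F (y (k mod n)) = y (m (k mod n))"
      using h1(2) h2(2) h3(2) mn by (simp add: F_def p_def)
    also have "m (k mod n) = Suc k mod n" by (simp add: m_def mod_Suc_eq)
    finally show ?case using Suc by simp
  qed simp
  then have "(F ^^ n) (y 0) = y 0" by simp
  moreover have "(F ^^ n) (y 0) \<noteq> y 0"
  proof (rule brouwer_no_periodic_point[of F F' "M + \<delta>"])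
    show "continuous_on UNIV F" "continuous_on UNIV F'" "\<And>z. F (F' z) = z" "\<And>z. F' (F z) = z"
      using hF by (auto simp: homeomorphism_def)
    show "F z \<noteq> z" for z using dF[of z] \<delta>(1)[of z] by (auto simp: dist_norm norm_minus_commute)
    show "norm (F z - z) \<le> M + \<delta>" for z
      using dF[of z] M[of z] norm_triangle_ineq[of "F z - f z" "f z - z"] by (simp add: dist_norm)
  qed (use n in simp)
  ultimately show False by simp
qed

section \<open>Grid cells and walks\<close>

definition gauss_ints :: "complex set" where "gauss_ints = {z. Re z \<in> \<int> \<and> Im z \<in> \<int>}"

lemma gauss_ints_simps [simp]: "0 \<in> gauss_ints" "1 \<in> gauss_ints" "\<i> \<in> gauss_ints"
  by (auto simp: gauss_ints_def)

lemma gauss_ints_add [simp]: "a \<in> gauss_ints \<Longrightarrow> b \<in> gauss_ints \<Longrightarrow> a + b \<in> gauss_ints"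
  and gauss_ints_diff [simp]: "a \<in> gauss_ints \<Longrightarrow> b \<in> gauss_ints \<Longrightarrow> a - b \<in> gauss_ints"
  and gauss_ints_mult [simp]: "a \<in> gauss_ints \<Longrightarrow> b \<in> gauss_ints \<Longrightarrow> a * b \<in> gauss_ints"
  and gauss_ints_minus [simp]: "a \<in> gauss_ints \<Longrightarrow> - a \<in> gauss_ints"
  by (auto simp: gauss_ints_def)

lemma gauss_ints_of_int [simp]: "of_int k \<in> gauss_ints" by (auto simp: gauss_ints_def)
lemma gauss_ints_of_nat [simp]: "of_nat k \<in> gauss_ints" by (auto simp: gauss_ints_def)

lemma inner_gauss_ints: "a \<in> gauss_ints \<Longrightarrow> b \<in> gauss_ints \<Longrightarrow> inner a b \<in> \<int>"
  by (auto simp: gauss_ints_def inner_complex_def)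

lemma gauss_ints_eqI: "a \<in> gauss_ints \<Longrightarrow> b \<in> gauss_ints \<Longrightarrow> \<bar>Re a - Re b\<bar> < 1 \<Longrightarrow> \<bar>Im a - Im b\<bar> < 1 \<Longrightarrow> a = b"
  by (simp add: gauss_ints_def complex_eq_iff Ints_eq_abs_less1)

text \<open>The index is \<open>N\<close> times the lower left corner. Cells of the grid thus have
  indices in \<open>gauss_ints\<close>, and a translation by \<open>w\<close> shifts the index by
  \<open>of_nat N * w\<close>, which is the form of periodicity used throughout.\<close>

definition cell :: "nat \<Rightarrow> complex \<Rightarrow> complex set" where
  "cell N a = cbox (a / of_nat N) ((a + 1 + \<i>) / of_nat N)"

lemma mem_cell:
  "0 < N \<Longrightarrow> z \<in> cell N a \<longleftrightarrow> Re a \<le> N * Re z \<and> N * Re z \<le> Re a + 1 \<and> Im a \<le> N * Im z \<and> N * Im z \<le> Im a + 1"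
  by (auto simp: cell_def in_cbox_complex_iff field_simps)

lemma mem_interior_cell:
  "0 < N \<Longrightarrow> z \<in> interior (cell N a) \<longleftrightarrow> Re a < N * Re z \<and> N * Re z < Re a + 1 \<and> Im a < N * Im z \<and> N * Im z < Im a + 1"
  by (auto simp: cell_def interior_cbox in_box_complex_iff field_simps)

lemma cell_shift: "0 < N \<Longrightarrow> z + w \<in> cell N (a + of_nat N * w) \<longleftrightarrow> z \<in> cell N a"
  by (simp add: mem_cell algebra_simps)

lemma cell_translate: "0 < N \<Longrightarrow> cell N (a + of_nat N * w) = (+) w ` cell N a"
proof -
  assume N: "0 < N"
  show ?thesis
  proof (intro set_eqI iffI)
    fix z assume "z \<in> cell N (a + of_nat N * w)"
    then have "z - w \<in> cell N a" using cell_shift[OF N, of "z - w" w a] by simp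
    then show "z \<in> (+) w ` cell N a" by (intro image_eqI[of _ _ "z - w"]) auto
  next
    fix z assume "z \<in> (+) w ` cell N a"
    then show "z \<in> cell N (a + of_nat N * w)" using cell_shift[OF N, of _ w a] by (auto simp: add.commute)
  qed
qed

lemma dist_cell: "0 < N \<Longrightarrow> x \<in> cell N a \<Longrightarrow> y \<in> cell N a \<Longrightarrow> dist x y \<le> 2 / N"
proof -
  assume N: "0 < N" and "x \<in> cell N a" "y \<in> cell N a"
  then have "N * \<bar>Re (x - y)\<bar> \<le> 1" "N * \<bar>Im (x - y)\<bar> \<le> 1"
    by (auto simp: mem_cell abs_if algebra_simps)
  then have "\<bar>Re (x - y)\<bar> \<le> 1 / N" "\<bar>Im (x - y)\<bar> \<le> 1 / N" using N by (auto simp: field_simps)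
  then show ?thesis using cmod_le[of "x - y"] by (simp add: dist_norm)
qed

lemma convex_cell: "convex (cell N a)" and compact_cell: "compact (cell N a)"
  by (auto simp: cell_def)

lemma interior_cell_disjoint:
  assumes "0 < N" "a \<in> gauss_ints" "b \<in> gauss_ints" "a \<noteq> b"
  shows "interior (cell N a) \<inter> interior (cell N b) = {}"
proof (rule ccontr)
  assume "interior (cell N a) \<inter> interior (cell N b) \<noteq> {}"
  then obtain z where "z \<in> interior (cell N a)" "z \<in> interior (cell N b)" by auto
  then have "a = b" using assms by (intro gauss_ints_eqI) (auto simp: mem_interior_cell)
  then show False using assms by simp
qed

lemma center_in_interior_cell: "0 < N \<Longrightarrow> (a + (1 + \<i>) / 2) / of_nat N \<in> interior (cell N a)"
  by (auto simp: mem_interior_cell)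

definition cell_of :: "nat \<Rightarrow> complex \<Rightarrow> complex" where
  "cell_of N z = Complex \<lfloor>N * Re z\<rfloor> \<lfloor>N * Im z\<rfloor>"

lemma cell_of: "0 < N \<Longrightarrow> z \<in> cell N (cell_of N z)" "cell_of N z \<in> gauss_ints"
  by (auto simp: mem_cell cell_of_def gauss_ints_def)

lemma cell_of_interior:
  assumes "0 < N" "a \<in> gauss_ints" "z \<in> interior (cell N a)" "b \<in> gauss_ints" "z \<in> cell N b"
  shows "a = b"
  using assms by (intro gauss_ints_eqI) (auto simp: mem_interior_cell mem_cell)

text \<open>Orbits give walks in this graph (\<open>orbit_walk\<close>), but a walk is in general
  only a pseudo-orbit.\<close>

definition cell_rel :: "nat \<Rightarrow> (complex \<Rightarrow> complex) \<Rightarrow> (complex \<times> complex) set" where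
  "cell_rel N f = {(a, b). a \<in> gauss_ints \<and> b \<in> gauss_ints \<and> f ` cell N a \<inter> cell N b \<noteq> {}}"

text \<open>\<open>no_closed_chain\<close> asks for disjoint interiors for all distinct elements of
  the index type. Cells have this property only for lattice indices, hence the passage to pairs of
  integers.\<close>

lemma no_closed_cell_chain:
  assumes "continuous_on UNIV f" "continuous_on UNIV g" "\<And>z. f (g z) = z" "\<And>z. g (f z) = z"
    and M: "\<And>z. norm (f z - z) \<le> M" and \<delta>: "\<And>z. \<delta> \<le> norm (f z - z)" "2 / real N < \<delta>" and N: "0 < N"
  shows "(a, a) \<notin> (cell_rel N f)\<^sup>+"
proof -
  define Q where "Q = (\<lambda>i::int\<times>int. cell N (Complex (real_of_int (fst i)) (real_of_int (snd i))))"
  define \<phi> where "\<phi> = (\<lambda>a. (\<lfloor>Re a\<rfloor>, \<lfloor>Im a\<rfloor>))"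
  have \<phi>: "Complex (real_of_int (fst (\<phi> a))) (real_of_int (snd (\<phi> a))) = a" if "a \<in> gauss_ints" for a
    using that by (auto simp: \<phi>_def gauss_ints_def complex_eq_iff elim!: Ints_cases)
  have G: "Complex (real_of_int m) (real_of_int n) \<in> gauss_ints" for m n by (auto simp: gauss_ints_def)
  define E where "E = (\<lambda>(a, b). (\<phi> a, \<phi> b)) ` cell_rel N f"
  have "(i, i) \<notin> E\<^sup>+" for i
  proof (rule no_closed_chain[of f g M \<delta> "2 / real N" Q])
    show "interior (Q i) \<inter> interior (Q j) = {}" if "i \<noteq> j" for i j
      unfolding Q_def by (rule interior_cell_disjoint[OF N G G]) (use that in \<open>auto simp: prod_eq_iff\<close>)
    show "f ` Q i \<inter> Q j \<noteq> {}" if "(i, j) \<in> E" for i j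
    proof -
      obtain a b where "(a, b) \<in> cell_rel N f" "i = \<phi> a" "j = \<phi> b" using \<open>(i, j) \<in> E\<close> by (auto simp: E_def)
      then show ?thesis using \<phi>[of a] \<phi>[of b] unfolding Q_def cell_rel_def by simp
    qed
    show "interior (Q i) \<noteq> {}" for i unfolding Q_def using center_in_interior_cell[OF N] by blast
  qed (use assms dist_cell[OF N] in \<open>auto simp: Q_def convex_cell\<close>)
  moreover have "(\<phi> a, \<phi> b) \<in> E\<^sup>+" if "(a, b) \<in> (cell_rel N f)\<^sup>+" for a b
    using that
  proof (induction rule: trancl_induct)
    case (base b)
    then show ?case by (auto simp: E_def)
  next
    case (step b c)
    then have "(\<phi> b, \<phi> c) \<in> E" by (auto simp: E_def)
    then show ?case using step by auto
  qed
  ultimately show ?thesis by blast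
qed

section \<open>Lattice semigroups and half planes\<close>

lemma semigroup_nat_combination:
  fixes S :: "complex set" and a b c :: complex and k l m :: nat
  assumes add: "\<And>a b. a \<in> S \<Longrightarrow> b \<in> S \<Longrightarrow> a + b \<in> S" and abc: "a \<in> S" "b \<in> S" "c \<in> S" and "0 < k + l + m"
  shows "of_nat k * a + of_nat l * b + of_nat m * c \<in> S"
proof -
  have mult: "of_nat (Suc k) * a \<in> S" if "a \<in> S" for k a
  proof (induction k)
    case (Suc k)
    have "of_nat (Suc (Suc k)) * a = of_nat (Suc k) * a + a" by (simp add: algebra_simps)
    then show ?case using add[OF Suc that] by simp
  qed (use that in simp)
  have mult': "of_nat k * a \<in> S \<or> k = 0" if "a \<in> S" for k a using mult[OF that] by (cases k) auto
  show ?thesis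
    using mult'[OF abc(1), of k] mult'[OF abc(2), of l] mult'[OF abc(3), of m] assms(5)
    by (auto intro: add)
qed

text \<open>In the plane, a lattice semigroup without 0 lies in a half plane. Rational coefficients in a convex combination
  of three lattice points are read off from their pairwise determinants.\<close>

lemma gauss_semigroup_halfplane:
  fixes S :: "complex set"
  assumes S: "S \<subseteq> gauss_ints" "S \<noteq> {}" and add: "\<And>a b. a \<in> S \<Longrightarrow> b \<in> S \<Longrightarrow> a + b \<in> S" and 0: "0 \<notin> S"
  obtains v where "v \<noteq> 0" "\<And>s. s \<in> S \<Longrightarrow> 0 \<le> inner v s" "\<exists>s\<in>S. 0 < inner v s"
proof -
  define X where "X = (\<lambda>a b. Re a * Im b - Im a * Re b)"
  have Xint: "X a b \<in> \<int>" if "a \<in> S" "b \<in> S" for a b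
    using that S(1) by (auto simp: X_def gauss_ints_def subset_eq)
  \<comment> \<open>For opposite lattice vectors on a line the integers \<open>inner a a\<close> and
    \<open>- inner b a\<close> are coefficients of a vanishing combination inside the
    semigroup.\<close>
  have antipodal: "False" if ab: "a \<in> S" "b \<in> S" and X0: "X a b = 0" and neg: "inner b a < 0" for a b
  proof -
    have "inner a a \<in> \<int>" "inner b a \<in> \<int>" using ab S(1) inner_gauss_ints by auto
    then obtain m n where mn: "inner a a = of_int m" "inner b a = of_int n" by (elim Ints_cases)
    then have "0 \<le> m" "n < 0" using neg inner_ge_zero[of a] by simp_all
    have "of_real (inner a a) * b - of_real (inner b a) * a = 0"
      using X0 by (simp add: complex_eq_iff X_def inner_complex_def) algebra
    then have "of_nat (nat m) * b + of_nat (nat (- n)) * a + of_nat 0 * a = 0"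
      using \<open>0 \<le> m\<close> \<open>n < 0\<close> by (simp add: mn)
    moreover have "of_nat (nat m) * b + of_nat (nat (- n)) * a + of_nat 0 * a \<in> S"
      using ab \<open>n < 0\<close> by (intro semigroup_nat_combination add) auto
    ultimately show False using 0 by simp
  qed
  have triple: "False" if abc: "a \<in> S" "b \<in> S" "c \<in> S" and u: "0 < u" "0 \<le> v" "0 \<le> w"
    and comb: "of_real u * a + of_real v * b + of_real w * c = 0" for a b c u v w
  proof -
    obtain k l m where klm: "X b c = of_int k" "X c a = of_int l" "X a b = of_int m"
      using Xint abc by (metis Ints_cases)
    have re: "u * Re a + v * Re b + w * Re c = 0" "u * Im a + v * Im b + w * Im c = 0"
      using comb by (auto simp: complex_eq_iff)
    then have l: "u * X c a = v * X b c" and m: "u * X a b = w * X b c"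
      unfolding X_def by algebra+
    \<comment> \<open>The linear relation between three vectors of the plane. By \<open>l\<close>
      and \<open>m\<close> its integer coefficients are proportional to \<open>u\<close>,
      \<open>v\<close>, \<open>w\<close>, so up to a common sign they are nonnegative.\<close>
    have id: "of_real (X b c) * a + of_real (X c a) * b + of_real (X a b) * c = 0"
      by (simp add: complex_eq_iff X_def) algebra
    show False
    proof (cases "k = 0")
      case True
      then have z: "X b c = 0" "X c a = 0" "X a b = 0" using l m klm u by auto
      have "u * inner a a + v * inner b a + w * inner c a = inner (of_real u * a + of_real v * b + of_real w * c) a"
        by (simp add: inner_complex_def algebra_simps)
      then have "u * inner a a + v * inner b a + w * inner c a = 0" using comb by simp
      moreover have "0 < u * inner a a" using u 0 abc by (metis inner_gt_zero_iff mult_pos_pos)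
      ultimately have "v * inner b a < 0 \<or> w * inner c a < 0" by linarith
      then have "inner b a < 0 \<or> inner c a < 0" using u by (meson mult_nonneg_nonneg not_le)
      moreover have "X a c = 0" using z by (simp add: X_def mult.commute)
      ultimately show False using antipodal[OF abc(1,2)] antipodal[OF abc(1,3)] z by blast
    next
      case False
      define \<sigma> where "\<sigma> = sgn k"
      have sg: "0 \<le> \<sigma> * l" "0 \<le> \<sigma> * m" "0 < \<sigma> * k"
      proof -
        have "of_int \<sigma> * of_int k > (0::real)" using False by (simp add: \<sigma>_def sgn_if)
        moreover have "u * (of_int \<sigma> * of_int l) = v * (of_int \<sigma> * of_int k)" "u * (of_int \<sigma> * of_int m) = w * (of_int \<sigma> * of_int k)"
          using l m klm by (simp_all add: algebra_simps)
        ultimately have "0 \<le> u * (of_int \<sigma> * of_int l)" "0 \<le> u * (of_int \<sigma> * of_int m)"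
          using u by (metis less_imp_le mult_nonneg_nonneg)+
        then have "0 \<le> real_of_int \<sigma> * of_int l" "0 \<le> real_of_int \<sigma> * of_int m" using u by (simp_all add: zero_le_mult_iff)
        then show "0 \<le> \<sigma> * l" "0 \<le> \<sigma> * m" by (metis of_int_0_le_iff of_int_mult)+
        show "0 < \<sigma> * k" using False by (simp add: \<sigma>_def sgn_if)
      qed
      have "of_int (\<sigma> * k) * a + of_int (\<sigma> * l) * b + of_int (\<sigma> * m) * c = of_int \<sigma> * (of_real (X b c) * a + of_real (X c a) * b + of_real (X a b) * c)"
        by (simp add: klm algebra_simps)
      then have "of_nat (nat (\<sigma> * k)) * a + of_nat (nat (\<sigma> * l)) * b + of_nat (nat (\<sigma> * m)) * c = 0"
        using sg id by simp
      moreover have "of_nat (nat (\<sigma> * k)) * a + of_nat (nat (\<sigma> * l)) * b + of_nat (nat (\<sigma> * m)) * c \<in> S"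
        using sg abc by (intro semigroup_nat_combination add) auto
      ultimately show False using 0 by simp
    qed
  qed
  have "0 \<notin> convex hull S"
  proof
    assume "0 \<in> convex hull S"
    then obtain T where T: "finite T" "T \<subseteq> S" "card T \<le> 3" "0 \<in> convex hull T"
      unfolding caratheodory[of S] by auto
    then have "T \<noteq> {}" by auto
    have "\<exists>a b c. T = {a, b, c}"
    proof -
      have "card T = 1 \<or> card T = 2 \<or> card T = 3" using T \<open>T \<noteq> {}\<close> card_0_eq[OF T(1)] by linarith
      then show ?thesis by (metis card_1_singletonE card_2_iff card_3_iff insert_absorb2)
    qed
    then obtain a b c where abc: "T = {a, b, c}" by blast
    then obtain u v w where uvw: "0 \<le> u" "0 \<le> v" "0 \<le> w" "u + v + w = 1" "0 = u *\<^sub>R a + v *\<^sub>R b + w *\<^sub>R c"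
      using T(4) by (auto simp: convex_hull_3)
    have in_S: "a \<in> S" "b \<in> S" "c \<in> S" using T(2) abc by auto
    have comb: "of_real u * a + of_real v * b + of_real w * c = 0" using uvw(5) by (simp add: scaleR_conv_of_real)
    consider "0 < u" | "0 < v" | "0 < w" using uvw by linarith
    then show False
    proof cases
      case 1 then show ?thesis using triple[OF in_S] uvw comb by blast
    next
      case 2 then show ?thesis using triple[OF in_S(2,3,1), of v w u] uvw comb by (simp add: algebra_simps)
    next
      case 3 then show ?thesis using triple[OF in_S(3,1,2), of w u v] uvw comb by (simp add: algebra_simps)
    qed
  qed
  then obtain v where v: "v \<noteq> 0" "\<And>s. s \<in> S \<Longrightarrow> 0 \<le> inner v s"
    using separating_hyperplane_set_0[OF convex_convex_hull] hull_subset[of S convex] by (metis subsetD)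
  show ?thesis
  proof (cases "\<exists>s\<in>S. 0 < inner v s")
    \<comment> \<open>The separating functional vanishes on all of \<open>S\<close>, so
      \<open>S\<close> lies on a line and by \<open>antipodal\<close> on one half of it; any element
      of \<open>S\<close> then serves as the normal vector.\<close>
    case False
    obtain s0 where s0: "s0 \<in> S" using S by blast
    have "0 \<le> inner s0 s" if "s \<in> S" for s
    proof (rule ccontr)
      assume "\<not> 0 \<le> inner s0 s"
      moreover have "inner v s = 0" "inner v s0 = 0" using False v s0 that by (metis less_eq_real_def)+
      then have "X s s0 = 0" using v(1) by (auto simp: X_def inner_complex_def complex_eq_iff) algebra+
      ultimately show False using antipodal[OF that s0] by (simp add: inner_commute)
    qed
    moreover have "0 < inner s0 s0" "s0 \<noteq> 0" using s0 0 by auto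
    ultimately show ?thesis using that[of s0] s0 by blast
  qed (use that v in blast)
qed

section \<open>Periodic graphs and the cost of walks\<close>

definition tinv :: "nat \<Rightarrow> (complex \<times> complex) set \<Rightarrow> bool" where
  "tinv N E \<longleftrightarrow> (\<forall>(a, b)\<in>E. a \<in> gauss_ints \<and> b \<in> gauss_ints \<and> (\<forall>w\<in>gauss_ints. (a + of_nat N * w, b + of_nat N * w) \<in> E))"

lemma tinvD:
  assumes "tinv N E" "(a, b) \<in> E"
  shows "a \<in> gauss_ints" "b \<in> gauss_ints" "\<And>w. w \<in> gauss_ints \<Longrightarrow> (a + of_nat N * w, b + of_nat N * w) \<in> E"
  using assms by (auto simp: tinv_def)

lemma tinv_relpow:
  assumes E: "tinv N E" and "(a, b) \<in> E ^^ L" "w \<in> gauss_ints"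
  shows "(a + of_nat N * w, b + of_nat N * w) \<in> E ^^ L"
  using assms(2)
proof (induction L arbitrary: b)
  case (Suc L)
  then obtain y where "(a, y) \<in> E ^^ L" "(y, b) \<in> E" by auto
  then show ?case using Suc.IH tinvD(3)[OF E _ assms(3)] by auto
qed simp

lemma tinv_trancl:
  assumes "tinv N E" "(a, b) \<in> E\<^sup>+" "w \<in> gauss_ints"
  shows "(a + of_nat N * w, b + of_nat N * w) \<in> E\<^sup>+"
  using assms tinv_relpow unfolding trancl_power by blast

lemma tinv_relpow_gauss:
  assumes E: "tinv N E" and "(a, b) \<in> E ^^ L" "a \<in> gauss_ints"
  shows "b \<in> gauss_ints"
  using assms(2) by (cases L) (use assms in \<open>auto dest: tinvD\<close>)

lemma gauss_pigeonhole:
  fixes x :: "nat \<Rightarrow> complex"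
  assumes x: "\<And>i. i \<le> N * N \<Longrightarrow> x i \<in> gauss_ints" and N: "0 < N"
  obtains i j w where "i < j" "j \<le> N * N" "w \<in> gauss_ints" "x j = x i + of_nat N * w"
proof -
  define \<phi> where "\<phi> = (\<lambda>i. (\<lfloor>Re (x i)\<rfloor> mod int N, \<lfloor>Im (x i)\<rfloor> mod int N))"
  have "\<phi> ` {..N * N} \<subseteq> {0..<int N} \<times> {0..<int N}" using N by (auto simp: \<phi>_def)
  then have "card (\<phi> ` {..N * N}) \<le> card ({0..<int N} \<times> {0..<int N})" by (intro card_mono) auto
  then have "card (\<phi> ` {..N * N}) < card {..N * N}" by (simp add: card_cartesian_product)
  then have "\<not> inj_on \<phi> {..N * N}" using pigeonhole by blast
  then obtain i j where ij: "i < j" "j \<le> N * N" "\<phi> i = \<phi> j"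
    unfolding inj_on_def by (metis atMost_iff linorder_neqE_nat)
  have r: "of_int \<lfloor>Re (x k)\<rfloor> = Re (x k)" "of_int \<lfloor>Im (x k)\<rfloor> = Im (x k)" if "k \<le> N * N" for k
    using x[OF that] by (auto simp: gauss_ints_def elim!: Ints_cases)
  have "int N dvd \<lfloor>Re (x j)\<rfloor> - \<lfloor>Re (x i)\<rfloor>" "int N dvd \<lfloor>Im (x j)\<rfloor> - \<lfloor>Im (x i)\<rfloor>"
    using ij(3) by (auto simp: \<phi>_def mod_eq_dvd_iff dvd_diff_commute)
  then obtain m n where mn: "\<lfloor>Re (x j)\<rfloor> - \<lfloor>Re (x i)\<rfloor> = int N * m" "\<lfloor>Im (x j)\<rfloor> - \<lfloor>Im (x i)\<rfloor> = int N * n"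
    by (auto elim!: dvdE)
  have "Re (x j) - Re (x i) = real_of_int (int N * m)" "Im (x j) - Im (x i) = real_of_int (int N * n)"
    unfolding mn[symmetric] using r[of i] r[of j] ij by auto
  then have "x j = x i + of_nat N * Complex m n" by (simp add: complex_eq_iff)
  then show ?thesis using ij by (intro that[of i j "Complex m n"]) (auto simp: gauss_ints_def)
qed

text \<open>Removing closed subwalks reduces the bound to walks of length at most \<open>N\<^sup>2\<close>.\<close>

lemma walk_cost_bounded_below:
  assumes E: "tinv N E" and N: "0 < N" and D: "\<And>a b. (a, b) \<in> E \<Longrightarrow> norm (b - a) \<le> D"
    and loops: "\<And>L a w. \<lbrakk>1 \<le> L; L \<le> N * N; w \<in> gauss_ints; (a, a + of_nat N * w) \<in> E ^^ L\<rbrakk> \<Longrightarrow> 0 \<le> inner v w + c * real L"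
  obtains K where "\<And>L a b. (a, b) \<in> E ^^ L \<Longrightarrow> - K \<le> inner v (b - a) / N + c * real L"
proof -
  have len: "norm (b - a) \<le> D * real L" if "(a, b) \<in> E ^^ L" for L a b
    using that
  proof (induction L arbitrary: b)
    case (Suc L)
    then obtain y where y: "(a, y) \<in> E ^^ L" "(y, b) \<in> E" by auto
    then show ?case using Suc.IH[OF y(1)] D[OF y(2)] norm_triangle_ineq[of "b - y" "y - a"] by (simp add: algebra_simps)
  qed simp
  \<comment> \<open>This bounds the cost of walks of at most \<open>N * N\<close> steps. Longer
    walks meet two equivalent vertices among their first \<open>N * N + 1\<close> ones and so
    contain a loop.\<close>
  define K where "K = (norm v * \<bar>D\<bar> + \<bar>c\<bar>) * real (N * N)"
  have "- K \<le> inner v (b - a) / N + c * real L" if "(a, b) \<in> E ^^ L" for L a b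
    using that
  proof (induction L arbitrary: a b rule: less_induct)
    case (less L)
    show ?case
    proof (cases "L \<le> N * N")
      case True
      have "\<bar>inner v (b - a)\<bar> / N \<le> \<bar>inner v (b - a)\<bar>" using N by (simp add: divide_le_eq mult_le_cancel_left1)
      also have "\<dots> \<le> norm v * norm (b - a)" by (rule Cauchy_Schwarz_ineq2)
      also have "\<dots> \<le> norm v * (\<bar>D\<bar> * real L)"
        using len[OF less.prems] by (intro mult_left_mono order_trans[OF len[OF less.prems]] mult_right_mono) auto
      finally have "\<bar>inner v (b - a) / N + c * real L\<bar> \<le> (norm v * \<bar>D\<bar> + \<bar>c\<bar>) * real L"
        by (intro order_trans[OF abs_triangle_ineq]) (simp add: abs_mult algebra_simps)
      also have "\<dots> \<le> K" unfolding K_def using True by (intro mult_left_mono) (auto simp flip: of_nat_mult)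
      finally show ?thesis by linarith
    next
      case False
      obtain x where x: "x 0 = a" "x L = b" "\<And>i. i < L \<Longrightarrow> (x i, x (Suc i)) \<in> E"
        using less.prems unfolding relpow_fun_conv by metis
      have path: "(x i, x j) \<in> E ^^ (j - i)" if "i \<le> j" "j \<le> L" for i j
        unfolding relpow_fun_conv by (rule exI[of _ "\<lambda>m. x (i + m)"]) (use that x in auto)
      have xg: "x i \<in> gauss_ints" if "i \<le> N * N" for i
        using x(3)[of i] that False tinvD(1)[OF E] by (meson linorder_not_le order_le_less_trans)
      obtain i j w where ij: "i < j" "j \<le> N * N" "w \<in> gauss_ints" "x j = x i + of_nat N * w"
        using gauss_pigeonhole[of N x] xg N by metis
      have 1: "(x i, x i + of_nat N * w) \<in> E ^^ (j - i)" using path[of i j] ij False by simp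
      have "(a, x i) \<in> E ^^ i" "(x j, b) \<in> E ^^ (L - j)" using path[of 0 i] path[of j L] ij False x by auto
      \<comment> \<open>When the loop is cut out, periodicity lets the rest of the walk slide back
        by \<open>of_nat N * w\<close>; the cost drops by exactly the cost of the loop.\<close>
      then have "(x j + of_nat N * (- w), b + of_nat N * (- w)) \<in> E ^^ (L - j)" using tinv_relpow[OF E _ gauss_ints_minus[OF ij(3)]] by blast
      then have "(a, b - of_nat N * w) \<in> E ^^ (i + (L - j))"
        using \<open>(a, x i) \<in> E ^^ i\<close> ij(4) by (auto simp: relpow_add)
      then have "- K \<le> inner v (b - of_nat N * w - a) / N + c * real (i + (L - j))"
        using ij False by (intro less.IH) auto
      moreover have "0 \<le> inner v w + c * real (j - i)" by (rule loops[OF _ _ ij(3) 1]) (use ij in auto)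
      moreover have "inner v (b - of_nat N * w - a) / N = inner v (b - a) / N - inner v w"
      proof -
        have "of_nat N * w = real N *\<^sub>R w" by (simp add: scaleR_conv_of_real)
        then show ?thesis using N by (simp only: inner_diff_right inner_scaleR_right) (simp add: field_simps)
      qed
      moreover have "c * real (i + (L - j)) + c * real (j - i) = c * real L"
        using ij False by (simp add: of_nat_diff algebra_simps)
      ultimately show ?thesis by linarith
    qed
  qed
  then show ?thesis using that by blast
qed

lemma cell_corner: "0 < N \<Longrightarrow> x \<in> cell N a \<Longrightarrow> norm (x - a / of_nat N) \<le> 2"
proof -
  assume N: "0 < N" and x: "x \<in> cell N a"
  have "a / of_nat N \<in> cell N a" using N by (simp add: mem_cell)
  then have "dist x (a / of_nat N) \<le> 2 / real N" using dist_cell[OF N x] by blast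
  also have "\<dots> \<le> 2" using N by (simp add: field_simps)
  finally show ?thesis by (simp add: dist_norm)
qed

section \<open>Lifts and rotation sets\<close>

definition rot :: "(complex \<Rightarrow> complex) \<Rightarrow> complex set" where
  "rot f = (\<Inter>m\<in>{1..}. closure (\<Union>n\<in>{m..}. {((f ^^ n) x - x) /\<^sub>R real n | x. x \<in> UNIV}))"

lemma rot_iff:
  "p \<in> rot f \<longleftrightarrow> (\<forall>m\<ge>1. \<forall>e>0. \<exists>n\<ge>m. \<exists>x. norm ((f ^^ n) x - x - real n *\<^sub>R p) < e * real n)"
proof -
  have "dist (((f ^^ n) x - x) /\<^sub>R real n) p < e \<longleftrightarrow> norm ((f ^^ n) x - x - real n *\<^sub>R p) < e * real n" if "1 \<le> n" for n x e
  proof -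
    have "((f ^^ n) x - x) /\<^sub>R real n - p = ((f ^^ n) x - x - real n *\<^sub>R p) /\<^sub>R real n"
      using that by (simp add: algebra_simps)
    then show ?thesis using that by (simp add: dist_norm divide_simps mult.commute)
  qed
  note eq = this
  have cl: "p \<in> closure (\<Union>n\<in>{m..}. {((f ^^ n) x - x) /\<^sub>R real n | x. x \<in> UNIV}) \<longleftrightarrow>
    (\<forall>e>0. \<exists>n\<ge>m. \<exists>x. dist (((f ^^ n) x - x) /\<^sub>R real n) p < e)" for m
    unfolding closure_approachable by (intro iff_allI imp_cong refl) fastforce
  have key: "(\<exists>n\<ge>m. \<exists>x. dist (((f ^^ n) x - x) /\<^sub>R real n) p < e) \<longleftrightarrow>
    (\<exists>n\<ge>m. \<exists>x. norm ((f ^^ n) x - x - real n *\<^sub>R p) < e * real n)" if "1 \<le> m" for m e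
    using eq[OF order_trans[OF that]] by (intro ex_cong1 conj_cong refl) auto
  show ?thesis unfolding rot_def INT_iff cl Ball_def atLeast_iff by (intro iff_allI imp_cong refl key)
qed

locale plane_lift =
  fixes f g :: "complex \<Rightarrow> complex"
  assumes cf: "continuous_on UNIV f" and cg: "continuous_on UNIV g"
    and fg [simp]: "f (g z) = z" and gf [simp]: "g (f z) = z"
    and per: "w \<in> gauss_ints \<Longrightarrow> f (z + w) = f z + w"
begin

lemma gper: "w \<in> gauss_ints \<Longrightarrow> g (z + w) = g z + w"
  by (metis fg gf per)

lemma inverse_lift: "plane_lift g f"
  by unfold_locales (use cf cg gper in auto)

lemma iterate_lift: "plane_lift (f ^^ n) (g ^^ n)"
proof (induction n)
  case (Suc n)
  then interpret i: plane_lift "f ^^ n" "g ^^ n" .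
  show ?case
  proof
    show "continuous_on UNIV (f ^^ Suc n)" using continuous_on_compose2[OF cf i.cf] by (simp add: o_def)
    show "continuous_on UNIV (g ^^ Suc n)" unfolding funpow_Suc_right using continuous_on_compose2[OF i.cg cg] by (simp add: o_def)
    show "(f ^^ Suc n) ((g ^^ Suc n) z) = z" for z by (subst funpow_Suc_right[of n g]) simp
    show "(g ^^ Suc n) ((f ^^ Suc n) z) = z" for z by (subst funpow_Suc_right[of n g]) simp
    show "(f ^^ Suc n) (z + w) = (f ^^ Suc n) z + w" if "w \<in> gauss_ints" for z w
      using i.per[OF that] per[OF that] by simp
  qed
qed (unfold_locales, auto)

lemma translate_lift: "w \<in> gauss_ints \<Longrightarrow> plane_lift (\<lambda>z. f z + w) (\<lambda>z. g (z - w))"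
  by unfold_locales (auto intro!: continuous_intros cf continuous_on_compose2[OF cg] simp: per)

lemma displacement_bounded: obtains M where "0 \<le> M" "\<And>z. norm (f z - z) \<le> M"
proof -
  have "compact ((\<lambda>z. f z - z) ` cell 1 0)"
    by (intro compact_continuous_image compact_cell continuous_intros continuous_on_subset[OF cf]) auto
  then have "bounded ((\<lambda>z. f z - z) ` cell 1 0)" by (rule compact_imp_bounded)
  then obtain M where M: "\<And>z. z \<in> cell 1 0 \<Longrightarrow> norm (f z - z) \<le> M"
    unfolding bounded_iff by blast
  have "norm (f z - z) \<le> M" for z
  proof -
    have "z - cell_of 1 z + cell_of 1 z \<in> cell 1 (0 + of_nat 1 * cell_of 1 z)" using cell_of(1)[of 1 z] by simp
    then have "z - cell_of 1 z \<in> cell 1 0" using cell_shift[of 1 "z - cell_of 1 z" "cell_of 1 z" 0] by simp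
    moreover have "f (z - cell_of 1 z + cell_of 1 z) = f (z - cell_of 1 z) + cell_of 1 z"
      using cell_of(2)[of 1 z] by (intro per) auto
    ultimately show ?thesis using M[of "z - cell_of 1 z"] by (simp add: algebra_simps)
  qed
  moreover from this[of 0] have "0 \<le> M" using norm_ge_zero order_trans by blast
  ultimately show ?thesis using that by blast
qed

lemma displacement_uniform:
  assumes "\<And>z. f z \<noteq> z" obtains \<delta> where "0 < \<delta>" "\<And>z. \<delta> \<le> norm (f z - z)"
proof -
  have "0 \<in> cell 1 0" by (simp add: mem_cell)
  then have "cell 1 0 \<noteq> {}" by blast
  moreover have "continuous_on (cell 1 0) (\<lambda>z. norm (f z - z))"
    by (intro continuous_intros continuous_on_subset[OF cf]) auto
  ultimately have "\<exists>x\<in>cell 1 0. \<forall>z\<in>cell 1 0. norm (f x - x) \<le> norm (f z - z)"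
    by (rule continuous_attains_inf[OF compact_cell])
  then obtain x where x: "x \<in> cell 1 0" "\<And>z. z \<in> cell 1 0 \<Longrightarrow> norm (f x - x) \<le> norm (f z - z)" by blast
  have "norm (f x - x) \<le> norm (f z - z)" for z
  proof -
    have "z - cell_of 1 z + cell_of 1 z \<in> cell 1 (0 + of_nat 1 * cell_of 1 z)" using cell_of(1)[of 1 z] by simp
    then have "z - cell_of 1 z \<in> cell 1 0" using cell_shift[of 1 "z - cell_of 1 z" "cell_of 1 z" 0] by simp
    moreover have "f (z - cell_of 1 z + cell_of 1 z) = f (z - cell_of 1 z) + cell_of 1 z"
      using cell_of(2)[of 1 z] by (intro per) auto
    ultimately show ?thesis using x(2)[of "z - cell_of 1 z"] by (simp add: algebra_simps)
  qed
  then show ?thesis using assms[of x] by (intro that[of "norm (f x - x)"]) auto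
qed

lemma iterate_displacement:
  assumes "\<And>z. norm (f z - z) \<le> M" shows "norm ((f ^^ n) z - z) \<le> real n * M"
proof (induction n)
  case (Suc n)
  then show ?case using assms[of "(f ^^ n) z"] norm_triangle_ineq[of "f ((f ^^ n) z) - (f ^^ n) z" "(f ^^ n) z - z"]
    by (simp add: algebra_simps)
qed simp

lemma f_uniformly_continuous: assumes "0 < e" obtains d where "0 < d" "\<And>x y. dist x y < d \<Longrightarrow> dist (f x) (f y) < e"
proof -
  have "uniformly_continuous_on (cball 0 4) f"
    by (intro compact_uniformly_continuous continuous_on_subset[OF cf]) auto
  then obtain d where d: "0 < d" "\<And>x y. \<lbrakk>x \<in> cball 0 4; y \<in> cball 0 4; dist x y < d\<rbrakk> \<Longrightarrow> dist (f x) (f y) < e"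
    using assms unfolding uniformly_continuous_on_def by (metis dist_commute)
  \<comment> \<open>An integer translation brings \<open>x\<close> within distance 2 of 0 and then
    \<open>y\<close> within distance 3, so both points are in the ball of radius 4.\<close>
  have "dist (f x) (f y) < e" if "dist x y < min d 1" for x y
  proof -
    define w where "w = cell_of 1 x"
    have w: "- w \<in> gauss_ints" using cell_of(2)[of 1 x] by (auto simp: w_def)
    have "x \<in> cell 1 w" unfolding w_def by (rule cell_of) auto
    then have "dist x w \<le> 2" using dist_cell[of 1 x w w] by (auto simp: mem_cell)
    then have "norm (x + - w) \<le> 2" "norm (y + - w) \<le> 3"
      using that dist_triangle[of y w x] by (auto simp: dist_norm norm_minus_commute)
    then have "dist (f (x + - w)) (f (y + - w)) < e" using that by (intro d(2)) (auto simp: dist_norm norm_minus_commute)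
    then show ?thesis using per[OF w] by (simp add: dist_norm)
  qed
  then show ?thesis using d(1) by (intro that[of "min d 1"]) auto
qed

lemma cell_rel_tinv: "0 < N \<Longrightarrow> tinv N (cell_rel N f)"
  unfolding tinv_def
proof clarify
  fix a b assume N: "0 < N" and ab: "(a, b) \<in> cell_rel N f"
  then obtain x where x: "x \<in> cell N a" "f x \<in> cell N b" "a \<in> gauss_ints" "b \<in> gauss_ints" by (auto simp: cell_rel_def)
  have "(a + of_nat N * w, b + of_nat N * w) \<in> cell_rel N f" if "w \<in> gauss_ints" for w
    using x cell_shift[OF N, of x w a] cell_shift[OF N, of "f x" w b] per[OF that, of x] that
    unfolding cell_rel_def by force
  then show "a \<in> gauss_ints \<and> b \<in> gauss_ints \<and> (\<forall>w\<in>gauss_ints. (a + of_nat N * w, b + of_nat N * w) \<in> cell_rel N f)"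
    using x by blast
qed

lemma cell_rel_step: "0 < N \<Longrightarrow> x \<in> cell N a \<Longrightarrow> f x \<in> cell N b \<Longrightarrow> a \<in> gauss_ints \<Longrightarrow> b \<in> gauss_ints \<Longrightarrow> (a, b) \<in> cell_rel N f"
  by (auto simp: cell_rel_def)

lemma orbit_walk: "0 < N \<Longrightarrow> (cell_of N x, cell_of N ((f ^^ n) x)) \<in> cell_rel N f ^^ n"
proof (induction n)
  case (Suc n)
  then show ?case using cell_rel_step[OF Suc.prems cell_of(1) _ cell_of(2) cell_of(2)] cell_of(1)[of N "(f ^^ Suc n) x"]
    by fastforce
qed simp

lemma cell_rel_bounded: assumes "0 < N" obtains D where "\<And>a b. (a, b) \<in> cell_rel N f \<Longrightarrow> norm (b - a) \<le> D"
proof -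
  obtain M where M: "\<And>z. norm (f z - z) \<le> M" using displacement_bounded by metis
  have "norm (b - a) \<le> real N * (4 + M)" if "(a, b) \<in> cell_rel N f" for a b
  proof -
    obtain x where x: "x \<in> cell N a" "f x \<in> cell N b" using \<open>(a, b) \<in> cell_rel N f\<close> by (auto simp: cell_rel_def)
    have "norm (b / of_nat N - a / of_nat N) \<le> 4 + M"
      using cell_corner[OF assms x(1)] cell_corner[OF assms x(2)] M[of x]
        norm_triangle_ineq[of "(x - a / of_nat N) - (f x - b / of_nat N)" "f x - x"]
        norm_triangle_ineq4[of "x - a / of_nat N" "f x - b / of_nat N"] by (simp add: algebra_simps)
    moreover have "norm (b - a) = real N * norm (b / of_nat N - a / of_nat N)"
      using assms by (simp add: norm_divide flip: diff_divide_distrib)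
    ultimately show ?thesis by (simp add: mult_left_mono)
  qed
  then show ?thesis using that by blast
qed

lemma rot_bounded: assumes "\<And>z. norm (f z - z) \<le> M" "p \<in> rot f" shows "norm p \<le> M"
proof (rule field_le_epsilon)
  fix e :: real assume "0 < e"
  then obtain n x where n: "1 \<le> n" "norm ((f ^^ n) x - x - real n *\<^sub>R p) < e * real n"
    using assms(2) unfolding rot_iff by (metis order_refl)
  have "norm (real n *\<^sub>R p) \<le> norm ((f ^^ n) x - x - real n *\<^sub>R p) + norm ((f ^^ n) x - x)"
    using norm_triangle_ineq4[of "(f ^^ n) x - x" "(f ^^ n) x - x - real n *\<^sub>R p"] by simp
  then have "real n * norm p \<le> real n * (M + e)"
    using n iterate_displacement[OF assms(1), of n x] by (simp add: algebra_simps)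
  then show "norm p \<le> M + e" using n(1) by (simp add: mult_le_cancel_left_pos)
qed

lemma closed_rot: "closed (rot f)"
  unfolding rot_def by (intro closed_INT) auto

lemma compact_rot: "compact (rot f)"
proof -
  obtain M where "\<And>z. norm (f z - z) \<le> M" using displacement_bounded by metis
  then have "bounded (rot f)" using rot_bounded unfolding bounded_iff by blast
  then show ?thesis using closed_rot by (simp add: compact_eq_bounded_closed)
qed

lemma rot_limit_point:
  assumes "\<And>k. k \<le> n k" "\<And>k. 1 \<le> n k"
  obtains p r where "p \<in> rot f" "strict_mono (r :: nat \<Rightarrow> nat)"
    "((\<lambda>k. ((f ^^ n (r k)) (x (r k)) - x (r k)) /\<^sub>R real (n (r k))) \<longlonglongrightarrow> p)"
proof -
  obtain M where M: "\<And>z. norm (f z - z) \<le> M" using displacement_bounded by metis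
  define q where "q = (\<lambda>k. ((f ^^ n k) (x k) - x k) /\<^sub>R real (n k))"
  have "q k \<in> cball 0 M" for k
    using iterate_displacement[OF M, of "n k" "x k"] assms(2)[of k] by (simp add: q_def divide_simps mult.commute)
  then obtain p r where pr: "strict_mono (r :: nat \<Rightarrow> nat)" "(q \<circ> r) \<longlonglongrightarrow> p"
    using compact_cball[of "0::complex" M] unfolding compact_def by meson
  have "p \<in> rot f" unfolding rot_iff
  proof (intro allI impI)
    fix m :: nat and e :: real assume "1 \<le> m" "0 < e"
    then have "\<forall>\<^sub>F k in sequentially. dist ((q \<circ> r) k) p < e" using pr(2) tendstoD by blast
    then obtain k where k: "m \<le> k" "dist (q (r k)) p < e"
      unfolding eventually_sequentially by (metis comp_apply nle_le)
    have n: "m \<le> n (r k)" using k(1) seq_suble[OF pr(1), of k] assms(1)[of "r k"] by linarith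
    have "q (r k) - p = ((f ^^ n (r k)) (x (r k)) - x (r k) - real (n (r k)) *\<^sub>R p) /\<^sub>R real (n (r k))"
      using assms(2)[of "r k"] by (simp add: q_def algebra_simps)
    then have "norm ((f ^^ n (r k)) (x (r k)) - x (r k) - real (n (r k)) *\<^sub>R p) < e * real (n (r k))"
      using k(2) assms(2)[of "r k"] by (simp add: dist_norm divide_simps mult.commute)
    then show "\<exists>n\<ge>m. \<exists>x. norm ((f ^^ n) x - x - real n *\<^sub>R p) < e * real n" using n by blast
  qed
  then show ?thesis using pr that unfolding q_def o_def by blast
qed

lemma rot_nonempty: "rot f \<noteq> {}"
proof -
  have "k \<le> Suc k" "1 \<le> Suc k" for k by auto
  from rot_limit_point[OF this, of "\<lambda>_. 0"] show ?thesis by blast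
qed

text \<open>By compactness: longer and longer orbit segments violating the bound would have average
  displacements accumulating at a rotation vector with \<open>inner v p \<le> \<beta>\<close>. The
  gain is that \<open>n0\<close> does not depend on the starting point.\<close>

lemma rot_drift:
  assumes "\<And>p. p \<in> rot f \<Longrightarrow> \<beta> < inner v p"
  obtains n0 where "\<And>n x. n0 \<le> n \<Longrightarrow> \<beta> * real n \<le> inner v ((f ^^ n) x - x)"
proof -
  have "\<exists>n0. \<forall>n\<ge>n0. \<forall>x. \<beta> * real n \<le> inner v ((f ^^ n) x - x)"
  proof (rule ccontr)
    assume "\<not> ?thesis"
    then have "\<forall>k. \<exists>n x. Suc k \<le> n \<and> inner v ((f ^^ n) x - x) < \<beta> * real n" by (meson not_le)
    then obtain n x where nx: "\<And>k. Suc k \<le> n k" "\<And>k. inner v ((f ^^ n k) (x k) - x k) < \<beta> * real (n k)" by metis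
    have n: "k \<le> n k" "1 \<le> n k" for k using nx(1)[of k] by auto
    obtain p r where pr: "p \<in> rot f" "strict_mono (r :: nat \<Rightarrow> nat)"
      "((\<lambda>k. ((f ^^ n (r k)) (x (r k)) - x (r k)) /\<^sub>R real (n (r k))) \<longlonglongrightarrow> p)"
      by (rule rot_limit_point[OF n, where x = x])
    have "((\<lambda>k. inner v (((f ^^ n (r k)) (x (r k)) - x (r k)) /\<^sub>R real (n (r k)))) \<longlonglongrightarrow> inner v p)"
      by (intro tendsto_intros pr(3))
    moreover have "inner v (((f ^^ n (r k)) (x (r k)) - x (r k)) /\<^sub>R real (n (r k))) \<le> \<beta>" for k
      using nx(1)[of "r k"] nx(2)[of "r k"] by (simp add: divide_simps mult.commute)
    ultimately have "inner v p \<le> \<beta>" by (intro LIMSEQ_le_const2) auto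
    then show False using assms[OF pr(1)] by simp
  qed
  then show ?thesis using that by blast
qed

lemma iterate_inner_le:
  assumes "\<And>x. inner v ((f ^^ n) x - x) \<le> \<beta>"
  shows "inner v ((f ^^ (n * k)) x - x) \<le> real k * \<beta>"
proof (induction k)
  case (Suc k)
  have "(f ^^ (n * Suc k)) x = (f ^^ n) ((f ^^ (n * k)) x)" by (simp add: funpow_add)
  then have "inner v ((f ^^ (n * Suc k)) x - x) = inner v ((f ^^ n) ((f ^^ (n * k)) x) - (f ^^ (n * k)) x) + inner v ((f ^^ (n * k)) x - x)"
    by (simp add: inner_diff_right)
  then show ?case using Suc assms[of "(f ^^ (n * k)) x"] by (simp add: algebra_simps)
qed simp

text \<open>A long orbit is cut into blocks of length \<open>n\<close>; the incomplete block
  contributes a bounded amount, which disappears in the average. Information on a single iterate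
  thus reaches the rotation set without loss.\<close>

lemma rot_inner_le:
  assumes n: "1 \<le> n" and le: "\<And>x. inner v ((f ^^ n) x - x) \<le> \<beta>" and p: "p \<in> rot f"
  shows "real n * inner v p \<le> \<beta>"
proof (rule ccontr)
  assume neg: "\<not> real n * inner v p \<le> \<beta>"
  obtain M where M: "0 \<le> M" "\<And>z. norm (f z - z) \<le> M" using displacement_bounded by metis
  define C where "C = norm v * (real n * M) + \<bar>\<beta>\<bar>"
  define \<gamma> where "\<gamma> = inner v p - \<beta> / real n"
  have "0 < \<gamma>" using neg n by (simp add: \<gamma>_def field_simps)
  obtain m0 where m0: "C / (\<gamma> / 2) < real m0" using reals_Archimedean2 by blast
  \<comment> \<open>Small enough for the error of approximating \<open>p\<close> to use up at most
    half of the excess \<open>\<gamma>\<close>.\<close>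
  define e where "e = \<gamma> / (2 * (norm v + 1))"
  have "0 < e" using \<open>0 < \<gamma>\<close> by (simp add: e_def add_nonneg_pos)
  have ev: "norm v * e \<le> \<gamma> / 2"
  proof -
    have "norm v * e = (\<gamma> / 2) * (norm v / (norm v + 1))" by (simp add: e_def)
    also have "\<dots> \<le> (\<gamma> / 2) * 1" using \<open>0 < \<gamma>\<close> by (intro mult_left_mono) (auto simp: divide_simps add_nonneg_pos)
    finally show ?thesis by simp
  qed
  obtain m x where m: "max 1 m0 \<le> m" "norm ((f ^^ m) x - x - real m *\<^sub>R p) < e * real m"
    using p \<open>0 < e\<close> unfolding rot_iff by (metis max.cobounded1)
  define k r where "k = m div n" and "r = m mod n"
  have mkr: "m = n * k + r" "r < n" using n by (auto simp: k_def r_def)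
  have "inner v ((f ^^ m) x - x) \<le> real k * \<beta> + norm v * (real n * M)"
  proof -
    have "(f ^^ m) x = (f ^^ (n * k)) ((f ^^ r) x)" using mkr by (simp add: funpow_add)
    then have "inner v ((f ^^ m) x - x) = inner v ((f ^^ (n * k)) ((f ^^ r) x) - (f ^^ r) x) + inner v ((f ^^ r) x - x)"
      by (simp add: inner_diff_right)
    moreover have "inner v ((f ^^ r) x - x) \<le> norm v * (real n * M)"
    proof -
      have "inner v ((f ^^ r) x - x) \<le> norm v * norm ((f ^^ r) x - x)" by (rule norm_cauchy_schwarz)
      also have "\<dots> \<le> norm v * (real r * M)" using iterate_displacement[OF M(2)] by (intro mult_left_mono) auto
      also have "\<dots> \<le> norm v * (real n * M)" using mkr M by (intro mult_left_mono mult_right_mono) auto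
      finally show ?thesis .
    qed
    ultimately show ?thesis using iterate_inner_le[OF le, of k "(f ^^ r) x"] by linarith
  qed
  moreover have "real k * \<beta> \<le> real m * (\<beta> / real n) + \<bar>\<beta>\<bar>"
  proof -
    have "real m * (\<beta> / real n) = real k * \<beta> + real r * (\<beta> / real n)"
      using n by (simp add: mkr(1) field_simps)
    moreover have "\<bar>real r * (\<beta> / real n)\<bar> \<le> \<bar>\<beta>\<bar>"
    proof -
      have "\<bar>real r * (\<beta> / real n)\<bar> = \<bar>\<beta>\<bar> * (real r / real n)" by (simp add: abs_mult)
      also have "\<dots> \<le> \<bar>\<beta>\<bar> * 1" using mkr n by (intro mult_left_mono) auto
      finally show ?thesis by simp
    qed
    ultimately show ?thesis by linarith
  qed
  moreover have "real m * inner v p \<le> inner v ((f ^^ m) x - x) + norm v * (e * real m)"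
  proof -
    have "inner v (real m *\<^sub>R p - ((f ^^ m) x - x)) \<le> norm v * norm (real m *\<^sub>R p - ((f ^^ m) x - x))" by (rule norm_cauchy_schwarz)
    also have "\<dots> \<le> norm v * (e * real m)" using m(2) by (intro mult_left_mono) (auto simp: norm_minus_commute)
    finally show ?thesis by (simp add: inner_diff_right)
  qed
  moreover have "norm v * (e * real m) \<le> \<gamma> / 2 * real m" using mult_right_mono[OF ev, of "real m"] by (simp add: mult.assoc)
  ultimately have "real m * inner v p \<le> real m * (\<beta> / real n) + C + \<gamma> / 2 * real m" unfolding C_def by linarith
  moreover have "real m * (\<beta> / real n) = real m * inner v p - \<gamma> * real m" by (simp add: \<gamma>_def algebra_simps)
  ultimately have "\<gamma> / 2 * real m \<le> C" by linarith
  then have "real m \<le> C / (\<gamma> / 2)" using \<open>0 < \<gamma>\<close> by (simp add: field_simps)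
  moreover have "real m0 \<le> real m" using m(1) by simp
  ultimately show False using m0 by linarith
qed

text \<open>Orbits are walks up to the bounded distance between a point and the corner of its cell,
  and averaging removes all constants. This is how bounds on closed walks restrict the rotation
  set.\<close>

lemma rot_walk_cost:
  assumes N: "0 < N" and K: "\<And>L a b. (a, b) \<in> cell_rel N f ^^ L \<Longrightarrow> - K \<le> inner v (b - a) / N + c * real L"
    and p: "p \<in> rot f"
  shows "- c \<le> inner v p"
proof -
  have bd: "inner (- v) ((f ^^ n) x - x) \<le> c * real n + (K + norm v * 4)" for n x
  proof -
    let ?a = "cell_of N x" and ?b = "cell_of N ((f ^^ n) x)"
    have "- K \<le> inner v (?b - ?a) / N + c * real n" by (rule K[OF orbit_walk[OF N]])
    moreover have "inner v (?b - ?a) / N = inner v (?b / of_nat N - ?a / of_nat N)"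
    proof -
      have e: "?b / of_nat N - ?a / of_nat N = (?b - ?a) /\<^sub>R real N" by (simp add: scaleR_conv_of_real field_simps flip: diff_divide_distrib)
      show ?thesis unfolding e inner_scaleR_right by (simp add: divide_inverse mult.commute)
    qed
    moreover have "\<bar>inner v ((?b / of_nat N - ?a / of_nat N) - ((f ^^ n) x - x))\<bar> \<le> norm v * 4"
    proof -
      have "norm ((?b / of_nat N - ?a / of_nat N) - ((f ^^ n) x - x)) \<le> 4"
        using cell_corner[OF N cell_of(1)[OF N], of x] cell_corner[OF N cell_of(1)[OF N], of "(f ^^ n) x"]
          norm_triangle_ineq4[of "x - ?a / of_nat N" "(f ^^ n) x - ?b / of_nat N"] by (simp add: algebra_simps)
      then show ?thesis using Cauchy_Schwarz_ineq2[of v] by (meson mult_left_mono norm_ge_zero order_trans)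
    qed
    ultimately show ?thesis by (simp add: inner_diff_right)
  qed
  have "real n * inner (- v) p \<le> c * real n + (K + norm v * 4)" if "1 \<le> n" for n
    using rot_inner_le[OF that bd p] .
  then have le: "real n * (- c - inner v p) \<le> K + norm v * 4" if "1 \<le> n" for n
  proof -
    have "real n * inner (- v) p \<le> c * real n + (K + norm v * 4)" using \<open>\<And>n. 1 \<le> n \<Longrightarrow> real n * inner (- v) p \<le> c * real n + (K + norm v * 4)\<close> that .
    then show ?thesis by (simp add: algebra_simps)
  qed
  show ?thesis
  proof (rule ccontr)
    assume "\<not> - c \<le> inner v p"
    then have pos: "0 < - c - inner v p" by simp
    then obtain n where n: "K + norm v * 4 < real n * (- c - inner v p)" using reals_Archimedean3 by blast
    show False using n le[of "max 1 n"] pos by (cases "1 \<le> n") (auto simp: not_le)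
  qed
qed

lemma rot_bounded_orbit:
  assumes L: "1 \<le> L" and C: "\<And>n. \<exists>x. norm ((f ^^ (L * n)) x - x - real n *\<^sub>R s) \<le> C"
  shows "s /\<^sub>R real L \<in> rot f"
  unfolding rot_iff
proof (intro allI impI)
  fix m :: nat and e :: real assume m: "1 \<le> m" and e: "0 < e"
  obtain n where n: "C < real n * e" using reals_Archimedean3[OF e] by blast
  define k where "k = max m n"
  obtain x where "norm ((f ^^ (L * k)) x - x - real k *\<^sub>R s) \<le> C" using C by blast
  also have "C < e * real (L * k)"
  proof -
    have "real n * e \<le> real (L * k) * e" using e L by (intro mult_right_mono) (auto simp: k_def simp flip: of_nat_mult of_nat_max intro: order_trans[OF _ mult_le_mono1[of 1 L "max m n"]])
    then show ?thesis using n by (simp add: mult.commute)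
  qed
  finally have "norm ((f ^^ (L * k)) x - x - real k *\<^sub>R s) < e * real (L * k)" .
  have "norm ((f ^^ (L * k)) x - x - real (L * k) *\<^sub>R (s /\<^sub>R real L)) < e * real (L * k)"
  proof -
    have "real (L * k) *\<^sub>R (s /\<^sub>R real L) = real k *\<^sub>R s" using L by (simp add: field_simps)
    then show ?thesis using \<open>norm ((f ^^ (L * k)) x - x - real k *\<^sub>R s) < e * real (L * k)\<close> by (simp only:)
  qed
  moreover have "m \<le> L * k" using mult_le_mono1[OF L, of k] by (simp add: k_def)
  ultimately show "\<exists>n\<ge>m. \<exists>x. norm ((f ^^ n) x - x - real n *\<^sub>R (s /\<^sub>R real L)) < e * real n" by blast
qed

text \<open>The theorem of Misiurewicz and Ziemian on the convexity of rotation sets, as far as it is needed. If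
  \<open>f\<^sup>n - z\<close> moved every point by more than the diameter of a unit cell, then the cells met by the
  images of a cell would generate a semigroup without 0 and all displacements would lie in a half plane.\<close>

lemma interior_convex_hull_rot: "interior (convex hull rot f) \<subseteq> rot f"
proof
  fix p assume "p \<in> interior (convex hull rot f)"
  then obtain r where r: "0 < r" "ball p r \<subseteq> convex hull rot f" by (meson mem_interior)
  show "p \<in> rot f" unfolding rot_iff
  proof (intro allI impI)
    fix m :: nat and e :: real assume m: "1 \<le> m" and e: "0 < e"
    \<comment> \<open>The 5 is the bound 3 obtained for \<open>h\<close> plus the error 2 of
      replacing \<open>n *\<^sub>R p\<close> by the lattice point \<open>z\<close>. The 12 makes a
      step of length \<open>r / 2\<close> away from \<open>p\<close> exceed the slack
      \<open>6 / n\<close> of the half plane.\<close>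
    obtain n1 n2 where n12: "5 / e < real n1" "12 / r < real n2" using reals_Archimedean2 by metis
    define n where "n = max m (max n1 n2)"
    have n: "m \<le> n" "1 \<le> n" "5 < e * real n" "12 < r * real n"
    proof -
      have "5 / e < real n" "12 / r < real n" using n12 by (auto simp: n_def max_def)
      then show "5 < e * real n" "12 < r * real n" using e r(1) by (auto simp: field_simps)
    qed (use m in \<open>auto simp: n_def\<close>)
    define z where "z = cell_of 1 (real n *\<^sub>R p)"
    have z: "z \<in> gauss_ints" "- z \<in> gauss_ints" "norm (real n *\<^sub>R p - z) \<le> 2"
      using cell_of[of 1 "real n *\<^sub>R p"] cell_corner[of 1 "real n *\<^sub>R p" z] by (auto simp: z_def)
    interpret i: plane_lift "f ^^ n" "g ^^ n" by (rule iterate_lift)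
    define h h' where "h = (\<lambda>x. (f ^^ n) x + - z)" and "h' = (\<lambda>x. (g ^^ n) (x - - z))"
    interpret h: plane_lift h h' unfolding h_def h'_def by (rule i.translate_lift[OF z(2)])
    \<comment> \<open>Unit cells have diameter at most 2, so if every point moved by at least 3,
      \<open>no_closed_cell_chain\<close> would apply with \<open>N = 1\<close>.\<close>
    have "\<exists>x. norm (h x - x) < 3"
    proof (rule ccontr)
      assume "\<not> ?thesis"
      then have big: "3 \<le> norm (h x - x)" for x by (meson not_le)
      obtain M where M: "\<And>x. norm (h x - x) \<le> M" using h.displacement_bounded by blast
      have nc: "(a, a) \<notin> (cell_rel 1 h)\<^sup>+" for a
        by (rule no_closed_cell_chain[OF h.cf h.cg h.fg h.gf M big]) auto
      have ti: "tinv 1 (cell_rel 1 h)" by (rule h.cell_rel_tinv) simp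
      define S where "S = {w \<in> gauss_ints. (0, w) \<in> (cell_rel 1 h)\<^sup>+}"
      have S1: "S \<noteq> {}"
      proof -
        have "(cell_of 1 0, cell_of 1 ((h ^^ 1) 0)) \<in> cell_rel 1 h ^^ 1" by (rule h.orbit_walk) simp
        then have "(0, cell_of 1 (h 0)) \<in> (cell_rel 1 h)\<^sup>+" by (auto simp: cell_of_def complex_eq_iff zero_complex.code)
        then show ?thesis using cell_of(2)[of 1 "h 0"] by (auto simp: S_def)
      qed
      have S2: "a + b \<in> S" if "a \<in> S" "b \<in> S" for a b
        using that tinv_trancl[OF ti, of 0 b a] by (auto simp: S_def add.commute)
      have S3: "S \<subseteq> gauss_ints" "0 \<notin> S" using nc[of 0] by (auto simp: S_def)
      obtain v where v: "v \<noteq> 0" "\<And>s. s \<in> S \<Longrightarrow> 0 \<le> inner v s" "\<exists>s\<in>S. 0 < inner v s"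
        using gauss_semigroup_halfplane[OF S3(1) S1 S2 S3(2)] by metis
      have le: "inner (- v) ((f ^^ n) x - x) \<le> - real n * inner v p + 6 * norm v" for x
      proof -
        define a b where "a = cell_of 1 x" and "b = cell_of 1 (h x)"
        have ab: "a \<in> gauss_ints" "b \<in> gauss_ints" "x \<in> cell 1 a" "h x \<in> cell 1 b" using cell_of[of 1] by (auto simp: a_def b_def)
        then have "(a, b) \<in> cell_rel 1 h" by (intro h.cell_rel_step) auto
        then have "(a + of_nat 1 * - a, b + of_nat 1 * - a) \<in> cell_rel 1 h"
          by (rule tinvD(3)[OF ti]) (use ab in simp)
        then have "b - a \<in> S" using ab by (auto simp: S_def)
        then have "0 \<le> inner v (b - a)" by (rule v)
        moreover have "norm ((b - a) - ((f ^^ n) x - x - real n *\<^sub>R p)) \<le> 6"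
          using cell_corner[of 1 x a] cell_corner[of 1 "h x" b] ab z(3)
            norm_triangle_ineq4[of "x - a" "h x - b"] norm_triangle_ineq[of "(x - a) - (h x - b)" "real n *\<^sub>R p - z"]
          by (simp add: h_def algebra_simps)
        then have "norm v * norm ((b - a) - ((f ^^ n) x - x - real n *\<^sub>R p)) \<le> norm v * 6" by (rule mult_left_mono) simp
        then have "inner v ((b - a) - ((f ^^ n) x - x - real n *\<^sub>R p)) \<le> norm v * 6"
          using norm_cauchy_schwarz order_trans by blast
        ultimately show ?thesis by (simp add: inner_diff_right algebra_simps)
      qed
      have "rot f \<subseteq> {q. real n * inner (- v) q \<le> - real n * inner v p + 6 * norm v}"
        using rot_inner_le[OF n(2) le] by blast
      moreover have "convex {q. real n * inner (- v) q \<le> - real n * inner v p + 6 * norm v}"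
        using convex_halfspace_le[of "real n *\<^sub>R (- v)"] by simp
      ultimately have "convex hull rot f \<subseteq> {q. real n * inner (- v) q \<le> - real n * inner v p + 6 * norm v}"
        by (rule hull_minimal)
      \<comment> \<open>The point of the hull lying furthest outside the half plane within half the
        radius \<open>r\<close>.\<close>
      moreover have "p - (r / 2) *\<^sub>R sgn v \<in> convex hull rot f"
        using r v(1) by (intro subsetD[OF r(2)]) (simp add: dist_norm norm_sgn)
      moreover have "inner v (sgn v) = norm v" using v(1) by (simp add: sgn_div_norm power2_norm_eq_inner[symmetric] power2_eq_square)
      ultimately have "real n * (r / 2) * norm v \<le> 6 * norm v" by (auto simp: inner_diff_right algebra_simps)
      then show False using n(4) v(1) by (simp add: mult.commute)
    qed
    then obtain x where "norm (h x - x) < 3" by blast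
    then have "norm ((f ^^ n) x - x - real n *\<^sub>R p) < 5"
      using z(3) norm_triangle_ineq4[of "h x - x" "real n *\<^sub>R p - z"] by (simp add: h_def algebra_simps)
    then have "norm ((f ^^ n) x - x - real n *\<^sub>R p) < e * real n" using n by linarith
    then show "\<exists>n\<ge>m. \<exists>x. norm ((f ^^ n) x - x - real n *\<^sub>R p) < e * real n" using n(1) by blast
  qed
qed

lemma rot_translate:
  assumes w: "w \<in> gauss_ints" shows "p \<in> rot f \<Longrightarrow> p + w \<in> rot (\<lambda>z. f z + w)"
proof -
  have wn: "real n *\<^sub>R w \<in> gauss_ints" for n using w by (auto simp: scaleR_conv_of_real)
  have it: "((\<lambda>z. f z + w) ^^ n) x = (f ^^ n) x + real n *\<^sub>R w" for n x
  proof (induction n)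
    case (Suc n)
    then show ?case using per[OF wn, of "(f ^^ n) x" n] by (simp add: algebra_simps)
  qed simp
  show "p \<in> rot f \<Longrightarrow> p + w \<in> rot (\<lambda>z. f z + w)" unfolding rot_iff it by (simp add: algebra_simps)
qed

end

section \<open>Attractors and free curves\<close>

lemma finite_gauss_bounded: "finite {a \<in> gauss_ints. norm a \<le> r}"
proof (rule finite_subset)
  let ?k = "\<lceil>\<bar>r\<bar>\<rceil>"
  show "{a \<in> gauss_ints. norm a \<le> r} \<subseteq> (\<lambda>(m, n). Complex (of_int m) (of_int n)) ` ({- ?k..?k} \<times> {- ?k..?k})"
  proof
    fix a assume "a \<in> {a \<in> gauss_ints. norm a \<le> r}"
    then have a: "a \<in> gauss_ints" "norm a \<le> r" by auto
    then obtain m n where mn: "Re a = of_int m" "Im a = of_int n" by (auto simp: gauss_ints_def elim!: Ints_cases)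
    have "\<bar>Re a\<bar> \<le> r" "\<bar>Im a\<bar> \<le> r" using a abs_Re_le_cmod[of a] abs_Im_le_cmod[of a] by linarith+
    then have "m \<in> {- ?k..?k}" "n \<in> {- ?k..?k}" unfolding mn atLeastAtMost_iff by linarith+
    moreover have "a = (\<lambda>(m, n). Complex (of_int m) (of_int n)) (m, n)" using mn by (simp add: complex_eq_iff)
    ultimately show "a \<in> (\<lambda>(m, n). Complex (of_int m) (of_int n)) ` ({- ?k..?k} \<times> {- ?k..?k})" by blast
  qed
qed auto

lemma closed_locally_finite_UN:
  fixes S :: "'i \<Rightarrow> complex set"
  assumes cl: "\<And>i. i \<in> I \<Longrightarrow> closed (S i)" and fin: "\<And>x. finite {i \<in> I. S i \<inter> ball x 1 \<noteq> {}}"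
  shows "closed (\<Union>i\<in>I. S i)"
proof -
  have "x \<in> (\<Union>i\<in>I. S i)" if x: "x \<in> closure (\<Union>i\<in>I. S i)" for x
  proof -
    let ?J = "{i \<in> I. S i \<inter> ball x 1 \<noteq> {}}"
    have cl': "closed (\<Union>i\<in>?J. S i)" using cl by (intro closed_UN fin) auto
    have "x \<in> closure (\<Union>i\<in>?J. S i)"
      unfolding closure_approachable
    proof (intro allI impI)
      fix e :: real assume "0 < e"
      then have "0 < min e 1" by simp
      then obtain y where y: "y \<in> (\<Union>i\<in>I. S i)" "dist y x < min e 1"
        using x unfolding closure_approachable by blast
      then obtain i where "i \<in> I" "y \<in> S i" by blast
      then have "i \<in> ?J" using y(2) by (auto simp: dist_commute)
      then have "y \<in> (\<Union>i\<in>?J. S i)" using \<open>y \<in> S i\<close> by blast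
      then show "\<exists>y\<in>\<Union>i\<in>?J. S i. dist y x < e" using y(2) by auto
    qed
    then have "x \<in> (\<Union>i\<in>?J. S i)" by (simp only: closure_closed[OF cl'])
    then show ?thesis by blast
  qed
  then show ?thesis by (metis closure_subset_eq subsetI)
qed

definition region :: "nat \<Rightarrow> complex set \<Rightarrow> complex set" where
  "region N W = (\<Union>a\<in>W. cell N a)"

text \<open>This plays the part of the interior of \<open>region N W\<close>. Its description by
  cells makes it the complement of a closed region and turns invariance under the graph directly
  into \<open>attractor_core\<close>.\<close>

definition core :: "nat \<Rightarrow> complex set \<Rightarrow> complex set" where
  "core N W = {z. \<forall>b\<in>gauss_ints. z \<in> cell N b \<longrightarrow> b \<in> W}"

lemma core_subset_region: "0 < N \<Longrightarrow> core N W \<subseteq> region N W"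
  using cell_of[of N] by (auto simp: core_def region_def)

lemma norm_near_corner:
  fixes a x z :: complex
  assumes N: "0 < N" and "norm (z - a / of_nat N) \<le> 2" "z \<in> ball x 1"
  shows "norm a \<le> real N * (norm x + 3)"
proof -
  have "norm (x - z) < 1" using assms by (simp add: dist_norm)
  then have "norm (a / of_nat N) \<le> norm x + 3"
    using assms(2) norm_triangle_ineq4[of x "x - z"] norm_triangle_ineq4[of z "z - a / of_nat N"] by simp
  moreover have "norm a = real N * norm (a / of_nat N)" using N by (simp add: norm_divide)
  ultimately show ?thesis by (simp add: mult_left_mono)
qed

lemma closed_region: assumes "0 < N" "W \<subseteq> gauss_ints" shows "closed (region N W)"
  unfolding region_def
proof (rule closed_locally_finite_UN)
  fix x
  have "{i \<in> W. cell N i \<inter> ball x 1 \<noteq> {}} \<subseteq> {a \<in> gauss_ints. norm a \<le> real N * (norm x + 3)}"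
    using norm_near_corner[OF assms(1) cell_corner[OF assms(1)]] assms(2) by blast
  then show "finite {i \<in> W. cell N i \<inter> ball x 1 \<noteq> {}}" using finite_gauss_bounded finite_subset by blast
qed (simp add: compact_cell compact_imp_closed)

lemma open_core: assumes "0 < N" shows "open (core N W)"
proof -
  have "core N W = - region N (gauss_ints - W)" by (auto simp: core_def region_def)
  then show ?thesis using closed_region[OF assms, of "gauss_ints - W"] by auto
qed

section \<open>Grid edges and boundaries of unions of cells\<close>

definition edge :: "nat \<Rightarrow> complex \<times> complex \<Rightarrow> complex set" where
  "edge N e = {z. \<exists>s\<in>{0..1::real}. of_nat N * z = fst e + of_real s * snd e}"

definition carrier :: "nat \<Rightarrow> (complex \<times> complex) set \<Rightarrow> complex set" where
  "carrier N G = (\<Union>e\<in>G. edge N e)"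

lemma mem_edge_1: "z \<in> edge N (a, 1) \<longleftrightarrow> N * Im z = Im a \<and> Re a \<le> N * Re z \<and> N * Re z \<le> Re a + 1"
  unfolding edge_def by (auto simp: complex_eq_iff intro!: bexI[of _ "N * Re z - Re a"])

lemma mem_edge_ii: "z \<in> edge N (a, \<i>) \<longleftrightarrow> N * Re z = Re a \<and> Im a \<le> N * Im z \<and> N * Im z \<le> Im a + 1"
  unfolding edge_def by (auto simp: complex_eq_iff intro!: bexI[of _ "N * Im z - Im a"])

text \<open>The horizontal edge starting at \<open>a\<close> separates the cells \<open>a\<close>
  and \<open>a - \<i>\<close>, the vertical one the cells \<open>a\<close> and
  \<open>a - 1\<close>.\<close>

definition bd :: "complex set \<Rightarrow> (complex \<times> complex) set" where
  "bd W = {(a, d). a \<in> gauss_ints \<and> (d = 1 \<and> (a \<in> W) \<noteq> (a - \<i> \<in> W) \<or> d = \<i> \<and> (a \<in> W) \<noteq> (a - 1 \<in> W))}"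

lemma bd_cells:
  assumes N: "0 < N" and W: "W \<subseteq> gauss_ints" and z: "z \<in> carrier N (bd W)"
  shows "z \<in> region N W" "z \<notin> core N W"
proof -
  obtain a d where ad: "(a, d) \<in> bd W" "z \<in> edge N (a, d)" using z by (auto simp: carrier_def)
  define b where "b = (if d = 1 then a - \<i> else a - 1)"
  have a: "a \<in> gauss_ints" "b \<in> gauss_ints" "(a \<in> W) \<noteq> (b \<in> W)"
    using ad(1) by (auto simp: bd_def b_def complex_eq_iff)
  have d: "d = 1 \<or> d = \<i>" using ad(1) by (auto simp: bd_def)
  then have "z \<in> cell N a \<and> z \<in> cell N b"
  proof
    assume "d = 1"
    then show ?thesis using ad(2) by (simp add: mem_edge_1 mem_cell[OF N] b_def)
  next
    assume d: "d = \<i>"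
    then have "b = a - 1" by (simp add: b_def complex_eq_iff)
    then show ?thesis using ad(2) d by (simp add: mem_edge_ii mem_cell[OF N])
  qed
  then show "z \<in> region N W" "z \<notin> core N W" using a by (auto simp: region_def core_def)
qed

text \<open>Two cells at \<open>z\<close> are connected by changing first the column and then the
  row of the cell. Each change crosses an edge through \<open>z\<close>, which is not in
  \<open>bd W\<close>, so membership in \<open>W\<close> is preserved.\<close>

lemma region_bd_core:
  assumes N: "0 < N" and W: "W \<subseteq> gauss_ints" and z: "z \<in> region N W" "z \<notin> carrier N (bd W)"
  shows "z \<in> core N W"
proof -
  have adj1: "a \<in> W \<longleftrightarrow> a - \<i> \<in> W" if "a \<in> gauss_ints" "z \<in> cell N a" "z \<in> cell N (a - \<i>)" for a
  proof (rule ccontr)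
    assume "\<not> ?thesis"
    then have "(a, 1) \<in> bd W" using that by (auto simp: bd_def)
    moreover have "z \<in> edge N (a, 1)" using that by (auto simp: mem_edge_1 mem_cell[OF N])
    ultimately show False using z(2) by (auto simp: carrier_def)
  qed
  have adj2: "a \<in> W \<longleftrightarrow> a - 1 \<in> W" if "a \<in> gauss_ints" "z \<in> cell N a" "z \<in> cell N (a - 1)" for a
  proof (rule ccontr)
    assume "\<not> ?thesis"
    then have "(a, \<i>) \<in> bd W" using that by (auto simp: bd_def)
    moreover have "z \<in> edge N (a, \<i>)" using that by (auto simp: mem_edge_ii mem_cell[OF N])
    ultimately show False using z(2) by (auto simp: carrier_def)
  qed
  have H: "a \<in> W \<longleftrightarrow> b \<in> W" if ab: "a \<in> gauss_ints" "b \<in> gauss_ints" and that: "z \<in> cell N a" "z \<in> cell N b" "Im a = Im b" for a b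
  proof -
    have "\<bar>Re a - Re b\<bar> \<le> 1" using that by (auto simp: mem_cell[OF N])
    moreover obtain m n where mn: "Re a = of_int m" "Re b = of_int n" using ab by (auto simp: gauss_ints_def elim!: Ints_cases)
    ultimately have "m = n \<or> m = n + 1 \<or> n = m + 1" by linarith
    then have "a = b \<or> b = a - 1 \<or> a = b - 1" using mn that by (auto simp: complex_eq_iff)
    then show ?thesis using adj2[of a] adj2[of b] that ab by auto
  qed
  have V: "a \<in> W \<longleftrightarrow> b \<in> W" if ab: "a \<in> gauss_ints" "b \<in> gauss_ints" and that: "z \<in> cell N a" "z \<in> cell N b" "Re a = Re b" for a b
  proof -
    have "\<bar>Im a - Im b\<bar> \<le> 1" using that by (auto simp: mem_cell[OF N])
    moreover obtain m n where mn: "Im a = of_int m" "Im b = of_int n" using ab by (auto simp: gauss_ints_def elim!: Ints_cases)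
    ultimately have "m = n \<or> m = n + 1 \<or> n = m + 1" by linarith
    then have "a = b \<or> b = a - \<i> \<or> a = b - \<i>" using mn that by (auto simp: complex_eq_iff)
    then show ?thesis using adj1[of a] adj1[of b] that ab by auto
  qed
  obtain a where a: "a \<in> W" "z \<in> cell N a" using z(1) by (auto simp: region_def)
  have "b \<in> W" if b: "b \<in> gauss_ints" "z \<in> cell N b" for b
  proof -
    define c where "c = Complex (Re b) (Im a)"
    have "c \<in> gauss_ints" "z \<in> cell N c" using a b W by (auto simp: c_def gauss_ints_def mem_cell[OF N])
    moreover have "a \<in> gauss_ints" using a W by blast
    ultimately have "a \<in> W \<longleftrightarrow> c \<in> W" "c \<in> W \<longleftrightarrow> b \<in> W"
      by (intro H a; simp add: c_def) (intro V b \<open>c \<in> gauss_ints\<close> \<open>z \<in> cell N c\<close>; simp add: c_def)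
    then show ?thesis using a by blast
  qed
  then show ?thesis by (auto simp: core_def)
qed

lemma edge_corner: assumes N: "0 < N" and "z \<in> edge N (a, d)" "d = 1 \<or> d = \<i>" shows "norm (z - a / of_nat N) \<le> 2"
proof -
  have "z \<in> cell N a" using assms by (auto simp: mem_edge_1 mem_edge_ii mem_cell)
  then show ?thesis by (rule cell_corner[OF N])
qed

lemma closed_edge: assumes "d = 1 \<or> d = \<i>" shows "closed (edge N (a, d))"
proof -
  have 1: "edge N (a, 1) = {z. N * Im z = Im a} \<inter> {z. Re a \<le> N * Re z} \<inter> {z. N * Re z \<le> Re a + 1}"
    and 2: "edge N (a, \<i>) = {z. N * Re z = Re a} \<inter> {z. Im a \<le> N * Im z} \<inter> {z. N * Im z \<le> Im a + 1}"
    by (auto simp: mem_edge_1 mem_edge_ii)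
  have "closed (edge N (a, 1))" "closed (edge N (a, \<i>))" unfolding 1 2
    by (intro closed_Int closed_Collect_eq closed_Collect_le continuous_intros)+
  then show ?thesis using assms by auto
qed

lemma closed_carrier:
  assumes N: "0 < N" and G: "G \<subseteq> gauss_ints \<times> {1, \<i>}"
  shows "closed (carrier N G)"
  unfolding carrier_def
proof (rule closed_locally_finite_UN)
  fix x
  have "{e \<in> G. edge N e \<inter> ball x 1 \<noteq> {}} \<subseteq> {a \<in> gauss_ints. norm a \<le> real N * (norm x + 3)} \<times> {1, \<i>}"
  proof
    fix e assume e: "e \<in> {e \<in> G. edge N e \<inter> ball x 1 \<noteq> {}}"
    obtain a d where ed: "e = (a, d)" by (cases e)
    obtain z where "z \<in> edge N e" "z \<in> ball x 1" using e by auto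
    then have ad: "e = (a, d)" "a \<in> gauss_ints" "d = 1 \<or> d = \<i>" "z \<in> edge N (a, d)" "z \<in> ball x 1" using G e ed by auto
    then show "e \<in> {a \<in> gauss_ints. norm a \<le> real N * (norm x + 3)} \<times> {1, \<i>}"
      using norm_near_corner[OF N edge_corner[OF N ad(4,3)] ad(5)] by auto
  qed
  then show "finite {e \<in> G. edge N e \<inter> ball x 1 \<noteq> {}}"
    using finite_gauss_bounded by (meson finite.intros finite_SigmaI finite_subset)
next
  show "closed (edge N e)" if "e \<in> G" for e
  proof -
    obtain a d where "e = (a, d)" "d = 1 \<or> d = \<i>" using \<open>e \<in> G\<close> G by auto
    then show ?thesis using closed_edge by simp
  qed
qed

text \<open>Some component of a closed separating set already separates the two points. It cannot be
  bounded, because \<open>K1\<close> and \<open>K2\<close> leave every disc and the complement of a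
  disc is connected.\<close>

lemma unbounded_component_of_separator:
  fixes B :: "complex set"
  assumes B: "closed B" and K1: "connected K1" "\<not> bounded K1" "K1 \<inter> B = {}" "x \<in> K1"
    and K2: "connected K2" "\<not> bounded K2" "K2 \<inter> B = {}" "y \<in> K2"
    and sep: "\<not> connected_component (- B) x y"
  obtains C where "connected C" "\<not> bounded C" "C \<subseteq> B"
proof -
  obtain C where C: "C \<in> components B" "\<not> connected_component (- C) x y"
    using separation_by_component_closed_pointwise[OF B sep] by blast
  have "\<not> bounded C"
  proof
    assume "bounded C"
    then obtain r where "\<And>z. z \<in> C \<Longrightarrow> norm z \<le> r" unfolding bounded_iff by blast
    then have r: "C \<subseteq> cball 0 r" by auto
    have CB: "C \<subseteq> B" using C(1) in_components_subset by blast
    obtain x' y' where xy: "x' \<in> K1" "x' \<notin> cball 0 r" "y' \<in> K2" "y' \<notin> cball 0 r"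
      using K1(2) K2(2) by (meson bounded_cball bounded_subset subsetI)
    have "connected_component (- C) x x'" using K1 CB xy unfolding connected_component_def by blast
    moreover have "connected_component (- C) y' y" using K2 CB xy unfolding connected_component_def by blast
    moreover have "connected (- cball (0::complex) r)" by (rule connected_complement_bounded_convex) auto
    then have "connected_component (- C) x' y'" using r xy unfolding connected_component_def by (intro exI[of _ "- cball 0 r"]) auto
    ultimately show False using C(2) connected_component_trans by metis
  qed
  then show ?thesis using that C(1) in_components_connected in_components_subset by metis
qed

lemma region_boundary_unbounded:
  assumes N: "0 < N" and W: "W \<subseteq> gauss_ints"
    and K1: "connected K1" "\<not> bounded K1" "K1 \<subseteq> core N W"
    and K2: "connected K2" "\<not> bounded K2" "K2 \<inter> region N W = {}"
  obtains C where "connected C" "\<not> bounded C" "C \<subseteq> carrier N (bd W)"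
proof -
  have "K1 \<noteq> {}" "K2 \<noteq> {}" using K1 K2 by auto
  then obtain x y where xy: "x \<in> K1" "y \<in> K2" by blast
  have "bd W \<subseteq> gauss_ints \<times> {1, \<i>}" by (auto simp: bd_def)
  then have cl: "closed (carrier N (bd W))" by (rule closed_carrier[OF N])
  have "\<not> connected_component (- carrier N (bd W)) x y"
  proof
    assume "connected_component (- carrier N (bd W)) x y"
    then obtain T where T: "connected T" "T \<subseteq> - carrier N (bd W)" "x \<in> T" "y \<in> T" unfolding connected_component_def by blast
    have "T \<subseteq> core N W \<union> - region N W" using region_bd_core[OF N W] T(2) by blast
    moreover have "core N W \<inter> - region N W \<inter> T = {}" using core_subset_region[OF N] by blast
    moreover have "open (core N W)" "open (- region N W)" using open_core[OF N] closed_region[OF N W] by auto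
    ultimately have "core N W \<inter> T = {} \<or> - region N W \<inter> T = {}" using T(1) unfolding connected_def by metis
    then show False using xy T K1 K2 by blast
  qed
  moreover have "K1 \<inter> carrier N (bd W) = {}" "K2 \<inter> carrier N (bd W) = {}" using bd_cells[OF N W] K1 K2 by blast+
  ultimately show ?thesis
    using unbounded_component_of_separator[OF cl K1(1,2) _ xy(1) K2(1,2) _ xy(2)] that by metis
qed

text \<open>A shortest walk between two equivalent vertices of such an unbounded set of edges projects to an essential simple closed
  curve in the torus.\<close>

definition no_free_grid_curve :: "(complex \<Rightarrow> complex) \<Rightarrow> bool" where
  "no_free_grid_curve f \<longleftrightarrow> (\<forall>N\<ge>3. \<forall>G \<subseteq> gauss_ints \<times> {1, \<i>}.
     (\<forall>(a, d)\<in>G. \<forall>w\<in>gauss_ints. (a + of_nat N * w, d) \<in> G) \<longrightarrow> f ` carrier N G \<inter> carrier N G = {} \<longrightarrow>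
     (\<forall>K. connected K \<longrightarrow> K \<subseteq> carrier N G \<longrightarrow> bounded K))"

lemma no_free_grid_curveD:
  assumes "no_free_grid_curve f" "3 \<le> N" "G \<subseteq> gauss_ints \<times> {1, \<i>}"
    "\<And>a d w. (a, d) \<in> G \<Longrightarrow> w \<in> gauss_ints \<Longrightarrow> (a + of_nat N * w, d) \<in> G"
    "f ` carrier N G \<inter> carrier N G = {}" "connected K" "K \<subseteq> carrier N G"
  shows "bounded K"
proof -
  have "\<forall>(a, d)\<in>G. \<forall>w\<in>gauss_ints. (a + of_nat N * w, d) \<in> G" using assms(4) by blast
  then show ?thesis using assms(1)[unfolded no_free_grid_curve_def, rule_format, OF assms(2,3) _ assms(5,6,7)] by simp
qed

lemma edge_shift: "0 < N \<Longrightarrow> z + w \<in> edge N (a + of_nat N * w, d) \<longleftrightarrow> z \<in> edge N (a, d)"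
  by (auto simp: edge_def algebra_simps)

lemma carrier_shift:
  assumes N: "0 < N" and G: "\<And>a d w. (a, d) \<in> G \<Longrightarrow> w \<in> gauss_ints \<Longrightarrow> (a + of_nat N * w, d) \<in> G"
    and "z \<in> carrier N G" "w \<in> gauss_ints"
  shows "z + w \<in> carrier N G"
proof -
  obtain a d where "(a, d) \<in> G" "z \<in> edge N (a, d)" using assms(3) by (auto simp: carrier_def)
  then have "(a + of_nat N * w, d) \<in> G" "z + w \<in> edge N (a + of_nat N * w, d)" using G assms(4) edge_shift[OF N] by auto
  then show ?thesis unfolding carrier_def by blast
qed

text \<open>The carrier is invariant under integer translations, so its being free does not depend
  on the chosen lift.\<close>

lemma no_free_grid_curve_translate:
  assumes nf: "no_free_grid_curve f" and w: "w \<in> gauss_ints"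
  shows "no_free_grid_curve (\<lambda>z. f z + w)"
  unfolding no_free_grid_curve_def
proof (intro allI impI)
  fix N G K assume h: "3 \<le> N" "G \<subseteq> gauss_ints \<times> {1, \<i>}" "\<forall>(a, d)\<in>G. \<forall>w\<in>gauss_ints. (a + of_nat N * w, d) \<in> G"
    "(\<lambda>z. f z + w) ` carrier N G \<inter> carrier N G = {}" "connected K" "K \<subseteq> carrier N G"
  have G: "(a + of_nat N * w, d) \<in> G" if "(a, d) \<in> G" "w \<in> gauss_ints" for a d w using h(3) that by blast
  have "f ` carrier N G \<inter> carrier N G = {}"
  proof (rule ccontr)
    assume "\<not> ?thesis"
    then obtain z where z: "z \<in> carrier N G" "f z \<in> carrier N G" by blast
    then have "f z + w \<in> carrier N G" using carrier_shift[OF _ G z(2) w] h(1) by simp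
    then show False using z h(4) by blast
  qed
  then show "bounded K" using no_free_grid_curveD[OF nf h(1,2) G _ h(5,6)] by blast
qed

lemma not_bounded_halfspace:
  assumes "v \<noteq> 0" shows "\<not> bounded {z::complex. c < inner v z}"
proof
  assume "bounded {z::complex. c < inner v z}"
  then obtain r where r: "\<And>z. c < inner v z \<Longrightarrow> norm z \<le> r" unfolding bounded_iff by blast
  define s where "s = max (\<bar>c\<bar> / (norm v ^ 2) + 1) (\<bar>r\<bar> / norm v + 1)"
  have pos: "0 < norm v" "0 < norm v ^ 2" using assms by auto
  have "\<bar>c\<bar> / (norm v ^ 2) < s" "\<bar>r\<bar> / norm v < s" "0 \<le> s"
    using divide_nonneg_pos[OF abs_ge_zero pos(1), of r] by (auto simp: s_def le_max_iff_disj)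
  then have "\<bar>c\<bar> < s * norm v ^ 2" "\<bar>r\<bar> < s * norm v" using pos by (simp_all add: pos_divide_less_eq)
  moreover have "inner v (s *\<^sub>R v) = s * norm v ^ 2" by (simp add: power2_norm_eq_inner)
  moreover have "norm (s *\<^sub>R v) = s * norm v" using \<open>0 \<le> s\<close> by simp
  ultimately have "c < inner v (s *\<^sub>R v)" "r < norm (s *\<^sub>R v)" by linarith+
  then show False using r[of "s *\<^sub>R v"] by linarith
qed

context plane_lift
begin

lemma image_unbounded: assumes "\<not> bounded K" shows "\<not> bounded (f ` K)"
proof
  assume "bounded (f ` K)"
  then obtain r where r: "\<And>x. x \<in> K \<Longrightarrow> norm (f x) \<le> r" unfolding bounded_iff by blast
  obtain M where M: "\<And>z. norm (f z - z) \<le> M" using displacement_bounded by metis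
  have "norm x \<le> r + M" if "x \<in> K" for x using r[OF that] M[of x] norm_triangle_ineq4[of "f x" "f x - x"] by simp
  then show False using assms unfolding bounded_iff by blast
qed

lemma attractor_core:
  assumes "0 < N" "W \<subseteq> gauss_ints" "\<And>a b. a \<in> W \<Longrightarrow> (a, b) \<in> cell_rel N f \<Longrightarrow> b \<in> W"
  shows "f ` region N W \<subseteq> core N W"
  using assms cell_rel_step[OF assms(1)] by (fastforce simp: region_def core_def)

lemma attractor_dichotomy:
  assumes nf: "no_free_grid_curve f" and N: "3 \<le> N" and W: "W \<subseteq> gauss_ints"
    and Wt: "\<And>a w. a \<in> W \<Longrightarrow> w \<in> gauss_ints \<Longrightarrow> a + of_nat N * w \<in> W"
    and up: "\<And>a b. a \<in> W \<Longrightarrow> (a, b) \<in> cell_rel N f \<Longrightarrow> b \<in> W"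
    and K1: "connected K1" "\<not> bounded K1" "K1 \<subseteq> region N W"
    and K2: "connected K2" "K2 \<inter> region N W = {}"
  shows "bounded K2"
proof (rule ccontr)
  assume "\<not> bounded K2"
  have N0: "0 < N" using N by simp
  have core: "f ` region N W \<subseteq> core N W" by (rule attractor_core[OF N0 W up])
  obtain C where C: "connected C" "\<not> bounded C" "C \<subseteq> carrier N (bd W)"
  proof (rule region_boundary_unbounded[OF N0 W])
    show "connected (f ` K1)" by (rule connected_continuous_image[OF continuous_on_subset[OF cf] K1(1)]) simp
    show "\<not> bounded (f ` K1)" by (rule image_unbounded[OF K1(2)])
    show "f ` K1 \<subseteq> core N W" using core K1(3) by blast
  qed (use K2 \<open>\<not> bounded K2\<close> in auto)
  have Wt': "a + of_nat N * w \<in> W \<longleftrightarrow> a \<in> W" if "w \<in> gauss_ints" for a w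
    using Wt[of a w] Wt[of "a + of_nat N * w" "- w"] that by auto
  have "bounded C"
  proof (rule no_free_grid_curveD[OF nf N _ _ _ C(1,3)])
    show "bd W \<subseteq> gauss_ints \<times> {1, \<i>}" by (auto simp: bd_def)
    show "(a + of_nat N * w, d) \<in> bd W" if "(a, d) \<in> bd W" "w \<in> gauss_ints" for a d w
      using that Wt'[of w a] Wt'[of w "a - 1"] Wt'[of w "a - \<i>"] by (auto simp: bd_def algebra_simps)
    show "f ` carrier N (bd W) \<inter> carrier N (bd W) = {}"
      using bd_cells[OF N0 W] core by blast
  qed
  then show False using C by simp
qed

text \<open>A half plane \<open>W\<close> that is mapped into itself by \<open>f\<close> and by \<open>f\<inverse> + t\<close> has a boundary that is
  disjoint from its image under every lift.\<close>

lemma half_plane_free_curve: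
  assumes nf: "no_free_grid_curve f" and v: "v \<in> gauss_ints" "t \<in> gauss_ints" "inner v t = 1"
    and Wu: "\<And>z. z \<in> W \<Longrightarrow> z + \<i> * v \<in> W" "\<And>z. z \<in> W \<Longrightarrow> z - \<i> * v \<in> W" and Wt: "\<And>z. z \<in> W \<Longrightarrow> z + t \<in> W"
    and half: "\<And>z. c \<le> inner v z \<Longrightarrow> z \<in> W" "\<And>z. z \<in> W \<Longrightarrow> - c \<le> inner v z"
    and \<delta>: "0 < \<delta>" "\<And>x y. y \<in> W \<Longrightarrow> dist x y \<le> \<delta> \<Longrightarrow> f x \<in> W" "\<And>x y. y \<in> W \<Longrightarrow> dist x y \<le> \<delta> \<Longrightarrow> g x + t \<in> W"
  shows False
proof -
  have "v \<noteq> 0" using v(3) by auto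
  obtain N0 :: nat where N0: "2 / \<delta> < real N0" using reals_Archimedean2 by blast
  define N where "N = max 3 N0"
  have N: "3 \<le> N" "0 < N" "2 / real N \<le> \<delta>"
  proof -
    have "2 / \<delta> < real N" using N0 by (simp add: N_def)
    then show "2 / real N \<le> \<delta>" using \<delta>(1) by (simp add: N_def field_simps)
  qed (auto simp: N_def)
  \<comment> \<open>Cells meeting \<open>W\<close>: then \<open>W\<close> lies in the core, and by
    \<open>2 / N \<le> \<delta>\<close> the region stays so close to \<open>W\<close> that the
    hypotheses on \<open>\<delta>\<close> apply to it.\<close>
  define A where "A = {a \<in> gauss_ints. cell N a \<inter> W \<noteq> {}}"
  have A: "A \<subseteq> gauss_ints" by (auto simp: A_def)
  have near: "\<exists>y\<in>W. dist z y \<le> \<delta>" if "z \<in> region N A" for z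
    using that N dist_cell[OF N(2)] by (fastforce simp: region_def A_def)
  have Wcore: "W \<subseteq> core N A" by (auto simp: core_def A_def)
  have Wu': "z + of_int l * (\<i> * v) \<in> W" if "z \<in> W" for z l
  proof (induction l rule: int_induct[where k = 0])
    case (step1 i)
    then show ?case using Wu(1)[OF step1(2)] by (simp add: algebra_simps)
  next
    case (step2 i)
    then show ?case using Wu(2)[OF step2(2)] by (simp add: algebra_simps)
  qed (use that in simp)
  have Wt': "z + of_nat k * t \<in> W" if "z \<in> W" for z k
  proof (induction k)
    case (Suc k)
    then show ?case using Wt[OF Suc] by (simp add: algebra_simps)
  qed (use that in simp)
  have Au: "a + of_nat N * (of_int l * (\<i> * v)) \<in> A" if "a \<in> A" for a l
  proof -
    obtain z where z: "z \<in> cell N a" "z \<in> W" "a \<in> gauss_ints" using \<open>a \<in> A\<close> by (auto simp: A_def)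
    then have "z + of_int l * (\<i> * v) \<in> cell N (a + of_nat N * (of_int l * (\<i> * v)))" "z + of_int l * (\<i> * v) \<in> W"
      using cell_shift[OF N(2)] Wu' by auto
    then show ?thesis using z(3) v(1) by (auto simp: A_def)
  qed
  have Au': "a + of_nat N * (of_int l * (\<i> * v)) \<in> A \<longleftrightarrow> a \<in> A" for a l
    using Au[of a l] Au[of "a + of_nat N * (of_int l * (\<i> * v))" "- l"] by auto
  have bdu: "(a + of_nat N * (of_int l * (\<i> * v)), d) \<in> bd A" if "(a, d) \<in> bd A" for a d l
    using that Au'[of a l] Au'[of "a - 1" l] Au'[of "a - \<i>" l] v(1) by (auto simp: bd_def algebra_simps)
  \<comment> \<open>The boundary of the half plane is periodic only along \<open>\<i> * v\<close>.
    Together with its translates by multiples of \<open>t\<close> it is lattice periodic, since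
    \<open>inner v t = 1\<close> makes \<open>t\<close> and \<open>\<i> * v\<close> a basis of the
    lattice (\<open>decomp\<close>).\<close>
  define G where "G = {(a, d). \<exists>k::int. (a - of_nat N * (of_int k * t), d) \<in> bd A}"
  have decomp: "\<exists>k l. w = of_int k * t + of_int l * (\<i> * v)" if w: "w \<in> gauss_ints" for w
  proof -
    obtain k where k: "inner v w = of_int k" using inner_gauss_ints[OF v(1) w] by (auto elim: Ints_cases)
    have "Re t * Im w - Im t * Re w \<in> \<int>" using v w by (auto simp: gauss_ints_def)
    then obtain l where l: "Re t * Im w - Im t * Re w = of_int l" by (auto elim: Ints_cases)
    have e: "Re v * Re t + Im v * Im t = 1" "Re v * Re w + Im v * Im w = of_int k"
      using v(3) k by (auto simp: inner_complex_def)
    have "Re w = of_int k * Re t - of_int l * Im v" "Im w = of_int k * Im t + of_int l * Re v"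
      using e l by algebra+
    then have "w = of_int k * t + of_int l * (\<i> * v)" by (simp add: complex_eq_iff)
    then show ?thesis by blast
  qed
  have Gt: "(a + of_nat N * w, d) \<in> G" if ad: "(a, d) \<in> G" and w: "w \<in> gauss_ints" for a d w
  proof -
    obtain k where k: "(a - of_nat N * (of_int k * t), d) \<in> bd A" using ad by (auto simp: G_def)
    obtain k' l where "w = of_int k' * t + of_int l * (\<i> * v)" using decomp[OF w] by blast
    then have "a + of_nat N * w - of_nat N * (of_int (k + k') * t) = a - of_nat N * (of_int k * t) + of_nat N * (of_int l * (\<i> * v))"
      by (simp add: algebra_simps)
    then show ?thesis using bdu[OF k, of l] unfolding G_def by (metis (mono_tags, lifting) case_prodI mem_Collect_eq)
  qed
  have carG: "\<exists>k::int. z - of_int k * t \<in> carrier N (bd A)" if "z \<in> carrier N G" for z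
  proof -
    obtain a d k where "(a - of_nat N * (of_int k * t), d) \<in> bd A" "z \<in> edge N (a, d)"
      using \<open>z \<in> carrier N G\<close> by (auto simp: carrier_def G_def)
    then show ?thesis using edge_shift[OF N(2), of "z - of_int k * t" "of_int k * t" "a - of_nat N * (of_int k * t)" d]
      by (auto simp: carrier_def intro!: exI[of _ k])
  qed
  have perk: "f (z + of_int k * t) = f z + of_int k * t" "g (z + of_int k * t) = g z + of_int k * t" for z k
    using per gper v(2) by auto
  \<comment> \<open>For \<open>k \<le> 0\<close> the point is moved inwards by \<open>f\<close> and
    by translations. For \<open>k \<ge> 1\<close> the roles of source and image are exchanged:
    \<open>g\<close> together with one \<open>t\<close> leads into \<open>W\<close>, and
    \<open>k - 1\<close> translations remain.\<close>
  have free: False if z: "z \<in> carrier N (bd A)" "f z - of_int k * t \<in> carrier N (bd A)" for z k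
  proof (cases "k \<le> 0")
    case True
    obtain y where "y \<in> W" "dist z y \<le> \<delta>" using near bd_cells(1)[OF N(2) A z(1)] by blast
    then have "f z \<in> W" by (rule \<delta>(2))
    from Wt'[OF this, of "nat (- k)"] have "f z - of_int k * t \<in> W" using True by simp
    then show False using Wcore bd_cells(2)[OF N(2) A z(2)] by blast
  next
    case False
    obtain y where "y \<in> W" "dist (f z - of_int k * t) y \<le> \<delta>" using near bd_cells(1)[OF N(2) A z(2)] by blast
    then have "g (f z - of_int k * t) + t \<in> W" by (rule \<delta>(3))
    then have "z - of_int k * t + t \<in> W" using perk(2)[of "f z" "- k"] by simp
    from Wt'[OF this, of "nat (k - 1)"] have "z \<in> W" using False by (simp add: algebra_simps)
    then show False using Wcore bd_cells(2)[OF N(2) A z(1)] by blast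
  qed
  obtain C where C: "connected C" "\<not> bounded C" "C \<subseteq> carrier N (bd A)"
  proof (rule region_boundary_unbounded[OF N(2) A])
    show "connected {z. c < inner v z}" using convex_halfspace_gt[of c v] convex_connected by auto
    show "\<not> bounded {z. c < inner v z}" by (rule not_bounded_halfspace[OF \<open>v \<noteq> 0\<close>])
    show "{z. c < inner v z} \<subseteq> core N A" using half(1) Wcore by force
    show "connected {z. c + norm v * \<delta> < inner (- v) z}" using convex_halfspace_gt[of "c + norm v * \<delta>" "- v"] convex_connected by auto
    show "\<not> bounded {z. c + norm v * \<delta> < inner (- v) z}" by (rule not_bounded_halfspace) (use \<open>v \<noteq> 0\<close> in simp)
    show "{z. c + norm v * \<delta> < inner (- v) z} \<inter> region N A = {}"
    proof (rule ccontr)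
      assume "\<not> ?thesis"
      then obtain z where z: "c + norm v * \<delta> < inner (- v) z" "z \<in> region N A" by blast
      obtain y where y: "y \<in> W" "dist z y \<le> \<delta>" using near[OF z(2)] by blast
      have "inner v (y - z) \<le> norm v * \<delta>"
        using norm_cauchy_schwarz[of v "y - z"] mult_left_mono[OF y(2), of "norm v"] by (simp add: dist_norm norm_minus_commute)
      then show False using z(1) half(2)[OF y(1)] by (simp add: inner_diff_right)
    qed
  qed
  have "bounded C"
  proof (rule no_free_grid_curveD[OF nf N(1) _ Gt _ C(1)])
    show "G \<subseteq> gauss_ints \<times> {1, \<i>}"
    proof
      fix e assume "e \<in> G"
      then obtain a d k where e: "e = (a, d)" "(a - of_nat N * (of_int k * t), d) \<in> bd A" by (auto simp: G_def)
      then have "a - of_nat N * (of_int k * t) + of_nat N * (of_int k * t) \<in> gauss_ints" "d \<in> {1, \<i>}"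
        using v(2) by (intro gauss_ints_add, auto simp: bd_def)
      then show "e \<in> gauss_ints \<times> {1, \<i>}" using e by simp
    qed
    have "bd A \<subseteq> G" unfolding G_def by (auto intro!: exI[of _ 0])
    then have "carrier N (bd A) \<subseteq> carrier N G" unfolding carrier_def by blast
    then show "C \<subseteq> carrier N G" using C(3) by blast
    show "f ` carrier N G \<inter> carrier N G = {}"
    proof (rule ccontr)
      assume "\<not> ?thesis"
      then obtain z where z: "z \<in> carrier N G" "f z \<in> carrier N G" by blast
      obtain k1 k2 where k: "z - of_int k1 * t \<in> carrier N (bd A)" "f z - of_int k2 * t \<in> carrier N (bd A)"
        using carG[OF z(1)] carG[OF z(2)] by blast
      have "f (z - of_int k1 * t) - of_int (k2 - k1) * t = f z - of_int k2 * t"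
        using perk(1)[of z "- k1"] by (simp add: algebra_simps)
      then show False using free[OF k(1), of "k2 - k1"] k(2) by simp
    qed
  qed
  then show False using C by simp
qed


section \<open>Half planes from orbit averages and from reachable cells\<close>

lemma iterates_equicontinuous:
  assumes "0 < e" obtains d where "0 < d" "\<And>k x y. k \<le> n \<Longrightarrow> dist x y < d \<Longrightarrow> dist ((f ^^ k) x) ((f ^^ k) y) < e"
proof -
  have "\<exists>d>0. \<forall>k\<le>n. \<forall>x y. dist x y < d \<longrightarrow> dist ((f ^^ k) x) ((f ^^ k) y) < e"
  proof (induction n)
    case 0
    then show ?case using assms by (intro exI[of _ e]) auto
  next
    case (Suc n)
    then obtain d where d: "0 < d" "\<And>k x y. k \<le> n \<Longrightarrow> dist x y < d \<Longrightarrow> dist ((f ^^ k) x) ((f ^^ k) y) < e" by blast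
    interpret i: plane_lift "f ^^ Suc n" "g ^^ Suc n" by (rule iterate_lift)
    obtain d' where d': "0 < d'" "\<And>x y. dist x y < d' \<Longrightarrow> dist ((f ^^ Suc n) x) ((f ^^ Suc n) y) < e"
      using i.f_uniformly_continuous[OF assms] by blast
    have "dist ((f ^^ k) x) ((f ^^ k) y) < e" if "k \<le> Suc n" "dist x y < min d d'" for k x y
    proof (cases "k \<le> n")
      case True
      then show ?thesis using d(2)[of k x y] that by simp
    next
      case False
      then have "k = Suc n" using that by simp
      then show ?thesis using d'(2)[of x y] that by (simp del: funpow.simps)
    qed
    then show ?case using d(1) d'(1) by (intro exI[of _ "min d d'"]) auto
  qed
  then show ?thesis using that by blast
qed

lemma funpow_per: "w \<in> gauss_ints \<Longrightarrow> (f ^^ n) (z + w) = (f ^^ n) z + w"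
  using plane_lift.per[OF iterate_lift] .

text \<open>The averages \<open>\<phi>\<close> of a coordinate along orbits increase by less than 1 under \<open>f\<close>, so that \<open>\<phi> \<ge> 0\<close> is a half plane as
  required by the preceding lemma.\<close>

lemma rot_strip_free_curve:
  assumes nf: "no_free_grid_curve f" and v: "v \<in> gauss_ints" "t \<in> gauss_ints" "inner v t = 1"
    and strip: "\<And>p. p \<in> rot f \<Longrightarrow> 0 < inner v p \<and> inner v p < 1"
  shows False
proof -
  have cts: "continuous_on (rot f) (inner v)" by (intro continuous_intros)
  obtain p where p: "p \<in> rot f" "\<And>q. q \<in> rot f \<Longrightarrow> inner v p \<le> inner v q"
    using continuous_attains_inf[OF compact_rot rot_nonempty cts] by blast
  obtain q where q: "q \<in> rot f" "\<And>p. p \<in> rot f \<Longrightarrow> inner v p \<le> inner v q"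
    using continuous_attains_sup[OF compact_rot rot_nonempty cts] by blast
  \<comment> \<open>A third of the distance to 0 and 1: long orbits keep a margin of
    \<open>2 * \<eta>\<close> on both sides, of which one \<open>\<eta>\<close> is spent on the
    variation of \<open>\<phi>\<close> over short distances.\<close>
  define \<eta> where "\<eta> = min (inner v p) (1 - inner v q) / 3"
  have \<eta>: "0 < \<eta>" "3 * \<eta> \<le> inner v p" "3 * \<eta> \<le> 1 - inner v q"
    using strip[OF p(1)] strip[OF q(1)] by (auto simp: \<eta>_def)
  have "2 * \<eta> < inner v r" "2 * \<eta> - 1 < inner (- v) r" if "r \<in> rot f" for r
    using p(2)[OF that] q(2)[OF that] \<eta> by auto
  then obtain n1 n2 where n1: "\<And>n x. n1 \<le> n \<Longrightarrow> 2 * \<eta> * real n \<le> inner v ((f ^^ n) x - x)"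
    and n2: "\<And>n x. n2 \<le> n \<Longrightarrow> (2 * \<eta> - 1) * real n \<le> inner (- v) ((f ^^ n) x - x)"
    using rot_drift[of "2 * \<eta>" v] rot_drift[of "2 * \<eta> - 1" "- v"] by metis
  define n where "n = max 1 (max n1 n2)"
  have n: "0 < n" "n1 \<le> n" "n2 \<le> n" by (auto simp: n_def)
  define \<phi> where "\<phi> = (\<lambda>x. (\<Sum>k<n. inner v ((f ^^ k) x)) / real n)"
  have \<phi>f: "\<phi> (f x) - \<phi> x = inner v ((f ^^ n) x - x) / real n" for x
  proof -
    have "(\<Sum>k<n. inner v ((f ^^ k) (f x))) - (\<Sum>k<n. inner v ((f ^^ k) x)) = (\<Sum>k<n. inner v ((f ^^ Suc k) x) - inner v ((f ^^ k) x))"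
      by (simp add: sum_subtractf funpow_swap1)
    also have "\<dots> = inner v ((f ^^ n) x - x)"
      using sum_lessThan_telescope[of "\<lambda>k. inner v ((f ^^ k) x)" n] by (simp add: inner_diff_right)
    finally show ?thesis by (simp add: \<phi>_def diff_divide_distrib[symmetric])
  qed
  have inc: "2 * \<eta> \<le> \<phi> (f x) - \<phi> x" "\<phi> (f x) - \<phi> x \<le> 1 - 2 * \<eta>" for x
  proof -
    have "2 * \<eta> * real n \<le> inner v ((f ^^ n) x - x)" "inner v ((f ^^ n) x - x) \<le> (1 - 2 * \<eta>) * real n"
      using n1[OF n(2), of x] n2[OF n(3), of x] by (simp_all add: algebra_simps)
    then show "2 * \<eta> \<le> \<phi> (f x) - \<phi> x" "\<phi> (f x) - \<phi> x \<le> 1 - 2 * \<eta>"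
      using n(1) unfolding \<phi>f by (simp_all add: pos_le_divide_eq pos_divide_le_eq)
  qed
  have \<phi>shift: "\<phi> (z + w) = \<phi> z + inner v w" if "w \<in> gauss_ints" for z w
    using n(1) by (simp add: \<phi>_def funpow_per[OF that] inner_add_right sum.distrib add_divide_distrib)
  obtain d where d: "0 < d" "\<And>k x y. k \<le> n \<Longrightarrow> dist x y < d \<Longrightarrow> dist ((f ^^ k) x) ((f ^^ k) y) < \<eta> / (norm v + 1)"
    using iterates_equicontinuous[of "\<eta> / (norm v + 1)" n] \<eta>(1) by (metis add_nonneg_pos divide_pos_pos norm_ge_zero zero_less_one)
  have \<phi>c: "\<bar>\<phi> x - \<phi> y\<bar> \<le> \<eta>" if "dist x y < d" for x y
  proof -
    have le: "\<bar>inner v ((f ^^ k) x) - inner v ((f ^^ k) y)\<bar> \<le> \<eta>" if "k < n" for k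
    proof -
      have "\<bar>inner v ((f ^^ k) x - (f ^^ k) y)\<bar> \<le> norm v * norm ((f ^^ k) x - (f ^^ k) y)" by (rule Cauchy_Schwarz_ineq2)
      also have "\<dots> \<le> norm v * (\<eta> / (norm v + 1))"
        using d(2)[of k x y] \<open>k < n\<close> \<open>dist x y < d\<close> by (intro mult_left_mono) (auto simp: dist_norm)
      also have "\<dots> = \<eta> * (norm v / (norm v + 1))" by simp
      also have "\<dots> \<le> \<eta> * 1" using \<eta>(1) by (intro mult_left_mono) (auto simp: divide_simps add_nonneg_pos)
      finally show ?thesis by (simp add: inner_diff_right)
    qed
    have "\<bar>\<phi> x - \<phi> y\<bar> = \<bar>\<Sum>k<n. inner v ((f ^^ k) x) - inner v ((f ^^ k) y)\<bar> / real n"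
      by (simp add: \<phi>_def sum_subtractf diff_divide_distrib[symmetric])
    also have "\<dots> \<le> (\<Sum>k<n. \<bar>inner v ((f ^^ k) x) - inner v ((f ^^ k) y)\<bar>) / real n"
      by (intro divide_right_mono sum_abs) auto
    also have "\<dots> \<le> (\<Sum>k<n. \<eta>) / real n" using le by (intro divide_right_mono sum_mono) auto
    finally show ?thesis using n(1) by simp
  qed
  obtain M where M: "0 \<le> M" "\<And>z. norm (f z - z) \<le> M" using displacement_bounded by metis
  have \<phi>v: "\<bar>\<phi> x - inner v x\<bar> \<le> norm v * (real n * M)" for x
  proof -
    have le: "\<bar>inner v ((f ^^ k) x) - inner v x\<bar> \<le> norm v * (real n * M)" if "k < n" for k
    proof -
      have "\<bar>inner v ((f ^^ k) x - x)\<bar> \<le> norm v * norm ((f ^^ k) x - x)" by (rule Cauchy_Schwarz_ineq2)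
      also have "\<dots> \<le> norm v * (real k * M)" by (intro mult_left_mono iterate_displacement M) auto
      also have "\<dots> \<le> norm v * (real n * M)" using \<open>k < n\<close> M by (intro mult_left_mono mult_right_mono) auto
      finally show ?thesis by (simp add: inner_diff_right)
    qed
    have "\<bar>\<phi> x - inner v x\<bar> = \<bar>\<Sum>k<n. inner v ((f ^^ k) x) - inner v x\<bar> / real n"
      using n(1) by (simp add: \<phi>_def sum_subtractf field_simps)
    also have "\<dots> \<le> (\<Sum>k<n. \<bar>inner v ((f ^^ k) x) - inner v x\<bar>) / real n"
      by (intro divide_right_mono sum_abs) auto
    also have "\<dots> \<le> (\<Sum>k<n. norm v * (real n * M)) / real n" using le by (intro divide_right_mono sum_mono) auto
    finally show ?thesis using n(1) by simp
  qed
  have u: "\<i> * v \<in> gauss_ints" "- (\<i> * v) \<in> gauss_ints" "inner v (\<i> * v) = 0" using v(1) by (auto simp: inner_complex_def)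
  show False
  proof (rule half_plane_free_curve[OF nf v, of "{x. 0 \<le> \<phi> x}" "norm v * (real n * M)" "d / 2"])
    fix x y assume xy: "y \<in> {x. 0 \<le> \<phi> x}" "dist x y \<le> d / 2"
    then have \<phi>x: "- \<eta> \<le> \<phi> x" using \<phi>c[of x y] d(1) by auto
    show "f x \<in> {x. 0 \<le> \<phi> x}" using inc(1)[of x] \<phi>x \<eta>(1) by simp
    show "g x + t \<in> {x. 0 \<le> \<phi> x}" using inc(2)[of "g x"] \<phi>x \<eta>(1) \<phi>shift[OF v(2)] v(3) by simp
  next
    fix z assume z: "norm v * (real n * M) \<le> inner v z"
    show "z \<in> {x. 0 \<le> \<phi> x}" using \<phi>v[of z] z by simp
  next
    fix z assume z: "z \<in> {x. 0 \<le> \<phi> x}"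
    show "- (norm v * (real n * M)) \<le> inner v z" using \<phi>v[of z] z by simp
    show "z + \<i> * v \<in> {x. 0 \<le> \<phi> x}" using z \<phi>shift[OF u(1), of z] u(3) by simp
    show "z - \<i> * v \<in> {x. 0 \<le> \<phi> x}" using z \<phi>shift[OF u(2), of z] u(3) by simp
    show "z + t \<in> {x. 0 \<le> \<phi> x}" using z \<phi>shift[OF v(2), of z] v(3) by simp
  qed (use d(1) in simp)
qed

text \<open>The values on the convex hull form an interval. Without an integer in it, a change of
  the lift by a multiple of \<open>t\<close> puts all values strictly between 0 and 1. Such a
  \<open>t\<close> exists exactly when \<open>v\<close> is primitive.\<close>

lemma rot_integer_value:
  assumes nf: "no_free_grid_curve f" and v: "v \<in> gauss_ints" "t \<in> gauss_ints" "inner v t = 1"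
  shows "\<exists>p\<in>convex hull rot f. inner v p \<in> \<int>"
proof (rule ccontr)
  assume neg: "\<not> ?thesis"
  obtain p0 where p0: "p0 \<in> rot f" using rot_nonempty by blast
  define k where "k = \<lfloor>inner v p0\<rfloor>"
  have conn: "connected (inner v ` (convex hull rot f))"
    by (intro connected_continuous_image continuous_intros convex_connected) simp
  have in_hull: "p \<in> convex hull rot f" if "p \<in> rot f" for p using that by (rule hull_inc)
  have between: "of_int k < inner v p \<and> inner v p < of_int k + 1" if p: "p \<in> rot f" for p
  proof (rule ccontr)
    assume n: "\<not> ?thesis"
    have v0: "of_int k < inner v p0" "inner v p0 < of_int k + 1"
    proof -
      have "of_int k \<le> inner v p0" "inner v p0 < of_int k + 1" by (auto simp: k_def)
      moreover have "of_int k \<noteq> inner v p0" using neg in_hull[OF p0] by (metis Ints_of_int)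
      ultimately show "of_int k < inner v p0" "inner v p0 < of_int k + 1" by auto
    qed
    obtain j :: int where j: "min (inner v p) (inner v p0) \<le> of_int j" "of_int j \<le> max (inner v p) (inner v p0)"
    proof (cases "of_int k < inner v p")
      case True
      then show ?thesis using n v0 by (intro that[of "k + 1"]) auto
    next
      case False
      then show ?thesis using v0 by (intro that[of k]) auto
    qed
    have "of_int j \<in> inner v ` (convex hull rot f)"
    proof (cases "inner v p \<le> inner v p0")
      case True
      then show ?thesis using connectedD_interval[OF conn, of "inner v p" "inner v p0" "of_int j"] in_hull p p0 j by auto
    next
      case False
      then show ?thesis using connectedD_interval[OF conn, of "inner v p0" "inner v p" "of_int j"] in_hull p p0 j by auto
    qed
    then show False using neg by (metis Ints_of_int imageE)
  qed
  have w: "- (of_int k * t) \<in> gauss_ints" using v(2) by simp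
  interpret h: plane_lift "\<lambda>z. f z + - (of_int k * t)" "\<lambda>z. g (z - - (of_int k * t))" by (rule translate_lift[OF w])
  have rot_sub: "rot (\<lambda>z. f z + - (of_int k * t)) \<subseteq> (\<lambda>p. p - of_int k * t) ` rot f"
  proof
    fix p assume "p \<in> rot (\<lambda>z. f z + - (of_int k * t))"
    then have "p + of_int k * t \<in> rot (\<lambda>z. f z + - (of_int k * t) + of_int k * t)"
      using v(2) by (intro h.rot_translate) auto
    then show "p \<in> (\<lambda>p. p - of_int k * t) ` rot f" by (intro image_eqI[of _ _ "p + of_int k * t"]) auto
  qed
  have kt: "inner v (of_int k * t) = of_int k"
  proof -
    have "inner v (of_int k * t) = of_int k * inner v t" by (simp add: inner_complex_def algebra_simps)
    then show ?thesis using v(3) by simp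
  qed
  show False
  proof (rule h.rot_strip_free_curve[OF no_free_grid_curve_translate[OF nf w] v])
    fix p assume "p \<in> rot (\<lambda>z. f z + - (of_int k * t))"
    then obtain q where "q \<in> rot f" "p = q - of_int k * t" using rot_sub by blast
    then show "0 < inner v p \<and> inner v p < 1" using between[of q] kt by (simp add: inner_diff_right)
  qed
qed

text \<open>Unrelated cells have a positive distance between image and target, and up to translation
  only finitely many pairs can come close. As a consequence attracting sets of cells also absorb a
  neighbourhood of their region.\<close>

lemma cell_rel_uniform:
  assumes N: "0 < N"
  obtains \<delta> where "0 < \<delta>" "\<And>a b x z. \<lbrakk>a \<in> gauss_ints; b \<in> gauss_ints; z \<in> cell N a; dist x z \<le> \<delta>; f x \<in> cell N b\<rbrakk> \<Longrightarrow> (a, b) \<in> cell_rel N f"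
proof -
  obtain M where M: "0 \<le> M" "\<And>z. norm (f z - z) \<le> M" using displacement_bounded by metis
  define A where "A = {a \<in> gauss_ints. norm a \<le> 2 * real N}"
  \<comment> \<open>\<open>M + 7\<close> is \<open>2 + M + 1 + 2 + 2\<close>: the corner of
    \<open>b\<close>, the displacement of \<open>x\<close>, the step from \<open>x\<close> to
    \<open>z\<close>, the corner of \<open>a\<close>, and the reduction of \<open>a\<close> by a
    translation.\<close>
  define B where "B = {b \<in> gauss_ints. norm b \<le> real N * (M + 7)}"
  have "\<exists>e>0. (a, b) \<notin> cell_rel N f \<longrightarrow> (\<forall>p\<in>f ` cell N a. \<forall>q\<in>cell N b. e \<le> dist p q)" if "a \<in> A" "b \<in> B" for a b
  proof (cases "(a, b) \<in> cell_rel N f")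
    case False
    then have "f ` cell N a \<inter> cell N b = {}" using that by (auto simp: cell_rel_def A_def B_def)
    moreover have "compact (f ` cell N a)" by (intro compact_continuous_image compact_cell continuous_on_subset[OF cf]) auto
    ultimately show ?thesis
      using separate_compact_closed[of "f ` cell N a" "cell N b"] compact_cell compact_imp_closed by metis
  qed (auto intro: exI[of _ 1])
  then have "\<forall>s\<in>A \<times> B. \<exists>e>0. s \<notin> cell_rel N f \<longrightarrow> (\<forall>p\<in>f ` cell N (fst s). \<forall>q\<in>cell N (snd s). e \<le> dist p q)" by auto
  then obtain E where E: "\<And>s. s \<in> A \<times> B \<Longrightarrow> 0 < E s \<and> (s \<notin> cell_rel N f \<longrightarrow> (\<forall>p\<in>f ` cell N (fst s). \<forall>q\<in>cell N (snd s). E s \<le> dist p q))"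
    by metis
  have fin: "finite (A \<times> B)" unfolding A_def B_def by (intro finite_cartesian_product finite_gauss_bounded)
  define e where "e = Min (insert 1 (E ` (A \<times> B)))"
  have e: "0 < e" "\<And>s. s \<in> A \<times> B \<Longrightarrow> e \<le> E s" using fin E by (auto simp: e_def)
  obtain d where d: "0 < d" "\<And>x y. dist x y < d \<Longrightarrow> dist (f x) (f y) < e" using f_uniformly_continuous[OF e(1)] by blast
  show ?thesis
  proof (rule that[of "min (d / 2) 1"])
    fix a b x z assume h: "a \<in> gauss_ints" "b \<in> gauss_ints" "z \<in> cell N a" "dist x z \<le> min (d / 2) 1" "f x \<in> cell N b"
    define w where "w = cell_of 1 (a / of_nat N)"
    have w: "w \<in> gauss_ints" "- w \<in> gauss_ints" using cell_of(2)[of 1] by (auto simp: w_def)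
    have "norm (a / of_nat N - w / of_nat 1) \<le> 2" unfolding w_def by (intro cell_corner cell_of) auto
    then have aw: "norm (a / of_nat N - w) \<le> 2" by simp
    have Nn: "of_nat N * y = real N *\<^sub>R y" for y :: complex by (simp add: scaleR_conv_of_real)
    have "a + of_nat N * (- w) = real N *\<^sub>R (a / of_nat N - w)" using N by (simp add: Nn[symmetric] algebra_simps)
    then have "norm (a + of_nat N * (- w)) \<le> real N * 2" using aw by (simp only: norm_scaleR) (simp add: mult_left_mono)
    then have a': "a + of_nat N * (- w) \<in> A" using h(1) w(2) unfolding A_def
      by (intro CollectI conjI gauss_ints_add gauss_ints_mult gauss_ints_of_nat) (auto simp: mult.commute)
    have "b / of_nat N - w = (b / of_nat N - f x) + (f x - x) + (x - z) + (z - a / of_nat N) + (a / of_nat N - w)" by simp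
    also have "norm \<dots> \<le> 2 + M + 1 + 2 + 2"
      using cell_corner[OF N h(5)] cell_corner[OF N h(3)] M(2)[of x] h(4) aw
      by (intro order_trans[OF norm_triangle_ineq] add_mono) (auto simp: dist_norm norm_minus_commute)
    finally have "norm (b / of_nat N - w) \<le> M + 7" by simp
    moreover have "b + of_nat N * (- w) = real N *\<^sub>R (b / of_nat N - w)" using N by (simp add: Nn[symmetric] algebra_simps)
    ultimately have "norm (b + of_nat N * (- w)) \<le> real N * (M + 7)" by (simp only: norm_scaleR) (simp add: mult_left_mono)
    then have b': "b + of_nat N * (- w) \<in> B" using h(2) w(2) unfolding B_def
      by (intro CollectI conjI gauss_ints_add gauss_ints_mult gauss_ints_of_nat)
    have z': "z + - w \<in> cell N (a + of_nat N * (- w))" "f x + - w \<in> cell N (b + of_nat N * (- w))"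
      using cell_shift[OF N, of z "- w" a] cell_shift[OF N, of "f x" "- w" b] h(3,5) by (simp_all only:)
    have "dist (f x) (f z) < e" using h(4) d by (intro d(2)) auto
    then have "dist (f (z + - w)) (f x + - w) < e" using per[OF w(2)] by (simp add: dist_norm norm_minus_commute)
    then have "(a + of_nat N * (- w), b + of_nat N * (- w)) \<in> cell_rel N f"
      using E[of "(a + of_nat N * (- w), b + of_nat N * (- w))"] e(2)[of "(a + of_nat N * (- w), b + of_nat N * (- w))"] a' b' z'
      by fastforce
    from tinvD(3)[OF cell_rel_tinv[OF N] this w(1)] show "(a, b) \<in> cell_rel N f" by simp
  qed (use d in simp)
qed

text \<open>If no closed walk decreases \<open>v\<close>, the cells reachable from a half plane form an attracting half plane \<open>W\<^sub>0\<close>. The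
  images of slightly larger neighbourhoods of \<open>W\<^sub>0\<close> under the iterates of \<open>f\<inverse> + t\<close>, which commutes with \<open>f\<close> and moves
  to the right on average, have a union that is attracting for both maps.\<close>

lemma closed_walks_nonneg_free_curve:
  assumes nf: "no_free_grid_curve f" and v: "v \<in> gauss_ints" "t \<in> gauss_ints" "inner v t = 1"
    and rot0: "\<And>p. p \<in> rot f \<Longrightarrow> inner v p = 0" and N: "0 < N"
    and loops: "\<And>L a w. \<lbrakk>1 \<le> L; w \<in> gauss_ints; (a, a + of_nat N * w) \<in> cell_rel N f ^^ L\<rbrakk> \<Longrightarrow> 0 \<le> inner v w"
  shows False
proof -
  have ti: "tinv N (cell_rel N f)" by (rule cell_rel_tinv[OF N])
  obtain D where D: "\<And>a b. (a, b) \<in> cell_rel N f \<Longrightarrow> norm (b - a) \<le> D" using cell_rel_bounded[OF N] by blast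
  obtain K where K: "\<And>L a b. (a, b) \<in> cell_rel N f ^^ L \<Longrightarrow> - K \<le> inner v (b - a) / N + 0 * real L"
    using walk_cost_bounded_below[OF ti N D, of v 0] loops by auto
  obtain M where M: "0 \<le> M" "\<And>z. norm (f z - z) \<le> M" using displacement_bounded by metis
  define S where "S = {a \<in> gauss_ints. \<exists>z\<in>cell N a. 0 \<le> inner v z}"
  define R where "R = {b. \<exists>a\<in>S. \<exists>L. (a, b) \<in> cell_rel N f ^^ L}"
  have SR: "S \<subseteq> R" unfolding R_def by (auto intro!: exI[of _ 0])
  have Rg: "R \<subseteq> gauss_ints" using tinv_relpow_gauss[OF ti] by (auto simp: R_def S_def)
  have Rstep: "b \<in> R" if "a \<in> R" "(a, b) \<in> cell_rel N f" for a b
  proof -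
    obtain s L where "s \<in> S" "(s, a) \<in> cell_rel N f ^^ L" using \<open>a \<in> R\<close> by (auto simp: R_def)
    then have "(s, b) \<in> cell_rel N f ^^ Suc L" using that(2) by auto
    then show ?thesis using \<open>s \<in> S\<close> unfolding R_def by blast
  qed
  have Rw: "a + of_nat N * w \<in> R" if a: "a \<in> R" and w: "w \<in> gauss_ints" "0 \<le> inner v w" for a w
  proof -
    obtain s L where s: "s \<in> S" "(s, a) \<in> cell_rel N f ^^ L" using a by (auto simp: R_def)
    obtain z where z: "z \<in> cell N s" "0 \<le> inner v z" "s \<in> gauss_ints" using s(1) by (auto simp: S_def)
    have "z + w \<in> cell N (s + of_nat N * w)" using cell_shift[OF N] z by simp
    then have "s + of_nat N * w \<in> S" using z w by (auto simp: S_def inner_add_right intro!: bexI[of _ "z + w"])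
    then show ?thesis using tinv_relpow[OF ti s(2) w(1)] by (auto simp: R_def)
  qed
  define W where "W = region N R"
  have Ww: "z + w \<in> W" if "z \<in> W" "w \<in> gauss_ints" "0 \<le> inner v w" for z w
  proof -
    obtain a where "a \<in> R" "z \<in> cell N a" using \<open>z \<in> W\<close> by (auto simp: W_def region_def)
    then have "a + of_nat N * w \<in> R" "z + w \<in> cell N (a + of_nat N * w)" using Rw[OF _ that(2,3)] cell_shift[OF N] by auto
    then show ?thesis unfolding W_def region_def by blast
  qed
  have Wright: "z \<in> W" if "0 \<le> inner v z" for z
  proof -
    have "cell_of N z \<in> S" using cell_of(1)[OF N, of z] cell_of(2)[of N z] that by (auto simp: S_def)
    then show ?thesis using SR cell_of(1)[OF N, of z] by (auto simp: W_def region_def)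
  qed
  define c0 where "c0 = K + norm v * 6"
  have Wleft: "- c0 \<le> inner v z" if zW: "z \<in> W" for z
  proof -
    obtain b where b: "b \<in> R" "z \<in> cell N b" using zW by (auto simp: W_def region_def)
    then obtain a L where a: "a \<in> S" "(a, b) \<in> cell_rel N f ^^ L" by (auto simp: R_def)
    then obtain y where y: "y \<in> cell N a" "0 \<le> inner v y" by (auto simp: S_def)
    have e: "b / of_nat N - a / of_nat N = (b - a) /\<^sub>R real N" by (simp add: scaleR_conv_of_real field_simps flip: diff_divide_distrib)
    have "inner v (b - a) / N = inner v (b / of_nat N - a / of_nat N)"
      unfolding e inner_scaleR_right by (simp add: divide_inverse mult.commute)
    then have "- K \<le> inner v (b / of_nat N - a / of_nat N)" using K[OF a(2)] by simp
    moreover have "norm ((b / of_nat N - a / of_nat N) - (z - y)) \<le> 4"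
      using cell_corner[OF N b(2)] cell_corner[OF N y(1)] norm_triangle_ineq4[of "y - a / of_nat N" "z - b / of_nat N"]
      by (simp add: algebra_simps)
    then have "norm v * norm ((b / of_nat N - a / of_nat N) - (z - y)) \<le> norm v * 4" by (rule mult_left_mono) simp
    then have "inner v ((b / of_nat N - a / of_nat N) - (z - y)) \<le> norm v * 4"
      using norm_cauchy_schwarz order_trans by blast
    ultimately show ?thesis using y(2) norm_ge_zero[of v] unfolding c0_def inner_diff_right by linarith
  qed
  obtain \<delta>0 where \<delta>0: "0 < \<delta>0" "\<And>a b x z. \<lbrakk>a \<in> gauss_ints; b \<in> gauss_ints; z \<in> cell N a; dist x z \<le> \<delta>0; f x \<in> cell N b\<rbrakk> \<Longrightarrow> (a, b) \<in> cell_rel N f"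
    using cell_rel_uniform[OF N] by blast
  define \<delta>1 where "\<delta>1 = min \<delta>0 1"
  have fW: "f x \<in> W" if y: "y \<in> W" "dist x y \<le> \<delta>1" for x y
  proof -
    obtain a where a: "a \<in> R" "y \<in> cell N a" using y(1) by (auto simp: W_def region_def)
    have "(a, cell_of N (f x)) \<in> cell_rel N f"
      by (rule \<delta>0(2)[OF _ cell_of(2) a(2) _ cell_of(1)[OF N]]) (use a Rg y in \<open>auto simp: \<delta>1_def\<close>)
    then show ?thesis using Rstep[OF a(1)] cell_of(1)[OF N, of "f x"] by (auto simp: W_def region_def)
  qed
  have "- (1/2) < inner (- v) p" if "p \<in> rot f" for p using rot0[OF that] by simp
  then obtain n0 where n0: "\<And>n x. n0 \<le> n \<Longrightarrow> - (1/2) * real n \<le> inner (- v) ((f ^^ n) x - x)" using rot_drift by metis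
  \<comment> \<open>After \<open>m\<close> steps \<open>f\<close> has gained at most
    \<open>m / 2\<close> in direction \<open>v\<close>, against the \<open>m\<close> from the
    translations by \<open>t\<close>. So a point that needs stage \<open>m\<close> is far to the
    right, and \<open>g x + t\<close> lies in the initial half plane.\<close>
  obtain m0 where m0: "2 * (c0 + norm v + norm v * M) \<le> real m0" using real_arch_simple by blast
  define m where "m = max n0 m0"
  define \<eta> where "\<eta> = \<delta>1 / real (Suc m)"
  have \<eta>: "0 < \<eta>" "real (Suc m) * \<eta> = \<delta>1" using \<delta>0(1) by (auto simp: \<eta>_def \<delta>1_def)
  obtain \<delta> where \<delta>: "0 < \<delta>" "\<And>k x y. k \<le> m \<Longrightarrow> dist x y < \<delta> \<Longrightarrow> dist ((f ^^ k) x) ((f ^^ k) y) < \<eta>"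
    using iterates_equicontinuous[OF \<eta>(1), of m] by blast
  \<comment> \<open>Stage \<open>n\<close> tolerates an error of \<open>real n * \<eta>\<close>, and
    a perturbation costs one further \<open>\<eta>\<close>. Applying \<open>f\<close> resets the
    error to 0, as \<open>W\<close> absorbs up to \<open>\<delta>1\<close>; applying
    \<open>g\<close> and \<open>t\<close> leads to the next stage, where the larger error is
    allowed.\<close>
  define C where "C = {x. \<exists>n\<le>m. \<exists>y\<in>W. dist ((f ^^ n) x - of_nat n * t) y \<le> real n * \<eta>}"
  have WC: "W \<subseteq> C" unfolding C_def by (auto intro!: exI[of _ 0])
  have le\<delta>1: "real n * \<eta> \<le> \<delta>1" if "n \<le> Suc m" for n
  proof -
    have "real n * \<eta> \<le> real (Suc m) * \<eta>" using \<eta>(1) that by (intro mult_right_mono) auto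
    then show ?thesis by (simp only: \<eta>(2))
  qed
  have Cw: "z + w \<in> C" if z: "z \<in> C" and w: "w \<in> gauss_ints" "0 \<le> inner v w" for z w
  proof -
    obtain n y where n: "n \<le> m" "y \<in> W" "dist ((f ^^ n) z - of_nat n * t) y \<le> real n * \<eta>" using z by (auto simp: C_def)
    have "dist ((f ^^ n) (z + w) - of_nat n * t) (y + w) \<le> real n * \<eta>"
      using n(3) funpow_per[OF w(1), of n z] by (simp add: dist_norm algebra_simps)
    then show ?thesis using n(1) Ww[OF n(2) w] unfolding C_def by blast
  qed
  have nt: "of_nat n * t \<in> gauss_ints" "inner v (of_nat n * t) = real n" for n
  proof -
    have "inner v (of_nat n * t) = of_nat n * inner v t" by (simp add: inner_complex_def algebra_simps)
    then show "inner v (of_nat n * t) = real n" using v(3) by simp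
  qed (use v(2) in simp)
  have near: "\<exists>n\<le>m. \<exists>y'\<in>W. dist ((f ^^ n) x - of_nat n * t) y' \<le> real (Suc n) * \<eta>" if y: "y \<in> C" "dist x y \<le> \<delta> / 2" for x y
  proof -
    obtain n y' where n: "n \<le> m" "y' \<in> W" "dist ((f ^^ n) y - of_nat n * t) y' \<le> real n * \<eta>" using y(1) by (auto simp: C_def)
    have "dist ((f ^^ n) x) ((f ^^ n) y) < \<eta>" using y(2) \<delta>(1) by (intro \<delta>(2) n) auto
    then have "dist ((f ^^ n) x - of_nat n * t) ((f ^^ n) y - of_nat n * t) < \<eta>" by (simp add: dist_norm)
    then have "dist ((f ^^ n) x - of_nat n * t) y' \<le> real (Suc n) * \<eta>"
      using n(3) dist_triangle[of "(f ^^ n) x - of_nat n * t" y' "(f ^^ n) y - of_nat n * t"] by (simp add: algebra_simps)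
    then show ?thesis using n by blast
  qed
  have dv: "\<bar>inner v (a - b)\<bar> \<le> norm v" if "dist a b \<le> 1" for a b
    using Cauchy_Schwarz_ineq2[of v "a - b"] mult_left_mono[OF that, of "norm v"] by (simp add: dist_norm)
  have u: "\<i> * v \<in> gauss_ints" "- (\<i> * v) \<in> gauss_ints" "inner v (\<i> * v) = 0" using v(1) by (auto simp: inner_complex_def)
  define c where "c = \<bar>c0\<bar> + norm v + real m * (norm v * M) + norm v"
  show False
  proof (rule half_plane_free_curve[OF nf v, of C c "\<delta> / 2"])
    fix x y assume xy: "y \<in> C" "dist x y \<le> \<delta> / 2"
    obtain n y' where n: "n \<le> m" "y' \<in> W" "dist ((f ^^ n) x - of_nat n * t) y' \<le> real (Suc n) * \<eta>" using near[OF xy] by blast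
    then have d1: "dist ((f ^^ n) x - of_nat n * t) y' \<le> \<delta>1" using le\<delta>1[of "Suc n"] by simp
    have "f ((f ^^ n) x - of_nat n * t) \<in> W" by (rule fW[OF n(2) d1])
    moreover have "f ((f ^^ n) x - of_nat n * t) = (f ^^ n) (f x) - of_nat n * t"
      using per[of "- (of_nat n * t)" "(f ^^ n) x"] nt(1) by (simp add: funpow_swap1)
    ultimately show "f x \<in> C" using n(1) \<eta>(1) unfolding C_def by (auto intro!: exI[of _ n] bexI[of _ "(f ^^ n) (f x) - of_nat n * t"])
    show "g x + t \<in> C"
    proof (cases "n < m")
      case True
      have "(f ^^ Suc n) (g x + t) = (f ^^ n) x + t"
        using per[OF v(2), of "g x"] funpow_per[OF v(2), of n x] by (simp only: funpow_Suc_right comp_apply fg)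
      then have "dist ((f ^^ Suc n) (g x + t) - of_nat (Suc n) * t) y' \<le> real (Suc n) * \<eta>"
        using n(3) by (simp add: algebra_simps)
      then show ?thesis using True n(2) unfolding C_def by (intro CollectI exI[of _ "Suc n"] conjI bexI[of _ y']) auto
    next
      case False
      then have nm: "n = m" using n(1) by simp
      have "dist ((f ^^ m) x - of_nat m * t) y' \<le> 1" using d1 nm by (simp add: \<delta>1_def)
      then have "\<bar>inner v ((f ^^ m) x - of_nat m * t - y')\<bar> \<le> norm v" by (rule dv)
      then have "inner v ((f ^^ m) x) \<ge> real m - c0 - norm v" using Wleft[OF n(2)] nt(2)[of m] by (simp add: inner_diff_right)
      moreover have "inner v ((f ^^ m) x - x) \<le> real m / 2" using n0[of m x] by (simp add: m_def)
      moreover have "2 * (c0 + norm v + norm v * M) \<le> real m" using m0 by (simp add: m_def)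
      ultimately have "norm v * M \<le> inner v x" by (simp add: inner_diff_right)
      moreover have "inner v (x - g x) \<le> norm v * M"
        using norm_cauchy_schwarz[of v "x - g x"] mult_left_mono[OF M(2)[of "g x"], of "norm v"] by simp
      ultimately have "0 \<le> inner v (g x + t)" using v(3) by (simp add: inner_diff_right inner_add_right)
      then show ?thesis using Wright WC by blast
    qed
  next
    fix z assume "c \<le> inner v z"
    moreover have "0 \<le> c" using M(1) by (simp add: c_def)
    ultimately show "z \<in> C" using Wright WC by force
  next
    fix z assume z: "z \<in> C"
    obtain n y where n: "n \<le> m" "y \<in> W" "dist ((f ^^ n) z - of_nat n * t) y \<le> real n * \<eta>" using z by (auto simp: C_def)
    then have "dist ((f ^^ n) z - of_nat n * t) y \<le> 1" using le\<delta>1[of n] by (simp add: \<delta>1_def)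
    then have "\<bar>inner v ((f ^^ n) z - of_nat n * t - y)\<bar> \<le> norm v" by (rule dv)
    moreover have "\<bar>inner v ((f ^^ n) z - z)\<bar> \<le> real m * (norm v * M)"
    proof -
      have "\<bar>inner v ((f ^^ n) z - z)\<bar> \<le> norm v * norm ((f ^^ n) z - z)" by (rule Cauchy_Schwarz_ineq2)
      also have "\<dots> \<le> norm v * (real n * M)" by (intro mult_left_mono iterate_displacement M) auto
      also have "\<dots> \<le> norm v * (real m * M)" using n(1) M(1) by (intro mult_left_mono mult_right_mono) auto
      finally show ?thesis by (simp add: algebra_simps)
    qed
    ultimately show "- c \<le> inner v z" using Wleft[OF n(2)] nt(2)[of n] unfolding c_def by (simp add: inner_diff_right)
    show "z + \<i> * v \<in> C" using Cw[OF z u(1)] u(3) by simp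
    show "z - \<i> * v \<in> C" using Cw[OF z u(2)] u(3) by simp
    show "z + t \<in> C" using Cw[OF z v(2)] v(3) by simp
  qed (use \<delta>(1) in simp)
qed

end

section \<open>Lattice points on a segment\<close>

text \<open>Euclid's algorithm carried out by single additions and subtractions, because
  \<open>Q\<close> is only known to survive steps that do not increase the value. By
  \<open>nz\<close> it never stops, and each round at least halves the larger value.\<close>

lemma subtractive_euclid:
  fixes c :: "'a::ab_group_add \<Rightarrow> real" and Q :: "'a::ab_group_add \<Rightarrow> 'a \<Rightarrow> bool"
  assumes Q0: "Q a0 b0" and sym: "\<And>a b. Q a b \<Longrightarrow> Q b a"
    and nz: "\<And>a b. Q a b \<Longrightarrow> c a \<noteq> 0"
    and step: "\<And>a b a'. \<lbrakk>Q a b; a' = a - b \<or> a' = a + b; \<bar>c a'\<bar> \<le> \<bar>c a\<bar>\<rbrakk> \<Longrightarrow> Q a' b"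
    and lin: "\<And>a b. c (a + b) = c a + c b" "\<And>a b. c (a - b) = c a - c b"
    and \<eta>: "0 < \<eta>"
  obtains a b where "Q a b" "\<bar>c a\<bar> < \<eta>" "\<bar>c b\<bar> < \<eta>"
proof -
  have reduce: "\<exists>a'. Q a' b \<and> \<bar>c a'\<bar> = \<bar>c a\<bar> - real k * \<bar>c b\<bar>" if "Q a b" "real k * \<bar>c b\<bar> \<le> \<bar>c a\<bar>" for a b k
    using that
  proof (induction k)
    case (Suc k)
    have "real k * \<bar>c b\<bar> \<le> \<bar>c a\<bar>" using Suc.prems(2) by (simp add: algebra_simps)
    then obtain a' where a': "Q a' b" "\<bar>c a'\<bar> = \<bar>c a\<bar> - real k * \<bar>c b\<bar>" using Suc by blast
    have le: "\<bar>c b\<bar> \<le> \<bar>c a'\<bar>" using Suc.prems(2) a'(2) by (simp add: algebra_simps)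
    have "\<exists>x. (x = a' - b \<or> x = a' + b) \<and> \<bar>c x\<bar> = \<bar>c a'\<bar> - \<bar>c b\<bar>"
    proof (cases "\<bar>c a' - c b\<bar> = \<bar>c a'\<bar> - \<bar>c b\<bar>")
      case True
      then show ?thesis by (intro exI[of _ "a' - b"]) (simp add: lin)
    next
      case False
      then have "\<bar>c a' + c b\<bar> = \<bar>c a'\<bar> - \<bar>c b\<bar>" using le by linarith
      then show ?thesis by (intro exI[of _ "a' + b"]) (simp add: lin)
    qed
    then obtain x where x: "x = a' - b \<or> x = a' + b" "\<bar>c x\<bar> = \<bar>c a'\<bar> - \<bar>c b\<bar>" by blast
    then have "Q x b" by (intro step[OF a'(1)]) auto
    then show ?case using x(2) a'(2) by (intro exI[of _ x]) (simp add: algebra_simps)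
  qed auto
  have half: "\<exists>a'. Q a' b \<and> \<bar>c a'\<bar> < \<bar>c b\<bar> \<and> 2 * \<bar>c a'\<bar> \<le> \<bar>c a\<bar>" if ab: "Q a b" "\<bar>c b\<bar> \<le> \<bar>c a\<bar>" for a b
  proof -
    have pos: "0 < \<bar>c b\<bar>" using nz[OF sym[OF ab(1)]] by simp
    define k where "k = nat \<lfloor>\<bar>c a\<bar> / \<bar>c b\<bar>\<rfloor>"
    have "1 \<le> \<bar>c a\<bar> / \<bar>c b\<bar>" using ab(2) pos by simp
    then have k: "real k \<le> \<bar>c a\<bar> / \<bar>c b\<bar>" "\<bar>c a\<bar> / \<bar>c b\<bar> < real k + 1"
      unfolding k_def by linarith+
    have "0 < real k" using k \<open>1 \<le> \<bar>c a\<bar> / \<bar>c b\<bar>\<close> by linarith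
    then have "1 \<le> real k" by simp
    then have kb: "real k * \<bar>c b\<bar> \<le> \<bar>c a\<bar>" "\<bar>c a\<bar> < (real k + 1) * \<bar>c b\<bar>" "1 * \<bar>c b\<bar> \<le> real k * \<bar>c b\<bar>"
      using pos k \<open>1 \<le> real k\<close> by (simp_all add: pos_le_divide_eq pos_divide_less_eq)
    obtain a' where a': "Q a' b" "\<bar>c a'\<bar> = \<bar>c a\<bar> - real k * \<bar>c b\<bar>" using reduce[OF ab(1) kb(1)] by blast
    have "\<bar>c a'\<bar> < \<bar>c b\<bar>" "2 * \<bar>c a'\<bar> \<le> \<bar>c a\<bar>" using a'(2) kb by (simp_all add: algebra_simps)
    then show ?thesis using a'(1) by blast
  qed
  define C where "C = max \<bar>c a0\<bar> \<bar>c b0\<bar>"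
  have "\<exists>a b. Q a b \<and> \<bar>c b\<bar> \<le> \<bar>c a\<bar> \<and> \<bar>c a\<bar> \<le> C / 2 ^ n" for n
  proof (induction n)
    case 0
    show ?case
    proof (cases "\<bar>c b0\<bar> \<le> \<bar>c a0\<bar>")
      case True
      then have "Q a0 b0 \<and> \<bar>c b0\<bar> \<le> \<bar>c a0\<bar> \<and> \<bar>c a0\<bar> \<le> C / 2 ^ 0" using Q0 by (simp add: C_def)
      then show ?thesis by blast
    next
      case False
      then have "Q b0 a0 \<and> \<bar>c a0\<bar> \<le> \<bar>c b0\<bar> \<and> \<bar>c b0\<bar> \<le> C / 2 ^ 0" using sym[OF Q0] by (simp add: C_def)
      then show ?thesis by blast
    qed
  next
    case (Suc n)
    then obtain a b where ab: "Q a b" "\<bar>c b\<bar> \<le> \<bar>c a\<bar>" "\<bar>c a\<bar> \<le> C / 2 ^ n" by blast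
    obtain a' where a': "Q a' b" "\<bar>c a'\<bar> < \<bar>c b\<bar>" "2 * \<bar>c a'\<bar> \<le> \<bar>c a\<bar>" using half[OF ab(1,2)] by blast
    obtain b' where b': "Q b' a'" "\<bar>c b'\<bar> < \<bar>c a'\<bar>" using half[OF sym[OF a'(1)]] a'(2) by fastforce
    have "\<bar>c a'\<bar> \<le> C / 2 ^ Suc n" using a'(3) ab(3) by simp
    then have "Q a' b' \<and> \<bar>c b'\<bar> \<le> \<bar>c a'\<bar> \<and> \<bar>c a'\<bar> \<le> C / 2 ^ Suc n" using sym[OF b'(1)] b'(2) by simp
    then show ?case by blast
  qed
  note it = this
  obtain n :: nat where n: "C / \<eta> < 2 ^ n" using real_arch_pow[of 2 "C / \<eta>"] by auto
  then have "C / 2 ^ n < \<eta>" using \<eta> by (simp add: field_simps)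
  then show ?thesis using it[of n] that by fastforce
qed

definition crossp :: "complex \<Rightarrow> complex \<Rightarrow> real" where
  "crossp a b = Re a * Im b - Im a * Re b"

lemma primitive_gauss:
  assumes w: "w \<in> gauss_ints" "w \<noteq> 0"
  obtains v t m where "v \<in> gauss_ints" "t \<in> gauss_ints" "inner v t = 1" "w = of_real m * v" "0 < m"
proof -
  obtain x y where xy: "Re w = of_int x" "Im w = of_int y" using w(1) by (auto simp: gauss_ints_def elim!: Ints_cases)
  define d where "d = gcd x y"
  have "d \<noteq> 0" using w(2) xy by (auto simp: d_def complex_eq_iff)
  then have d: "0 < d" by (simp add: d_def)
  obtain x' y' where xy': "x = d * x'" "y = d * y'" by (metis d_def dvd_def gcd_dvd1 gcd_dvd2)
  obtain r s where rs: "r * x + s * y = d" using bezout_int unfolding d_def by blast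
  have "d * (r * x' + s * y') = d * 1" using rs xy' by (simp add: algebra_simps)
  then have one: "r * x' + s * y' = 1" using d by (simp only: mult_cancel_left) auto
  define v t where "v = Complex (of_int x') (of_int y')" and "t = Complex (of_int r) (of_int s)"
  have "inner v t = of_int (r * x' + s * y')" by (simp add: v_def t_def inner_complex_def algebra_simps)
  moreover have "w = of_real (of_int d) * v" using xy xy' by (simp add: complex_eq_iff v_def)
  ultimately show ?thesis using one d by (intro that[of v t "of_int d"]) (auto simp: v_def t_def gauss_ints_def)
qed

lemma basis_primitive:
  assumes "a \<in> gauss_ints" "b \<in> gauss_ints" "\<bar>crossp a b\<bar> = 1"
  obtains t where "t \<in> gauss_ints" "inner a t = 1"
proof -
  have "of_int k * (\<i> * b) \<in> gauss_ints" for k :: int using assms by simp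
  moreover have "inner a (of_int k * (\<i> * b)) = - of_int k * crossp a b" for k :: int
    by (simp add: crossp_def inner_complex_def algebra_simps)
  ultimately show ?thesis using assms(3) that[of "of_int 1 * (\<i> * b)"] that[of "of_int (-1) * (\<i> * b)"]
    by (metis (no_types, lifting) abs_eq_iff' minus_minus mult.commute mult_1 mult_minus_left of_int_1 of_int_minus zero_le_one)
qed

text \<open>In the irrational case \<open>subtractive_euclid\<close> is run twice on bases of integer functionals: first until both are nearly
  constant on \<open>I\<close>; from then on the lattice point \<open>z\<close> at which the functionals take their integer values on \<open>I\<close>
  does not change any more, and it must lie on \<open>I\<close>.\<close>

lemma segment_lattice_point:
  fixes I :: "complex set"
  assumes ne: "I \<noteq> {}" and d: "d \<noteq> 0"
    and line: "\<And>p q. p \<in> I \<Longrightarrow> q \<in> I \<Longrightarrow> \<exists>s. \<bar>s\<bar> \<le> 1 \<and> q = p + of_real s * d"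
    and int: "\<And>v t. \<lbrakk>v \<in> gauss_ints; t \<in> gauss_ints; inner v t = 1\<rbrakk> \<Longrightarrow> \<exists>p\<in>I. inner v p \<in> \<int>"
  obtains z where "z \<in> I" "z \<in> gauss_ints"
proof (cases "\<exists>w\<in>gauss_ints. w \<noteq> 0 \<and> inner w d = 0")
  \<comment> \<open>Rational direction: \<open>v\<close> is constant on \<open>I\<close>, hence an
    integer there, and \<open>\<i> * t\<close>, which completes \<open>v\<close> to a basis, is an
    integer at some point of \<open>I\<close>. At this point both coordinates are integers.\<close>
  case True
  then obtain w where w: "w \<in> gauss_ints" "w \<noteq> 0" "inner w d = 0" by blast
  obtain v t m where v: "v \<in> gauss_ints" "t \<in> gauss_ints" "inner v t = 1" "w = of_real m * v" "0 < m"
    using primitive_gauss[OF w(1,2)] .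
  have vd: "inner v d = 0"
  proof -
    have "m * inner v d = 0" using w(3) v(4) by (simp add: inner_complex_def algebra_simps)
    then show ?thesis using v(5) by simp
  qed
  obtain p1 where p1: "p1 \<in> I" "inner v p1 \<in> \<int>" using int[OF v(1-3)] by blast
  have "inner (\<i> * t) (\<i> * v) = 1" using v(3) by (simp add: inner_complex_def algebra_simps)
  then obtain p where p: "p \<in> I" "inner (\<i> * t) p \<in> \<int>" using int[of "\<i> * t" "\<i> * v"] v by auto
  obtain s where "p = p1 + of_real s * d" using line[OF p1(1) p(1)] by blast
  moreover have "inner v (of_real s * d) = s * inner v d" by (simp add: inner_complex_def algebra_simps)
  ultimately have "inner v p = inner v p1" using vd by (simp add: inner_add_right)
  have vt: "Re v * Re t + Im v * Im t = 1" using v(3) by (simp add: inner_complex_def)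
  have "of_real (inner v p) * t + of_real (inner (\<i> * t) p) * (\<i> * v) = of_real (Re v * Re t + Im v * Im t) * p"
    by (simp add: complex_eq_iff inner_complex_def algebra_simps)
  then have "p = of_real (inner v p) * t + of_real (inner (\<i> * t) p) * (\<i> * v)" using vt by simp
  moreover have "of_real (inner v p) \<in> gauss_ints" "of_real (inner (\<i> * t) p) \<in> gauss_ints"
    using p p1 \<open>inner v p = inner v p1\<close> by (auto simp: gauss_ints_def)
  ultimately have "p \<in> gauss_ints" using v by (metis gauss_ints_add gauss_ints_mult gauss_ints_simps(3))
  then show ?thesis using that p(1) by blast
next
  case False
  then have irr: "inner w d \<noteq> 0" if "w \<in> gauss_ints" "w \<noteq> 0" for w using that by blast
  define c where "c = (\<lambda>a. inner a d)"
  have clin: "c (a + b) = c a + c b" "c (a - b) = c a - c b" for a b by (auto simp: c_def inner_add_left inner_diff_left)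
  define P where "P = (\<lambda>a b. a \<in> gauss_ints \<and> b \<in> gauss_ints \<and> \<bar>crossp a b\<bar> = 1)"
  have Psym: "P b a" if "P a b" for a b using that by (auto simp: P_def crossp_def abs_minus_commute mult.commute)
  have Pnz: "c a \<noteq> 0" if "P a b" for a b
  proof -
    have "a \<noteq> 0" using that by (auto simp: P_def crossp_def)
    then show ?thesis using that irr[of a] by (simp add: P_def c_def)
  qed
  have Pstep: "P a' b" if "P a b" "a' = a - b \<or> a' = a + b" for a b a'
  proof -
    have "crossp (a - b) b = crossp a b" "crossp (a + b) b = crossp a b" by (auto simp: crossp_def algebra_simps)
    then show ?thesis using that by (auto simp: P_def)
  qed
  have var: "\<bar>inner a p - inner a q\<bar> \<le> \<bar>c a\<bar>" if pq: "p \<in> I" "q \<in> I" for a p q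
  proof -
    obtain s where s: "\<bar>s\<bar> \<le> 1" "p = q + of_real s * d" using line[OF pq(2,1)] by blast
    have "inner a p - inner a q = s * c a" using s(2) by (simp add: c_def inner_complex_def algebra_simps)
    then show ?thesis using s(1) by (simp add: abs_mult mult_left_le_one_le)
  qed
  \<comment> \<open>First run, starting from the coordinate functionals. Below \<open>1/4\<close>
    the variations of two functionals on \<open>I\<close> add up to less than 1, so integer values
    can be identified.\<close>
  obtain a0 b0 where ab0: "P a0 b0" "\<bar>c a0\<bar> < 1/4" "\<bar>c b0\<bar> < 1/4"
  proof (rule subtractive_euclid[of P 1 \<i> c "1/4"])
    show "P 1 \<i>" by (simp add: P_def crossp_def)
    show "P a' b" if "P a b" "a' = a - b \<or> a' = a + b" for a b a' using Pstep that .
    show "P b a" if "P a b" for a b using Psym that .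
    show "c a \<noteq> 0" if "P a b" for a b using Pnz that .
    show "c (a + b) = c a + c b" "c (a - b) = c a - c b" for a b using clin .
  qed auto
  have val: "\<exists>p\<in>I. inner a p \<in> \<int>" if ab: "P a b" for a b
  proof -
    obtain t where "t \<in> gauss_ints" "inner a t = 1" using basis_primitive[of a b] ab unfolding P_def by blast
    then show ?thesis using int[of a t] ab by (auto simp: P_def)
  qed
  obtain pa pb where pa: "pa \<in> I" "inner a0 pa \<in> \<int>" and pb: "pb \<in> I" "inner b0 pb \<in> \<int>"
    using val[OF ab0(1)] val[OF Psym[OF ab0(1)]] by blast
  define X where "X = crossp a0 b0"
  have XX: "X * X = 1" using ab0(1) by (auto simp: P_def X_def abs_if split: if_splits)
  \<comment> \<open>Cramer's rule for the point at which \<open>a0\<close> and \<open>b0\<close>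
    take their integer values; the determinant \<open>X\<close> is 1 or -1, so the point is in the
    lattice.\<close>
  define z where "z = of_real X * (of_real (inner a0 pa) * (- \<i> * b0) + of_real (inner b0 pb) * (\<i> * a0))"
  have z: "z \<in> gauss_ints"
  proof -
    have "of_real X \<in> gauss_ints" "of_real (inner a0 pa) \<in> gauss_ints" "of_real (inner b0 pb) \<in> gauss_ints"
      using ab0(1) pa pb by (auto simp: P_def X_def crossp_def gauss_ints_def)
    then show ?thesis using ab0(1) unfolding z_def P_def by simp
  qed
  have za: "inner a0 z = inner a0 pa"
  proof -
    have "inner a0 z = X * (inner a0 pa * X)" by (simp add: z_def X_def crossp_def inner_complex_def algebra_simps)
    then show ?thesis using XX by (simp add: algebra_simps)
  qed
  have zb: "inner b0 z = inner b0 pb"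
  proof -
    have "inner b0 z = X * (inner b0 pb * X)" by (simp add: z_def X_def crossp_def inner_complex_def algebra_simps)
    then show ?thesis using XX by (simp add: algebra_simps)
  qed
  \<comment> \<open>\<open>R a\<close> says that \<open>a\<close> takes on \<open>I\<close> its
    value at \<open>z\<close>. If this holds for \<open>a\<close> and \<open>b\<close>, the integer
    value of their sum or difference on \<open>I\<close> is less than 1 away from its integer value
    at \<open>z\<close>, so it is the same; hence \<open>z\<close> stays good during the second
    run.\<close>
  define R where "R = (\<lambda>a. \<exists>p\<in>I. inner a p = inner a z)"
  define Q where "Q = (\<lambda>a b. P a b \<and> R a \<and> R b \<and> \<bar>c a\<bar> < 1/4 \<and> \<bar>c b\<bar> < 1/4)"
  have Q0: "Q a0 b0" using ab0 za zb pa pb by (auto simp: Q_def R_def)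
  have Qstep: "Q a' b" if Q: "Q a b" and a': "a' = a - b \<or> a' = a + b" and le: "\<bar>c a'\<bar> \<le> \<bar>c a\<bar>" for a b a'
  proof -
    have P': "P a' b" using Pstep Q a' by (auto simp: Q_def)
    obtain p where p: "p \<in> I" "inner a' p \<in> \<int>" using val[OF P'] by blast
    obtain p1 p2 where p12: "p1 \<in> I" "inner a p1 = inner a z" "p2 \<in> I" "inner b p2 = inner b z" using Q by (auto simp: Q_def R_def)
    have "\<bar>inner a p - inner a z\<bar> < 1/4" "\<bar>inner b p - inner b z\<bar> < 1/4"
      using var[OF p(1) p12(1), of a] var[OF p(1) p12(3), of b] p12 Q by (auto simp: Q_def)
    moreover have "inner a' p - inner a' z = (inner a p - inner a z) - (inner b p - inner b z) \<or>
      inner a' p - inner a' z = (inner a p - inner a z) + (inner b p - inner b z)"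
      using a' by (auto simp: inner_diff_left inner_add_left)
    ultimately have "\<bar>inner a' p - inner a' z\<bar> < 1" by linarith
    moreover have "inner a' z \<in> \<int>" using P' z inner_gauss_ints by (auto simp: P_def)
    ultimately have "inner a' p = inner a' z" using p(2) by (simp add: Ints_eq_abs_less1)
    then show ?thesis using P' p(1) Q le by (auto simp: Q_def R_def)
  qed
  have small: "\<exists>a. a \<in> gauss_ints \<and> a \<noteq> 0 \<and> R a \<and> \<bar>c a\<bar> < \<eta>" if "0 < \<eta>" for \<eta>
  proof -
    obtain a b where "Q a b" "\<bar>c a\<bar> < \<eta>" "\<bar>c b\<bar> < \<eta>"
    proof (rule subtractive_euclid[of Q a0 b0 c \<eta>])
      show "Q b a" if "Q a b" for a b using that Psym by (auto simp: Q_def)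
      show "c a \<noteq> 0" if "Q a b" for a b using that Pnz by (auto simp: Q_def)
      show "Q a' b" if "Q a b" "a' = a - b \<or> a' = a + b" "\<bar>c a'\<bar> \<le> \<bar>c a\<bar>" for a b a' using Qstep that .
      show "c (a + b) = c a + c b" "c (a - b) = c a - c b" for a b using clin .
    qed (auto simp: Q0 \<open>0 < \<eta>\<close>)
    then show ?thesis using Pnz by (auto simp: Q_def P_def crossp_def intro!: exI[of _ a])
  qed
  obtain p0 where p0: "p0 \<in> I" using ne by blast
  define r where "r = p0 - z"
  have rle: "\<bar>inner a r\<bar> \<le> \<bar>c a\<bar>" if Ra: "R a" for a
  proof -
    obtain p where "p \<in> I" "inner a p = inner a z" using Ra by (auto simp: R_def)
    then show ?thesis using var[OF p0, of p a] by (simp add: r_def inner_diff_right)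
  qed
  \<comment> \<open>\<open>z\<close> lies on the line through \<open>I\<close>: otherwise
    \<open>inner a r\<close> and \<open>c a\<close> would determine \<open>a\<close> linearly, and
    both being tiny would make the nonzero lattice vector \<open>a\<close> shorter than 1.\<close>
  have "crossp r d = 0"
  proof (rule ccontr)
    assume neq: "crossp r d \<noteq> 0"
    define \<eta> where "\<eta> = \<bar>crossp r d\<bar> / (norm d + norm r + 1)"
    have nn: "0 < norm d + norm r + 1" by (simp add: add_nonneg_pos)
    have "0 < \<eta>" using neq nn by (simp add: \<eta>_def)
    then obtain a where a: "a \<in> gauss_ints" "a \<noteq> 0" "R a" "\<bar>c a\<bar> < \<eta>" using small by blast
    have "1 \<le> norm a"
    proof -
      have "inner a a \<in> \<int>" using inner_gauss_ints a(1) by blast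
      then obtain k where k: "inner a a = of_int k" by (auto elim: Ints_cases)
      moreover have "0 < inner a a" using a(2) by simp
      ultimately have "1 \<le> inner a a" by simp
      then have "1 \<le> norm a ^ 2" by (simp only: power2_norm_eq_inner)
      then show ?thesis using power_le_one_iff[of "norm a" 2] abs_le_square_iff[of 1 "norm a"] by simp
    qed
    have id: "of_real (crossp r d) * a = of_real (inner a r) * (- \<i> * d) + of_real (c a) * (\<i> * r)"
      by (simp add: complex_eq_iff crossp_def c_def inner_complex_def algebra_simps)
    have "\<bar>crossp r d\<bar> * 1 \<le> \<bar>crossp r d\<bar> * norm a" using \<open>1 \<le> norm a\<close> by (intro mult_left_mono) auto
    also have "\<dots> = norm (of_real (crossp r d) * a)" by (simp add: norm_mult)
    also have "\<dots> \<le> \<bar>inner a r\<bar> * norm d + \<bar>c a\<bar> * norm r"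
      unfolding id by (rule order_trans[OF norm_triangle_ineq]) (simp add: norm_mult)
    also have "\<dots> \<le> \<eta> * norm d + \<eta> * norm r"
      using rle[OF a(3)] a(4) by (intro add_mono mult_right_mono) auto
    also have "\<dots> < \<eta> * (norm d + norm r + 1)" using \<open>0 < \<eta>\<close> by (simp add: algebra_simps)
    also have "\<dots> = \<bar>crossp r d\<bar>" using nn by (simp add: \<eta>_def)
    finally show False by simp
  qed
  have dd: "inner d d \<noteq> 0" using d by simp
  define \<tau> where "\<tau> = - inner r d / inner d d"
  have r: "r = - of_real \<tau> * d"
  proof -
    have "of_real (inner d d) * r = of_real (inner r d) * d"
      using \<open>crossp r d = 0\<close> by (simp add: complex_eq_iff crossp_def inner_complex_def) algebra
    then have "of_real (inner d d) * r = of_real (inner d d) * (- of_real \<tau> * d)" using dd by (simp add: \<tau>_def)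
    then show ?thesis using dd by (simp only: mult_cancel_left of_real_eq_0_iff) auto
  qed
  obtain a where a: "a \<in> gauss_ints" "a \<noteq> 0" "R a" using small[of 1] by auto
  obtain p where p: "p \<in> I" "inner a p = inner a z" using a(3) by (auto simp: R_def)
  obtain s where s: "p = p0 + of_real s * d" using line[OF p0 p(1)] by blast
  have "p - z = of_real (s - \<tau>) * d" using r s by (simp add: r_def algebra_simps)
  then have "inner a p - inner a z = inner a (of_real (s - \<tau>) * d)" by (simp only: inner_diff_right[symmetric])
  also have "\<dots> = (s - \<tau>) * c a" by (simp add: c_def inner_complex_def algebra_simps)
  finally have "inner a p - inner a z = (s - \<tau>) * c a" .
  then have "s = \<tau>" using p(2) irr[OF a(1,2)] by (simp add: c_def)
  then have "p = z" using \<open>p - z = of_real (s - \<tau>) * d\<close> by simp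
  then show ?thesis using that p(1) z by blast
qed

section \<open>Basins of periodic components\<close>

lemma cost_between_cells:
  assumes N: "0 < N" and "x \<in> cell N a" "y \<in> cell N b"
  shows "\<bar>inner v (b - a) / N - inner v (y - x)\<bar> \<le> norm v * 4"
proof -
  have e: "b / of_nat N - a / of_nat N = (b - a) /\<^sub>R real N" by (simp add: scaleR_conv_of_real field_simps flip: diff_divide_distrib)
  have "inner v (b - a) / N = inner v (b / of_nat N - a / of_nat N)"
    unfolding e inner_scaleR_right by (simp add: divide_inverse mult.commute)
  then have "inner v (b - a) / N - inner v (y - x) = inner v ((b / of_nat N - a / of_nat N) - (y - x))"
    by (simp only: inner_diff_right)
  moreover have "norm ((b / of_nat N - a / of_nat N) - (y - x)) \<le> 4"
    using cell_corner[OF N assms(2)] cell_corner[OF N assms(3)] norm_triangle_ineq4[of "x - a / of_nat N" "y - b / of_nat N"]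
    by (simp add: algebra_simps)
  then have "norm v * norm ((b / of_nat N - a / of_nat N) - (y - x)) \<le> norm v * 4" by (rule mult_left_mono) simp
  ultimately show ?thesis using Cauchy_Schwarz_ineq2 order_trans by metis
qed

lemma tinv_restrict:
  assumes "tinv N E" "\<And>a w. a \<in> Z \<Longrightarrow> w \<in> gauss_ints \<Longrightarrow> a + of_nat N * w \<in> Z"
  shows "tinv N (E \<inter> Z \<times> Z)"
  using assms unfolding tinv_def by auto

lemma finite_loops:
  assumes N: "0 < N" and D: "\<And>a b. (a, b) \<in> E \<Longrightarrow> norm (b - a) \<le> D"
  shows "finite {(L, w). 1 \<le> L \<and> L \<le> N * N \<and> w \<in> gauss_ints \<and> (\<exists>a. (a, a + of_nat N * w) \<in> E ^^ L)}" (is "finite ?T")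
proof -
  have len: "norm (b - a) \<le> \<bar>D\<bar> * real L" if "(a, b) \<in> E ^^ L" for L a b
    using that
  proof (induction L arbitrary: b)
    case (Suc L)
    then obtain y where y: "(a, y) \<in> E ^^ L" "(y, b) \<in> E" by auto
    then show ?case using Suc.IH[OF y(1)] D[OF y(2)] norm_triangle_ineq[of "b - y" "y - a"] by (simp add: algebra_simps)
  qed simp
  have "?T \<subseteq> {1..N * N} \<times> {w \<in> gauss_ints. norm w \<le> \<bar>D\<bar> * real (N * N)}"
  proof
    fix s assume "s \<in> ?T"
    then obtain L w a where s: "s = (L, w)" "1 \<le> L" "L \<le> N * N" "w \<in> gauss_ints" "(a, a + of_nat N * w) \<in> E ^^ L" by auto
    have "norm w \<le> norm (of_nat N * w)" using N by (simp add: norm_mult mult_le_cancel_right1)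
    also have "\<dots> \<le> \<bar>D\<bar> * real L" using len[OF s(5)] by simp
    also have "\<dots> \<le> \<bar>D\<bar> * real (N * N)" using s(3) by (intro mult_left_mono) (auto simp flip: of_nat_mult)
    finally show "s \<in> {1..N * N} \<times> {w \<in> gauss_ints. norm w \<le> \<bar>D\<bar> * real (N * N)}" using s by auto
  qed
  then show ?thesis using finite_gauss_bounded by (meson finite_SigmaI finite_atLeastAtMost finite_subset)
qed

text \<open>Up to translation there are only finitely many pairs of a length at most
  \<open>N * N\<close> and a realised \<open>w\<close>, so strict inequalities improve to a uniform
  rate.\<close>

lemma strict_loops:
  assumes E: "tinv N E" and N: "0 < N" and D: "\<And>a b. (a, b) \<in> E \<Longrightarrow> norm (b - a) \<le> D"
    and pos: "\<And>L a w. \<lbrakk>1 \<le> L; L \<le> N * N; w \<in> gauss_ints; (a, a + of_nat N * w) \<in> E ^^ L\<rbrakk> \<Longrightarrow> 0 < inner v w + c * real L"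
  obtains \<eta> where "0 < \<eta>" "\<And>L a w. \<lbrakk>1 \<le> L; L \<le> N * N; w \<in> gauss_ints; (a, a + of_nat N * w) \<in> E ^^ L\<rbrakk> \<Longrightarrow> \<eta> * real L \<le> inner v w + c * real L"
proof -
  define T where "T = {(L, w). 1 \<le> L \<and> L \<le> N * N \<and> w \<in> gauss_ints \<and> (\<exists>a. (a, a + of_nat N * w) \<in> E ^^ L)}"
  have fin: "finite T" unfolding T_def by (rule finite_loops[OF N D])
  define V where "V = insert 1 ((\<lambda>(L, w). (inner v w + c * real L) / real L) ` T)"
  have V: "finite V" "V \<noteq> {}" using fin by (auto simp: V_def)
  have "0 < x" if "x \<in> V" for x
  proof (cases "x = 1")
    case False
    then obtain L w where "(L, w) \<in> T" "x = (inner v w + c * real L) / real L" using \<open>x \<in> V\<close> by (auto simp: V_def)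
    then show ?thesis using pos[of L w] by (auto simp: T_def)
  qed simp
  then have "0 < Min V" using V by simp
  moreover have "Min V * real L \<le> inner v w + c * real L"
    if "1 \<le> L" "L \<le> N * N" "w \<in> gauss_ints" "(a, a + of_nat N * w) \<in> E ^^ L" for L a w
  proof -
    have "(L, w) \<in> T" using that by (auto simp: T_def)
    then have "(inner v w + c * real L) / real L \<in> V" unfolding V_def by force
    then have "Min V \<le> (inner v w + c * real L) / real L" using V by simp
    then show ?thesis using that(1) by (simp add: pos_le_divide_eq)
  qed
  ultimately show ?thesis using that by blast
qed

definition center :: "nat \<Rightarrow> complex \<Rightarrow> complex" where
  "center N a = (a + (1 + \<i>) / 2) / of_nat N"

lemma center_interior: "0 < N \<Longrightarrow> center N a \<in> interior (cell N a)"
  unfolding center_def by (rule center_in_interior_cell)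

lemma center_shift: "0 < N \<Longrightarrow> center N (a + of_nat N * w) = center N a + w"
  by (simp add: center_def field_simps)

lemma interior_cell_core: "0 < N \<Longrightarrow> W \<subseteq> gauss_ints \<Longrightarrow> a \<in> W \<Longrightarrow> interior (cell N a) \<subseteq> core N W"
  unfolding core_def using cell_of_interior by blast

context plane_lift
begin

definition attracting :: "nat \<Rightarrow> complex set \<Rightarrow> bool" where
  "attracting N W \<longleftrightarrow> W \<subseteq> gauss_ints \<and> (\<forall>a\<in>W. \<forall>w\<in>gauss_ints. a + of_nat N * w \<in> W) \<and> (\<forall>a\<in>W. \<forall>b. (a, b) \<in> cell_rel N f \<longrightarrow> b \<in> W)"

lemma attractingD:
  assumes "attracting N W"
  shows "W \<subseteq> gauss_ints" "\<And>a w. a \<in> W \<Longrightarrow> w \<in> gauss_ints \<Longrightarrow> a + of_nat N * w \<in> W" "\<And>a b. a \<in> W \<Longrightarrow> (a, b) \<in> cell_rel N f \<Longrightarrow> b \<in> W"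
  using assms unfolding attracting_def by blast+

lemma attracting_relpow: "attracting N W \<Longrightarrow> a \<in> W \<Longrightarrow> (a, b) \<in> cell_rel N f ^^ L \<Longrightarrow> b \<in> W"
proof (induction L arbitrary: b)
  case (Suc L)
  then show ?case using attractingD(3)[OF Suc.prems(1)] by auto
qed simp

lemma attracting_image: "0 < N \<Longrightarrow> attracting N W \<Longrightarrow> f ` region N W \<subseteq> core N W"
  using attractor_core attractingD by metis

lemma core_translate:
  assumes N: "0 < N" and W: "attracting N W" and z: "z \<in> core N W" and w: "w \<in> gauss_ints"
  shows "z + w \<in> core N W"
  unfolding core_def
proof (intro CollectI ballI impI)
  fix b assume b: "b \<in> gauss_ints" "z + w \<in> cell N b"
  then have "z \<in> cell N (b + of_nat N * (- w))" using cell_shift[OF N, of "z + w" "- w" b] by simp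
  then have "b + of_nat N * (- w) \<in> W" using z b(1) w by (simp add: core_def)
  from attractingD(2)[OF W this w] show "b \<in> W" by simp
qed

lemma region_translate:
  assumes N: "0 < N" and W: "attracting N W" and z: "z \<in> region N W" and w: "w \<in> gauss_ints"
  shows "z + w \<in> region N W"
proof -
  obtain a where "a \<in> W" "z \<in> cell N a" using z by (auto simp: region_def)
  then have "a + of_nat N * w \<in> W" "z + w \<in> cell N (a + of_nat N * w)" using attractingD(2)[OF W _ w] cell_shift[OF N] by auto
  then show ?thesis unfolding region_def by blast
qed

abbreviation comp :: "nat \<Rightarrow> complex set \<Rightarrow> complex \<Rightarrow> complex set" where
  "comp N W z \<equiv> connected_component_set (core N W) z"

lemma comp_absorb:
  assumes "connected T" "T \<subseteq> core N W" "z \<in> T" "z \<in> comp N W y" shows "T \<subseteq> comp N W y"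
proof -
  have "T \<subseteq> comp N W z" using assms by (intro connected_component_maximal) auto
  also have "comp N W z = comp N W y" using assms(4) connected_component_eq by metis
  finally show ?thesis .
qed

text \<open>The component of \<open>a\<close> together with the whole cell \<open>a\<close> is
  connected, and its image lies in the core and contains a point \<open>f x\<close> of the cell
  \<open>b\<close>. The open component of \<open>f x\<close> meets the interior of that cell and is
  therefore the component of its center.\<close>

lemma comp_step:
  assumes N: "0 < N" and W: "attracting N W" and a: "a \<in> W" and ab: "(a, b) \<in> cell_rel N f"
  shows "f ` comp N W (center N a) \<subseteq> comp N W (center N b)"
proof -
  have Wg: "W \<subseteq> gauss_ints" using attractingD(1)[OF W] .
  have b: "b \<in> W" using attractingD(3)[OF W a ab] .
  have im: "f ` region N W \<subseteq> core N W" by (rule attracting_image[OF N W])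
  let ?P = "comp N W (center N a)"
  have ca: "center N a \<in> core N W" "center N b \<in> core N W"
    using interior_cell_core[OF N Wg] center_interior[OF N] a b by blast+
  obtain x where x: "x \<in> cell N a" "f x \<in> cell N b" using ab by (auto simp: cell_rel_def)
  have cellW: "cell N a \<subseteq> region N W" using a by (auto simp: region_def)
  have fx: "f x \<in> core N W" using im cellW x by blast
  have "connected (comp N W (f x) \<union> interior (cell N b))"
  proof (rule connected_Un)
    show "connected (interior (cell N b))" by (intro convex_connected convex_interior convex_cell)
    have "open (comp N W (f x))" by (rule open_connected_component[OF open_core[OF N]])
    moreover have "f x \<in> comp N W (f x)" using fx by simp
    moreover have "f x \<in> closure (interior (cell N b))"
    proof -
      have "interior (cell N b) \<noteq> {}" using center_interior[OF N] by blast
      then show ?thesis using convex_closure_interior[OF convex_cell] closure_subset x(2) by blast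
    qed
    ultimately show "comp N W (f x) \<inter> interior (cell N b) \<noteq> {}"
      by (meson closure_iff_nhds_not_empty open_Int_closure_eq_empty disjoint_iff)
  qed simp
  then have "comp N W (f x) \<union> interior (cell N b) \<subseteq> comp N W (center N b)"
  proof (rule connected_component_maximal[rotated])
    show "center N b \<in> comp N W (f x) \<union> interior (cell N b)" using center_interior[OF N] by blast
    show "comp N W (f x) \<union> interior (cell N b) \<subseteq> core N W"
      using interior_cell_core[OF N Wg b] connected_component_subset[of "core N W" "f x"] by blast
  qed
  moreover have "f x \<in> comp N W (f x)" using fx by simp
  ultimately have fxb: "f x \<in> comp N W (center N b)" by blast
  have conn: "connected (f ` (?P \<union> cell N a))"
  proof (intro connected_continuous_image continuous_on_subset[OF cf] connected_Un)
    show "?P \<inter> cell N a \<noteq> {}"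
    proof -
      have "center N a \<in> ?P" using ca(1) by simp
      moreover have "center N a \<in> cell N a" using center_interior[OF N, of a] interior_subset by blast
      ultimately show ?thesis by blast
    qed
  qed (auto intro: convex_connected convex_cell)
  have "?P \<subseteq> region N W" using connected_component_subset core_subset_region[OF N] by blast
  then have "f ` (?P \<union> cell N a) \<subseteq> core N W" using im cellW by blast
  then have "f ` (?P \<union> cell N a) \<subseteq> comp N W (center N b)"
    using x(1) fxb by (intro comp_absorb[OF conn, of N W "f x"]) auto
  then show ?thesis by blast
qed

lemma comp_translate:
  assumes N: "0 < N" and W: "attracting N W" and w: "w \<in> gauss_ints" and z: "z \<in> comp N W (y + w)"
  shows "z - w \<in> comp N W y"
proof -
  let ?T = "(\<lambda>z. z - w) ` comp N W (y + w)"
  have "y + w \<in> core N W" using z connected_component_in by (metis mem_Collect_eq)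
  have "connected ?T" by (intro connected_continuous_image continuous_intros) simp
  moreover have "?T \<subseteq> core N W"
    using core_translate[OF N W _ gauss_ints_minus[OF w]] connected_component_subset by fastforce
  moreover have "y \<in> ?T" using \<open>y + w \<in> core N W\<close> by (intro image_eqI[of _ _ "y + w"]) auto
  ultimately have "?T \<subseteq> comp N W y" by (rule connected_component_maximal[rotated])
  then show ?thesis using z by blast
qed

lemma comp_relpow:
  assumes N: "0 < N" and W: "attracting N W" and a: "a \<in> W" and ab: "(a, b) \<in> cell_rel N f ^^ L"
  shows "(f ^^ L) ` comp N W (center N a) \<subseteq> comp N W (center N b)"
  using ab
proof (induction L arbitrary: b)
  case (Suc L)
  then obtain y where y: "(a, y) \<in> cell_rel N f ^^ L" "(y, b) \<in> cell_rel N f" by auto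
  have "y \<in> W" by (rule attracting_relpow[OF W a y(1)])
  then show ?case using Suc.IH[OF y(1)] comp_step[OF N W _ y(2)] by (auto simp: image_subset_iff)
qed simp

text \<open>The basin of a periodic component of an attractor; \<open>h = f\<^sup>L - w\<close> maps the component \<open>P\<close> into itself.\<close>

lemma periodic_component_basin:
  assumes N: "0 < N" and W: "attracting N W" and small: "\<And>K. connected K \<Longrightarrow> K \<subseteq> core N W \<Longrightarrow> bounded K"
    and a: "a \<in> W" and L: "1 \<le> L" and w: "w \<in> gauss_ints" and walk: "(a, a + of_nat N * w) \<in> cell_rel N f ^^ L"
  obtains P B where "bounded P" "open B" "center N a \<in> B" "P \<subseteq> B"
    "\<And>x. x \<in> B \<Longrightarrow> \<exists>n. (f ^^ (L * n)) x - of_nat n * w \<in> P"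
    "\<And>x n. x \<in> P \<Longrightarrow> (f ^^ (L * n)) x - of_nat n * w \<in> P"
    "\<And>x z. x \<in> B \<Longrightarrow> z \<in> gauss_ints \<Longrightarrow> x + z \<in> B \<Longrightarrow> z = 0"
    "\<And>x k. x \<in> closure B \<Longrightarrow> (f ^^ k) x \<in> core N W \<Longrightarrow> x \<in> B"
    "\<And>x n. x \<in> closure B \<Longrightarrow> (f ^^ (L * n)) x - of_nat n * w \<in> closure B"
proof -
  define P where "P = comp N W (center N a)"
  define h where "h = (\<lambda>n x. (f ^^ (L * n)) x - of_nat n * w)"
  have nw: "of_nat n * w \<in> gauss_ints" for n using w by simp
  have hS: "h (m + n) x = h m (h n x)" for m n x
  proof -
    have "(f ^^ (L * m)) (h n x) = (f ^^ (L * m)) ((f ^^ (L * n)) x) - of_nat n * w"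
      using funpow_per[OF gauss_ints_minus[OF nw], of "L * m" "(f ^^ (L * n)) x" n] by (simp add: h_def)
    then show ?thesis by (simp add: h_def funpow_add distrib_left algebra_simps)
  qed
  have hz: "h n (x + z) = h n x + z" if "z \<in> gauss_ints" for n x z using funpow_per[OF that] by (simp add: h_def)
  have ch: "continuous_on UNIV (h n)" for n
    unfolding h_def by (intro continuous_intros) (rule plane_lift.cf[OF iterate_lift])
  have cP: "center N a \<in> P"
    unfolding P_def using interior_cell_core[OF N attractingD(1)[OF W] a] center_interior[OF N] by fastforce
  have Pcore: "P \<subseteq> core N W" unfolding P_def by (rule connected_component_subset)
  have Pconn: "connected P" unfolding P_def by simp
  have h1: "h 1 x \<in> P" if x: "x \<in> P" for x
  proof -
    have "(f ^^ L) x \<in> comp N W (center N (a + of_nat N * w))"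
      using comp_relpow[OF N W a walk] x by (auto simp: P_def)
    then show ?thesis using comp_translate[OF N W w] by (simp add: center_shift[OF N] P_def h_def)
  qed
  have hP: "h n x \<in> P" if "x \<in> P" for n x
  proof (induction n)
    case (Suc n)
    then show ?case using hS[of 1 n x] h1 by simp
  qed (use that in \<open>simp add: h_def\<close>)
  have absorb: "T \<subseteq> P" if "connected T" "T \<subseteq> core N W" "T \<inter> P \<noteq> {}" for T
    using comp_absorb[of T N W] that unfolding P_def by blast
  have Pbd: "bounded P" by (rule small[OF Pconn Pcore])
  \<comment> \<open>A component containing two points that differ by a lattice vector is carried
    into itself by this translation, which a bounded set does not allow.\<close>
  have Pz: "z = 0" if x: "x \<in> P" "x + z \<in> P" and z: "z \<in> gauss_ints" for x z
  proof (rule ccontr)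
    assume "z \<noteq> 0"
    have sub: "(\<lambda>y. y + z) ` P \<subseteq> P"
    proof (rule absorb)
      show "connected ((\<lambda>y. y + z) ` P)" by (intro connected_continuous_image continuous_intros Pconn)
      show "(\<lambda>y. y + z) ` P \<subseteq> core N W" using core_translate[OF N W _ z] Pcore by blast
      show "(\<lambda>y. y + z) ` P \<inter> P \<noteq> {}" using x by blast
    qed
    have "x + of_nat n * z \<in> P" for n
    proof (induction n)
      case (Suc n)
      then have "x + of_nat n * z + z \<in> P" using sub by blast
      then show ?case by (simp add: algebra_simps)
    qed (use x in simp)
    moreover obtain r where r: "\<And>y. y \<in> P \<Longrightarrow> norm y \<le> r" using Pbd unfolding bounded_iff by blast
    ultimately have le: "norm (x + of_nat n * z) \<le> r" for n by blast
    have nz: "0 < norm z" using \<open>z \<noteq> 0\<close> by simp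
    obtain n where n: "r + norm x < real n * norm z" using reals_Archimedean3[OF nz] by blast
    have "real n * norm z = norm (of_nat n * z)" by (simp add: norm_mult)
    also have "\<dots> \<le> norm (x + of_nat n * z) + norm x" using norm_triangle_ineq4[of "x + of_nat n * z" x] by simp
    finally show False using le[of n] n by linarith
  qed
  define B where "B = (\<Union>n. h n -` P)"
  have memB: "x \<in> B \<longleftrightarrow> (\<exists>n. h n x \<in> P)" for x by (auto simp: B_def)
  have Bup: "h (m + n) x \<in> P" if "h n x \<in> P" for m n x using hS hP that by metis
  have "open P" unfolding P_def by (rule open_connected_component[OF open_core[OF N]])
  then have openB: "open B" unfolding B_def using ch by (auto intro!: open_UN continuous_open_vimage simp: continuous_on_eq_continuous_at)
  have Bz: "z = 0" if x: "x \<in> B" "x + z \<in> B" and z: "z \<in> gauss_ints" for x z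
  proof -
    obtain m n where "h m x \<in> P" "h n (x + z) \<in> P" using x memB by blast
    then have "h (n + m) x \<in> P" "h (m + n) (x + z) \<in> P" using Bup by blast+
    then show ?thesis using Pz[of "h (m + n) x" z] hz[OF z] z by (simp add: add.commute)
  qed
  \<comment> \<open>Points that \<open>f ^^ k\<close> sends into the component \<open>P''\<close> of
    \<open>(f ^^ k) x\<close> form an open set meeting \<open>B\<close>. Components of the core are
    carried into components, so one point of \<open>P''\<close> ending in \<open>P\<close> takes all
    of \<open>P''\<close> along.\<close>
  have Bcl: "x \<in> B" if x: "x \<in> closure B" "(f ^^ k) x \<in> core N W" for x k
  proof -
    define P'' where "P'' = comp N W ((f ^^ k) x)"
    have "open P''" unfolding P''_def by (rule open_connected_component[OF open_core[OF N]])
    then have "open ((f ^^ k) -` P'')" using plane_lift.cf[OF iterate_lift, of k]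
      by (auto intro!: continuous_open_vimage simp: continuous_on_eq_continuous_at)
    moreover have xP: "(f ^^ k) x \<in> P''" using x(2) by (simp add: P''_def)
    ultimately have "B \<inter> (f ^^ k) -` P'' \<noteq> {}" using x(1) by (metis IntI disjoint_iff open_Int_closure_eq_empty vimageI2 Int_commute)
    then obtain z where z: "z \<in> B" "(f ^^ k) z \<in> P''" by blast
    obtain n where "h n z \<in> P" using z(1) memB by blast
    then have hm: "h (k + n) z \<in> P" by (rule Bup)
    have kL: "k \<le> L * (k + n)" using L mult_le_mono[of 1 L k "k + n"] by simp
    define j where "j = L * (k + n) - k"
    have fj: "(f ^^ (L * (k + n))) y = (f ^^ j) ((f ^^ k) y)" for y using kL by (simp add: j_def flip: funpow_add[THEN fun_cong, unfolded comp_apply])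
    let ?T = "(\<lambda>y. (f ^^ j) y + - (of_nat (k + n) * w)) ` P''"
    have P''core: "P'' \<subseteq> core N W" unfolding P''_def by (rule connected_component_subset)
    have fcore: "(f ^^ i) y \<in> core N W" if "y \<in> core N W" for i y
    proof (induction i)
      case (Suc i)
      then show ?case using attracting_image[OF N W] core_subset_region[OF N, of W] by auto
    qed (use that in simp)
    have "?T \<subseteq> P"
    proof (rule absorb)
      show "connected ?T" unfolding P''_def
        by (intro connected_continuous_image continuous_intros continuous_on_subset[OF plane_lift.cf[OF iterate_lift]]) auto
      show "?T \<subseteq> core N W" using P''core fcore core_translate[OF N W _ gauss_ints_minus[OF nw]] by blast
      have "h (k + n) z \<in> ?T" using z(2) fj[of z] by (auto simp: h_def intro!: image_eqI[of _ _ "(f ^^ k) z"])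
      then show "?T \<inter> P \<noteq> {}" using hm by blast
    qed
    moreover have "h (k + n) x \<in> ?T" using xP fj[of x] by (auto simp: h_def intro!: image_eqI[of _ _ "(f ^^ k) x"])
    ultimately show ?thesis using memB by blast
  qed
  have hB: "h n x \<in> B" if "x \<in> B" for n x
  proof -
    obtain m where "h m x \<in> P" using \<open>x \<in> B\<close> memB by blast
    then have "h m (h n x) \<in> P" using Bup[of m x n] hS[of m n x] hS[of n m x] by (simp add: add.commute)
    then show ?thesis using memB by blast
  qed
  have hcl: "h n x \<in> closure B" if "x \<in> closure B" for n x
  proof -
    have "h n ` closure B \<subseteq> closure (h n ` B)"
      by (rule image_closure_subset) (use closure_subset[of "h n ` B"] in \<open>auto intro: continuous_on_subset[OF ch]\<close>)
    also have "\<dots> \<subseteq> closure B" using hB by (intro closure_mono) auto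
    finally show ?thesis using that by blast
  qed
  have PB: "P \<subseteq> B" using memB by (auto intro!: exI[of _ 0] simp: h_def)
  show ?thesis
  proof (rule that[of P B])
    show "\<exists>n. (f ^^ (L * n)) x - of_nat n * w \<in> P" if "x \<in> B" for x using that memB by (simp add: h_def)
    show "(f ^^ (L * n)) x - of_nat n * w \<in> P" if "x \<in> P" for x n using hP[OF that] by (simp add: h_def)
    show "(f ^^ (L * n)) x - of_nat n * w \<in> closure B" if "x \<in> closure B" for x n using hcl[OF that] by (simp add: h_def)
    show "center N a \<in> B" using cP PB by blast
    show "z = 0" if "x \<in> B" "z \<in> gauss_ints" "x + z \<in> B" for x z using Bz that by blast
    show "x \<in> B" if "x \<in> closure B" "(f ^^ k) x \<in> core N W" for x k by (rule Bcl[OF that])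
  qed (fact Pbd openB PB)+
qed

lemma cell_rel_inverse: "cell_rel N g = (cell_rel N f)\<inverse>"
proof -
  have "g ` cell N b \<inter> cell N a \<noteq> {} \<longleftrightarrow> f ` cell N a \<inter> cell N b \<noteq> {}" for a b
  proof
    assume "g ` cell N b \<inter> cell N a \<noteq> {}"
    then obtain x where "x \<in> cell N b" "g x \<in> cell N a" by blast
    then show "f ` cell N a \<inter> cell N b \<noteq> {}" using fg[of x] by (metis IntI empty_iff imageI)
  next
    assume "f ` cell N a \<inter> cell N b \<noteq> {}"
    then obtain x where "x \<in> cell N a" "f x \<in> cell N b" by blast
    then show "g ` cell N b \<inter> cell N a \<noteq> {}" using gf[of x] by (metis IntI empty_iff imageI)
  qed
  then show ?thesis by (auto simp: cell_rel_def)
qed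

lemma inverse_relpow: "(a, b) \<in> cell_rel N g ^^ L \<longleftrightarrow> (b, a) \<in> cell_rel N f ^^ L"
proof (induction L arbitrary: b)
  case (Suc L)
  then have "(a, b) \<in> cell_rel N g ^^ Suc L \<longleftrightarrow> (b, a) \<in> cell_rel N f O cell_rel N f ^^ L"
    by (auto simp: cell_rel_inverse relcomp_unfold)
  then show ?case by (simp add: relpow_commute)
qed auto

lemma inverse_iterate: "(f ^^ n) ((g ^^ n) x) = x" "(g ^^ n) ((f ^^ n) x) = x"
  using plane_lift.fg[OF iterate_lift] plane_lift.gf[OF iterate_lift] by auto

text \<open>Here a closed walk becomes an orbit: points of the bounded set \<open>P\<close> return
  to \<open>P\<close> under \<open>f ^^ L\<close> followed by the translation by \<open>- w\<close>,
  so their displacement stays at bounded distance from multiples of \<open>w\<close>. The same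
  orbits run backwards give the statement on \<open>g\<close>, which serves for repellers.\<close>

lemma attracting_rotation:
  assumes N: "0 < N" and W: "attracting N W" and small: "\<And>K. connected K \<Longrightarrow> K \<subseteq> core N W \<Longrightarrow> bounded K"
    and a: "a \<in> W" and L: "1 \<le> L" and w: "w \<in> gauss_ints" and walk: "(a, a + of_nat N * w) \<in> cell_rel N f ^^ L"
  shows "w /\<^sub>R real L \<in> rot f" "- w /\<^sub>R real L \<in> rot g"
proof -
  obtain P B where P: "bounded P" "center N a \<in> B" "\<And>x. x \<in> B \<Longrightarrow> \<exists>n. (f ^^ (L * n)) x - of_nat n * w \<in> P"
    "\<And>x n. x \<in> P \<Longrightarrow> (f ^^ (L * n)) x - of_nat n * w \<in> P"
    using periodic_component_basin[OF N W small a L w walk] by metis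
  obtain x where x: "x \<in> P" using P(2,3) by blast
  obtain r where r: "\<And>y. y \<in> P \<Longrightarrow> norm y \<le> r" using P(1) unfolding bounded_iff by blast
  have bd: "norm ((f ^^ (L * n)) x - x - real n *\<^sub>R w) \<le> 2 * r" for n
    using r[OF P(4)[OF x, of n]] r[OF x] norm_triangle_ineq4[of "(f ^^ (L * n)) x - of_nat n * w" x]
    by (simp add: scaleR_conv_of_real algebra_simps)
  show "w /\<^sub>R real L \<in> rot f" using rot_bounded_orbit[OF L, of w "2 * r"] bd by blast
  have "norm ((g ^^ (L * n)) ((f ^^ (L * n)) x) - (f ^^ (L * n)) x - real n *\<^sub>R (- w)) \<le> 2 * r" for n
  proof -
    have "(g ^^ (L * n)) ((f ^^ (L * n)) x) - (f ^^ (L * n)) x - real n *\<^sub>R (- w) = - ((f ^^ (L * n)) x - x - real n *\<^sub>R w)"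
      using inverse_iterate(2)[of "L * n" x] by simp
    then show ?thesis using bd[of n] by (simp only: norm_minus_cancel)
  qed
  then show "- w /\<^sub>R real L \<in> rot g" using plane_lift.rot_bounded_orbit[OF inverse_lift L, of "- w" "2 * r"] by blast
qed

end

section \<open>A maximal small attractor and the class above it\<close>

lemma tinv_rtrancl:
  assumes "tinv N E" "(a, b) \<in> E\<^sup>*" "w \<in> gauss_ints" shows "(a + of_nat N * w, b + of_nat N * w) \<in> E\<^sup>*"
  using tinv_relpow[OF assms(1) _ assms(3)] assms(2) by (metis rtrancl_imp_relpow relpow_imp_rtrancl)

definition residues :: "nat \<Rightarrow> complex set" where
  "residues N = {a \<in> gauss_ints. 0 \<le> Re a \<and> Re a < N \<and> 0 \<le> Im a \<and> Im a < N}"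

lemma finite_residues: "finite (residues N)"
proof (rule finite_subset[OF _ finite_gauss_bounded[of "2 * real N"]])
  show "residues N \<subseteq> {a \<in> gauss_ints. norm a \<le> 2 * real N}"
  proof
    fix a assume "a \<in> residues N"
    then have "a \<in> gauss_ints" "\<bar>Re a\<bar> \<le> N" "\<bar>Im a\<bar> \<le> N" by (auto simp: residues_def)
    then show "a \<in> {a \<in> gauss_ints. norm a \<le> 2 * real N}" using cmod_le[of a] by simp
  qed
qed

lemma residue_ex:
  assumes N: "0 < N" and a: "a \<in> gauss_ints" obtains w where "w \<in> gauss_ints" "a + of_nat N * w \<in> residues N"
proof -
  define w where "w = - cell_of 1 (a / of_nat N)"
  have w: "w \<in> gauss_ints" unfolding w_def using cell_of(2)[of 1] by (intro gauss_ints_minus) auto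
  have fl: "0 \<le> x / N - of_int \<lfloor>x / N\<rfloor>" "x / N - of_int \<lfloor>x / N\<rfloor> < 1" for x :: real by linarith+
  have "Re (a + of_nat N * w) = N * (Re a / N - of_int \<lfloor>Re a / N\<rfloor>)" "Im (a + of_nat N * w) = N * (Im a / N - of_int \<lfloor>Im a / N\<rfloor>)"
    using N by (simp_all add: w_def cell_of_def algebra_simps)
  then have "0 \<le> Re (a + of_nat N * w)" "Re (a + of_nat N * w) < real N * 1" "0 \<le> Im (a + of_nat N * w)" "Im (a + of_nat N * w) < real N * 1"
    using fl[of "Re a"] fl[of "Im a"] N by (simp_all only: mult_less_cancel_left_pos mult_nonneg_nonneg of_nat_0_le_iff of_nat_0_less_iff)
  then show ?thesis using w a by (intro that[of w]) (auto simp: residues_def)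
qed

context plane_lift
begin

lemma attracting_subset_residues:
  assumes N: "0 < N" and W: "attracting N W" and V: "\<And>a w. a \<in> V \<Longrightarrow> w \<in> gauss_ints \<Longrightarrow> a + of_nat N * w \<in> V"
    and sub: "W \<inter> residues N \<subseteq> V"
  shows "W \<subseteq> V"
proof
  fix a assume a: "a \<in> W"
  obtain w where w: "w \<in> gauss_ints" "a + of_nat N * w \<in> residues N" using residue_ex[OF N] a attractingD(1)[OF W] by blast
  then have "a + of_nat N * w \<in> V" using sub attractingD(2)[OF W a] by blast
  from V[OF this gauss_ints_minus[OF w(1)]] show "a \<in> V" by simp
qed

lemma connected_Un_cell:
  assumes "connected K" "z \<in> K" "z \<in> cell N a" shows "connected (K \<union> cell N a)"
  using connected_Un[OF assms(1) convex_connected[OF convex_cell]] assms(2,3) by blast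

text \<open>\<open>U\<close> is a maximal attractor without unbounded components; \<open>Y\<close> consists of the unbounded components of a minimal
  larger attractor.\<close>

lemma attractor_structure:
  assumes nf: "no_free_grid_curve f" and N3: "3 \<le> N"
  obtains U Y where "attracting N U" "attracting N Y"
    "\<And>K. connected K \<Longrightarrow> K \<subseteq> region N U \<Longrightarrow> bounded K"
    "\<And>K. connected K \<Longrightarrow> K \<inter> region N Y = {} \<Longrightarrow> bounded K"
    "\<And>p. p \<in> region N Y \<Longrightarrow> \<exists>K. connected K \<and> \<not> bounded K \<and> K \<subseteq> region N Y \<and> p \<in> K"
    "\<And>a b. a \<in> Y - U \<Longrightarrow> b \<in> Y - U \<Longrightarrow> \<exists>w\<in>gauss_ints. (a, b + of_nat N * w) \<in> (cell_rel N f)\<^sup>*"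
proof -
  have N: "0 < N" using N3 by simp
  have ti: "tinv N (cell_rel N f)" by (rule cell_rel_tinv[OF N])
  define small where "small = (\<lambda>W. \<forall>K. connected K \<longrightarrow> K \<subseteq> region N W \<longrightarrow> bounded K)"
  \<comment> \<open>By periodicity an attractor is determined by its cells in a finite fundamental
    domain, so maximal and minimal choices exist.\<close>
  define \<mu> where "\<mu> = (\<lambda>W. card (W \<inter> residues N))"
  have \<mu>_le: "\<mu> W \<le> card (residues N)" for W unfolding \<mu>_def by (intro card_mono finite_residues) auto
  have gg: "attracting N gauss_ints" unfolding attracting_def by (auto simp: cell_rel_def)
  have "attracting N {} \<and> small {}" by (auto simp: attracting_def small_def region_def)
  then obtain U where U: "attracting N U" "small U" and Umax: "\<And>W. attracting N W \<Longrightarrow> small W \<Longrightarrow> \<mu> W \<le> \<mu> U"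
    using ex_has_greatest_nat[of "\<lambda>W. attracting N W \<and> small W" "{}" \<mu> "Suc (card (residues N))"] \<mu>_le by (auto simp: less_Suc_eq_le)
  \<comment> \<open>The attractor generated by \<open>U\<close> and \<open>a\<close>.\<close>
  define R where "R = (\<lambda>a. U \<union> {b \<in> gauss_ints. \<exists>w\<in>gauss_ints. (a, b + of_nat N * w) \<in> (cell_rel N f)\<^sup>*})"
  have R: "attracting N (R a)" if a: "a \<in> gauss_ints" for a
    unfolding attracting_def
  proof (intro conjI ballI allI impI)
    show "R a \<subseteq> gauss_ints" using attractingD(1)[OF U(1)] by (auto simp: R_def)
    show "b + of_nat N * w \<in> R a" if b: "b \<in> R a" and w: "w \<in> gauss_ints" for b w
    proof (cases "b \<in> U")
      case True
      then show ?thesis using attractingD(2)[OF U(1) _ w] by (simp add: R_def)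
    next
      case False
      then obtain w' where w': "b \<in> gauss_ints" "w' \<in> gauss_ints" "(a, b + of_nat N * w') \<in> (cell_rel N f)\<^sup>*" using b by (auto simp: R_def)
      have "b + of_nat N * w + of_nat N * (w' - w) = b + of_nat N * w'" by (simp add: algebra_simps)
      then have "(a, b + of_nat N * w + of_nat N * (w' - w)) \<in> (cell_rel N f)\<^sup>*" using w'(3) by (simp only:)
      moreover have "b + of_nat N * w \<in> gauss_ints" "w' - w \<in> gauss_ints" using w w' by simp_all
      ultimately show ?thesis unfolding R_def by blast
    qed
    show "c \<in> R a" if b: "b \<in> R a" and bc: "(b, c) \<in> cell_rel N f" for b c
    proof (cases "b \<in> U")
      case True
      then show ?thesis using attractingD(3)[OF U(1) _ bc] by (simp add: R_def)
    next
      case False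
      then obtain w' where w': "w' \<in> gauss_ints" "(a, b + of_nat N * w') \<in> (cell_rel N f)\<^sup>*" using b by (auto simp: R_def)
      have "(a, c + of_nat N * w') \<in> (cell_rel N f)\<^sup>*" using w'(2) tinvD(3)[OF ti bc w'(1)] by simp
      moreover have "c \<in> gauss_ints" using bc by (simp add: cell_rel_def)
      ultimately show ?thesis using w'(1) unfolding R_def by blast
    qed
  qed
  have aR: "a \<in> R a" if "a \<in> gauss_ints" for a
    using that unfolding R_def by (auto intro!: bexI[of _ 0])
  have Rmin: "R b \<subseteq> R a" if a: "a \<in> gauss_ints" and b: "b \<in> R a - U" for a b
  proof
    fix c assume c: "c \<in> R b"
    show "c \<in> R a"
    proof (cases "c \<in> U")
      case False
      obtain w where w: "w \<in> gauss_ints" "(a, b + of_nat N * w) \<in> (cell_rel N f)\<^sup>*" using b by (auto simp: R_def)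
      obtain w' where w': "c \<in> gauss_ints" "w' \<in> gauss_ints" "(b, c + of_nat N * w') \<in> (cell_rel N f)\<^sup>*" using c False by (auto simp: R_def)
      have "(b + of_nat N * w, c + of_nat N * w' + of_nat N * w) \<in> (cell_rel N f)\<^sup>*" by (rule tinv_rtrancl[OF ti w'(3) w(1)])
      then have "(a, c + of_nat N * (w' + w)) \<in> (cell_rel N f)\<^sup>*" using w(2) by (simp add: algebra_simps)
      moreover have "w' + w \<in> gauss_ints" using w w' by simp
      ultimately show ?thesis using w'(1) unfolding R_def by blast
    qed (simp add: R_def)
  qed
  have "\<exists>a. a \<in> gauss_ints - U"
  proof (rule ccontr)
    assume "\<not> ?thesis"
    then have "gauss_ints \<subseteq> U" by blast
    then have "region N U = UNIV" using cell_of[of N] N unfolding region_def by blast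
    then show False using U(2) not_bounded_UNIV connected_UNIV unfolding small_def by blast
  qed
  \<comment> \<open>By minimality every cell of \<open>R a\<close> outside \<open>U\<close>
    generates all of \<open>R a\<close>, so these cells reach one another up to translation: a
    single class.\<close>
  then obtain a where a: "a \<in> gauss_ints - U" and amin: "\<And>b. b \<in> gauss_ints - U \<Longrightarrow> \<mu> (R a) \<le> \<mu> (R b)"
    using ex_has_least_nat[of "\<lambda>a. a \<in> gauss_ints - U" _ "\<lambda>a. \<mu> (R a)"] by auto
  have Req: "R b = R a" if b: "b \<in> R a - U" for b
  proof -
    have bg: "b \<in> gauss_ints" using b attractingD(1)[OF R, of a] a by blast
    have sub: "R b \<subseteq> R a" using Rmin[of a b] a b by blast
    have "card (R a \<inter> residues N) \<le> card (R b \<inter> residues N)" using amin[of b] b bg by (auto simp: \<mu>_def)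
    then have "R b \<inter> residues N = R a \<inter> residues N"
      using sub finite_residues[of N] by (intro card_seteq) auto
    note eq = this
    have "R a \<subseteq> R b"
    proof (rule attracting_subset_residues[OF N])
      show "attracting N (R a)" using R a by blast
      show "x + of_nat N * w \<in> R b" if "x \<in> R b" "w \<in> gauss_ints" for x w
        by (rule attractingD(2)[OF R[OF bg] that])
      show "R a \<inter> residues N \<subseteq> R b" using eq by blast
    qed
    then show ?thesis using sub by blast
  qed
  have notsmall: "\<not> small (R a)"
  proof
    assume "small (R a)"
    then have "\<mu> (R a) \<le> \<mu> U" using Umax R a by blast
    moreover have "U \<subseteq> R a" by (auto simp: R_def)
    ultimately have "U \<inter> residues N = R a \<inter> residues N"
      using finite_residues[of N] by (intro card_seteq) (auto simp: \<mu>_def)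
    note eq = this
    have "R a \<subseteq> U"
    proof (rule attracting_subset_residues[OF N])
      show "attracting N (R a)" using R a by blast
      show "x + of_nat N * w \<in> U" if "x \<in> U" "w \<in> gauss_ints" for x w
        by (rule attractingD(2)[OF U(1) that])
      show "R a \<inter> residues N \<subseteq> U" using eq by blast
    qed
    then show False using aR[of a] a by blast
  qed
  \<comment> \<open>Only the cells on unbounded connected pieces are kept. Each point of the region
    then has an unbounded connected set attached to it, as the separation argument for basins
    requires, and the dichotomy leaves bounded components in the complement.\<close>
  define Y where "Y = {b \<in> R a. \<exists>K. connected K \<and> \<not> bounded K \<and> cell N b \<subseteq> K \<and> K \<subseteq> region N (R a)}"
  have Ra: "attracting N (R a)" using R a by blast
  have big: "K \<subseteq> region N Y" if K: "connected K" "\<not> bounded K" "K \<subseteq> region N (R a)" for K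
  proof
    fix z assume z: "z \<in> K"
    then obtain c where c: "c \<in> R a" "z \<in> cell N c" using K(3) by (auto simp: region_def)
    have "connected (K \<union> cell N c)" by (rule connected_Un_cell[OF K(1) z c(2)])
    moreover have "\<not> bounded (K \<union> cell N c)" using K(2) bounded_subset by blast
    moreover have "K \<union> cell N c \<subseteq> region N (R a)" using K(3) c(1) by (auto simp: region_def)
    ultimately have "c \<in> Y" using c(1) unfolding Y_def by blast
    then show "z \<in> region N Y" using c(2) by (auto simp: region_def)
  qed
  have Yatt: "attracting N Y"
    unfolding attracting_def
  proof (intro conjI ballI allI impI)
    show "Y \<subseteq> gauss_ints" using attractingD(1)[OF Ra] by (auto simp: Y_def)
    fix b assume b: "b \<in> Y"
    then obtain K where K: "connected K" "\<not> bounded K" "cell N b \<subseteq> K" "K \<subseteq> region N (R a)" and bR: "b \<in> R a" by (auto simp: Y_def)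
    show "b + of_nat N * w \<in> Y" if w: "w \<in> gauss_ints" for w
    proof -
      have "connected ((+) w ` K)" by (rule connected_continuous_image[OF _ K(1)]) (intro continuous_intros)
      moreover have "\<not> bounded ((+) w ` K)" using K(2) bounded_translation[of "(+) w ` K" "- w"] by (auto simp: image_image)
      moreover have "cell N (b + of_nat N * w) \<subseteq> (+) w ` K" using K(3) by (simp add: cell_translate[OF N] image_mono)
      moreover have "(+) w ` K \<subseteq> region N (R a)"
        using K(4) region_translate[OF N Ra _ w] by (auto simp: add.commute)
      ultimately show ?thesis using attractingD(2)[OF Ra bR w] unfolding Y_def by blast
    qed
    show "c \<in> Y" if bc: "(b, c) \<in> cell_rel N f" for c
    proof -
      obtain x where x: "x \<in> cell N b" "f x \<in> cell N c" using bc by (auto simp: cell_rel_def)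
      have c: "c \<in> R a" by (rule attractingD(3)[OF Ra bR bc])
      have "connected (f ` K)" by (rule connected_continuous_image[OF continuous_on_subset[OF cf] K(1)]) simp
      then have "connected (f ` K \<union> cell N c)" using x K(3) by (intro connected_Un_cell[of _ "f x"]) auto
      moreover have "\<not> bounded (f ` K \<union> cell N c)" using image_unbounded[OF K(2)] bounded_subset by blast
      moreover have "f ` K \<subseteq> region N (R a)"
        using K(4) attracting_image[OF N Ra] core_subset_region[OF N, of "R a"] by blast
      moreover have "cell N c \<subseteq> region N (R a)" using c by (auto simp: region_def)
      ultimately show ?thesis using c unfolding Y_def by blast
    qed
  qed
  obtain K0 where K0: "connected K0" "\<not> bounded K0" "K0 \<subseteq> region N (R a)" using notsmall by (auto simp: small_def)
  show ?thesis
  proof (rule that[OF U(1) Yatt])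
    show "bounded K" if "connected K" "K \<subseteq> region N U" for K using U(2) that by (auto simp: small_def)
    show "bounded K" if "connected K" "K \<inter> region N Y = {}" for K
      by (rule attractor_dichotomy[OF nf N3 attractingD(1)[OF Yatt] attractingD(2)[OF Yatt] attractingD(3)[OF Yatt] K0(1,2) big[OF K0] that])
    show "\<exists>K. connected K \<and> \<not> bounded K \<and> K \<subseteq> region N Y \<and> p \<in> K" if p: "p \<in> region N Y" for p
    proof -
      obtain b where "b \<in> Y" "p \<in> cell N b" using p by (auto simp: region_def)
      then obtain K where "connected K" "\<not> bounded K" "cell N b \<subseteq> K" "K \<subseteq> region N (R a)" by (auto simp: Y_def)
      then show ?thesis using big \<open>p \<in> cell N b\<close> by blast
    qed
    show "\<exists>w\<in>gauss_ints. (b, c + of_nat N * w) \<in> (cell_rel N f)\<^sup>*" if bc: "b \<in> Y - U" "c \<in> Y - U" for b c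
    proof -
      have "R b = R a" using Req[of b] bc by (auto simp: Y_def)
      then have "c \<in> R b" using bc by (auto simp: Y_def)
      then show ?thesis using bc by (auto simp: R_def)
    qed
  qed
qed

text \<open>Outside \<open>Y\<close> only bounded components remain, so the results on attractors
  with bounded components become available there for the inverse map.\<close>

lemma repelling_complement:
  assumes N: "0 < N" and W: "attracting N W"
  shows "plane_lift.attracting g N (gauss_ints - W)" "core N (gauss_ints - W) = - region N W"
proof -
  have "a + of_nat N * w \<in> gauss_ints - W" if "a \<in> gauss_ints - W" "w \<in> gauss_ints" for a w
    using that attractingD(2)[OF W, of "a + of_nat N * w" "- w"] by auto
  moreover have "a \<in> gauss_ints - W" if "b \<in> gauss_ints - W" "(a, b) \<in> cell_rel N f" for a b
    using that attractingD(3)[OF W] by (auto simp: cell_rel_def)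
  ultimately show "plane_lift.attracting g N (gauss_ints - W)"
    unfolding plane_lift.attracting_def[OF inverse_lift] cell_rel_inverse by blast
  show "core N (gauss_ints - W) = - region N W"
    using attractingD(1)[OF W] by (auto simp: core_def region_def)
qed

text \<open>The first cell is prescribed, because a point in the region of \<open>Z\<close> may have
  its \<open>cell_of\<close> outside \<open>Z\<close>; for later iterates, which lie in the core of
  an attractor, the choice of the cell does not matter.\<close>

lemma orbit_walk_within:
  assumes N: "0 < N" and a: "a \<in> Z" "a \<in> gauss_ints" "x \<in> cell N a" and Z: "\<And>k. 1 \<le> k \<Longrightarrow> k \<le> n \<Longrightarrow> cell_of N ((f ^^ k) x) \<in> Z"
  obtains b where "(a, b) \<in> (cell_rel N f \<inter> Z \<times> Z) ^^ n" "(f ^^ n) x \<in> cell N b"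
proof -
  define c where "c = (\<lambda>k. if k = 0 then a else cell_of N ((f ^^ k) x))"
  have c: "(f ^^ k) x \<in> cell N (c k)" "c k \<in> gauss_ints" for k using a cell_of(1)[OF N] cell_of(2)[of N] by (auto simp: c_def)
  have cZ: "c k \<in> Z" if "k \<le> n" for k using a Z[of k] that by (auto simp: c_def)
  have "(c 0, c k) \<in> (cell_rel N f \<inter> Z \<times> Z) ^^ k" if "k \<le> n" for k
    using that
  proof (induction k)
    case (Suc k)
    have "(c k, c (Suc k)) \<in> cell_rel N f" using c[of k] c[of "Suc k"] by (intro cell_rel_step[OF N, of "(f ^^ k) x"]) auto
    then show ?case using Suc cZ by auto
  qed simp
  from this[of n] show ?thesis using c[of n] by (intro that[of "c n"]) (simp_all add: c_def)
qed

lemma relpow_restrict: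
  fixes E :: "('a \<times> 'a) set"
  shows "(a, b) \<in> (E \<inter> Z) ^^ L \<Longrightarrow> (a, b) \<in> E ^^ L"
proof (induction L arbitrary: b)
  case (Suc L)
  then show ?case by auto
qed simp

end

lemma relpow_first: fixes E :: "('a \<times> 'a) set" assumes "1 \<le> L" "(a, b) \<in> E ^^ L" shows "\<exists>y. (a, y) \<in> E"
proof -
  have "(a, b) \<in> E ^^ Suc (L - 1)" using assms by simp
  from relpow_Suc_D2[OF this] show ?thesis by blast
qed

text \<open>The translations realised by closed walks at a fixed vertex form a semigroup that avoids \<open>0\<close>.\<close>

lemma strong_class_halfplane:
  assumes ti: "tinv N E" and nc: "\<And>a. (a, a) \<notin> E\<^sup>+"
    and conn: "\<And>a b. a \<in> X \<Longrightarrow> b \<in> X \<Longrightarrow> \<exists>w\<in>gauss_ints. (a, b + of_nat N * w) \<in> E\<^sup>*"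
    and a0: "a0 \<in> X" "w0 \<in> gauss_ints" "(a0, a0 + of_nat N * w0) \<in> E\<^sup>+"
  obtains v where "v \<noteq> 0" "\<And>L a w. \<lbrakk>1 \<le> L; w \<in> gauss_ints; a \<in> X; (a, a + of_nat N * w) \<in> E ^^ L\<rbrakk> \<Longrightarrow> 0 \<le> inner v w"
    "\<exists>s\<in>gauss_ints. (a0, a0 + of_nat N * s) \<in> E\<^sup>+ \<and> 0 < inner v s"
proof -
  define S where "S = {w \<in> gauss_ints. (a0, a0 + of_nat N * w) \<in> E\<^sup>+}"
  have S1: "S \<subseteq> gauss_ints" by (auto simp: S_def)
  have S2: "S \<noteq> {}" using a0(2,3) by (auto simp: S_def)
  have S3: "x + y \<in> S" if "x \<in> S" "y \<in> S" for x y
  proof -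
    have x: "x \<in> gauss_ints" "(a0, a0 + of_nat N * x) \<in> E\<^sup>+" and y: "y \<in> gauss_ints" "(a0, a0 + of_nat N * y) \<in> E\<^sup>+"
      using that by (auto simp: S_def)
    have "(a0 + of_nat N * x, a0 + of_nat N * y + of_nat N * x) \<in> E\<^sup>+" by (rule tinv_trancl[OF ti y(2) x(1)])
    then have "(a0, a0 + of_nat N * (x + y)) \<in> E\<^sup>+" using trancl_trans[OF x(2)] by (simp add: algebra_simps)
    then show ?thesis using x y by (simp add: S_def)
  qed
  have S4: "0 \<notin> S" using nc by (auto simp: S_def)
  obtain v where v: "v \<noteq> 0" "\<And>s. s \<in> S \<Longrightarrow> 0 \<le> inner v s" "\<exists>s\<in>S. 0 < inner v s"
    by (rule gauss_semigroup_halfplane[OF S1 S2 S3 S4]) (assumption, assumption, blast intro: that)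
  have "0 \<le> inner v w" if L: "1 \<le> L" and w: "w \<in> gauss_ints" and a: "a \<in> X" and walk: "(a, a + of_nat N * w) \<in> E ^^ L" for L a w
  proof (rule ccontr)
    assume neg: "\<not> 0 \<le> inner v w"
    obtain w1 where w1: "w1 \<in> gauss_ints" "(a0, a + of_nat N * w1) \<in> E\<^sup>*" using conn[OF a0(1) a] by blast
    obtain w2 where w2: "w2 \<in> gauss_ints" "(a, a0 + of_nat N * w2) \<in> E\<^sup>*" using conn[OF a a0(1)] by blast
    have aw: "(a, a + of_nat N * w) \<in> E\<^sup>+" using L walk by (auto simp: trancl_power intro!: exI[of _ L])
    have loop: "(a, a + of_nat N * (of_nat (Suc k) * w)) \<in> E\<^sup>+" for k
    proof (induction k)
      case (Suc k)
      have "of_nat (Suc k) * w \<in> gauss_ints" using w by (metis gauss_ints_mult gauss_ints_of_nat)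
      from tinv_trancl[OF ti aw this] show ?case using trancl_trans[OF Suc] by (simp add: algebra_simps)
    qed (use aw in simp)
    \<comment> \<open>A walk from \<open>a0\<close> to \<open>a\<close>, many rounds of the loop,
      and a walk back: if the loop decreased \<open>v\<close>, enough rounds would outweigh the two
      connecting walks.\<close>
    have inS: "w1 + of_nat (Suc k) * w + w2 \<in> S" for k
    proof -
      have kw: "of_nat (Suc k) * w \<in> gauss_ints" using w by (metis gauss_ints_mult gauss_ints_of_nat)
      have 1: "(a + of_nat N * w1, a + of_nat N * (of_nat (Suc k) * w) + of_nat N * w1) \<in> E\<^sup>+" by (rule tinv_trancl[OF ti loop w1(1)])
      have 2: "(a + of_nat N * (of_nat (Suc k) * w + w1), a0 + of_nat N * w2 + of_nat N * (of_nat (Suc k) * w + w1)) \<in> E\<^sup>*"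
        by (rule tinv_rtrancl[OF ti w2(2)]) (use kw w1 in simp)
      have "(a0, a + of_nat N * (of_nat (Suc k) * w) + of_nat N * w1) \<in> E\<^sup>+" by (rule rtrancl_trancl_trancl[OF w1(2) 1])
      then have "(a0, a0 + of_nat N * w2 + of_nat N * (of_nat (Suc k) * w + w1)) \<in> E\<^sup>+"
        using trancl_rtrancl_trancl[OF _ 2] by (simp add: algebra_simps)
      then have "(a0, a0 + of_nat N * (w1 + of_nat (Suc k) * w + w2)) \<in> E\<^sup>+" by (simp add: algebra_simps)
      then show ?thesis unfolding S_def using w1(1) w2(1) kw by (simp add: gauss_ints_add)
    qed
    obtain k where k: "inner v w1 + inner v w2 < real k * (- inner v w)" using reals_Archimedean3[of "- inner v w"] neg by auto
    have "inner v (of_nat (Suc k) * w) = real (Suc k) * inner v w" by (simp add: inner_complex_def algebra_simps)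
    then have "0 \<le> inner v w1 + real (Suc k) * inner v w + inner v w2" using v(2)[OF inS[of k]] by (simp only: inner_add_right)
    moreover have "real (Suc k) * inner v w = real k * inner v w + inner v w" by (simp add: algebra_simps)
    ultimately show False using k neg by simp
  qed
  then show ?thesis using that[OF v(1)] v(3) by (auto simp: S_def)
qed

section \<open>Closed walks of extremal rate\<close>

context plane_lift
begin

text \<open>If the extremal rate among closed walks is attained by a component \<open>P\<close> of an attractor \<open>U\<close>, all points in the
  closure of its basin stay on one side; boundary points in \<open>Y\<close> would drift to the other side.\<close>

lemma extremal_rate_in_attractor:
  assumes N: "0 < N" and U: "attracting N U" and Y: "attracting N Y"
    and U_small: "\<And>K. connected K \<Longrightarrow> K \<subseteq> region N U \<Longrightarrow> bounded K"
    and Y_compl: "\<And>K. connected K \<Longrightarrow> K \<inter> region N Y = {} \<Longrightarrow> bounded K"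
    and Y_thick: "\<And>p. p \<in> region N Y \<Longrightarrow> \<exists>K. connected K \<and> \<not> bounded K \<and> K \<subseteq> region N Y \<and> p \<in> K"
    and a: "a \<in> U" "a \<in> Y" and L: "1 \<le> L" and w: "w \<in> gauss_ints" and walk: "(a, a + of_nat N * w) \<in> cell_rel N f ^^ L"
    and rate: "inner v w = r * real L" "r < 0"
    and cost: "\<And>L a b. (a, b) \<in> cell_rel N f ^^ L \<Longrightarrow> - K1 \<le> inner v (b - a) / N - r * real L"
    and cost_C: "\<And>L a b. (a, b) \<in> (cell_rel N f \<inter> (Y - U) \<times> (Y - U)) ^^ L \<Longrightarrow> - K2 \<le> inner v (b - a) / N"
  shows False
proof -
  have core_small: "bounded K" if "connected K" "K \<subseteq> core N U" for K
    using U_small[OF that(1)] that(2) core_subset_region[OF N, of U] by blast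
  obtain P B where PB: "bounded P" "open B" "center N a \<in> B" and "P \<subseteq> B"
    and into_P: "\<And>x. x \<in> B \<Longrightarrow> \<exists>n. (f ^^ (L * n)) x - of_nat n * w \<in> P"
    and "\<And>x n. x \<in> P \<Longrightarrow> (f ^^ (L * n)) x - of_nat n * w \<in> P"
    and Bz: "\<And>x z. x \<in> B \<Longrightarrow> z \<in> gauss_ints \<Longrightarrow> x + z \<in> B \<Longrightarrow> z = 0"
    and Bcl: "\<And>x k. x \<in> closure B \<Longrightarrow> (f ^^ k) x \<in> core N U \<Longrightarrow> x \<in> B"
    and Bh: "\<And>x n. x \<in> closure B \<Longrightarrow> (f ^^ (L * n)) x - of_nat n * w \<in> closure B"
    by (rule periodic_component_basin[OF N U core_small a(1) L w walk]) (assumption, assumption, blast intro: that)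
  obtain \<rho> where \<rho>: "\<And>y. y \<in> P \<Longrightarrow> norm y \<le> \<rho>" using PB(1) unfolding bounded_iff by blast
  define C1 where "C1 = norm v * \<rho> + K1 + norm v * 4"
  have nw: "inner v (of_nat n * w) = r * real (L * n)" for n
  proof -
    have "inner v (of_nat n * w) = real n * inner v w" by (simp add: inner_complex_def algebra_simps)
    then show ?thesis using rate(1) by simp
  qed
  \<comment> \<open>A point of the basin reaches a translate of \<open>P\<close> that moves with
    rate \<open>r\<close>. Since by \<open>cost\<close> no orbit descends faster than that up to a
    constant, the point cannot have started too high.\<close>
  have B_le: "inner v x \<le> C1" if xB: "x \<in> B" for x
  proof -
    obtain n where n: "(f ^^ (L * n)) x - of_nat n * w \<in> P" using into_P[OF xB] by blast
    have "inner v ((f ^^ (L * n)) x - of_nat n * w) \<le> norm v * \<rho>"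
      using norm_cauchy_schwarz mult_left_mono[OF \<rho>[OF n], of "norm v"] order_trans by fastforce
    then have "inner v ((f ^^ (L * n)) x) \<le> norm v * \<rho> + r * real (L * n)" using nw[of n] by (simp only: inner_diff_right)
    moreover have "- K1 \<le> inner v (cell_of N ((f ^^ (L * n)) x) - cell_of N x) / N - r * real (L * n)"
      by (rule cost[OF orbit_walk[OF N]])
    moreover have "\<bar>inner v (cell_of N ((f ^^ (L * n)) x) - cell_of N x) / N - inner v ((f ^^ (L * n)) x - x)\<bar> \<le> norm v * 4"
      by (rule cost_between_cells[OF N cell_of(1)[OF N] cell_of(1)[OF N]])
    ultimately show ?thesis unfolding C1_def inner_diff_right by linarith
  qed
  have cl_le: "inner v x \<le> C1" if x: "x \<in> closure B" for x
  proof -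
    have "closed {x. inner v x \<le> C1}" by (rule closed_halfspace_le)
    then have "closure B \<subseteq> {x. inner v x \<le> C1}" using B_le by (intro closure_minimal) auto
    then show ?thesis using x by blast
  qed
  define F where "F = closure B - B"
  \<comment> \<open>A boundary point of the basin never enters \<open>U\<close>, so in
    \<open>Y\<close> its orbit is a walk in the class \<open>Y - U\<close>, which does not descend.
    But after translation by multiples of \<open>w\<close> the orbit stays in the closure of the
    basin, so it must descend with rate \<open>r\<close>.\<close>
  have "F \<inter> region N Y = {}"
  proof (rule ccontr)
    assume "F \<inter> region N Y \<noteq> {}"
    then obtain x where x: "x \<in> closure B" "x \<notin> B" "x \<in> region N Y" by (auto simp: F_def)
    have notU: "(f ^^ k) x \<notin> region N U" for k
    proof
      assume "(f ^^ k) x \<in> region N U"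
      then have "(f ^^ Suc k) x \<in> core N U" using attracting_image[OF N U] by auto
      then show False using Bcl[OF x(1)] x(2) by blast
    qed
    obtain b where b: "b \<in> Y" "x \<in> cell N b" using x(3) by (auto simp: region_def)
    have bU: "b \<in> Y - U" using b notU[of 0] by (auto simp: region_def)
    have inC: "cell_of N ((f ^^ k) x) \<in> Y - U" if "1 \<le> k" for k
    proof -
      define j where "j = k - 1"
      have j: "k = Suc j" using that by (simp add: j_def)
      have inY: "(f ^^ i) x \<in> region N Y" for i
      proof (induction i)
        case (Suc i)
        then show ?case using attracting_image[OF N Y] core_subset_region[OF N, of Y] by auto
      qed (use x in simp)
      have "(f ^^ Suc j) x \<in> core N Y" using inY[of j] attracting_image[OF N Y] by auto
      then have "cell_of N ((f ^^ k) x) \<in> Y" using cell_of(1)[OF N, of "(f ^^ k) x"] cell_of(2)[of N "(f ^^ k) x"] j by (simp add: core_def)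
      moreover have "cell_of N ((f ^^ k) x) \<notin> U" using notU[of k] cell_of(1)[OF N, of "(f ^^ k) x"] by (auto simp: region_def)
      ultimately show ?thesis by blast
    qed
    have low: "inner v x - K2 - norm v * 4 \<le> inner v ((f ^^ n) x)" for n
    proof -
      obtain c where c: "(b, c) \<in> (cell_rel N f \<inter> (Y - U) \<times> (Y - U)) ^^ n" "(f ^^ n) x \<in> cell N c"
        using orbit_walk_within[OF N bU _ b(2), of n] inC attractingD(1)[OF Y] b(1) by blast
      have "- K2 \<le> inner v (c - b) / N" by (rule cost_C[OF c(1)])
      moreover have "\<bar>inner v (c - b) / N - inner v ((f ^^ n) x - x)\<bar> \<le> norm v * 4" by (rule cost_between_cells[OF N b(2) c(2)])
      ultimately show ?thesis unfolding inner_diff_right by linarith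
    qed
    have bd: "inner v x - K2 - norm v * 4 - C1 \<le> real (L * n) * r" for n
    proof -
      have "inner v ((f ^^ (L * n)) x - of_nat n * w) \<le> C1" by (rule cl_le[OF Bh[OF x(1)]])
      then have "inner v ((f ^^ (L * n)) x) - r * real (L * n) \<le> C1" using nw[of n] by (simp only: inner_diff_right)
      then show ?thesis using low[of "L * n"] by (simp add: mult.commute)
    qed
    obtain n where n: "- (inner v x - K2 - norm v * 4 - C1) < real n * (- r)" using reals_Archimedean3[of "- r"] rate(2) by auto
    have "real n * (- r) \<le> real (L * n) * (- r)" using rate(2) mult_le_mono1[OF L, of n] by (intro mult_right_mono) (simp_all only: of_nat_le_iff less_imp_le nat_mult_1 neg_0_le_iff_le)
    then show False using n bd[of n] by simp
  qed
  moreover have cY: "center N a \<in> region N Y"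
    using a(2) center_interior[OF N, of a] interior_subset by (fastforce simp: region_def)
  then obtain K where K: "connected K" "\<not> bounded K" "K \<subseteq> region N Y" "center N a \<in> K" using Y_thick by blast
  define K' where "K' = (+) 1 ` K"
  have K': "connected K'" "\<not> bounded K'" "K' \<subseteq> region N Y" "center N a + 1 \<in> K'"
  proof -
    show "connected K'" unfolding K'_def by (rule connected_continuous_image[OF _ K(1)]) (intro continuous_intros)
    show "\<not> bounded K'" using K(2) bounded_translation[of K' "- 1"] by (auto simp: K'_def image_image)
    show "K' \<subseteq> region N Y" unfolding K'_def using K(3) region_translate[OF N Y _ gauss_ints_simps(2)] by (auto simp: add.commute)
    show "center N a + 1 \<in> K'" using K(4) by (auto simp: K'_def add.commute)
  qed
  have "F = frontier B" using PB(2) by (simp add: F_def frontier_def interior_open)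
  then have "closed F" by simp
  have notB: "center N a + 1 \<notin> B" using Bz[OF PB(3) gauss_ints_simps(2)] by auto
  \<comment> \<open>The frontier separates the basin from its translate by 1. Both centers lie on
    unbounded connected sets in \<open>Y\<close>, which the frontier avoids, so the frontier has an
    unbounded connected piece outside \<open>Y\<close>.\<close>
  have "\<not> connected_component (- F) (center N a) (center N a + 1)"
  proof
    assume "connected_component (- F) (center N a) (center N a + 1)"
    then obtain T where T: "connected T" "T \<subseteq> - F" "center N a \<in> T" "center N a + 1 \<in> T" unfolding connected_component_def by blast
    have "T \<subseteq> B \<union> - closure B" "B \<inter> - closure B \<inter> T = {}" using T(2) closure_subset[of B] by (auto simp: F_def)
    moreover have "open (- closure B)" by (simp add: open_Compl)
    ultimately have "B \<inter> T = {} \<or> - closure B \<inter> T = {}" using T(1) PB(2) unfolding connected_def by metis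
    moreover have "center N a + 1 \<notin> closure B" using T(2,4) notB by (auto simp: F_def)
    ultimately show False using T(3,4) PB(3) by blast
  qed
  then obtain X where "connected X" "\<not> bounded X" "X \<subseteq> F"
    using unbounded_component_of_separator[OF \<open>closed F\<close> K(1,2) _ K(4) K'(1,2) _ K'(4)] K(3) K'(3) calculation by blast
  then show False using Y_compl[of X] calculation by blast
qed

text \<open>If the extremal rate is only attained outside \<open>Y\<close>, the basin for the inverse map has no boundary points at all.\<close>

lemma extremal_rate_in_repeller:
  assumes N: "0 < N" and Y: "attracting N Y"
    and Y_compl: "\<And>K. connected K \<Longrightarrow> K \<inter> region N Y = {} \<Longrightarrow> bounded K"
    and a: "a \<in> gauss_ints" "a \<notin> Y" and L: "1 \<le> L" and w: "w \<in> gauss_ints" and walk: "(a, a + of_nat N * w) \<in> cell_rel N f ^^ L"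
    and rate: "inner v w = r * real L" and \<eta>: "0 < \<eta>"
    and cost: "\<And>L a b. (a, b) \<in> cell_rel N f ^^ L \<Longrightarrow> - K1 \<le> inner v (b - a) / N - r * real L"
    and cost_Y: "\<And>L a b. (a, b) \<in> (cell_rel N f \<inter> Y \<times> Y) ^^ L \<Longrightarrow> - K2 \<le> inner v (b - a) / N - r * real L - \<eta> * real L"
  shows False
proof -
  interpret i: plane_lift g f by (rule inverse_lift)
  define V where "V = gauss_ints - Y"
  have V: "i.attracting N V" "core N V = - region N Y" using repelling_complement[OF N Y] by (auto simp: V_def)
  have core_small: "bounded K" if "connected K" "K \<subseteq> core N V" for K
    using Y_compl[OF that(1)] that(2) V(2) by blast
  have mw: "- w \<in> gauss_ints" using w by simp
  have aV: "a \<in> V" using a by (simp add: V_def)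
  have "(a + of_nat N * w, a) \<in> cell_rel N g ^^ L" using walk by (simp add: inverse_relpow)
  from tinv_relpow[OF i.cell_rel_tinv[OF N] this mw]
  have walk': "(a, a + of_nat N * (- w)) \<in> cell_rel N g ^^ L" by simp
  obtain P B where PB: "bounded P" "open B" "center N a \<in> B" and "P \<subseteq> B"
    and into_P: "\<And>x. x \<in> B \<Longrightarrow> \<exists>n. (g ^^ (L * n)) x - of_nat n * (- w) \<in> P"
    and "\<And>x n. x \<in> P \<Longrightarrow> (g ^^ (L * n)) x - of_nat n * (- w) \<in> P"
    and Bz: "\<And>x z. x \<in> B \<Longrightarrow> z \<in> gauss_ints \<Longrightarrow> x + z \<in> B \<Longrightarrow> z = 0"
    and Bcl: "\<And>x k. x \<in> closure B \<Longrightarrow> (g ^^ k) x \<in> core N V \<Longrightarrow> x \<in> B"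
    and Bh: "\<And>x n. x \<in> closure B \<Longrightarrow> (g ^^ (L * n)) x - of_nat n * (- w) \<in> closure B"
    by (rule i.periodic_component_basin[OF N V(1) core_small aV L mw walk']) (assumption, assumption, blast intro: that)
  obtain \<rho> where \<rho>: "\<And>y. y \<in> P \<Longrightarrow> norm y \<le> \<rho>" using PB(1) unfolding bounded_iff by blast
  define C1 where "C1 = norm v * \<rho> + K1 + norm v * 4"
  have nw: "inner v (of_nat n * w) = r * real (L * n)" for n
  proof -
    have "inner v (of_nat n * w) = real n * inner v w" by (simp add: inner_complex_def algebra_simps)
    then show ?thesis using rate by simp
  qed
  \<comment> \<open>The inverse counterpart of the upper bound in the case of an attractor: the
    forward orbit from \<open>y\<close> to \<open>x\<close> cannot descend faster than the
    translates of \<open>P\<close>.\<close>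
  have B_ge: "- C1 \<le> inner v x" if xB: "x \<in> B" for x
  proof -
    obtain n where n: "(g ^^ (L * n)) x - of_nat n * (- w) \<in> P" using into_P[OF xB] by blast
    define y where "y = (g ^^ (L * n)) x"
    have fy: "(f ^^ (L * n)) y = x" using inverse_iterate by (simp add: y_def)
    have "y + of_nat n * w \<in> P" using n by (simp add: y_def)
    then have "norm v * norm (y + of_nat n * w) \<le> norm v * \<rho>" using \<rho> by (intro mult_left_mono) auto
    then have "\<bar>inner v (y + of_nat n * w)\<bar> \<le> norm v * \<rho>" using Cauchy_Schwarz_ineq2 order_trans by blast
    then have "- (norm v * \<rho>) \<le> inner v y + r * real (L * n)" using nw[of n] by (simp add: inner_add_right)
    moreover have "- K1 \<le> inner v (cell_of N ((f ^^ (L * n)) y) - cell_of N y) / N - r * real (L * n)"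
      by (rule cost[OF orbit_walk[OF N]])
    moreover have "\<bar>inner v (cell_of N ((f ^^ (L * n)) y) - cell_of N y) / N - inner v ((f ^^ (L * n)) y - y)\<bar> \<le> norm v * 4"
      by (rule cost_between_cells[OF N cell_of(1)[OF N] cell_of(1)[OF N]])
    ultimately show ?thesis unfolding C1_def inner_diff_right fy by linarith
  qed
  have cl_ge: "- C1 \<le> inner v x" if x: "x \<in> closure B" for x
  proof -
    have "closed {x. - C1 \<le> inner v x}" by (rule closed_halfspace_ge)
    then have "closure B \<subseteq> {x. - C1 \<le> inner v x}" using B_ge by (intro closure_minimal) auto
    then show ?thesis using x by blast
  qed
  \<comment> \<open>The backward orbit of a boundary point stays in \<open>Y\<close>, where walks
    exceed the rate \<open>r\<close> by \<open>\<eta>\<close>, while its position relative to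
    multiples of \<open>w\<close> is bounded from below. So the basin is open and closed, hence the
    whole plane, and contains points differing by 1.\<close>
  have "x \<in> B" if x: "x \<in> closure B" for x
  proof (rule ccontr)
    assume xB: "x \<notin> B"
    have inY: "(g ^^ k) x \<in> region N Y" for k using Bcl[OF x, of k] xB V(2) by blast
    have bd: "\<eta> * real (L * n) \<le> inner v x + K2 + norm v * 4 + C1" for n
    proof -
      define y where "y = (g ^^ (L * n)) x"
      have fy: "(f ^^ k) y \<in> region N Y" if "k \<le> L * n" for k
      proof -
        have "y = (g ^^ k) ((g ^^ (L * n - k)) x)" unfolding y_def using that by (simp flip: funpow_add[THEN fun_cong, unfolded comp_apply])
        then show ?thesis using inverse_iterate(1) inY by simp
      qed
      obtain b where b: "b \<in> Y" "y \<in> cell N b" using fy[of 0] by (auto simp: region_def)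
      have inC: "cell_of N ((f ^^ k) y) \<in> Y" if k: "1 \<le> k" "k \<le> L * n" for k
      proof -
        obtain j where j: "k = Suc j" using k by (cases k) auto
        have "(f ^^ Suc j) y \<in> core N Y" using fy[of j] k j attracting_image[OF N Y] by auto
        then show ?thesis using cell_of(1)[OF N, of "(f ^^ k) y"] cell_of(2)[of N "(f ^^ k) y"] j by (simp add: core_def)
      qed
      obtain c where c: "(b, c) \<in> (cell_rel N f \<inter> Y \<times> Y) ^^ (L * n)" "(f ^^ (L * n)) y \<in> cell N c"
        using orbit_walk_within[OF N b(1) _ b(2), of "L * n"] inC attractingD(1)[OF Y] b(1) by blast
      have "(f ^^ (L * n)) y = x" using inverse_iterate by (simp add: y_def)
      then have "\<bar>inner v (c - b) / N - inner v (x - y)\<bar> \<le> norm v * 4" using cost_between_cells[OF N b(2) c(2)] by simp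
      moreover have "- K2 \<le> inner v (c - b) / N - r * real (L * n) - \<eta> * real (L * n)" by (rule cost_Y[OF c(1)])
      moreover have "- C1 \<le> inner v (y + of_nat n * w)" using cl_ge[OF Bh[OF x, of n]] by (simp add: y_def)
      ultimately show ?thesis using nw[of n] unfolding inner_diff_right inner_add_right by linarith
    qed
    obtain n where n: "inner v x + K2 + norm v * 4 + C1 < real n * \<eta>" using reals_Archimedean3[OF \<eta>] by blast
    have "real n * \<eta> \<le> real (L * n) * \<eta>" using \<eta> mult_le_mono1[OF L, of n] by (intro mult_right_mono) (simp_all only: of_nat_le_iff less_imp_le nat_mult_1)
    then show False using n bd[of n] by (simp add: mult.commute)
  qed
  then have "closed B" by (metis closure_subset_eq subsetI)
  then have "B = UNIV" using PB(2,3) clopen by blast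
  then show False using Bz[of 0 1] by simp
qed

text \<open>Closed walks outside \<open>Y - U\<close> realise rotation vectors and hence
  translations on the line orthogonal to \<open>e\<close>; those in \<open>Y - U\<close> have a
  functional \<open>v\<close>. If \<open>v\<close> vanishes on that line, it is nonnegative on all
  closed walks. If not, rotation vectors on both sides of 0 force closed walks of negative rate,
  which must avoid \<open>Y - U\<close>.\<close>

lemma interior_zero_contradiction:
  assumes nf: "no_free_grid_curve f" and N3: "3 \<le> N" and nc: "\<And>a. (a, a) \<notin> (cell_rel N f)\<^sup>+"
    and e: "e \<noteq> 0" and line: "\<And>p. p \<in> rot f \<Longrightarrow> inner e p = 0"
    and p: "p \<in> rot f" "0 < inner (\<i> * e) p" and q: "q \<in> rot f" "inner (\<i> * e) q < 0"
  shows False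
proof -
  have N: "0 < N" using N3 by simp
  define E where "E = cell_rel N f"
  have ti: "tinv N E" unfolding E_def by (rule cell_rel_tinv[OF N])
  obtain D where D: "\<And>a b. (a, b) \<in> E \<Longrightarrow> norm (b - a) \<le> D" using cell_rel_bounded[OF N] unfolding E_def by blast
  obtain U Y where U: "attracting N U" and Y: "attracting N Y"
    and U_small: "\<And>K. connected K \<Longrightarrow> K \<subseteq> region N U \<Longrightarrow> bounded K"
    and Y_compl: "\<And>K. connected K \<Longrightarrow> K \<inter> region N Y = {} \<Longrightarrow> bounded K"
    and Y_thick: "\<And>p. p \<in> region N Y \<Longrightarrow> \<exists>K. connected K \<and> \<not> bounded K \<and> K \<subseteq> region N Y \<and> p \<in> K"
    and C_conn: "\<And>a b. a \<in> Y - U \<Longrightarrow> b \<in> Y - U \<Longrightarrow> \<exists>w\<in>gauss_ints. (a, b + of_nat N * w) \<in> (cell_rel N f)\<^sup>*"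
    by (rule attractor_structure[OF nf N3]) (blast intro: that)
  have nz: "w \<noteq> 0" if "1 \<le> L" "(a, a + of_nat N * w) \<in> E ^^ L" for L a w
  proof
    assume "w = 0"
    then have "(a, a) \<in> E\<^sup>+" using that by (auto simp: trancl_power intro!: exI[of _ L])
    then show False using nc unfolding E_def by blast
  qed
  have core_small: "bounded K" if "connected K" "K \<subseteq> core N U" for K
    using U_small[OF that(1)] that(2) core_subset_region[OF N, of U] by blast
  have outside: "inner e w = 0"
    if L: "1 \<le> L" and w: "w \<in> gauss_ints" and walk: "(a, a + of_nat N * w) \<in> E ^^ L" and a: "a \<notin> Y - U" "a \<in> gauss_ints" for L a w
  proof -
    have "w /\<^sub>R real L \<in> rot f"
    proof (cases "a \<in> U")
      case True
      show ?thesis by (rule attracting_rotation(1)[OF N U core_small True L w walk[unfolded E_def]])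
    next
      case False
      interpret i: plane_lift g f by (rule inverse_lift)
      define V where "V = gauss_ints - Y"
      have V: "i.attracting N V" "core N V = - region N Y" using repelling_complement[OF N Y] by (auto simp: V_def)
      have V_small: "bounded K" if "connected K" "K \<subseteq> core N V" for K
        using Y_compl[OF that(1)] that(2) V(2) by blast
      have aV: "a \<in> V" using a False by (simp add: V_def)
      have mw: "- w \<in> gauss_ints" using w by simp
      have "(a + of_nat N * w, a) \<in> cell_rel N g ^^ L" using walk by (simp add: inverse_relpow E_def)
      from tinv_relpow[OF i.cell_rel_tinv[OF N] this mw]
      have "(a, a + of_nat N * (- w)) \<in> cell_rel N g ^^ L" by simp
      from i.attracting_rotation(2)[OF N V(1) V_small aV L mw this] show ?thesis by simp
    qed
    then have "inner e (w /\<^sub>R real L) = 0" by (rule line)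
    then show ?thesis using L by simp
  qed
  \<comment> \<open>Without closed walks in the class any nonzero vector qualifies, and
    \<open>e\<close> is taken.\<close>
  obtain v where v0: "v \<noteq> 0" and vC: "\<And>L a w. \<lbrakk>1 \<le> L; w \<in> gauss_ints; a \<in> Y - U; (a, a + of_nat N * w) \<in> E ^^ L\<rbrakk> \<Longrightarrow> 0 \<le> inner v w"
  proof (cases "\<exists>a\<in>Y - U. \<exists>L w. 1 \<le> L \<and> w \<in> gauss_ints \<and> (a, a + of_nat N * w) \<in> E ^^ L")
    case False
    then show ?thesis using that[OF e] by blast
  next
    case True
    then obtain a0 L0 w0 where a0: "a0 \<in> Y - U" "1 \<le> L0" "w0 \<in> gauss_ints" "(a0, a0 + of_nat N * w0) \<in> E ^^ L0" by blast
    have w0: "(a0, a0 + of_nat N * w0) \<in> E\<^sup>+" using a0 by (auto simp: trancl_power intro!: exI[of _ L0])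
    show ?thesis
      by (rule strong_class_halfplane[OF ti nc[folded E_def] C_conn[folded E_def] a0(1,3) w0]) (assumption, assumption, rule that, assumption, blast)
  qed
  have ee: "0 < inner e e" using e by simp
  define d where "d = \<i> * e"
  \<comment> \<open>On the line, \<open>v\<close> is the coordinate along \<open>d\<close> times a
    fixed factor, whose sign is that of \<open>inner v d\<close>.\<close>
  have vx: "inner v x * inner e e = inner d x * inner v d" if "inner e x = 0" for x
    using that unfolding d_def inner_complex_def by simp algebra
  show False
  proof (cases "inner v d = 0")
    case True
    have vw0: "inner v x = 0" if "inner e x = 0" for x using vx[OF that] True ee by simp
    have loops: "0 \<le> inner v w" if "1 \<le> L" "w \<in> gauss_ints" "(a, a + of_nat N * w) \<in> E ^^ L" for L a w
    proof (cases "a \<in> Y - U")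
      case True
      then show ?thesis using vC that by blast
    next
      case False
      have "a \<in> gauss_ints"
      proof -
        obtain y where "(a, y) \<in> E" using relpow_first[OF \<open>1 \<le> L\<close> \<open>(a, a + of_nat N * w) \<in> E ^^ L\<close>] by blast
        then show ?thesis using tinvD(1)[OF ti] by blast
      qed
      then show ?thesis using vw0 outside[OF that False] by simp
    qed
    show False
    proof (cases "\<exists>w\<in>gauss_ints. w \<noteq> 0 \<and> inner v w = 0")
      case True
      then obtain w where w: "w \<in> gauss_ints" "w \<noteq> 0" "inner v w = 0" by blast
      \<comment> \<open>Rational case: a right angle turns the lattice vector orthogonal to
        \<open>v\<close> into a positive multiple of \<open>v\<close>, so \<open>v\<close> may be
        replaced by the primitive integer functional \<open>u\<close>.\<close>
      define w' where "w' = (if 0 < inner v (\<i> * w) then \<i> * w else - (\<i> * w))"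
      have "inner v (\<i> * w) \<noteq> 0"
      proof
        assume "inner v (\<i> * w) = 0"
        then have 1: "Im v * Re w - Re v * Im w = 0" and 2: "Re v * Re w + Im v * Im w = 0" using w(3) by (simp_all add: inner_complex_def)
        have "inner w w * Re v = 0" "inner w w * Im v = 0" using 1 2 unfolding inner_complex_def by algebra+
        then show False using w(2) v0 by (auto simp: complex_eq_iff)
      qed
      then have w': "w' \<in> gauss_ints" "w' \<noteq> 0" "0 < inner v w'" using w by (auto simp: w'_def)
      have par: "inner w' x * inner v w' = inner v x * inner w' w'" for x
      proof -
        have "inner v (\<i> * w') = 0" using w(3) by (auto simp: w'_def inner_complex_def)
        then show ?thesis unfolding inner_complex_def by simp algebra
      qed
      obtain u t m where u: "u \<in> gauss_ints" "t \<in> gauss_ints" "inner u t = 1" "w' = of_real m * u" "0 < m"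
        using primitive_gauss[OF w'(1,2)] .
      have mu: "inner w' x = m * inner u x" for x using u(4) by (simp add: inner_complex_def algebra_simps)
      have sgn: "inner u x = 0" if "inner v x = 0" for x using par[of x] mu[of x] that w'(3) u(5) by auto
      have pos: "0 \<le> inner u x" if "0 \<le> inner v x" for x
      proof -
        have "0 \<le> inner v x * inner w' w'" using that by simp
        then have "0 \<le> inner w' x * inner v w'" using par[of x] by simp
        then have "0 \<le> m * inner u x" using w'(3) mu[of x] by (simp add: zero_le_mult_iff)
        then show ?thesis using u(5) by (simp add: zero_le_mult_iff)
      qed
      show False
        by (rule closed_walks_nonneg_free_curve[OF nf u(1-3) _ N])
          (use sgn vw0 line pos loops in \<open>auto simp: E_def\<close>)
    next
      case False
      \<comment> \<open>Irrational case: only 0 is orthogonal to \<open>v\<close>, and 0 is not the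
        translation of a closed walk. So \<open>v\<close> grows along walks with a uniform rate
        \<open>\<eta>\<close>, although it vanishes at the rotation vector \<open>p\<close>.\<close>
      have strict: "0 < inner v w + 0 * real L" if "1 \<le> L" "L \<le> N * N" "w \<in> gauss_ints" "(a, a + of_nat N * w) \<in> E ^^ L" for L a w
        using loops[OF that(1,3,4)] nz[OF that(1,4)] False that(3) by fastforce
      obtain \<eta> where \<eta>: "0 < \<eta>" "\<And>L a w. \<lbrakk>1 \<le> L; L \<le> N * N; w \<in> gauss_ints; (a, a + of_nat N * w) \<in> E ^^ L\<rbrakk> \<Longrightarrow> \<eta> * real L \<le> inner v w + 0 * real L"
        using strict_loops[OF ti N D, of v 0] strict by metis
      have "0 \<le> inner v w + (- \<eta>) * real L" if "1 \<le> L" "L \<le> N * N" "w \<in> gauss_ints" "(a, a + of_nat N * w) \<in> E ^^ L" for L a w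
        using \<eta>(2)[OF that] by simp
      then obtain K where K: "\<And>L a b. (a, b) \<in> E ^^ L \<Longrightarrow> - K \<le> inner v (b - a) / N + (- \<eta>) * real L"
        using walk_cost_bounded_below[OF ti N D, of v "- \<eta>"] by metis
      have "- (- \<eta>) \<le> inner v p" by (rule rot_walk_cost[OF N K[unfolded E_def] p(1)])
      then show False using vw0[OF line[OF p(1)]] \<eta>(1) by simp
    qed
  next
    case False
    obtain s where s: "s \<in> rot f" "inner v s < 0"
    proof (cases "0 < inner v d")
      case True
      then have "inner d q * inner v d < 0" using q(2) by (simp add: d_def mult_neg_pos)
      then have "inner v q < 0" using vx[OF line[OF q(1)]] ee by (metis mult_less_0_iff not_less_iff_gr_or_eq)
      then show ?thesis using that q(1) by blast
    next
      case neg: False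
      then have "inner v d < 0" using False by simp
      then have "inner d p * inner v d < 0" using p(2) by (simp add: d_def mult_pos_neg)
      then have "inner v p < 0" using vx[OF line[OF p(1)]] ee by (metis mult_less_0_iff not_less_iff_gr_or_eq)
      then show ?thesis using that p(1) by blast
    qed
    define T where "T = {(L, w). 1 \<le> L \<and> L \<le> N * N \<and> w \<in> gauss_ints \<and> (\<exists>a. (a, a + of_nat N * w) \<in> E ^^ L)}"
    define rates where "rates = (\<lambda>(L, w). inner v w / real L) ` T"
    have "finite rates" unfolding rates_def T_def by (rule finite_imageI[OF finite_loops[OF N D]])
    have ex_neg: "\<exists>x\<in>rates. x < 0"
    proof (rule ccontr)
      assume neg: "\<not> ?thesis"
      have "0 \<le> inner v w + 0 * real L" if h: "1 \<le> L" "L \<le> N * N" "w \<in> gauss_ints" "(a, a + of_nat N * w) \<in> E ^^ L" for L a w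
      proof -
        have "(L, w) \<in> T" using h by (auto simp: T_def)
        then have "inner v w / real L \<in> rates" unfolding rates_def by force
        then have "0 \<le> inner v w / real L" using neg by force
        then show ?thesis using h(1) by (simp add: zero_le_divide_iff)
      qed
      then obtain K where K: "\<And>L a b. (a, b) \<in> E ^^ L \<Longrightarrow> - K \<le> inner v (b - a) / N + 0 * real L"
        using walk_cost_bounded_below[OF ti N D, of v 0] by metis
      have "- 0 \<le> inner v s" by (rule rot_walk_cost[OF N K[unfolded E_def] s(1)])
      then show False using s(2) by simp
    qed
    \<comment> \<open>The steepest descent among short closed walks; by cutting out loops it bounds
      all walks up to a constant. It is negative since \<open>inner v s < 0\<close> for some
      rotation vector \<open>s\<close>.\<close>
    define r where "r = Min rates"
    have r: "r \<in> rates" "r < 0" "\<And>x. x \<in> rates \<Longrightarrow> r \<le> x"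
    proof -
      have "rates \<noteq> {}" using ex_neg by blast
      then show "r \<in> rates" "\<And>x. x \<in> rates \<Longrightarrow> r \<le> x" using \<open>finite rates\<close> by (auto simp: r_def)
      then show "r < 0" using ex_neg by fastforce
    qed
    have loops: "0 \<le> inner v w + (- r) * real L" if h: "1 \<le> L" "L \<le> N * N" "w \<in> gauss_ints" "(a, a + of_nat N * w) \<in> E ^^ L" for L a w
    proof -
      have "(L, w) \<in> T" using h by (auto simp: T_def)
      then have "inner v w / real L \<in> rates" unfolding rates_def by force
      then have "r \<le> inner v w / real L" by (rule r(3))
      then show ?thesis using h(1) by (simp add: pos_le_divide_eq)
    qed
    obtain K1 where K1: "\<And>L a b. (a, b) \<in> E ^^ L \<Longrightarrow> - K1 \<le> inner v (b - a) / N + (- r) * real L"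
      using walk_cost_bounded_below[OF ti N D, of v "- r"] loops by metis
    have K1': "- K1 \<le> inner v (b - a) / N - r * real L" if "(a, b) \<in> cell_rel N f ^^ L" for L a b
      using K1[unfolded E_def, OF that] by simp
    have step_gauss: "a \<in> gauss_ints" if "1 \<le> L" "(a, b) \<in> E ^^ L" for L a b
    proof -
      obtain y where "(a, y) \<in> E" using relpow_first[OF \<open>1 \<le> L\<close> \<open>(a, b) \<in> E ^^ L\<close>] by blast
      then show ?thesis using tinvD(1)[OF ti] by blast
    qed
    show False
    proof (cases "\<exists>L a w. 1 \<le> L \<and> L \<le> N * N \<and> w \<in> gauss_ints \<and> a \<in> Y \<and> (a, a + of_nat N * w) \<in> E ^^ L \<and> inner v w = r * real L")
      case True
      then obtain L a w where h: "1 \<le> L" "L \<le> N * N" "w \<in> gauss_ints" "a \<in> Y" "(a, a + of_nat N * w) \<in> E ^^ L" "inner v w = r * real L" by blast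
      have "a \<in> U"
      proof (rule ccontr)
        assume "a \<notin> U"
        then have "0 \<le> inner v w" using vC[OF h(1,3) _ h(5)] h(4) by blast
        moreover have "r * real L < 0" using r(2) h(1) by (intro mult_neg_pos) auto
        ultimately show False using h(6) by simp
      qed
      let ?C = "Y - U"
      have Ct: "x + of_nat N * w \<in> ?C" if "x \<in> ?C" "w \<in> gauss_ints" for x w
        using that attractingD(2)[OF Y] attractingD(2)[OF U, of "x + of_nat N * w" "- w"] by auto
      have tiC: "tinv N (E \<inter> ?C \<times> ?C)" by (rule tinv_restrict[OF ti Ct])
      have DC: "norm (b - a) \<le> D" if "(a, b) \<in> E \<inter> ?C \<times> ?C" for a b using D that by blast
      have "0 \<le> inner v w + 0 * real L" if h: "1 \<le> L" "L \<le> N * N" "w \<in> gauss_ints" "(a, a + of_nat N * w) \<in> (E \<inter> ?C \<times> ?C) ^^ L" for L a w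
      proof -
        have "a \<in> ?C"
        proof -
          obtain y where "(a, y) \<in> E \<inter> ?C \<times> ?C" using relpow_first[OF h(1) h(4)] by blast
          then show ?thesis by blast
        qed
        then show ?thesis using vC[OF h(1,3)] relpow_restrict[OF h(4)] by simp
      qed
      then obtain K2 where K2: "\<And>L a b. (a, b) \<in> (E \<inter> ?C \<times> ?C) ^^ L \<Longrightarrow> - K2 \<le> inner v (b - a) / N + 0 * real L"
        using walk_cost_bounded_below[OF tiC N DC, of v 0] by metis
      have K2': "- K2 \<le> inner v (b - a) / N" if "(a, b) \<in> (cell_rel N f \<inter> ?C \<times> ?C) ^^ L" for L a b
        using K2[unfolded E_def, OF that] by simp
      show False
        by (rule extremal_rate_in_attractor[OF N U Y U_small Y_compl Y_thick \<open>a \<in> U\<close> h(4,1,3) h(5)[unfolded E_def] h(6) r(2) K1' K2'])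
    next
      \<comment> \<open>No short closed walk starting in \<open>Y\<close> attains \<open>r\<close>,
        so by finiteness walks inside \<open>Y\<close> exceed it by a uniform
        \<open>\<eta>\<close>.\<close>
      case noY: False
      obtain L w a where h: "1 \<le> L" "L \<le> N * N" "w \<in> gauss_ints" "(a, a + of_nat N * w) \<in> E ^^ L" "r = inner v w / real L"
        using r(1) unfolding rates_def T_def by auto
      have rate: "inner v w = r * real L" using h(1,5) by simp
      have aY: "a \<notin> Y" using noY h rate by blast
      have tiY: "tinv N (E \<inter> Y \<times> Y)" by (rule tinv_restrict[OF ti attractingD(2)[OF Y]])
      have DY: "norm (b - a) \<le> D" if "(a, b) \<in> E \<inter> Y \<times> Y" for a b using D that by blast
      have "0 < inner v w + (- r) * real L" if h: "1 \<le> L" "L \<le> N * N" "w \<in> gauss_ints" "(a, a + of_nat N * w) \<in> (E \<inter> Y \<times> Y) ^^ L" for L a w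
      proof -
        have "a \<in> Y"
        proof -
          obtain y where "(a, y) \<in> E \<inter> Y \<times> Y" using relpow_first[OF h(1) h(4)] by blast
          then show ?thesis by blast
        qed
        then have "inner v w \<noteq> r * real L" using noY h relpow_restrict[OF h(4)] by blast
        then show ?thesis using loops[OF h(1-3) relpow_restrict[OF h(4)]] by simp
      qed
      then obtain \<eta> where \<eta>: "0 < \<eta>" "\<And>L a w. \<lbrakk>1 \<le> L; L \<le> N * N; w \<in> gauss_ints; (a, a + of_nat N * w) \<in> (E \<inter> Y \<times> Y) ^^ L\<rbrakk> \<Longrightarrow> \<eta> * real L \<le> inner v w + (- r) * real L"
        using strict_loops[OF tiY N DY, of v "- r"] by metis
      have "0 \<le> inner v w + (- r - \<eta>) * real L" if "1 \<le> L" "L \<le> N * N" "w \<in> gauss_ints" "(a, a + of_nat N * w) \<in> (E \<inter> Y \<times> Y) ^^ L" for L a w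
        using \<eta>(2)[OF that] by (simp add: algebra_simps)
      then obtain K2 where K2: "\<And>L a b. (a, b) \<in> (E \<inter> Y \<times> Y) ^^ L \<Longrightarrow> - K2 \<le> inner v (b - a) / N + (- r - \<eta>) * real L"
        using walk_cost_bounded_below[OF tiY N DY, of v "- r - \<eta>"] by metis
      have K2': "- K2 \<le> inner v (b - a) / N - r * real L - \<eta> * real L" if "(a, b) \<in> (cell_rel N f \<inter> Y \<times> Y) ^^ L" for L a b
        using K2[unfolded E_def, OF that] by (simp add: algebra_simps)
      show False
        by (rule extremal_rate_in_repeller[OF N Y Y_compl step_gauss[OF h(1,4)] aY h(1,3) h(4)[unfolded E_def] rate \<eta>(1) K1' K2'])
    qed
  qed
qed

end

section \<open>Slow orbits\<close>

lemma card_less_Suc_Collect: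
  "card {i. i < Suc n \<and> Q i} = card {i. i < n \<and> Q i} + (if Q n then 1 else 0)"
proof -
  have "{i. i < Suc n \<and> Q i} = (if Q n then insert n {i. i < n \<and> Q i} else {i. i < n \<and> Q i})"
    by (auto simp: less_Suc_eq)
  then show ?thesis by simp
qed

text \<open>Over each maximal run of indices satisfying \<open>P\<close> the sum telescopes to at
  least \<open>- C\<close>, and the number of runs is at most one more than the number of changes.
  The induction carries the potential of the run still in progress.\<close>

lemma telescoping_runs:
  fixes \<psi> :: "nat \<Rightarrow> real"
  assumes "\<And>i. 0 \<le> \<psi> i" "\<And>i. \<psi> i \<le> C"
  shows "- C * (1 + real (card {i. i < n \<and> P i \<noteq> P (Suc i)})) \<le> (\<Sum>i<n. if P i then \<psi> i - \<psi> (Suc i) else 0)"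
proof -
  have "- C * real (card {i. i < n \<and> P i \<noteq> P (Suc i)}) \<le> (\<Sum>i<n. if P i then \<psi> i - \<psi> (Suc i) else 0) + (if P n then \<psi> n else 0)"
  proof (induction n)
    case 0
    then show ?case using assms by simp
  next
    case (Suc n)
    have c: "real (card {i. i < Suc n \<and> P i \<noteq> P (Suc i)}) = real (card {i. i < n \<and> P i \<noteq> P (Suc i)}) + (if P n \<noteq> P (Suc n) then 1 else 0)"
      by (simp add: card_less_Suc_Collect)
    show ?case
      using Suc.IH assms(1)[of n] assms(2)[of n] assms(1)[of "Suc n"] assms(2)[of "Suc n"]
      unfolding c sum.lessThan_Suc by (cases "P n"; cases "P (Suc n)") (simp_all add: algebra_simps)
  qed
  moreover have "(if P n then \<psi> n else 0) \<le> C" using assms[of n] order_trans[OF assms(1,2)] by simp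
  ultimately show ?thesis by (simp add: algebra_simps)
qed

definition edge_class :: "nat \<Rightarrow> complex \<times> complex \<Rightarrow> (complex \<times> complex) set" where
  "edge_class N e = {(fst e + of_nat N * w, snd e + of_nat N * w) | w. w \<in> gauss_ints}"

lemma edge_class_shift:
  assumes "(a, b) \<in> edge_class N e" "w \<in> gauss_ints" shows "(a + of_nat N * w, b + of_nat N * w) \<in> edge_class N e"
proof -
  obtain u where u: "u \<in> gauss_ints" "a = fst e + of_nat N * u" "b = snd e + of_nat N * u" using assms(1) by (auto simp: edge_class_def)
  then show ?thesis using assms(2) unfolding edge_class_def by (auto intro!: exI[of _ "u + w"] simp: algebra_simps)
qed

lemma tinv_edge_class_subset: "tinv N E \<Longrightarrow> e \<in> E \<Longrightarrow> edge_class N e \<subseteq> E"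
  unfolding edge_class_def using tinvD(3)[of N E "fst e" "snd e"] by auto

lemma tinv_Diff_edge_class:
  assumes "tinv N E" shows "tinv N (E - edge_class N e)"
  unfolding tinv_def
proof (clarsimp, intro conjI ballI)
  fix a b assume ab: "(a, b) \<in> E" "(a, b) \<notin> edge_class N e"
  show "a \<in> gauss_ints" "b \<in> gauss_ints" using tinvD[OF assms ab(1)] by auto
  fix w assume w: "w \<in> gauss_ints"
  show "(a + of_nat N * w, b + of_nat N * w) \<in> E" using tinvD(3)[OF assms ab(1) w] .
  show "(a + of_nat N * w, b + of_nat N * w) \<notin> edge_class N e"
    using edge_class_shift[of _ _ N e "- w"] ab(2) w by fastforce
qed

text \<open>Edges starting in the fundamental domain are the measure for the removal of edge classes
  in \<open>not_slow\<close>.\<close>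

lemma card_edge_classes_less:
  assumes E: "tinv N E" and N: "0 < N" and D: "\<And>a b. (a, b) \<in> E \<Longrightarrow> norm (b - a) \<le> D" and e: "e \<in> E"
  shows "card ((E - edge_class N e) \<inter> residues N \<times> UNIV) < card (E \<inter> residues N \<times> UNIV)"
proof (rule psubset_card_mono)
  have "E \<inter> residues N \<times> UNIV \<subseteq> (\<lambda>(a, d). (a, a + d)) ` (residues N \<times> {d \<in> gauss_ints. norm d \<le> D})"
  proof clarify
    fix a b assume ab: "(a, b) \<in> E" "a \<in> residues N"
    have "b - a \<in> gauss_ints" using tinvD[OF E ab(1)] by simp
    then show "(a, b) \<in> (\<lambda>(a, d). (a, a + d)) ` (residues N \<times> {d \<in> gauss_ints. norm d \<le> D})"
      using ab D by (intro image_eqI[of _ _ "(a, b - a)"]) auto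
  qed
  then show "finite (E \<inter> residues N \<times> UNIV)"
    using finite_residues finite_gauss_bounded by (meson finite_SigmaI finite_imageI finite_subset)
  obtain w where w: "w \<in> gauss_ints" "fst e + of_nat N * w \<in> residues N"
    using residue_ex[OF N] tinvD(1)[OF E, of "fst e" "snd e"] e by auto
  then have "(fst e + of_nat N * w, snd e + of_nat N * w) \<in> edge_class N e" by (auto simp: edge_class_def)
  then show "(E - edge_class N e) \<inter> residues N \<times> UNIV \<subset> E \<inter> residues N \<times> UNIV"
    using w(2) tinv_edge_class_subset[OF E e] by blast
qed

context plane_lift
begin

text \<open>The potential \<open>\<psi>\<close> is, up to a constant, the infimum over the future
  orbit of the displacement in direction \<open>u\<close> with \<open>\<delta>\<close> added per
  step; it is bounded as rotation vectors have nonnegative coordinate. A single step then gains at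
  least the decrease of \<open>\<psi>\<close> minus \<open>\<delta>\<close>, and only the number of
  runs of \<open>P\<close> matters.\<close>

lemma drift_along_runs:
  assumes u: "\<And>p. p \<in> rot f \<Longrightarrow> 0 \<le> inner u p" and \<delta>: "0 < \<delta>"
  obtains C where "0 \<le> C" "\<And>x n P. - \<delta> * real n - C * (1 + real (card {i. i < n \<and> P i \<noteq> P (Suc i)}))
    \<le> (\<Sum>i<n. if P i then inner u ((f ^^ Suc i) x - (f ^^ i) x) else 0)"
proof -
  have "- \<delta> < inner u p" if "p \<in> rot f" for p using u[OF that] \<delta> by simp
  then obtain n0 where n0: "\<And>n x. n0 \<le> n \<Longrightarrow> - \<delta> * real n \<le> inner u ((f ^^ n) x - x)" using rot_drift by blast
  obtain M where M: "0 \<le> M" "\<And>z. norm (f z - z) \<le> M" using displacement_bounded by blast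
  define C where "C = norm u * (real n0 * M)"
  have C0: "0 \<le> C" using M by (simp add: C_def)
  have low: "- C \<le> inner u ((f ^^ n) x - x) + \<delta> * real n" for n x
  proof (cases "n0 \<le> n")
    case True
    then show ?thesis using n0[OF True, of x] C0 by simp
  next
    case False
    have "norm ((f ^^ n) x - x) \<le> real n0 * M"
      using iterate_displacement[OF M(2), of n x] mult_right_mono[of "real n" "real n0" M] M(1) False by linarith
    then have "\<bar>inner u ((f ^^ n) x - x)\<bar> \<le> C" unfolding C_def
      using Cauchy_Schwarz_ineq2[of u] mult_left_mono[of _ _ "norm u"] order_trans norm_ge_zero by meson
    moreover have "0 \<le> \<delta> * real n" using \<delta> by simp
    ultimately show ?thesis by linarith
  qed
  define G where "G = (\<lambda>z. range (\<lambda>k. inner u ((f ^^ k) z - z) + \<delta> * real k))"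
  define \<psi> where "\<psi> = (\<lambda>z. Inf (G z) + C)"
  have bdd: "bdd_below (G z)" for z using low unfolding G_def by (intro bdd_belowI[of _ "- C"]) auto
  have \<psi>0: "0 \<le> \<psi> z" for z
  proof -
    have "- C \<le> Inf (G z)" using low by (intro cInf_greatest) (auto simp: G_def)
    then show ?thesis by (simp add: \<psi>_def)
  qed
  have \<psi>C: "\<psi> z \<le> C" for z
  proof -
    have "0 \<in> G z" unfolding G_def by (intro image_eqI[of _ _ 0]) auto
    then have "Inf (G z) \<le> 0" by (rule cInf_lower[OF _ bdd])
    then show ?thesis by (simp add: \<psi>_def)
  qed
  have step: "\<psi> z - \<psi> (f z) - \<delta> \<le> inner u (f z - z)" for z
  proof -
    have "Inf (G z) - inner u (f z - z) - \<delta> \<le> Inf (G (f z))"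
    proof (rule cInf_greatest)
      show "G (f z) \<noteq> {}" by (simp add: G_def)
      fix y assume "y \<in> G (f z)"
      then obtain k where k: "y = inner u ((f ^^ k) (f z) - f z) + \<delta> * real k" by (auto simp: G_def)
      have "inner u ((f ^^ Suc k) z - z) + \<delta> * real (Suc k) \<in> G z" unfolding G_def by (rule rangeI)
      then have "Inf (G z) \<le> inner u ((f ^^ Suc k) z - z) + \<delta> * real (Suc k)" by (rule cInf_lower[OF _ bdd])
      also have "\<dots> = y + inner u (f z - z) + \<delta>" unfolding k funpow_Suc_right comp_def by (simp add: inner_diff_right algebra_simps)
      finally show "Inf (G z) - inner u (f z - z) - \<delta> \<le> y" by simp
    qed
    then show ?thesis by (simp add: \<psi>_def)
  qed
  show ?thesis
  proof (rule that[OF C0])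
    fix x n and P :: "nat \<Rightarrow> bool"
    have "- C * (1 + real (card {i. i < n \<and> P i \<noteq> P (Suc i)})) - \<delta> * real n
      \<le> (\<Sum>i<n. if P i then \<psi> ((f ^^ i) x) - \<psi> ((f ^^ Suc i) x) else 0) + (\<Sum>i<n. - \<delta>)"
      using telescoping_runs[of "\<lambda>i. \<psi> ((f ^^ i) x)" C n P] \<psi>0 \<psi>C by (simp add: algebra_simps)
    also have "\<dots> \<le> (\<Sum>i<n. if P i then inner u ((f ^^ Suc i) x - (f ^^ i) x) else 0)"
      unfolding sum.distrib[symmetric] using step[of "(f ^^ i) x" for i] \<delta>
      by (intro sum_mono) (auto simp: algebra_simps intro: less_imp_le)
    finally show "- \<delta> * real n - C * (1 + real (card {i. i < n \<and> P i \<noteq> P (Suc i)}))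
      \<le> (\<Sum>i<n. if P i then inner u ((f ^^ Suc i) x - (f ^^ i) x) else 0)" by simp
  qed
qed

definition outside :: "nat \<Rightarrow> (complex \<times> complex) set \<Rightarrow> complex \<Rightarrow> nat \<Rightarrow> real" where
  "outside N E x n = real (card {i. i < n \<and> (cell_of N ((f ^^ i) x), cell_of N ((f ^^ Suc i) x)) \<notin> E})"

definition visits :: "nat \<Rightarrow> complex \<times> complex \<Rightarrow> complex \<Rightarrow> nat \<Rightarrow> real" where
  "visits N e x n = real (card {i. i < n \<and> (cell_of N ((f ^^ i) x), cell_of N ((f ^^ Suc i) x)) \<in> edge_class N e})"

text \<open>The conjunct \<open>1 \<le> \<epsilon> * n\<close> forces \<open>n\<close> to be large when \<open>\<epsilon>\<close> is small.\<close>

definition slow :: "nat \<Rightarrow> (complex \<times> complex) set \<Rightarrow> bool" where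
  "slow N E \<longleftrightarrow> (\<forall>\<epsilon>>0. \<exists>x n. 1 \<le> \<epsilon> * real n \<and> outside N E x n \<le> \<epsilon> * real n \<and> norm ((f ^^ n) x - x) \<le> \<epsilon> * real n)"

lemma outside_Diff: "outside N (E - edge_class N e) x n \<le> outside N E x n + visits N e x n"
proof -
  have "{i. i < n \<and> (cell_of N ((f ^^ i) x), cell_of N ((f ^^ Suc i) x)) \<notin> E - edge_class N e} \<subseteq>
    {i. i < n \<and> (cell_of N ((f ^^ i) x), cell_of N ((f ^^ Suc i) x)) \<notin> E} \<union> {i. i < n \<and> (cell_of N ((f ^^ i) x), cell_of N ((f ^^ Suc i) x)) \<in> edge_class N e}" (is "?A \<subseteq> ?B \<union> ?C")
    by blast
  then have "card ?A \<le> card (?B \<union> ?C)" by (intro card_mono) auto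
  also have "\<dots> \<le> card ?B + card ?C" by (rule card_Un_le)
  finally show ?thesis unfolding outside_def visits_def by linarith
qed

lemma slow_Diff:
  assumes slow: "slow N E"
    and few: "\<And>\<epsilon>. 0 < \<epsilon> \<Longrightarrow> \<exists>\<epsilon>'>0. \<forall>x n. 1 \<le> \<epsilon>' * real n \<longrightarrow> outside N E x n \<le> \<epsilon>' * real n \<longrightarrow> norm ((f ^^ n) x - x) \<le> \<epsilon>' * real n
      \<longrightarrow> visits N e x n \<le> \<epsilon> * real n"
  shows "slow N (E - edge_class N e)"
  unfolding slow_def
proof (intro allI impI)
  fix \<epsilon> :: real assume \<epsilon>: "0 < \<epsilon>"
  obtain \<epsilon>' where e': "0 < \<epsilon>'" and v: "\<And>x n. 1 \<le> \<epsilon>' * real n \<Longrightarrow> outside N E x n \<le> \<epsilon>' * real n \<Longrightarrow> norm ((f ^^ n) x - x) \<le> \<epsilon>' * real n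
      \<Longrightarrow> visits N e x n \<le> \<epsilon> / 2 * real n"
    using few[of "\<epsilon> / 2"] \<epsilon> by auto
  define \<gamma> where "\<gamma> = min \<epsilon>' (\<epsilon> / 2)"
  have "0 < \<gamma>" using e' \<epsilon> by (simp add: \<gamma>_def)
  then obtain x n where h: "1 \<le> \<gamma> * real n" "outside N E x n \<le> \<gamma> * real n" "norm ((f ^^ n) x - x) \<le> \<gamma> * real n"
    using slow unfolding slow_def by blast
  have g: "\<gamma> * real n \<le> \<epsilon>' * real n" "\<gamma> * real n \<le> \<epsilon> / 2 * real n" using mult_right_mono[of \<gamma> \<epsilon>' "real n"] mult_right_mono[of \<gamma> "\<epsilon> / 2" "real n"] by (simp_all add: \<gamma>_def)
  have "visits N e x n \<le> \<epsilon> / 2 * real n" using h g(1) by (intro v) linarith+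
  then have "outside N (E - edge_class N e) x n \<le> \<epsilon> * real n" using outside_Diff[of N E e x n] h(2) g(2) by simp
  moreover have "1 \<le> \<epsilon> * real n" "norm ((f ^^ n) x - x) \<le> \<epsilon> * real n" using h g(2) \<epsilon> by auto
  ultimately show "\<exists>x n. 1 \<le> \<epsilon> * real n \<and> outside N (E - edge_class N e) x n \<le> \<epsilon> * real n \<and> norm ((f ^^ n) x - x) \<le> \<epsilon> * real n" by blast
qed

text \<open>Between two visits to an edge from \<open>a\<close> to \<open>b\<close> without return walk, the orbit must leave the subgraph.\<close>

lemma visits_one_way:
  assumes E: "tinv N E" and N: "0 < N" and ab: "(a, b) \<in> E" and no: "\<And>w. w \<in> gauss_ints \<Longrightarrow> (b, a + of_nat N * w) \<notin> E\<^sup>*"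
  shows "visits N (a, b) x n \<le> outside N E x n + 1"
proof -
  define c where "c = (\<lambda>i. cell_of N ((f ^^ i) x))"
  \<comment> \<open>Being reachable from a translate of \<open>b\<close>. A visit to the edge
    switches this from false to true, and only a step outside \<open>E\<close> can switch it
    back.\<close>
  define R where "R = (\<lambda>i. \<exists>w\<in>gauss_ints. (b + of_nat N * w, c i) \<in> E\<^sup>*)"
  have "visits N (a, b) x n \<le> outside N E x n + (if R n then 1 else 0)"
  proof (induction n)
    case 0
    then show ?case by (simp add: visits_def outside_def)
  next
    case (Suc n)
    have V: "visits N (a, b) x (Suc n) = visits N (a, b) x n + (if (c n, c (Suc n)) \<in> edge_class N (a, b) then 1 else 0)"
      unfolding visits_def c_def card_less_Suc_Collect by simp
    have O: "outside N E x (Suc n) = outside N E x n + (if (c n, c (Suc n)) \<notin> E then 1 else 0)"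
      unfolding outside_def c_def card_less_Suc_Collect by simp
    show ?case
    proof (cases "(c n, c (Suc n)) \<in> edge_class N (a, b)")
      case True
      then obtain w where w: "w \<in> gauss_ints" "c n = a + of_nat N * w" "c (Suc n) = b + of_nat N * w" by (auto simp: edge_class_def)
      have "R (Suc n)" unfolding R_def using w by auto
      moreover have "\<not> R n"
      proof
        assume "R n"
        then obtain u where u: "u \<in> gauss_ints" "(b + of_nat N * u, a + of_nat N * w) \<in> E\<^sup>*" unfolding R_def w(2) by blast
        have "(b, a + of_nat N * (w - u)) \<in> E\<^sup>*" using tinv_rtrancl[OF E u(2) gauss_ints_minus[OF u(1)]] by (simp add: algebra_simps)
        then show False using no[of "w - u"] w(1) u(1) by simp
      qed
      moreover have "(c n, c (Suc n)) \<in> E" using True tinv_edge_class_subset[OF E ab] by blast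
      ultimately show ?thesis using Suc.IH V O True by simp
    next
      case False
      have "R n \<Longrightarrow> (c n, c (Suc n)) \<in> E \<Longrightarrow> R (Suc n)" unfolding R_def by (blast intro: rtrancl_into_rtrancl)
      then show ?thesis using Suc.IH V O False by (auto split: if_splits)
    qed
  qed
  then show ?thesis by (auto split: if_splits)
qed

text \<open>The infimum \<open>\<phi>\<close> of the costs of walks ending at a vertex is a potential. Some edge has positive reduced cost,
  whereas the total displacement inside \<open>X\<close> along a slow orbit is negligible in every direction.\<close>

lemma visits_positive_cost:
  assumes N: "0 < N" and E: "tinv N E" and e: "norm e = 1"
    and line: "\<And>p. p \<in> rot f \<Longrightarrow> inner e p = 0" and side: "\<And>p. p \<in> rot f \<Longrightarrow> 0 \<le> inner (\<i> * e) p"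
    and Xt: "\<And>a w. a \<in> X \<Longrightarrow> w \<in> gauss_ints \<Longrightarrow> a + of_nat N * w \<in> X"
    and Xc: "\<And>a b. (a, b) \<in> E \<Longrightarrow> a \<in> X \<longleftrightarrow> b \<in> X"
    and cost: "\<And>L a b. (a, b) \<in> (E \<inter> X \<times> X) ^^ L \<Longrightarrow> - K \<le> inner v (b - a) / N"
    and loop: "a0 \<in> X" "(a0, a0 + of_nat N * s) \<in> E\<^sup>+" "s \<in> gauss_ints" "0 < inner v s"
  obtains p where "p \<in> E" "\<And>\<epsilon>. 0 < \<epsilon> \<Longrightarrow> \<exists>\<epsilon>'>0. \<forall>x n. 1 \<le> \<epsilon>' * real n \<longrightarrow> outside N E x n \<le> \<epsilon>' * real n
      \<longrightarrow> norm ((f ^^ n) x - x) \<le> \<epsilon>' * real n \<longrightarrow> visits N p x n \<le> \<epsilon> * real n"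
proof -
  define G where "G = (\<lambda>b. {inner v (b - a) / N | a L. (a, b) \<in> (E \<inter> X \<times> X) ^^ L})"
  define \<phi> where "\<phi> = (\<lambda>b. if b \<in> X then Inf (G b) else 0)"
  have K0: "0 \<le> K" using cost[of a0 a0 0] by simp
  have G0: "0 \<in> G b" for b unfolding G_def by (auto intro!: exI[of _ b] exI[of _ "0::nat"])
  have bdd: "bdd_below (G b)" for b using cost unfolding G_def by (intro bdd_belowI[of _ "- K"]) auto
  have \<phi>0: "\<phi> b \<le> 0" for b using cInf_lower[OF G0 bdd] by (simp add: \<phi>_def)
  have \<phi>K: "- K \<le> \<phi> b" for b
  proof -
    have "- K \<le> Inf (G b)" using G0[of b] cost by (intro cInf_greatest) (auto simp: G_def)
    then show ?thesis using K0 by (simp add: \<phi>_def)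
  qed
  have \<phi>step: "\<phi> c \<le> \<phi> b + inner v (c - b) / N" if bc: "(b, c) \<in> E" and b: "b \<in> X" for b c
  proof -
    have c: "c \<in> X" using Xc[OF bc] b by blast
    have "Inf (G c) - inner v (c - b) / N \<le> Inf (G b)"
    proof (rule cInf_greatest)
      show "G b \<noteq> {}" using G0 by blast
      fix y assume "y \<in> G b"
      then obtain a L where y: "y = inner v (b - a) / N" "(a, b) \<in> (E \<inter> X \<times> X) ^^ L" by (auto simp: G_def)
      have "(a, c) \<in> (E \<inter> X \<times> X) ^^ Suc L" using y(2) bc b c by auto
      then have "inner v (c - a) / N \<in> G c" unfolding G_def by blast
      then have "Inf (G c) \<le> inner v (c - a) / N" by (rule cInf_lower[OF _ bdd])
      moreover have "inner v (c - a) / N = y + inner v (c - b) / N" unfolding y(1) by (simp add: inner_diff_right add_divide_distrib[symmetric])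
      ultimately show "Inf (G c) - inner v (c - b) / N \<le> y" by simp
    qed
    then show ?thesis using b c by (simp add: \<phi>_def)
  qed
  have tiX: "tinv N (E \<inter> X \<times> X)" by (rule tinv_restrict[OF E Xt])
  have Gsub: "G b \<subseteq> G (b + of_nat N * w)" if w: "w \<in> gauss_ints" for b w
  proof
    fix y assume "y \<in> G b"
    then obtain a L where y: "y = inner v (b - a) / N" "(a, b) \<in> (E \<inter> X \<times> X) ^^ L" by (auto simp: G_def)
    have "(a + of_nat N * w, b + of_nat N * w) \<in> (E \<inter> X \<times> X) ^^ L" by (rule tinv_relpow[OF tiX y(2) w])
    then show "y \<in> G (b + of_nat N * w)" unfolding G_def y(1) by force
  qed
  have \<phi>per: "\<phi> (b + of_nat N * w) = \<phi> b" if w: "w \<in> gauss_ints" for b w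
  proof -
    have "G (b + of_nat N * w) = G b" using Gsub[OF w, of b] Gsub[of "- w" "b + of_nat N * w"] w by auto
    moreover have "b + of_nat N * w \<in> X \<longleftrightarrow> b \<in> X" using Xt[of b w] Xt[of "b + of_nat N * w" "- w"] w by auto
    ultimately show ?thesis by (simp add: \<phi>_def)
  qed
  \<comment> \<open>Otherwise \<open>\<phi>\<close> would grow at least as fast as \<open>v\<close>
    along the closed walk from \<open>a0\<close>; but it has period \<open>N\<close>, while
    \<open>inner v s\<close> is positive.\<close>
  have "\<exists>b c. (b, c) \<in> E \<and> b \<in> X \<and> \<phi> c < \<phi> b + inner v (c - b) / N"
  proof (rule ccontr)
    assume neg: "\<not> ?thesis"
    have all: "\<phi> b + inner v (c - b) / N \<le> \<phi> c" if "(b, c) \<in> E" "b \<in> X" for b c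
      using neg that not_le by blast
    have "b \<in> X \<and> \<phi> a0 + inner v (b - a0) / N \<le> \<phi> b" if "(a0, b) \<in> E\<^sup>+" for b
      using that
    proof (induction rule: trancl_induct)
      case (base b)
      then show ?case using all[OF base loop(1)] Xc[OF base] loop(1) by blast
    next
      case (step b c)
      have "\<phi> b + inner v (c - b) / N \<le> \<phi> c" using all[OF step(2)] step.IH by blast
      moreover have "inner v (c - a0) / N = inner v (b - a0) / N + inner v (c - b) / N"
        by (simp add: inner_diff_right add_divide_distrib[symmetric])
      ultimately show ?case using step.IH Xc[OF step(2)] by simp
    qed
    from this[OF loop(2)] have "inner v (of_nat N * s) / N \<le> 0" using \<phi>per[OF loop(3)] by simp
    moreover have "inner v (of_nat N * s) = N * inner v s" by (simp add: inner_complex_def algebra_simps)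
    ultimately show False using loop(4) N by simp
  qed
  then obtain b1 c1 where p: "(b1, c1) \<in> E" "b1 \<in> X" "\<phi> c1 < \<phi> b1 + inner v (c1 - b1) / N" by blast
  define \<eta> where "\<eta> = \<phi> b1 + inner v (c1 - b1) / N - \<phi> c1"
  have \<eta>: "0 < \<eta>" using p(3) by (simp add: \<eta>_def)
  obtain M where M: "0 \<le> M" "\<And>z. norm (f z - z) \<le> M" using displacement_bounded by blast
  define C where "C = K + 4 * norm v"
  \<comment> \<open>Penalty for a step outside \<open>E\<close>: the displacement counts at most
    \<open>norm v * M\<close>, and the potential varies by at most \<open>C\<close>.\<close>
  define V where "V = norm v * M + C"
  have C0: "0 \<le> C" "0 \<le> V" using K0 M(1) by (simp_all add: C_def V_def)
  have lower: "\<eta> * visits N (b1, c1) x n - C * (1 + real (card {i. i < n \<and> (cell_of N ((f ^^ i) x) \<in> X) \<noteq> (cell_of N ((f ^^ Suc i) x) \<in> X)})) - V * outside N E x n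
      \<le> (\<Sum>i<n. if cell_of N ((f ^^ i) x) \<in> X then inner v ((f ^^ Suc i) x - (f ^^ i) x) else 0)" for x n
  proof -
    define c where "c = (\<lambda>i. cell_of N ((f ^^ i) x))"
    define r where "r = (\<lambda>i. inner v (c i / of_nat N - (f ^^ i) x))"
    have r: "\<bar>r i\<bar> \<le> 2 * norm v" for i
    proof -
      have "norm (c i / of_nat N - (f ^^ i) x) \<le> 2" using cell_corner[OF N cell_of(1)[OF N]] unfolding c_def by (subst norm_minus_commute)
      then show ?thesis using Cauchy_Schwarz_ineq2[of v "c i / of_nat N - (f ^^ i) x"] mult_left_mono[of _ 2 "norm v"] unfolding r_def
        by (metis mult.commute norm_ge_zero order_trans)
    qed
    \<comment> \<open>The potential transferred from cells to points of the orbit by the correction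
      \<open>r\<close>; the term \<open>2 * norm v\<close> makes it nonnegative.\<close>
    define \<psi> where "\<psi> = (\<lambda>i. 2 * norm v - \<phi> (c i) + r i)"
    have \<psi>: "0 \<le> \<psi> i" "\<psi> i \<le> C" for i using r[of i] \<phi>0[of "c i"] \<phi>K[of "c i"] by (simp_all add: \<psi>_def C_def)
    have dr: "inner v (c (Suc i) - c i) / N = inner v ((f ^^ Suc i) x - (f ^^ i) x) + r (Suc i) - r i" for i
    proof -
      have "c (Suc i) / of_nat N - c i / of_nat N = (c (Suc i) - c i) /\<^sub>R real N" by (simp add: scaleR_conv_of_real field_simps flip: diff_divide_distrib)
      then have "inner v (c (Suc i) - c i) / N = inner v (c (Suc i) / of_nat N) - inner v (c i / of_nat N)"
        by (simp add: inner_diff_right[symmetric] divide_inverse_commute)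
      then show ?thesis by (simp add: r_def inner_diff_right)
    qed
    have per_step: "(if c i \<in> X then \<psi> i - \<psi> (Suc i) else 0) + (if (c i, c (Suc i)) \<in> edge_class N (b1, c1) then \<eta> else 0) - (if (c i, c (Suc i)) \<notin> E then V else 0)
      \<le> (if c i \<in> X then inner v ((f ^^ Suc i) x - (f ^^ i) x) else 0)" for i
    proof (cases "c i \<in> X")
      case True
      show ?thesis
      proof (cases "(c i, c (Suc i)) \<in> edge_class N (b1, c1)")
        case cls: True
        then obtain w where w: "w \<in> gauss_ints" "c i = b1 + of_nat N * w" "c (Suc i) = c1 + of_nat N * w" by (auto simp: edge_class_def)
        have "\<eta> = \<phi> (c i) + inner v (c (Suc i) - c i) / N - \<phi> (c (Suc i))" using w \<phi>per[OF w(1)] by (simp add: \<eta>_def)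
        moreover have "(c i, c (Suc i)) \<in> E" using cls tinv_edge_class_subset[OF E p(1)] by blast
        ultimately show ?thesis using True cls dr[of i] by (simp add: \<psi>_def)
      next
        case ncls: False
        show ?thesis
        proof (cases "(c i, c (Suc i)) \<in> E")
          case inE: True
          then show ?thesis using True ncls dr[of i] \<phi>step[OF inE True] by (simp add: \<psi>_def)
        next
          case nE: False
          have "norm ((f ^^ Suc i) x - (f ^^ i) x) \<le> M" using M(2) by simp
          then have "\<bar>inner v ((f ^^ Suc i) x - (f ^^ i) x)\<bar> \<le> norm v * M"
            using Cauchy_Schwarz_ineq2 mult_left_mono order_trans norm_ge_zero by metis
          then show ?thesis using True ncls nE \<psi>[of i] \<psi>[of "Suc i"] by (simp add: V_def)
        qed
      qed
    next
      case False
      have "(c i, c (Suc i)) \<notin> edge_class N (b1, c1)"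
        using False Xt p(2) by (auto simp: edge_class_def)
      then show ?thesis using False C0 by simp
    qed
    have vis: "visits N (b1, c1) x n = (\<Sum>i<n. if (c i, c (Suc i)) \<in> edge_class N (b1, c1) then 1 else 0)"
      unfolding visits_def c_def by (simp add: sum.If_cases Int_def lessThan_def)
    have out: "outside N E x n = (\<Sum>i<n. if (c i, c (Suc i)) \<notin> E then 1 else 0)"
      unfolding outside_def c_def by (subst sum.If_cases) (auto simp: Int_def lessThan_def)
    have "\<eta> * visits N (b1, c1) x n - C * (1 + real (card {i. i < n \<and> (c i \<in> X) \<noteq> (c (Suc i) \<in> X)})) - V * outside N E x n
      \<le> (\<Sum>i<n. (if c i \<in> X then \<psi> i - \<psi> (Suc i) else 0) + (if (c i, c (Suc i)) \<in> edge_class N (b1, c1) then \<eta> else 0) - (if (c i, c (Suc i)) \<notin> E then V else 0))"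
      using telescoping_runs[of \<psi> C n "\<lambda>i. c i \<in> X"] \<psi> unfolding vis out sum_subtractf sum.distrib sum_distrib_left
      by (simp add: if_distrib[of "(*) _"] cong: if_cong)
    also have "\<dots> \<le> (\<Sum>i<n. if c i \<in> X then inner v ((f ^^ Suc i) x - (f ^^ i) x) else 0)" by (intro sum_mono per_step)
    finally show ?thesis by (simp only: c_def)
  qed
  show ?thesis
  proof (rule that[OF p(1)])
    fix \<epsilon> :: real assume \<epsilon>: "0 < \<epsilon>"
    \<comment> \<open>The budget \<open>\<eta> * \<epsilon>\<close> is split in two halves:
      \<open>\<delta>\<close> pays for the drift, and \<open>\<epsilon>'\<close> for all other
      errors, whose constants are collected in \<open>Q\<close>.\<close>
    define \<delta> where "\<delta> = \<eta> * \<epsilon> / (4 * (norm v + 1))"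
    have nv: "0 < norm v + 1" using norm_ge_zero[of v] by linarith
    have \<delta>: "0 < \<delta>" using \<epsilon> \<eta> nv by (simp add: \<delta>_def)
    have e0: "0 \<le> inner e q" if "q \<in> rot f" for q using line[OF that] by simp
    obtain C1 where C1: "0 \<le> C1" "\<And>x n P. - \<delta> * real n - C1 * (1 + real (card {i. i < n \<and> P i \<noteq> P (Suc i)}))
      \<le> (\<Sum>i<n. if P i then inner e ((f ^^ Suc i) x - (f ^^ i) x) else 0)"
      by (rule drift_along_runs[OF e0 \<delta>]) (assumption, rule that, assumption, blast)
    obtain C2 where C2: "0 \<le> C2" "\<And>x n P. - \<delta> * real n - C2 * (1 + real (card {i. i < n \<and> P i \<noteq> P (Suc i)}))
      \<le> (\<Sum>i<n. if P i then inner (\<i> * e) ((f ^^ Suc i) x - (f ^^ i) x) else 0)"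
      by (rule drift_along_runs[OF side \<delta>]) (assumption, rule that, assumption, blast)
    define Q where "Q = norm v * (2 + 2 * C1 + 2 * C2) + 2 * C + V"
    have Q: "0 \<le> Q" using C0 C1(1) C2(1) by (simp add: Q_def)
    define \<epsilon>' where "\<epsilon>' = \<eta> * \<epsilon> / (2 * (Q + 1))"
    have \<epsilon>': "0 < \<epsilon>'" using \<eta> \<epsilon> Q by (simp add: \<epsilon>'_def)
    have "visits N (b1, c1) x n \<le> \<epsilon> * real n"
      if h: "1 \<le> \<epsilon>' * real n" "outside N E x n \<le> \<epsilon>' * real n" "norm ((f ^^ n) x - x) \<le> \<epsilon>' * real n" for x n
    proof -
      define P where "P = (\<lambda>i. cell_of N ((f ^^ i) x) \<in> X)"
      define m where "m = real (card {i. i < n \<and> P i \<noteq> P (Suc i)})"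
      have "m \<le> outside N E x n" unfolding m_def outside_def P_def using Xc by (intro of_nat_mono card_mono) auto
      then have m: "1 + m \<le> 2 * (\<epsilon>' * real n)" using h by linarith
      \<comment> \<open>Displacements gathered inside and outside \<open>X\<close>. In the
        directions \<open>e\<close> and \<open>\<i> * e\<close> both are bounded from below by
        \<open>drift_along_runs\<close>, and their sum is small along a slow orbit, so each is small
        in absolute value.\<close>
      define D where "D = (\<Sum>i<n. if P i then (f ^^ Suc i) x - (f ^^ i) x else 0)"
      define D' where "D' = (\<Sum>i<n. if \<not> P i then (f ^^ Suc i) x - (f ^^ i) x else 0)"
      have "D + D' = (\<Sum>i<n. (f ^^ Suc i) x - (f ^^ i) x)" unfolding D_def D'_def sum.distrib[symmetric] by (intro sum.cong) auto
      then have DD: "D + D' = (f ^^ n) x - x" using sum_lessThan_telescope[of "\<lambda>i. (f ^^ i) x" n] by simp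
      have inD: "inner u D = (\<Sum>i<n. if P i then inner u ((f ^^ Suc i) x - (f ^^ i) x) else 0)"
        "inner u D' = (\<Sum>i<n. if \<not> P i then inner u ((f ^^ Suc i) x - (f ^^ i) x) else 0)" for u
        unfolding D_def D'_def inner_sum_right by (intro sum.cong refl; simp)+
      have bound: "\<bar>inner u D\<bar> \<le> \<epsilon>' * real n + \<delta> * real n + C3 * (2 * (\<epsilon>' * real n))"
        if u: "norm u = 1" and C3: "0 \<le> C3" and l: "\<And>P. - \<delta> * real n - C3 * (1 + real (card {i. i < n \<and> P i \<noteq> P (Suc i)}))
          \<le> (\<Sum>i<n. if P i then inner u ((f ^^ Suc i) x - (f ^^ i) x) else 0)" for u C3
      proof -
        have 1: "- \<delta> * real n - C3 * (1 + m) \<le> inner u D" using l[of P] unfolding inD m_def .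
        have "{i. i < n \<and> (\<not> P i) \<noteq> (\<not> P (Suc i))} = {i. i < n \<and> P i \<noteq> P (Suc i)}" by auto
        then have 2: "- \<delta> * real n - C3 * (1 + m) \<le> inner u D'" using l[of "\<lambda>i. \<not> P i"] unfolding inD m_def by simp
        have "\<bar>inner u (D + D')\<bar> \<le> \<epsilon>' * real n" using Cauchy_Schwarz_ineq2[of u "D + D'"] u h(3) DD by simp
        moreover have "C3 * (1 + m) \<le> C3 * (2 * (\<epsilon>' * real n))" using m C3 by (rule mult_left_mono)
        moreover have "0 \<le> \<epsilon>' * real n" using h(1) by simp
        ultimately show ?thesis using 1 2 unfolding inner_add_right by (simp only: abs_le_iff) linarith
      qed
      have ne: "norm (\<i> * e) = 1" using e by (simp add: norm_mult)
      have b1: "\<bar>inner e D\<bar> \<le> \<epsilon>' * real n + \<delta> * real n + C1 * (2 * (\<epsilon>' * real n))" by (rule bound[OF e C1])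
      have b2: "\<bar>inner (\<i> * e) D\<bar> \<le> \<epsilon>' * real n + \<delta> * real n + C2 * (2 * (\<epsilon>' * real n))" by (rule bound[OF ne C2])
      have "(Re e)\<^sup>2 + (Im e)\<^sup>2 = 1" using e by (simp add: cmod_def)
      then have "inner v D = inner v e * inner e D + inner v (\<i> * e) * inner (\<i> * e) D"
        unfolding inner_complex_def by simp algebra
      also have "\<dots> \<le> norm v * \<bar>inner e D\<bar> + norm v * \<bar>inner (\<i> * e) D\<bar>"
      proof -
        have "\<bar>inner v e\<bar> \<le> norm v" "\<bar>inner v (\<i> * e)\<bar> \<le> norm v"
          using Cauchy_Schwarz_ineq2[of v e] Cauchy_Schwarz_ineq2[of v "\<i> * e"] e ne by simp_all
        then have "\<bar>inner v e * inner e D\<bar> \<le> norm v * \<bar>inner e D\<bar>" "\<bar>inner v (\<i> * e) * inner (\<i> * e) D\<bar> \<le> norm v * \<bar>inner (\<i> * e) D\<bar>"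
          unfolding abs_mult by (auto intro: mult_right_mono)
        then show ?thesis by linarith
      qed
      also have "\<dots> = norm v * (\<bar>inner e D\<bar> + \<bar>inner (\<i> * e) D\<bar>)" by (simp add: algebra_simps)
      also have "\<dots> \<le> norm v * (2 * (\<epsilon>' * real n) + 2 * (\<delta> * real n) + (2 * C1 + 2 * C2) * (\<epsilon>' * real n))"
        using b1 b2 by (intro mult_left_mono) (auto simp: algebra_simps)
      finally have up: "inner v D \<le> norm v * (2 * (\<epsilon>' * real n) + 2 * (\<delta> * real n) + (2 * C1 + 2 * C2) * (\<epsilon>' * real n))" .
      have "\<eta> * visits N (b1, c1) x n - C * (1 + m) - V * outside N E x n \<le> inner v D"
        using lower[of x n] unfolding inD m_def P_def .
      moreover have "C * (1 + m) \<le> C * (2 * (\<epsilon>' * real n))" using m C0(1) by (rule mult_left_mono)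
      moreover have "V * outside N E x n \<le> V * (\<epsilon>' * real n)" using h(2) C0(2) by (rule mult_left_mono)
      ultimately have "\<eta> * visits N (b1, c1) x n \<le> 2 * norm v * \<delta> * real n + Q * \<epsilon>' * real n"
        using up by (simp add: Q_def algebra_simps)
      moreover have "2 * norm v * \<delta> \<le> \<eta> * \<epsilon> / 2"
      proof -
        have "2 * norm v * \<delta> \<le> 2 * (norm v + 1) * \<delta>" using \<delta> by (intro mult_right_mono) auto
        also have "\<dots> = \<eta> * \<epsilon> / 2" using nv by (simp add: \<delta>_def field_simps)
        finally show ?thesis .
      qed
      then have "2 * norm v * \<delta> * real n \<le> \<eta> * \<epsilon> / 2 * real n" by (rule mult_right_mono) simp
      moreover have "Q * \<epsilon>' \<le> \<eta> * \<epsilon> / 2"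
      proof -
        have "Q * \<epsilon>' \<le> (Q + 1) * \<epsilon>'" using \<epsilon>' by (intro mult_right_mono) auto
        also have "\<dots> = \<eta> * \<epsilon> / 2" using Q by (simp add: \<epsilon>'_def field_simps)
        finally show ?thesis .
      qed
      then have "Q * \<epsilon>' * real n \<le> \<eta> * \<epsilon> / 2 * real n" by (rule mult_right_mono) simp
      ultimately have "\<eta> * visits N (b1, c1) x n \<le> \<eta> * (\<epsilon> * real n)" by simp
      then show ?thesis using \<eta> by simp
    qed
    then show "\<exists>\<epsilon>'>0. \<forall>x n. 1 \<le> \<epsilon>' * real n \<longrightarrow> outside N E x n \<le> \<epsilon>' * real n
      \<longrightarrow> norm ((f ^^ n) x - x) \<le> \<epsilon>' * real n \<longrightarrow> visits N (b1, c1) x n \<le> \<epsilon> * real n" using \<epsilon>' by blast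
  qed
qed

text \<open>By removal of edge classes. If every edge admits a return walk, \<open>E\<close> splits
  into strongly connected parts without edges between them; in the part \<open>X\<close> of one edge
  the half plane functional supplies an edge class that can be removed. The empty graph is not
  slow.\<close>

lemma not_slow:
  assumes N: "0 < N" and nc: "\<And>a. (a, a) \<notin> (cell_rel N f)\<^sup>+" and e: "norm e = 1"
    and line: "\<And>p. p \<in> rot f \<Longrightarrow> inner e p = 0" and side: "\<And>p. p \<in> rot f \<Longrightarrow> 0 \<le> inner (\<i> * e) p"
  shows "tinv N E \<Longrightarrow> E \<subseteq> cell_rel N f \<Longrightarrow> slow N E \<Longrightarrow> False"
proof (induction "card (E \<inter> residues N \<times> UNIV)" arbitrary: E rule: less_induct)
  case less
  note E = less.prems(1) and sub = less.prems(2) and slo = less.prems(3)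
  obtain D where "\<And>a b. (a, b) \<in> cell_rel N f \<Longrightarrow> norm (b - a) \<le> D" using cell_rel_bounded[OF N] by blast
  then have D: "norm (b - a) \<le> D" if "(a, b) \<in> E" for a b using sub that by blast
  have remove: False
    if p: "p \<in> E" and few: "\<And>\<epsilon>. 0 < \<epsilon> \<Longrightarrow> \<exists>\<epsilon>'>0. \<forall>x n. 1 \<le> \<epsilon>' * real n \<longrightarrow> outside N E x n \<le> \<epsilon>' * real n
      \<longrightarrow> norm ((f ^^ n) x - x) \<le> \<epsilon>' * real n \<longrightarrow> visits N p x n \<le> \<epsilon> * real n" for p
    by (rule less.hyps[OF card_edge_classes_less[OF E N D p] tinv_Diff_edge_class[OF E] _ slow_Diff[OF slo few]])
      (use sub in auto)
  have "E \<noteq> {}"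
  proof
    assume "E = {}"
    moreover obtain x n where "1 \<le> 1 / 2 * real n" "outside N E x n \<le> 1 / 2 * real n"
      using slo unfolding slow_def by (meson half_gt_zero_iff zero_less_one)
    ultimately show False by (simp add: outside_def)
  qed
  then obtain a0 b0 where ab0: "(a0, b0) \<in> E" by auto
  \<comment> \<open>An edge without return is used at most once more than \<open>E\<close> is left,
    so slow orbits use it with frequency 0 and it can be removed.\<close>
  have ret: "\<exists>w\<in>gauss_ints. (b, a + of_nat N * w) \<in> E\<^sup>*" if ab: "(a, b) \<in> E" for a b
  proof (rule ccontr)
    assume "\<not> ?thesis"
    then have le: "visits N (a, b) x n \<le> outside N E x n + 1" for x n by (intro visits_one_way[OF E N ab]) blast
    show False
    proof (rule remove[OF ab])
      fix \<epsilon> :: real assume \<epsilon>: "0 < \<epsilon>"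
      have "visits N (a, b) x n \<le> \<epsilon> * real n" if "1 \<le> \<epsilon> / 2 * real n" "outside N E x n \<le> \<epsilon> / 2 * real n" for x n
        using le[of x n] that by simp
      then show "\<exists>\<epsilon>'>0. \<forall>x n. 1 \<le> \<epsilon>' * real n \<longrightarrow> outside N E x n \<le> \<epsilon>' * real n
      \<longrightarrow> norm ((f ^^ n) x - x) \<le> \<epsilon>' * real n \<longrightarrow> visits N (a, b) x n \<le> \<epsilon> * real n" using \<epsilon> by (intro exI[of _ "\<epsilon> / 2"]) auto
    qed
  qed
  have sym: "\<exists>w\<in>gauss_ints. (b, a + of_nat N * w) \<in> E\<^sup>*" if "(a, b) \<in> E\<^sup>*" for a b
    using that
  proof (induction rule: rtrancl_induct)
    case base
    show ?case by (intro bexI[of _ 0]) auto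
  next
    case (step b c)
    obtain w where w: "w \<in> gauss_ints" "(b, a + of_nat N * w) \<in> E\<^sup>*" using step.IH by blast
    obtain u where u: "u \<in> gauss_ints" "(c, b + of_nat N * u) \<in> E\<^sup>*" using ret[OF step(2)] by blast
    have "(b + of_nat N * u, a + of_nat N * w + of_nat N * u) \<in> E\<^sup>*" by (rule tinv_rtrancl[OF E w(2) u(1)])
    with u(2) have "(c, a + of_nat N * (w + u)) \<in> E\<^sup>*" by (simp add: algebra_simps)
    then show ?case using w(1) u(1) by (intro bexI[of _ "w + u"]) auto
  qed
  define X where "X = {c. \<exists>w\<in>gauss_ints. (a0, c + of_nat N * w) \<in> E\<^sup>*}"
  have XI: "c \<in> X" if "w \<in> gauss_ints" "(a0, c + of_nat N * w) \<in> E\<^sup>*" for c w using that by (auto simp: X_def)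
  have Xt: "c + of_nat N * u \<in> X" if c: "c \<in> X" and u: "u \<in> gauss_ints" for c u
  proof -
    obtain w where w: "w \<in> gauss_ints" "(a0, c + of_nat N * w) \<in> E\<^sup>*" using c by (auto simp: X_def)
    show ?thesis by (rule XI[of "w - u"]) (use w u in \<open>auto simp: algebra_simps\<close>)
  qed
  have fwd: "b \<in> X" if a: "a \<in> X" and ab: "(a, b) \<in> E\<^sup>*" for a b
  proof -
    obtain w where w: "w \<in> gauss_ints" "(a0, a + of_nat N * w) \<in> E\<^sup>*" using a by (auto simp: X_def)
    show ?thesis using rtrancl_trans[OF w(2) tinv_rtrancl[OF E ab w(1)]] XI[OF w(1)] by blast
  qed
  have Xc: "a \<in> X \<longleftrightarrow> b \<in> X" if ab: "(a, b) \<in> E" for a b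
  proof
    show "b \<in> X" if "a \<in> X" using fwd[OF that] ab by blast
    assume "b \<in> X"
    obtain w where w: "w \<in> gauss_ints" "(b, a + of_nat N * w) \<in> E\<^sup>*" using ret[OF ab] by blast
    have "a + of_nat N * w \<in> X" by (rule fwd[OF \<open>b \<in> X\<close> w(2)])
    from Xt[OF this gauss_ints_minus[OF w(1)]] show "a \<in> X" by simp
  qed
  have conn: "\<exists>w\<in>gauss_ints. (a, b + of_nat N * w) \<in> E\<^sup>*" if a: "a \<in> X" and b: "b \<in> X" for a b
  proof -
    obtain w where w: "w \<in> gauss_ints" "(a0, a + of_nat N * w) \<in> E\<^sup>*" using a by (auto simp: X_def)
    obtain u where u: "u \<in> gauss_ints" "(a0, b + of_nat N * u) \<in> E\<^sup>*" using b by (auto simp: X_def)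
    obtain y where y: "y \<in> gauss_ints" "(a + of_nat N * w, a0 + of_nat N * y) \<in> E\<^sup>*" using sym[OF w(2)] by blast
    have 1: "(a, a0 + of_nat N * (y - w)) \<in> E\<^sup>*" using tinv_rtrancl[OF E y(2) gauss_ints_minus[OF w(1)]] by (simp add: algebra_simps)
    have 2: "(a0 + of_nat N * (y - w), b + of_nat N * u + of_nat N * (y - w)) \<in> E\<^sup>*" by (rule tinv_rtrancl[OF E u(2)]) (use y w in auto)
    have "(a, b + of_nat N * (u + (y - w))) \<in> E\<^sup>*" using rtrancl_trans[OF 1 2] by (simp add: algebra_simps)
    then show ?thesis using u(1) y(1) w(1) by (intro bexI[of _ "u + (y - w)"]) auto
  qed
  have a0: "a0 \<in> X" by (rule XI[of 0]) auto
  obtain w0 where w0: "w0 \<in> gauss_ints" "(b0, a0 + of_nat N * w0) \<in> E\<^sup>*" using ret[OF ab0] by blast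
  have lp: "(a0, a0 + of_nat N * w0) \<in> E\<^sup>+" using ab0 w0(2) by (rule rtrancl_into_trancl2)
  have ncE: "(a, a) \<notin> E\<^sup>+" for a using nc trancl_mono[OF _ sub] by blast
  obtain v where v: "\<And>L a w. \<lbrakk>1 \<le> L; w \<in> gauss_ints; a \<in> X; (a, a + of_nat N * w) \<in> E ^^ L\<rbrakk> \<Longrightarrow> 0 \<le> inner v w"
    and s: "\<exists>s\<in>gauss_ints. (a0, a0 + of_nat N * s) \<in> E\<^sup>+ \<and> 0 < inner v s"
    by (rule strong_class_halfplane[OF E ncE conn a0 w0(1) lp]) (assumption, assumption, blast intro: that)
  obtain s where s: "s \<in> gauss_ints" "(a0, a0 + of_nat N * s) \<in> E\<^sup>+" "0 < inner v s" using s by blast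
  have tiX: "tinv N (E \<inter> X \<times> X)" by (rule tinv_restrict[OF E Xt])
  have DX: "norm (b - a) \<le> D" if "(a, b) \<in> E \<inter> X \<times> X" for a b using D that by blast
  have lX: "0 \<le> inner v w + 0 * real L" if h: "1 \<le> L" "L \<le> N * N" "w \<in> gauss_ints" "(a, a + of_nat N * w) \<in> (E \<inter> X \<times> X) ^^ L" for L a w
  proof -
    obtain y where "(a, y) \<in> E \<inter> X \<times> X" using relpow_first[OF h(1,4)] by blast
    then show ?thesis using v[OF h(1,3) _ relpow_restrict[OF h(4)]] by simp
  qed
  obtain K where K: "\<And>L a b. (a, b) \<in> (E \<inter> X \<times> X) ^^ L \<Longrightarrow> - K \<le> inner v (b - a) / N + 0 * real L"
    using walk_cost_bounded_below[OF tiX N DX, of v 0] lX by metis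
  have K': "- K \<le> inner v (b - a) / N" if "(a, b) \<in> (E \<inter> X \<times> X) ^^ L" for L a b using K[OF that] by simp
  show False
    by (rule visits_positive_cost[OF N E e line side Xt Xc K' a0 s(2,1,3)]) (assumption | rule remove)+
qed

lemma endpoint_zero_contradiction:
  assumes N: "0 < N" and nc: "\<And>a. (a, a) \<notin> (cell_rel N f)\<^sup>+" and e: "norm e = 1"
    and line: "\<And>p. p \<in> rot f \<Longrightarrow> inner e p = 0" and side: "\<And>p. p \<in> rot f \<Longrightarrow> 0 \<le> inner (\<i> * e) p"
    and zero: "0 \<in> rot f"
  shows False
proof (rule not_slow[OF N nc e line side cell_rel_tinv[OF N] subset_refl])
  show "slow N (cell_rel N f)"
    unfolding slow_def
  proof (intro allI impI)
    fix \<epsilon> :: real assume \<epsilon>: "0 < \<epsilon>"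
    obtain m where m: "1 < real m * \<epsilon>" using reals_Archimedean3[OF \<epsilon>] by blast
    have "1 \<le> m" using m by (cases m) auto
    then obtain n x where n: "m \<le> n" "norm ((f ^^ n) x - x) < \<epsilon> * real n" using zero \<epsilon> unfolding rot_iff by fastforce
    have "real m * \<epsilon> \<le> real n * \<epsilon>" using n(1) \<epsilon> by (intro mult_right_mono) auto
    then have 1: "1 \<le> \<epsilon> * real n" using m by (simp add: mult.commute)
    have "(cell_of N ((f ^^ i) x), cell_of N ((f ^^ Suc i) x)) \<in> cell_rel N f" for i
      using cell_rel_step[OF N cell_of(1)[OF N] _ cell_of(2) cell_of(2), of "(f ^^ i) x"] cell_of(1)[OF N, of "(f ^^ Suc i) x"] by simp
    then have "outside N (cell_rel N f) x n = 0" by (simp add: outside_def)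
    then show "\<exists>x n. 1 \<le> \<epsilon> * real n \<and> outside N (cell_rel N f) x n \<le> \<epsilon> * real n \<and> norm ((f ^^ n) x - x) \<le> \<epsilon> * real n"
      using 1 n(2) by (intro exI[of _ x] exI[of _ n]) auto
  qed
qed

end

text \<open>\<open>nofix\<close> is stated for all integer translates because the lift is changed by
  a lattice point \<open>z\<close> that comes out of the argument.\<close>

lemma (in plane_lift) rotation_interior_or_fixed_point:
  assumes nf: "no_free_grid_curve f" and nofix: "\<And>z w. w \<in> gauss_ints \<Longrightarrow> f z \<noteq> z + w"
  shows "interior (rot f) \<noteq> {}"
proof
  assume int0: "interior (rot f) = {}"
  define I where "I = convex hull rot f"
  have "interior I = {}" using interior_convex_hull_rot int0 unfolding I_def
    by (metis interior_maximal open_interior subset_empty)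
  moreover have "convex I" by (simp add: I_def)
  ultimately obtain a \<beta>0 where a: "a \<noteq> 0" "I \<subseteq> {x. inner a x = \<beta>0}" using empty_interior_subset_hyperplane by metis
  define e where "e = sgn a"
  define \<beta> where "\<beta> = \<beta>0 / norm a"
  have e1: "norm e = 1" using a(1) by (simp add: e_def norm_sgn)
  have eI: "inner e x = \<beta>" if "x \<in> I" for x
    using a(2) that by (auto simp: e_def \<beta>_def sgn_div_norm divide_inverse_commute)
  have Ine: "I \<noteq> {}" using rot_nonempty by (simp add: I_def)
  have "bounded I" unfolding I_def by (intro bounded_convex_hull compact_imp_bounded compact_rot)
  then obtain B where B: "\<And>x. x \<in> I \<Longrightarrow> norm x \<le> B" unfolding bounded_iff by blast
  have e2: "(Re e)\<^sup>2 + (Im e)\<^sup>2 = 1" using e1 by (simp add: cmod_def)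
  have decomp: "x = of_real (inner e x) * e + of_real (inner (\<i> * e) x) * (\<i> * e)" for x
    using e2 unfolding complex_eq_iff inner_complex_def by simp algebra
  have ie1: "norm (\<i> * e) = 1" using e1 by (simp add: norm_mult)
  have B0: "0 \<le> B" using Ine B norm_ge_zero order_trans by blast
  \<comment> \<open>The length \<open>2 * B + 1\<close> exceeds the diameter of \<open>I\<close>, so
    differences of points of \<open>I\<close> are multiples of \<open>d\<close> by factors of
    absolute value at most 1.\<close>
  define d where "d = of_real (2 * B + 1) * (\<i> * e)"
  have d0: "d \<noteq> 0" using B0 ie1 unfolding d_def by (metis mult_eq_0_iff norm_zero of_real_eq_0_iff zero_neq_one add_nonneg_eq_0_iff mult_nonneg_nonneg zero_le_numeral zero_le_one)
  have seg: "\<exists>s. \<bar>s\<bar> \<le> 1 \<and> q = p + of_real s * d" if p: "p \<in> I" and q: "q \<in> I" for p q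
  proof -
    define s where "s = inner (\<i> * e) (q - p) / (2 * B + 1)"
    have "inner e (q - p) = 0" using eI[OF p] eI[OF q] by (simp add: inner_diff_right)
    then have "q - p = of_real (inner (\<i> * e) (q - p)) * (\<i> * e)" using decomp[of "q - p"] by simp
    also have "\<dots> = of_real s * d" using B0 by (simp add: s_def d_def flip: of_real_mult of_real_add)
    finally have "q = p + of_real s * d" by (simp add: algebra_simps)
    moreover have "\<bar>inner (\<i> * e) (q - p)\<bar> \<le> 2 * B + 1"
      using Cauchy_Schwarz_ineq2[of "\<i> * e" "q - p"] ie1 norm_triangle_ineq4[of q p] B[OF p] B[OF q] by simp
    then have "\<bar>s\<bar> \<le> 1" using B0 by (simp add: s_def)
    ultimately show ?thesis by blast
  qed
  have "\<exists>p\<in>I. inner v p \<in> \<int>" if "v \<in> gauss_ints" "t \<in> gauss_ints" "inner v t = 1" for v t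
    unfolding I_def by (rule rot_integer_value[OF nf that])
  then obtain z where z: "z \<in> I" "z \<in> gauss_ints" using segment_lattice_point[OF Ine d0 seg] by metis
  define h where "h = (\<lambda>x. f x + (- z))"
  define h' where "h' = (\<lambda>x. g (x - (- z)))"
  have mz: "- z \<in> gauss_ints" using z(2) by simp
  interpret h: plane_lift h h' unfolding h_def h'_def by (rule translate_lift[OF mz])
  have hf: "(\<lambda>x. h x + z) = f" by (auto simp: h_def)
  have rot_h: "p + z \<in> rot f" if "p \<in> rot h" for p using h.rot_translate[OF z(2) that] unfolding hf .
  have h_rot: "p - z \<in> rot h" if "p \<in> rot f" for p using rot_translate[OF mz that] unfolding h_def by simp
  have nfh: "no_free_grid_curve h" unfolding h_def by (rule no_free_grid_curve_translate[OF nf mz])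
  have "h x \<noteq> x" for x using nofix[OF z(2), of x] by (auto simp: h_def algebra_simps)
  then obtain \<delta> where \<delta>: "0 < \<delta>" "\<And>x. \<delta> \<le> norm (h x - x)" using h.displacement_uniform by blast
  obtain M where M: "\<And>x. norm (h x - x) \<le> M" using h.displacement_bounded by blast
  obtain n :: nat where n: "2 / \<delta> < real n" using reals_Archimedean2 by blast
  define N where "N = n + 3"
  have N: "3 \<le> N" "0 < N" "2 / real N < \<delta>" using n \<delta>(1) by (auto simp: N_def field_simps)
  have nc: "(a, a) \<notin> (cell_rel N h)\<^sup>+" for a
    by (rule no_closed_cell_chain[OF h.cf h.cg h.fg h.gf M \<delta>(2) N(3,2)])
  have e_h: "inner e p = 0" if "p \<in> rot h" for p
  proof -
    have "p + z \<in> I" unfolding I_def by (rule hull_inc[OF rot_h[OF that]])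
    from eI[OF this] show ?thesis using eI[OF z(1)] by (simp add: inner_add_right)
  qed
  have zero: "0 \<in> convex hull rot h"
  proof -
    have "(+) (- z) ` rot f \<subseteq> rot h" using h_rot by auto
    then have "convex hull ((+) (- z) ` rot f) \<subseteq> convex hull rot h" by (rule hull_mono)
    then have "(+) (- z) ` (convex hull rot f) \<subseteq> convex hull rot h" unfolding convex_hull_translation .
    moreover have "0 \<in> (+) (- z) ` (convex hull rot f)" using z(1) unfolding I_def by (intro image_eqI[of _ _ z]) auto
    ultimately show ?thesis by blast
  qed
  have cont: "continuous_on (rot h) (\<lambda>p. inner (\<i> * e) p)" by (intro continuous_intros)
  obtain p where p: "p \<in> rot h" "\<And>x. x \<in> rot h \<Longrightarrow> inner (\<i> * e) x \<le> inner (\<i> * e) p"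
    using continuous_attains_sup[OF h.compact_rot h.rot_nonempty cont] by blast
  obtain q where q: "q \<in> rot h" "\<And>x. x \<in> rot h \<Longrightarrow> inner (\<i> * e) q \<le> inner (\<i> * e) x"
    using continuous_attains_inf[OF h.compact_rot h.rot_nonempty cont] by blast
  have "convex hull rot h \<subseteq> {x. inner (\<i> * e) x \<le> inner (\<i> * e) p}"
    using p(2) by (intro hull_minimal convex_halfspace_le) auto
  then have p0: "0 \<le> inner (\<i> * e) p" using zero by auto
  have "convex hull rot h \<subseteq> {x. inner (\<i> * e) q \<le> inner (\<i> * e) x}"
    using q(2) by (intro hull_minimal convex_halfspace_ge) auto
  then have q0: "inner (\<i> * e) q \<le> 0" using zero by auto
  \<comment> \<open>The extreme points \<open>p\<close> and \<open>q\<close> belong to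
    \<open>rot h\<close> itself. So if 0 is an end point it is a rotation vector and not merely a
    point of the hull, as slow orbits require.\<close>
  have zeroI: "0 \<in> rot h" if "x \<in> rot h" "inner (\<i> * e) x = 0" for x
    using decomp[of x] e_h[OF that(1)] that by simp
  consider "inner (\<i> * e) p = 0" | "inner (\<i> * e) q = 0" | "0 < inner (\<i> * e) p" "inner (\<i> * e) q < 0" using p0 q0 by linarith
  then show False
  proof cases
    case 1
    \<comment> \<open>Here 0 is the upper end point; passing to \<open>- e\<close> makes it the
      lower one.\<close>
    have "inner (- e) x = 0" "0 \<le> inner (\<i> * - e) x" if "x \<in> rot h" for x
      using e_h[OF that] p(2)[OF that] 1 by simp_all
    then show False using h.endpoint_zero_contradiction[OF N(2) nc, of "- e"] e1 zeroI[OF p(1) 1] by simp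
  next
    case 2
    have "0 \<le> inner (\<i> * e) x" if "x \<in> rot h" for x using q(2)[OF that] 2 by simp
    then show False using h.endpoint_zero_contradiction[OF N(2) nc e1 e_h] zeroI[OF q(1) 2] by blast
  next
    case 3
    have "e \<noteq> 0" using e1 by auto
    then show False by (rule h.interior_zero_contradiction[OF nfh N(1) nc _ e_h p(1) 3(1) q(1) 3(2)])
  qed
qed

section \<open>Closed curves in the grid\<close>

lemma gauss_intsE:
  assumes "a \<in> gauss_ints" obtains x y where "a = Complex (of_int x) (of_int y)"
proof -
  obtain x y where "Re a = of_int x" "Im a = of_int y" using assms by (auto simp: gauss_ints_def elim!: Ints_cases)
  then show ?thesis using that[of x y] by (simp add: complex_eq_iff)
qed

lemma grid_edges_meet:
  assumes N: "0 < N" and ab: "a \<in> gauss_ints" "b \<in> gauss_ints" "d = 1 \<or> d = \<i>" "d' = 1 \<or> d' = \<i>"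
    and z: "z \<in> edge N (a, d)" "z \<in> edge N (b, d')"
  shows "{a, a + d} \<inter> {b, b + d'} \<noteq> {}"
proof -
  obtain x y x' y' where xy: "a = Complex (of_int x) (of_int y)" "b = Complex (of_int x') (of_int y')"
    using gauss_intsE[OF ab(1)] gauss_intsE[OF ab(2)] by metis
  have ints: "real_of_int i \<le> r \<Longrightarrow> r \<le> real_of_int j + 1 \<Longrightarrow> i \<le> j + 1" for i j r by linarith
  consider "d = 1" "d' = 1" | "d = 1" "d' = \<i>" | "d = \<i>" "d' = 1" | "d = \<i>" "d' = \<i>" using ab by blast
  then show ?thesis
  proof cases
    case 1
    then have "y = y'" "x \<le> x' + 1" "x' \<le> x + 1" using z ints[of x "N * Re z" x'] ints[of x' "N * Re z" x] by (simp_all add: mem_edge_1 xy)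
    then have "y = y'" "x = x' \<or> x = x' + 1 \<or> x' = x + 1" by auto
    then show ?thesis using 1 by (auto simp: xy complex_eq_iff)
  next
    case 2
    then have h: "N * Im z = of_int y" "of_int x \<le> N * Re z" "N * Re z \<le> of_int x + 1"
      "N * Re z = of_int x'" "of_int y' \<le> N * Im z" "N * Im z \<le> of_int y' + 1" using z by (simp_all add: mem_edge_1 mem_edge_ii xy)
    have "x \<le> x'" "x' \<le> x + 1" "y' \<le> y" "y \<le> y' + 1" using h by linarith+
    then have "x' = x \<or> x' = x + 1" "y = y' \<or> y = y' + 1" by auto
    then show ?thesis using 2 by (auto simp: xy complex_eq_iff)
  next
    case 3
    then have h: "N * Re z = of_int x" "of_int y \<le> N * Im z" "N * Im z \<le> of_int y + 1"
      "N * Im z = of_int y'" "of_int x' \<le> N * Re z" "N * Re z \<le> of_int x' + 1" using z by (simp_all add: mem_edge_1 mem_edge_ii xy)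
    have "x' \<le> x" "x \<le> x' + 1" "y \<le> y'" "y' \<le> y + 1" using h by linarith+
    then have "x = x' \<or> x = x' + 1" "y' = y \<or> y' = y + 1" by auto
    then show ?thesis using 3 by (auto simp: xy complex_eq_iff)
  next
    case 4
    then have "x = x'" "y \<le> y' + 1" "y' \<le> y + 1" using z ints[of y "N * Im z" y'] ints[of y' "N * Im z" y] by (simp_all add: mem_edge_ii xy)
    then have "x = x'" "y = y' \<or> y = y' + 1 \<or> y' = y + 1" by auto
    then show ?thesis using 4 by (auto simp: xy complex_eq_iff)
  qed
qed

definition adjacent :: "(complex \<times> complex) set \<Rightarrow> (complex \<times> complex) set" where
  "adjacent G = {(a, b). (a, b - a) \<in> G \<or> (b, a - b) \<in> G}"

lemma adjacent_sym: "(a, b) \<in> (adjacent G)\<^sup>* \<Longrightarrow> (b, a) \<in> (adjacent G)\<^sup>*"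
  using sym_rtrancl[of "adjacent G"] by (auto simp: adjacent_def sym_def)

text \<open>Edges with a common point share a vertex, so the edges reachable from one edge and the
  remaining ones have disjoint closed carriers. The connected \<open>K\<close> lies in one of them;
  being unbounded, it needs infinitely many vertices, and two of these are equivalent modulo
  \<open>N\<close>.\<close>

lemma unbounded_connected_grid_translation:
  assumes N: "0 < N" and G: "G \<subseteq> gauss_ints \<times> {1, \<i>}" and K: "connected K" "\<not> bounded K" "K \<subseteq> carrier N G"
  obtains a w n where "w \<in> gauss_ints" "w \<noteq> 0" "(a, a + of_nat N * w) \<in> adjacent G ^^ n"
proof -
  obtain z0 where "z0 \<in> K" using K(2) by (metis bounded_empty ex_in_conv)
  then obtain e0 where z0: "z0 \<in> K" "e0 \<in> G" "z0 \<in> edge N e0" using K(3) unfolding carrier_def by blast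
  define V where "V = {b. (fst e0, b) \<in> (adjacent G)\<^sup>*}"
  define G1 where "G1 = {e \<in> G. fst e \<in> V}"
  have disj: "carrier N G1 \<inter> carrier N (G - G1) = {}"
  proof (rule ccontr)
    assume "\<not> ?thesis"
    then obtain z a d b d' where z: "(a, d) \<in> G1" "z \<in> edge N (a, d)" "(b, d') \<in> G" "(b, d') \<notin> G1" "z \<in> edge N (b, d')"
      by (auto simp: carrier_def)
    have ad: "(a, d) \<in> G" "a \<in> V" using z(1) by (auto simp: G1_def)
    have "{a, a + d} \<inter> {b, b + d'} \<noteq> {}"
      by (rule grid_edges_meet[OF N _ _ _ _ z(2,5)]) (use G ad(1) z(3) in auto)
    then obtain c where c: "c \<in> {a, a + d}" "c \<in> {b, b + d'}" by blast
    have "(a, c) \<in> (adjacent G)\<^sup>*" using c(1) ad(1) by (auto simp: adjacent_def)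
    moreover have "(c, b) \<in> (adjacent G)\<^sup>*" using c(2) z(3) by (auto simp: adjacent_def)
    ultimately have "b \<in> V" using ad(2) unfolding V_def by (auto intro: rtrancl_trans)
    then show False using z(3,4) by (simp add: G1_def)
  qed
  have cl: "closed (carrier N G1)" "closed (carrier N (G - G1))"
    by (rule closed_carrier[OF N], use G in \<open>auto simp: G1_def\<close>)+
  have "carrier N G = carrier N G1 \<union> carrier N (G - G1)" by (auto simp: carrier_def G1_def)
  then have "K \<subseteq> carrier N G1 \<union> carrier N (G - G1)" using K(3) by blast
  then have "carrier N G1 \<inter> K = {} \<or> carrier N (G - G1) \<inter> K = {}"
    using K(1) cl disj unfolding connected_closed by (metis inf_bot_left)
  moreover have "e0 \<in> G1" using z0(2) by (simp add: G1_def V_def)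
  then have "z0 \<in> carrier N G1" using z0(3) unfolding carrier_def by blast
  ultimately have KG1: "K \<subseteq> carrier N G1" using \<open>K \<subseteq> _ \<union> _\<close> z0(1) by blast
  have "infinite (V \<inter> gauss_ints)"
  proof
    assume "finite (V \<inter> gauss_ints)"
    moreover have "G1 \<subseteq> (V \<inter> gauss_ints) \<times> {1, \<i>}" using G by (auto simp: G1_def)
    ultimately have "finite G1" by (meson finite.emptyI finite.insertI finite_SigmaI finite_subset)
    moreover have "bounded (edge N e)" if e: "e \<in> G1" for e
    proof -
      obtain a d where ad: "e = (a, d)" "d = 1 \<or> d = \<i>" using e G by (cases e) (auto simp: G1_def)
      have "edge N e \<subseteq> cball (a / of_nat N) 2" using edge_corner[OF N _ ad(2)] unfolding ad(1)
        by (auto simp: dist_norm norm_minus_commute)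
      then show ?thesis using bounded_cball bounded_subset by blast
    qed
    ultimately have "bounded (carrier N G1)" unfolding carrier_def by (intro bounded_UN) auto
    then show False using K(2) KG1 bounded_subset by blast
  qed
  define \<rho> where "\<rho> = (\<lambda>b. SOME r. r \<in> residues N \<and> (\<exists>w\<in>gauss_ints. r = b + of_nat N * w))"
  have \<rho>: "\<rho> b \<in> residues N" "\<exists>w\<in>gauss_ints. \<rho> b = b + of_nat N * w" if "b \<in> gauss_ints" for b
  proof -
    have "\<exists>r. r \<in> residues N \<and> (\<exists>w\<in>gauss_ints. r = b + of_nat N * w)" using residue_ex[OF N that] by metis
    from someI_ex[OF this] show "\<rho> b \<in> residues N" "\<exists>w\<in>gauss_ints. \<rho> b = b + of_nat N * w" unfolding \<rho>_def by blast+
  qed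
  have "\<not> inj_on \<rho> (V \<inter> gauss_ints)"
  proof
    assume "inj_on \<rho> (V \<inter> gauss_ints)"
    moreover have "finite (\<rho> ` (V \<inter> gauss_ints))" using \<rho>(1) by (intro finite_subset[OF _ finite_residues[of N]]) auto
    ultimately show False using \<open>infinite (V \<inter> gauss_ints)\<close> finite_imageD by blast
  qed
  then obtain b c where bc: "b \<in> V" "c \<in> V" "b \<in> gauss_ints" "c \<in> gauss_ints" "\<rho> b = \<rho> c" "b \<noteq> c" by (auto simp: inj_on_def)
  obtain w w' where w: "w \<in> gauss_ints" "\<rho> b = b + of_nat N * w" "w' \<in> gauss_ints" "\<rho> c = c + of_nat N * w'" using \<rho>(2) bc by meson
  have c: "c = b + of_nat N * (w - w')" using bc(5) w(2,4) by (simp add: algebra_simps)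
  have "(b, c) \<in> (adjacent G)\<^sup>*" using bc(1,2) adjacent_sym unfolding V_def by (blast intro: rtrancl_trans)
  then obtain n where "(b, c) \<in> adjacent G ^^ n" using rtrancl_imp_relpow by blast
  then show ?thesis using that[of "w - w'" b n] w(1,3) bc(6) c by auto
qed

text \<open>In a walk of least length between distinct equivalent vertices, a repeated vertex could
  be cut out, and two further equivalent vertices would bound a shorter walk of the same
  kind.\<close>

lemma shortest_translation_walk:
  assumes "w \<in> gauss_ints" "w \<noteq> 0" "(a, a + of_nat N * w) \<in> adjacent G ^^ m"
  obtains p n w where "w \<in> gauss_ints" "w \<noteq> 0" "p n = p 0 + of_nat N * w" "\<And>i. i < n \<Longrightarrow> (p i, p (Suc i)) \<in> adjacent G"
    "\<And>i j u. i < j \<Longrightarrow> j \<le> n \<Longrightarrow> u \<in> gauss_ints \<Longrightarrow> p j = p i + of_nat N * u \<Longrightarrow> i = 0 \<and> j = n"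
proof -
  define T where "T = (\<lambda>n. \<exists>a w. w \<in> gauss_ints \<and> w \<noteq> 0 \<and> (a, a + of_nat N * w) \<in> adjacent G ^^ n)"
  define n where "n = (LEAST n. T n)"
  have "T m" using assms by (auto simp: T_def)
  then have Tn: "T n" unfolding n_def by (rule LeastI)
  have least: "n \<le> k" if "T k" for k unfolding n_def by (rule Least_le[of T, OF that])
  obtain b w where w: "w \<in> gauss_ints" "w \<noteq> 0" "(b, b + of_nat N * w) \<in> adjacent G ^^ n" using Tn by (auto simp: T_def)
  obtain p where p: "p 0 = b" "p n = b + of_nat N * w" "\<And>i. i < n \<Longrightarrow> (p i, p (Suc i)) \<in> adjacent G"
    using w(3) unfolding relpow_fun_conv by blast
  have sub: "(p i, p (i + k)) \<in> adjacent G ^^ k" if "i + k \<le> n" for i k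
    using that
  proof (induction k)
    case (Suc k)
    then show ?case using p(3)[of "i + k"] by auto
  qed simp
  have inj: "i = 0 \<and> j = n" if h: "i < j" "j \<le> n" "u \<in> gauss_ints" "p j = p i + of_nat N * u" for i j u
  proof (cases "u = 0")
    case True
    have 1: "(p 0, p i) \<in> adjacent G ^^ i" using sub[of 0 i] h by simp
    have 2: "(p i, p n) \<in> adjacent G ^^ (n - j)" using sub[of j "n - j"] h True by simp
    have "(b, b + of_nat N * w) \<in> adjacent G ^^ (i + (n - j))" unfolding relpow_add using 1 2 p(1,2) by auto
    then have "T (i + (n - j))" using w(1,2) by (auto simp: T_def)
    then show ?thesis using least[of "i + (n - j)"] h by simp
  next
    case False
    have "(p i, p i + of_nat N * u) \<in> adjacent G ^^ (j - i)" using sub[of i "j - i"] h by simp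
    then have "T (j - i)" using False h(3) by (auto simp: T_def)
    then show ?thesis using least[of "j - i"] h(1,2) by auto
  qed
  show ?thesis
  proof (rule that[OF w(1,2)])
    show "p n = p 0 + of_nat N * w" by (simp add: p)
    show "(p i, p (Suc i)) \<in> adjacent G" if "i < n" for i by (rule p(3)[OF that])
    show "i = 0 \<and> j = n" if "i < j" "j \<le> n" "u \<in> gauss_ints" "p j = p i + of_nat N * u" for i j u by (rule inj[OF that])
  qed
qed

lemma half_open_unit_steps:
  fixes \<sigma> \<tau> \<delta> \<delta>' :: real
  assumes "of_int x + \<sigma> * \<delta> = of_int x' + \<tau> * \<delta>'" "\<delta> \<in> {- 1, 0, 1}" "\<delta>' \<in> {- 1, 0, 1}"
    and "0 \<le> \<sigma>" "\<sigma> < 1" "0 \<le> \<tau>" "\<tau> < 1"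
  shows "x = x' \<or> (\<delta>' = - \<delta> \<and> of_int x + \<delta> = of_int x')"
proof -
  have near: "i = j" if "\<bar>real_of_int i - real_of_int j\<bar> < 1" for i j using that by linarith
  have near2: "i = j \<or> j = i + 1" if "0 \<le> real_of_int j - real_of_int i" "real_of_int j - real_of_int i < 2" for i j using that by linarith
  show ?thesis
  proof (cases "\<delta>' = - \<delta> \<and> \<delta> \<noteq> 0")
    case True
    then consider "\<delta> = 1" "\<delta>' = - 1" | "\<delta> = - 1" "\<delta>' = 1" using assms by auto
    then show ?thesis
    proof cases
      case 1
      then have "real_of_int x' - real_of_int x = \<sigma> + \<tau>" using assms(1) by simp
      then have "x = x' \<or> x' = x + 1" using assms(4-7) by (intro near2) linarith+
      then show ?thesis using 1 by auto
    next
      case 2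
      then have "real_of_int x - real_of_int x' = \<sigma> + \<tau>" using assms(1) by simp
      then have "x' = x \<or> x = x' + 1" using assms(4-7) by (intro near2) linarith+
      then show ?thesis using 2 by auto
    qed
  next
    case False
    then have "\<bar>\<sigma> * \<delta> - \<tau> * \<delta>'\<bar> < 1" using assms(2-) by auto
    then have "x = x'" using assms(1) by (intro near) linarith
    then show ?thesis by blast
  qed
qed

text \<open>With the final point excluded each vertex of a walk counts once. The second alternative
  is a single edge traversed in both directions.\<close>

lemma half_open_edges_meet:
  fixes \<sigma> \<tau> :: real
  assumes ab: "a \<in> gauss_ints" "b \<in> gauss_ints" and d: "d \<in> {1, - 1, \<i>, - \<i>}" "d' \<in> {1, - 1, \<i>, - \<i>}"
    and s: "0 \<le> \<sigma>" "\<sigma> < 1" and t: "0 \<le> \<tau>" "\<tau> < 1" and eq: "a + of_real \<sigma> * d = b + of_real \<tau> * d'"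
  shows "a = b \<or> (a + d = b \<and> a = b + d')"
proof -
  obtain x y x' y' where xy: "a = Complex (of_int x) (of_int y)" "b = Complex (of_int x') (of_int y')"
    using gauss_intsE[OF ab(1)] gauss_intsE[OF ab(2)] by metis
  have R: "of_int x + \<sigma> * Re d = of_int x' + \<tau> * Re d'" "of_int y + \<sigma> * Im d = of_int y' + \<tau> * Im d'"
    using eq by (simp_all add: xy complex_eq_iff)
  have "Re d \<in> {- 1, 0, 1}" "Re d' \<in> {- 1, 0, 1}" "Im d \<in> {- 1, 0, 1}" "Im d' \<in> {- 1, 0, 1}" using d by auto
  then have 1: "x = x' \<or> (Re d' = - Re d \<and> of_int x + Re d = of_int x')" and 2: "y = y' \<or> (Im d' = - Im d \<and> of_int y + Im d = of_int y')"
    using half_open_unit_steps[OF R(1)] half_open_unit_steps[OF R(2)] s t by blast+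
  show ?thesis
  proof (cases "a = b")
    case False
    then consider "x \<noteq> x'" | "y \<noteq> y'" by (auto simp: xy)
    then show ?thesis
    proof cases
      case x: 1
      then have r: "Re d' = - Re d" "of_int x + Re d = of_int x'" using 1 by auto
      then have "Re d \<noteq> 0" using x by auto
      then have "Im d = 0" "Im d' = 0" using d r(1) by auto
      then show ?thesis using r 2 by (auto simp: xy complex_eq_iff)
    next
      case y: 2
      then have r: "Im d' = - Im d" "of_int y + Im d = of_int y'" using 2 by auto
      then have "Im d \<noteq> 0" using y by auto
      then have "Re d = 0" "Re d' = 0" using d r(1) by auto
      then show ?thesis using r 1 by (auto simp: xy complex_eq_iff)
    qed
  qed simp
qed

text \<open>The clamped factors let the segments be run through one after the other; as a sum of
  continuous terms the curve is continuous without any gluing.\<close>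

definition polygon :: "nat \<Rightarrow> (nat \<Rightarrow> complex) \<Rightarrow> real \<Rightarrow> complex" where
  "polygon n p s = p 0 + (\<Sum>i<n. of_real (max 0 (min 1 (real n * s - real i))) * (p (Suc i) - p i))"

lemma continuous_on_polygon: "continuous_on S (polygon n p)"
  unfolding polygon_def by (intro continuous_intros)

lemma polygon_eq:
  assumes i: "i < n" and \<sigma>: "0 \<le> \<sigma>" "\<sigma> \<le> 1"
  shows "polygon n p ((real i + \<sigma>) / real n) = p i + of_real \<sigma> * (p (Suc i) - p i)"
proof -
  have n: "real n * ((real i + \<sigma>) / real n) = real i + \<sigma>" using i by simp
  have c: "max 0 (min 1 (real i + \<sigma> - real j)) = (if j < i then 1 else 0) + (if j = i then \<sigma> else 0)" for j
  proof -
    consider "j + 1 \<le> i" | "j = i" | "i + 1 \<le> j" by linarith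
    then show ?thesis
    proof cases
      case 1
      then have "real j + 1 \<le> real i" by linarith
      then show ?thesis using 1 \<sigma> by simp
    next
      case 3
      then have "real i + 1 \<le> real j" by linarith
      then show ?thesis using 3 \<sigma> by simp
    qed (use \<sigma> in simp)
  qed
  have "(\<Sum>j<n. of_real (max 0 (min 1 (real n * ((real i + \<sigma>) / real n) - real j))) * (p (Suc j) - p j))
    = (\<Sum>j<n. (if j < i then p (Suc j) - p j else 0) + (if j = i then of_real \<sigma> * (p (Suc j) - p j) else 0))"
    unfolding n c by (intro sum.cong) auto
  also have "\<dots> = (\<Sum>j<n. if j < i then p (Suc j) - p j else 0) + of_real \<sigma> * (p (Suc i) - p i)"
    using i by (simp add: sum.distrib)
  also have "(\<Sum>j<n. if j < i then p (Suc j) - p j else 0) = (\<Sum>j<i. p (Suc j) - p j)"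
    using i by (intro sum.mono_neutral_cong_right) auto
  also have "\<dots> = p i - p 0" by (rule sum_lessThan_telescope)
  finally show ?thesis by (simp add: polygon_def)
qed

lemma unit_interval_step:
  assumes n: "0 < n" and s: "0 \<le> s" "s < 1"
  obtains i \<sigma> where "i < n" "0 \<le> \<sigma>" "\<sigma> < 1" "s = (real i + \<sigma>) / real n"
proof
  have "0 \<le> real n * s" "real n * s < real n" using n s by auto
  then show "nat \<lfloor>real n * s\<rfloor> < n" by linarith
  show "0 \<le> frac (real n * s)" "frac (real n * s) < 1" by (auto simp: frac_lt_1)
  have "real (nat \<lfloor>real n * s\<rfloor>) + frac (real n * s) = real n * s" using \<open>0 \<le> real n * s\<close> by (simp add: frac_def)
  then show "s = (real (nat \<lfloor>real n * s\<rfloor>) + frac (real n * s)) / real n" using n by simp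
qed

lemma gauss_ints_norm_ge_1: assumes "w \<in> gauss_ints" "w \<noteq> 0" shows "1 \<le> norm w"
proof -
  have "Re w \<noteq> 0 \<or> Im w \<noteq> 0" using assms(2) by (auto simp: complex_eq_iff)
  then have "1 \<le> \<bar>Re w\<bar> \<or> 1 \<le> \<bar>Im w\<bar>" using assms(1) by (auto simp: gauss_ints_def Ints_nonzero_abs_ge1)
  then show ?thesis using abs_Re_le_cmod[of w] abs_Im_le_cmod[of w] by linarith
qed

lemma unbounded_grid_closed_curve:
  assumes N: "3 \<le> N" and G: "G \<subseteq> gauss_ints \<times> {1, \<i>}" and K: "connected K" "\<not> bounded K" "K \<subseteq> carrier N G"
  obtains \<gamma> :: "real \<Rightarrow> complex" and w where "path \<gamma>" "path_image \<gamma> \<subseteq> carrier N G"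
    "w \<in> gauss_ints" "w \<noteq> 0" "pathfinish \<gamma> = pathstart \<gamma> + w"
    "\<And>s t. \<lbrakk>s \<in> {0..1}; t \<in> {0..1}; \<gamma> s - \<gamma> t \<in> gauss_ints\<rbrakk> \<Longrightarrow> s = t \<or> (s = 0 \<and> t = 1) \<or> (s = 1 \<and> t = 0)"
proof -
  have N0: "0 < N" using N by simp
  obtain a0 w0 m where "w0 \<in> gauss_ints" "w0 \<noteq> 0" "(a0, a0 + of_nat N * w0) \<in> adjacent G ^^ m"
    using unbounded_connected_grid_translation[OF N0 G K] by metis
  then obtain p n w where w: "w \<in> gauss_ints" "w \<noteq> 0" and pn: "p n = p 0 + of_nat N * w"
    and adj: "\<And>i. i < n \<Longrightarrow> (p i, p (Suc i)) \<in> adjacent G"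
    and inj: "\<And>i j u. i < j \<Longrightarrow> j \<le> n \<Longrightarrow> u \<in> gauss_ints \<Longrightarrow> p j = p i + of_nat N * u \<Longrightarrow> i = 0 \<and> j = n"
    using shortest_translation_walk by metis
  define d where "d = (\<lambda>i. p (Suc i) - p i)"
  have d: "d i \<in> {1, - 1, \<i>, - \<i>}" if i: "i < n" for i
  proof -
    consider "(p i, d i) \<in> G" | "(p (Suc i), - d i) \<in> G" using adj[OF i] by (auto simp: adjacent_def d_def)
    then show ?thesis
    proof cases
      case 2
      then have "- d i = 1 \<or> - d i = \<i>" using G by auto
      then have "d i = - 1 \<or> d i = - \<i>" by (metis minus_minus)
      then show ?thesis by auto
    qed (use G in auto)
  qed
  have pg: "p i \<in> gauss_ints" if "i < n" for i
  proof -
    have "d i \<in> gauss_ints" using d[OF that] by auto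
    moreover have "p i \<in> gauss_ints \<or> p (Suc i) \<in> gauss_ints" using adj[OF that] G by (auto simp: adjacent_def)
    moreover have "p i = p (Suc i) - d i" by (simp add: d_def)
    ultimately show ?thesis by (metis gauss_ints_diff)
  qed
  have "norm (p k - p 0) \<le> real k" if "k \<le> n" for k
    using that
  proof (induction k)
    case (Suc k)
    have "norm (d k) = 1" using d[of k] Suc.prems by auto
    moreover have e: "p (Suc k) - p 0 = d k + (p k - p 0)" by (simp add: d_def)
    moreover have "norm (p k - p 0) \<le> real k" using Suc by simp
    ultimately show ?case unfolding e using norm_triangle_ineq[of "d k" "p k - p 0"] by linarith
  qed simp
  then have "norm (of_nat N * w) \<le> real n" using pn by fastforce
  moreover have "real N * 1 \<le> real N * norm w" using gauss_ints_norm_ge_1[OF w] by (intro mult_left_mono) auto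
  ultimately have "real N \<le> real n" by (simp add: norm_mult)
  \<comment> \<open>Unit steps need at least \<open>N\<close> moves for a nonzero translation. With
    \<open>n \<ge> 3\<close> two edges cannot be cyclic successors of each other, which rules out an
    edge traversed back and forth.\<close>
  then have n3: "3 \<le> n" using N by simp
  then have n0: "0 < n" by simp
  have mod: "a = b \<or> (a = 0 \<and> b = n) \<or> (a = n \<and> b = 0)" if "a \<le> n" "b \<le> n" "u \<in> gauss_ints" "p a = p b + of_nat N * u" for a b u
  proof -
    consider "a = b" | "a < b" | "b < a" by linarith
    then show ?thesis
    proof cases
      case 2
      have "p b = p a + of_nat N * (- u)" using that(4) by simp
      then show ?thesis using inj[OF 2 that(2) gauss_ints_minus[OF that(3)]] by blast
    next
      case 3
      then show ?thesis using inj[OF 3 that(1,3,4)] by blast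
    qed simp
  qed
  define \<gamma> where "\<gamma> = (\<lambda>s. polygon n p s / of_nat N)"
  have N\<gamma>: "of_nat N * \<gamma> ((real i + \<sigma>) / real n) = p i + of_real \<sigma> * d i" if "i < n" "0 \<le> \<sigma>" "\<sigma> \<le> 1" for i \<sigma>
    using polygon_eq[OF that, of p] N0 by (simp add: \<gamma>_def d_def)
  have \<gamma>0: "of_nat N * \<gamma> 0 = p 0" using N\<gamma>[of 0 0] n0 by simp
  have \<gamma>1: "of_nat N * \<gamma> 1 = p 0 + of_nat N * w"
  proof -
    have 1: "(real (n - 1) + 1) / real n = 1" using n0 by (simp add: of_nat_diff)
    have "of_nat N * \<gamma> ((real (n - 1) + 1) / real n) = p (n - 1) + of_real 1 * d (n - 1)" using n0 by (intro N\<gamma>) auto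
    then have "of_nat N * \<gamma> 1 = p (n - 1) + of_real 1 * d (n - 1)" unfolding 1 .
    also have "\<dots> = p n" using n0 by (simp add: d_def)
    finally show ?thesis unfolding pn .
  qed
  have on: "\<gamma> ((real i + \<sigma>) / real n) \<in> carrier N G" if h: "i < n" "0 \<le> \<sigma>" "\<sigma> \<le> 1" for i \<sigma>
  proof -
    consider "(p i, d i) \<in> G" | "(p (Suc i), - d i) \<in> G" using adj[OF h(1)] by (auto simp: adjacent_def d_def)
    then show ?thesis
    proof cases
      case 1
      have "\<gamma> ((real i + \<sigma>) / real n) \<in> edge N (p i, d i)" unfolding edge_def using N\<gamma>[OF h] h by auto
      then show ?thesis using 1 unfolding carrier_def by blast
    next
      case 2
      have "of_nat N * \<gamma> ((real i + \<sigma>) / real n) = p (Suc i) + of_real (1 - \<sigma>) * (- d i)"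
        using N\<gamma>[OF h] by (simp add: d_def algebra_simps)
      then have "\<gamma> ((real i + \<sigma>) / real n) \<in> edge N (p (Suc i), - d i)" unfolding edge_def using h
        by (auto intro!: bexI[of _ "1 - \<sigma>"])
      then show ?thesis using 2 unfolding carrier_def by blast
    qed
  qed
  have inj': "s = t" if s: "0 \<le> s" "s < 1" and t: "0 \<le> t" "t < 1" and u: "\<gamma> s - \<gamma> t \<in> gauss_ints" for s t
  proof -
    define u where "u = \<gamma> s - \<gamma> t"
    have ug: "u \<in> gauss_ints" using u by (simp add: u_def)
    obtain i \<sigma> where i: "i < n" "0 \<le> \<sigma>" "\<sigma> < 1" "s = (real i + \<sigma>) / real n" using unit_interval_step[OF n0 s] .
    obtain j \<tau> where j: "j < n" "0 \<le> \<tau>" "\<tau> < 1" "t = (real j + \<tau>) / real n" using unit_interval_step[OF n0 t] .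
    have "of_nat N * \<gamma> s = of_nat N * \<gamma> t + of_nat N * u" by (simp add: u_def algebra_simps)
    then have eq: "p i + of_real \<sigma> * d i = (p j + of_nat N * u) + of_real \<tau> * d j"
      using N\<gamma>[of i \<sigma>] N\<gamma>[of j \<tau>] i j by (simp add: algebra_simps)
    have pju: "p j + of_nat N * u \<in> gauss_ints" using pg[OF j(1)] ug by simp
    from half_open_edges_meet[OF pg[OF i(1)] pju d[OF i(1)] d[OF j(1)] i(2,3) j(2,3) eq]
    show "s = t"
    proof (elim disjE conjE)
      assume h: "p i = p j + of_nat N * u"
      have ij: "i = j" using mod[of i j u] h i(1) j(1) ug by auto
      have "d j \<noteq> 0" using d[OF j(1)] by auto
      moreover have "u = 0" using h ij N0 by simp
      ultimately have "\<sigma> = \<tau>" using eq h ij by simp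
      then show "s = t" using i(4) j(4) ij by simp
    next
      assume h: "p i + d i = p j + of_nat N * u" "p i = p j + of_nat N * u + d j"
      have "p (Suc i) = p j + of_nat N * u" "p i = p (Suc j) + of_nat N * u" using h by (simp_all add: d_def algebra_simps)
      then have "Suc i = j \<or> (Suc i = n \<and> j = 0)" "i = Suc j \<or> (i = 0 \<and> Suc j = n)"
        using mod[of "Suc i" j u] mod[of i "Suc j" u] i(1) j(1) ug by auto
      then show "s = t" using n3 by auto
    qed
  qed
  have \<gamma>01: "\<gamma> 1 = \<gamma> 0 + w"
  proof -
    have "of_nat N * \<gamma> 1 = of_nat N * (\<gamma> 0 + w)" using \<gamma>0 \<gamma>1 by (simp add: algebra_simps)
    then show ?thesis using N0 by simp
  qed
  have "s = t \<or> (s = 0 \<and> t = 1) \<or> (s = 1 \<and> t = 0)" if s: "s \<in> {0..1}" and t: "t \<in> {0..1}" and u: "\<gamma> s - \<gamma> t \<in> gauss_ints" for s t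
  proof (cases "s = 1")
    case s1: True
    show ?thesis
    proof (cases "t = 1")
      case False
      have "\<gamma> 0 - \<gamma> t = (\<gamma> s - \<gamma> t) - w" using \<gamma>01 s1 by simp
      then have "\<gamma> 0 - \<gamma> t \<in> gauss_ints" using gauss_ints_diff[OF u w(1)] by (simp only:)
      then have "0 = t" using t False by (intro inj') auto
      then show ?thesis using s1 by simp
    qed (use s1 in simp)
  next
    case s1: False
    show ?thesis
    proof (cases "t = 1")
      case True
      have "\<gamma> s - \<gamma> 0 = (\<gamma> s - \<gamma> t) + w" using \<gamma>01 True by simp
      then have "\<gamma> s - \<gamma> 0 \<in> gauss_ints" using gauss_ints_add[OF u w(1)] by (simp only:)
      then have "s = 0" using s s1 by (intro inj') auto
      then show ?thesis using True by simp
    next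
      case False
      then have "s = t" using s t s1 u by (intro inj') auto
      then show ?thesis by simp
    qed
  qed
  moreover have "path \<gamma>" unfolding path_def \<gamma>_def using N0 by (intro continuous_intros continuous_on_polygon) simp
  moreover have "path_image \<gamma> \<subseteq> carrier N G"
  proof
    fix x assume "x \<in> path_image \<gamma>"
    then obtain s where s: "0 \<le> s" "s \<le> 1" "x = \<gamma> s" by (auto simp: path_image_def)
    show "x \<in> carrier N G"
    proof (cases "s = 1")
      case True
      have "(real (n - 1) + 1) / real n = 1" using n0 by (simp add: of_nat_diff)
      then show ?thesis using on[of "n - 1" 1] n0 s(3) True by simp
    next
      case False
      then obtain i \<sigma> where "i < n" "0 \<le> \<sigma>" "\<sigma> < 1" "s = (real i + \<sigma>) / real n" using unit_interval_step[OF n0, of s] s by auto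
      then show ?thesis using on[of i \<sigma>] s(3) by simp
    qed
  qed
  moreover have "pathfinish \<gamma> = pathstart \<gamma> + w" using \<gamma>01 by (simp add: pathfinish_def pathstart_def)
  ultimately show ?thesis using that w by blast
qed

section \<open>The torus\<close>

definition to_plane :: "real^2 \<Rightarrow> complex" where
  "to_plane x = Complex (x $ 1) (x $ 2)"

definition of_plane :: "complex \<Rightarrow> real^2" where
  "of_plane z = (\<chi> i. if i = 1 then Re z else Im z)"

lemma to_of_plane [simp]: "to_plane (of_plane z) = z"
  by (simp add: to_plane_def of_plane_def complex_eq_iff)

lemma of_to_plane [simp]: "of_plane (to_plane x) = x"
  by (simp add: to_plane_def of_plane_def vec_eq_iff forall_2)

lemma of_plane_nth: "of_plane z $ 1 = Re z" "of_plane z $ 2 = Im z"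
  by (simp_all add: of_plane_def)

lemma of_plane_add: "of_plane (a + b) = of_plane a + of_plane b"
  by (simp add: vec_eq_iff forall_2 of_plane_nth)

lemma of_plane_diff: "of_plane (a - b) = of_plane a - of_plane b"
  by (simp add: vec_eq_iff forall_2 of_plane_nth)

lemma of_plane_scaleR: "of_plane (r *\<^sub>R a) = r *\<^sub>R of_plane a"
  by (simp add: vec_eq_iff forall_2 of_plane_nth)

lemma continuous_on_to_plane [continuous_intros]: "continuous_on S h \<Longrightarrow> continuous_on S (\<lambda>x. to_plane (h x))"
  unfolding to_plane_def Complex_eq by (intro continuous_intros)

lemma continuous_on_of_plane [continuous_intros]: "continuous_on S h \<Longrightarrow> continuous_on S (\<lambda>x. of_plane (h x))"
proof -
  assume h: "continuous_on S h"
  have "continuous_on S (\<lambda>x. if i = 1 then Re (h x) else Im (h x))" for i :: 2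
    by (cases "i = 1") (auto intro!: continuous_intros h)
  then show ?thesis unfolding of_plane_def by (rule continuous_on_vec_lambda)
qed

lemma torus_proj_eq_iff: "torus_proj x = torus_proj y \<longleftrightarrow> to_plane x - to_plane y \<in> gauss_ints"
  by (simp add: torus.abs_eq_iff forall_2 gauss_ints_def to_plane_def)

lemma torus_proj_rep [simp]: "torus_proj (torus_rep t) = t"
  by (rule Quotient_abs_rep[OF Quotient_torus])

lemma continuous_on_torus_proj: "continuous_on UNIV torus_proj"
  by (rule continuous_on_open_vimage[THEN iffD2, OF open_UNIV]) (auto simp: open_torus_def)

lemma path_torus_proj: "path \<gamma> \<Longrightarrow> path (torus_proj \<circ> \<gamma>)"
  by (rule path_continuous_image) (auto intro: continuous_on_subset[OF continuous_on_torus_proj])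

text \<open>The circle valued coordinates of the torus; winding numbers around 0 of their
  compositions with loops detect homotopy classes.\<close>

definition character :: "2 \<Rightarrow> torus \<Rightarrow> complex" where
  "character k t = exp (of_real (2 * pi * torus_rep t $ k) * \<i>)"

lemma character_proj: "character k (torus_proj x) = exp (of_real (2 * pi * x $ k) * \<i>)"
proof -
  define y where "y = torus_rep (torus_proj x)"
  have "torus_proj y = torus_proj x" by (simp add: y_def)
  then have "y $ k - x $ k \<in> \<int>" by (simp add: torus.abs_eq_iff)
  then have "exp (of_real (2 * (y $ k - x $ k) * pi) * \<i>) = 1" using exp_integer_2pi[of "of_real (y $ k - x $ k)"]
    by (auto elim!: Ints_cases)
  moreover have "of_real (2 * pi * y $ k) * \<i> = of_real (2 * pi * x $ k) * \<i> + of_real (2 * (y $ k - x $ k) * pi) * \<i>"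
    by (simp add: algebra_simps)
  ultimately show ?thesis unfolding character_def y_def[symmetric] by (simp add: exp_add)
qed

lemma continuous_on_character: "continuous_on UNIV (character k)"
proof (rule continuous_on_open_vimage[THEN iffD2, OF open_UNIV], intro allI impI)
  fix B :: "complex set" assume B: "open B"
  have "continuous_on UNIV (\<lambda>x::real^2. exp (of_real (2 * pi * x $ k) * \<i>))" by (intro continuous_intros)
  then have "open ((\<lambda>x::real^2. exp (of_real (2 * pi * x $ k) * \<i>)) -` B)" by (intro open_vimage B)
  then show "open (character k -` B \<inter> UNIV)"
    by (simp add: open_torus_def vimage_def character_proj)
qed

lemma winding_number_character:
  assumes "path \<gamma>"
  shows "winding_number (character k \<circ> (torus_proj \<circ> \<gamma>)) 0 = of_real ((pathfinish \<gamma> - pathstart \<gamma>) $ k)"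
proof -
  define p where "p = (\<lambda>t. of_real (2 * pi * \<gamma> t $ k) * \<i>)"
  have e: "character k \<circ> (torus_proj \<circ> \<gamma>) = exp \<circ> p" by (auto simp: p_def character_proj)
  have "path p" using assms unfolding path_def p_def by (intro continuous_intros)
  then have "winding_number (exp \<circ> p) 0 = (pathfinish p - pathstart p) / (2 * of_real pi * \<i>)" by (rule winding_number_compose_exp)
  also have "\<dots> = of_real ((pathfinish \<gamma> - pathstart \<gamma>) $ k)"
    by (simp add: p_def pathfinish_def pathstart_def field_simps)
  finally show ?thesis unfolding e .
qed

text \<open>The winding numbers of the two characters along the loop read off the coordinates of the
  difference of end points and are invariant under free homotopies. This takes the place of lifting
  a homotopy.\<close>

lemma homotopic_loops_same_translation:
  assumes h: "homotopic_loops UNIV (torus_proj \<circ> \<gamma>) (torus_proj \<circ> \<gamma>')" and p: "path \<gamma>" "path \<gamma>'"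
  shows "pathfinish \<gamma> - pathstart \<gamma> = pathfinish \<gamma>' - pathstart \<gamma>'"
proof (rule vec_eq_iff[THEN iffD2], rule allI)
  fix k
  have "homotopic_loops (- {0}) (character k \<circ> (torus_proj \<circ> \<gamma>)) (character k \<circ> (torus_proj \<circ> \<gamma>'))"
    by (rule homotopic_loops_continuous_image[OF h continuous_on_character]) (auto simp: character_def)
  from winding_number_homotopic_loops[OF this]
  show "(pathfinish \<gamma> - pathstart \<gamma>) $ k = (pathfinish \<gamma>' - pathstart \<gamma>') $ k"
    unfolding winding_number_character[OF p(1)] winding_number_character[OF p(2)] of_real_eq_iff .
qed

text \<open>The projected segment from \<open>x\<close> to \<open>x + v\<close> is a loop, and its
  image under \<open>F\<close> is freely homotopic to it because \<open>F\<close> is homotopic to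
  the identity. Hence both lifts have the same translation \<open>v\<close>.\<close>

lemma lift_commutes_translations:
  assumes lift: "torus_proj \<circ> f = F \<circ> torus_proj" and cf: "continuous_on UNIV f"
    and hom: "homotopic_with_canon (\<lambda>h. True) UNIV UNIV F id" and v: "to_plane v \<in> gauss_ints"
  shows "f (x + v) = f x + v"
proof -
  define \<gamma> where "\<gamma> = (\<lambda>t::real. x + t *\<^sub>R v)"
  have p\<gamma>: "path \<gamma>" unfolding path_def \<gamma>_def by (intro continuous_intros)
  then have pf: "path (f \<circ> \<gamma>)" using path_continuous_image continuous_on_subset[OF cf subset_UNIV] by blast
  have "torus_proj (x + v) = torus_proj x"
    using v unfolding torus_proj_eq_iff by (simp add: to_plane_def gauss_ints_def)
  then have loop: "pathfinish (torus_proj \<circ> \<gamma>) = pathstart (torus_proj \<circ> \<gamma>)" by (simp add: \<gamma>_def pathfinish_def pathstart_def)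
  have "continuous_on {0..1} (torus_proj \<circ> \<gamma>)" using path_torus_proj[OF p\<gamma>] by (simp add: path_def)
  moreover have "homotopic_with_canon (\<lambda>h. pathfinish (h \<circ> (torus_proj \<circ> \<gamma>)) = pathstart (h \<circ> (torus_proj \<circ> \<gamma>))) UNIV UNIV F id"
    by (rule homotopic_with_mono[OF hom]) (use loop in \<open>simp add: pathfinish_def pathstart_def\<close>)
  ultimately have "homotopic_loops UNIV (F \<circ> (torus_proj \<circ> \<gamma>)) (id \<circ> (torus_proj \<circ> \<gamma>))"
    unfolding homotopic_loops_def by (intro homotopic_with_compose_continuous_right[where X = UNIV]) auto
  moreover have "F \<circ> (torus_proj \<circ> \<gamma>) = torus_proj \<circ> (f \<circ> \<gamma>)" using lift by (metis comp_assoc)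
  ultimately have "homotopic_loops UNIV (torus_proj \<circ> (f \<circ> \<gamma>)) (torus_proj \<circ> \<gamma>)" by simp
  from homotopic_loops_same_translation[OF this pf p\<gamma>] show ?thesis
    by (simp add: \<gamma>_def pathfinish_def pathstart_def algebra_simps)
qed

text \<open>A curve in the carrier that is injective modulo the lattice projects to a simple closed
  curve, and it is essential since its lift ends at a nonzero translate of its start.\<close>

lemma no_free_grid_curve_of_torus:
  assumes cip: "curve_intersection_property F" and lift: "torus_proj \<circ> f = F \<circ> torus_proj"
  shows "no_free_grid_curve (\<lambda>z. to_plane (f (of_plane z)))" (is "no_free_grid_curve ?h")
  unfolding no_free_grid_curve_def
proof (intro allI impI, rule ccontr)
  fix N :: nat and G K
  assume N: "3 \<le> N" and G: "G \<subseteq> gauss_ints \<times> {1, \<i>}" and Gt: "\<forall>(a, d)\<in>G. \<forall>w\<in>gauss_ints. (a + of_nat N * w, d) \<in> G"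
    and free: "?h ` carrier N G \<inter> carrier N G = {}" and K: "connected K" "K \<subseteq> carrier N G" "\<not> bounded K"
  obtain \<gamma> w where \<gamma>: "path \<gamma>" "path_image \<gamma> \<subseteq> carrier N G" and w: "w \<noteq> 0" "w \<in> gauss_ints" "pathfinish \<gamma> = pathstart \<gamma> + w"
    and inj: "\<And>s t. \<lbrakk>s \<in> {0..1}; t \<in> {0..1}; \<gamma> s - \<gamma> t \<in> gauss_ints\<rbrakk> \<Longrightarrow> s = t \<or> (s = 0 \<and> t = 1) \<or> (s = 1 \<and> t = 0)"
    using unbounded_grid_closed_curve[OF N G K(1,3,2)] by metis
  define \<Gamma> where "\<Gamma> = torus_proj \<circ> (of_plane \<circ> \<gamma>)"
  have p: "path (of_plane \<circ> \<gamma>)" using \<gamma>(1) unfolding path_def comp_def by (intro continuous_intros)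
  then have p\<Gamma>: "path \<Gamma>" unfolding \<Gamma>_def by (rule path_torus_proj)
  have "essential_curve \<Gamma>"
    unfolding essential_curve_def
  proof (intro conjI p\<Gamma> notI)
    show "pathfinish \<Gamma> = pathstart \<Gamma>" using w(2,3) by (simp add: \<Gamma>_def pathfinish_def pathstart_def torus_proj_eq_iff)
    assume "\<exists>a. homotopic_loops UNIV \<Gamma> (\<lambda>t. a)"
    then obtain a where a: "homotopic_loops UNIV \<Gamma> (\<lambda>t. a)" by blast
    have "homotopic_loops UNIV (torus_proj \<circ> (of_plane \<circ> \<gamma>)) (torus_proj \<circ> (\<lambda>t. torus_rep a))" using a by (simp add: \<Gamma>_def comp_def)
    moreover have "path (\<lambda>t::real. torus_rep a)" by (simp add: path_def)
    ultimately have "pathfinish (of_plane \<circ> \<gamma>) = pathstart (of_plane \<circ> \<gamma>)"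
      using homotopic_loops_same_translation[OF _ p] by (fastforce simp: pathfinish_def pathstart_def)
    then have "to_plane (of_plane (pathfinish \<gamma>)) = to_plane (of_plane (pathstart \<gamma>))" by (simp add: pathfinish_def pathstart_def)
    then show False using w(1,3) by simp
  qed
  moreover have "simple_path \<Gamma>"
    unfolding simple_path_def loop_free_def using p\<Gamma> inj by (auto simp: \<Gamma>_def torus_proj_eq_iff)
  moreover have "F ` path_image \<Gamma> \<inter> path_image \<Gamma> = {}"
  proof (rule ccontr)
    assume "\<not> ?thesis"
    then obtain y where "y \<in> F ` path_image \<Gamma>" "y \<in> path_image \<Gamma>" by blast
    then obtain s t where st: "s \<in> {0..1}" "t \<in> {0..1}" "F (\<Gamma> s) = \<Gamma> t" unfolding path_image_def by blast
    have "F (\<Gamma> s) = torus_proj (f (of_plane (\<gamma> s)))" using lift by (simp add: \<Gamma>_def fun_eq_iff)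
    then have "torus_proj (f (of_plane (\<gamma> s))) = torus_proj (of_plane (\<gamma> t))" using st(3) by (simp add: \<Gamma>_def)
    then have d: "?h (\<gamma> s) - \<gamma> t \<in> gauss_ints" by (simp add: torus_proj_eq_iff)
    have on: "\<gamma> s \<in> carrier N G" "\<gamma> t \<in> carrier N G" using \<gamma>(2) st by (auto simp: path_image_def)
    \<comment> \<open>An intersection in the torus only gives points of the plane differing by a
      lattice vector; the periodicity of the carrier absorbs this vector.\<close>
    have "\<gamma> t + (?h (\<gamma> s) - \<gamma> t) \<in> carrier N G"
      by (rule carrier_shift[OF _ _ on(2) d]) (use N Gt in auto)
    then show False using free on(1) by auto
  qed
  ultimately show False using cip unfolding curve_intersection_property_def free_curve_def by blast
qed

lemma interior_rot_of_rotation_set: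
  assumes "interior (rot (\<lambda>z. to_plane (f (of_plane z)))) \<noteq> {}" (is "interior (rot ?h) \<noteq> {}")
  shows "interior (rotation_set f) \<noteq> {}"
proof -
  have it: "(?h ^^ n) z = to_plane ((f ^^ n) (of_plane z))" for n z
    by (induction n) auto
  have sub: "x \<in> rotation_set f" if x: "to_plane x \<in> rot ?h" for x
    unfolding rotation_set_def
  proof
    fix m :: nat assume m: "m \<in> {1..}"
    define A where "A = (\<Union>n\<in>{m..}. {((?h ^^ n) z - z) /\<^sub>R real n | z. z \<in> UNIV})"
    define B where "B = (\<Union>n\<in>{m..}. {((f ^^ n) z - z) /\<^sub>R real n | z. z \<in> UNIV})"
    have "to_plane x \<in> closure A" using x m unfolding rot_def A_def by blast
    then have "of_plane (to_plane x) \<in> of_plane ` closure A" by (rule imageI)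
    also have "of_plane ` closure A \<subseteq> closure (of_plane ` A)"
    proof (rule image_closure_subset)
      show "continuous_on (closure A) of_plane" using continuous_on_of_plane[OF continuous_on_id, of "closure A"] by simp
    qed (auto intro: closure_subset[THEN subsetD])
    also have "of_plane ` A \<subseteq> B"
    proof
      fix y assume "y \<in> of_plane ` A"
      then obtain n z where n: "n \<in> {m..}" "y = of_plane (((?h ^^ n) z - z) /\<^sub>R real n)" by (auto simp: A_def)
      then have "y = ((f ^^ n) (of_plane z) - of_plane z) /\<^sub>R real n" by (simp add: it of_plane_diff of_plane_scaleR)
      then show "y \<in> B" using n(1) unfolding B_def by blast
    qed
    then have "closure (of_plane ` A) \<subseteq> closure B" by (rule closure_mono)
    finally show "x \<in> closure (\<Union>n\<in>{m..}. {((f ^^ n) z - z) /\<^sub>R real n | z. z \<in> UNIV})" by (simp add: B_def)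
  qed
  obtain y where y: "y \<in> interior (rot ?h)" using assms by blast
  have "continuous_on UNIV to_plane" using continuous_on_to_plane[OF continuous_on_id, of UNIV] by simp
  then have "open (to_plane -` interior (rot ?h))" by (intro open_vimage) auto
  moreover have "to_plane -` interior (rot ?h) \<subseteq> rotation_set f" using sub interior_subset by blast
  ultimately have "to_plane -` interior (rot ?h) \<subseteq> interior (rotation_set f)" by (rule interior_maximal[rotated])
  moreover have "of_plane y \<in> to_plane -` interior (rot ?h)" using y by simp
  ultimately show ?thesis by blast
qed

theorem theoremB:
  fixes F :: "torus \<Rightarrow> torus"
  assumes "\<exists>G. homeomorphism UNIV UNIV F G"
    and "homotopic_with_canon (\<lambda>h. True) UNIV UNIV F id"
    and "curve_intersection_property F"
  shows "(\<exists>x. F x = x) \<or> (\<forall>f. is_lift f F \<longrightarrow> interior (rotation_set f) \<noteq> {})"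
proof (cases "\<exists>x. F x = x")
  case nofix: False
  have "interior (rotation_set f) \<noteq> {}" if lift_f: "is_lift f F" for f
  proof -
    from lift_f obtain g where hom: "homeomorphism UNIV UNIV f g" and lift: "torus_proj \<circ> f = F \<circ> torus_proj"
      by (auto simp: is_lift_def)
    have cf: "continuous_on UNIV f" and cg: "continuous_on UNIV g" and fg: "\<And>x. f (g x) = x" "\<And>x. g (f x) = x"
      using hom by (auto simp: homeomorphism_def)
    define h where "h = (\<lambda>z. to_plane (f (of_plane z)))"
    define k where "k = (\<lambda>z. to_plane (g (of_plane z)))"
    interpret plane_lift h k
    proof
      show "continuous_on UNIV h" unfolding h_def by (intro continuous_intros continuous_on_compose2[OF cf]) auto
      show "continuous_on UNIV k" unfolding k_def by (intro continuous_intros continuous_on_compose2[OF cg]) auto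
      show "h (k z) = z" "k (h z) = z" for z by (simp_all add: h_def k_def fg)
      show "h (z + w) = h z + w" if "w \<in> gauss_ints" for z w
      proof -
        have "f (of_plane z + of_plane w) = f (of_plane z) + of_plane w"
          by (rule lift_commutes_translations[OF lift cf assms(2)]) (simp add: that)
        then have "h (z + w) = to_plane (f (of_plane z) + of_plane w)" by (simp add: h_def of_plane_add)
        also have "\<dots> = h z + w" by (simp add: h_def to_plane_def of_plane_nth complex_eq_iff)
        finally show ?thesis .
      qed
    qed
    have "h z \<noteq> z + w" if w: "w \<in> gauss_ints" for z w
    proof
      assume "h z = z + w"
      then have "torus_proj (f (of_plane z)) = torus_proj (of_plane z)" using w by (simp add: torus_proj_eq_iff h_def)
      then have "F (torus_proj (of_plane z)) = torus_proj (of_plane z)" using lift by (metis comp_apply)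
      then show False using nofix by blast
    qed
    moreover have "no_free_grid_curve h" unfolding h_def by (rule no_free_grid_curve_of_torus[OF assms(3) lift])
    ultimately have "interior (rot h) \<noteq> {}" by (rule rotation_interior_or_fixed_point[rotated])
    then show ?thesis unfolding h_def by (rule interior_rot_of_rotation_set)
  qed
  then show ?thesis by blast
qed blast

end
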